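(* Let $\rho\colon\bar\Gamma_6\to\bar\Gamma_2$ be the homomorphism with $\rho(\tau_i)=\tau_i$ for $i=1,2,3,4$. There exists a $\rho$-equivariant $K$-Lipschitz map $\widetilde f\colon\mathbb H^3\to\mathbb H^3$, for some $K<1$, that descends to a $K$-Lipschitz map \[ f\colon M_{\Gamma_6}\to M_{\Gamma_2}. \] Furthermore, $f$ sends some neighborhood of each cusp of $M_{\Gamma_6}$ to a single point, and \[ \int_{M_{\Gamma_6}} f^*\,d\mathrm{vol}_{\mathbb H}=\mathrm{Vol}(M_{\Gamma_2}). \]
   Context: For $j\in\{2,3,4,5,6\}$ let $T_j=T(2,3,j;2,3,5)\subset\mathbb H^3$ be the hyperbolic tetrahedron (compact for $j\le5$, with two ideal vertices for $j=6$) with faces $F_1^j,F_2^j,F_3^j,F_4^j$, whose dihedral angles are: $\pi/2,\ \pi/3,\ \pi/j$ along $F_1^j\cap F_4^j$, $F_2^j\cap F_4^j$, $F_3^j\cap F_4^j$ respectively, and $\pi/2,\ \pi/3,\ \pi/5$ along the respectively opposite edges $F_2^j\cap F_3^j$, $F_1^j\cap F_3^j$, $F_1^j\cap F_2^j$. The tetrahedra are placed so that they share a common vertex $v=F_1^j\cap F_2^j\cap F_3^j$ and the faces $F_1^j,F_2^j,F_3^j$ lie in common planes $P_1,P_2,P_3$ independent of $j$, with $T_2\subset T_3\subset T_4\subset T_5\subset T_6$. $\bar\Gamma_j$ is the discrete group generated by the reflections $\tau_1,\tau_2,\tau_3,\tau_4$ in the planes containing $F_1^j,F_2^j,F_3^j,F_4^j$;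 it has the presentation $\langle\tau_1,\dots,\tau_4\mid(\tau_i\tau_k)^{e_{ik}}\rangle$, where $e_{ii}=1$ and for $i\ne k$ the dihedral angle between $F_i^j$ and $F_k^j$ is $\pi/e_{ik}$. The assignment $\tau_i\mapsto\tau_i$ defines a homomorphism $\bar\Gamma_6\to\bar\Gamma_2$. $\Gamma_j<\bar\Gamma_j$ is the index two orientation preserving subgroup and $M_{\Gamma_j}=\Gamma_j\backslash\mathbb H^3$ is the quotient oriented hyperbolic orbifold. $\mathrm{vol}_{\mathbb H}$ is the hyperbolic volume form, and $\mathrm{Vol}$ denotes hyperbolic volume. *)

theory Defs
  imports "HOL-Analysis.Analysis" "HOL-Algebra.Generated_Groups"
begin

text \<open>Hyperbolic 3-space is the hyperboloid model; the fourth coordinate is the timelike one.\<close>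

definition lor :: "real^4 \<Rightarrow> real^4 \<Rightarrow> real" where
  "lor x y = x$1 * y$1 + x$2 * y$2 + x$3 * y$3 - x$4 * y$4"

definition hyperboloid :: "(real^4) set" where
  "hyperboloid = {x. lor x x = -1 \<and> x$4 > 0}"

lemma axis_in_hyperboloid: "axis 4 1 \<in> hyperboloid"
  by (simp add: hyperboloid_def lor_def axis_def)

typedef hyp3 = hyperboloid
  using axis_in_hyperboloid by blast

lemma lor_commute: "lor x y = lor y x"
  by (simp add: lor_def mult.commute)

lemma lor_add_left: "lor (x + y) z = lor x z + lor y z"
  by (simp add: lor_def algebra_simps)

lemma lor_add_right: "lor z (x + y) = lor z x + lor z y"
  by (simp add: lor_def algebra_simps)

lemma lor_diff_left: "lor (x - y) z = lor x z - lor y z"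
  by (simp add: lor_def algebra_simps)

lemma lor_diff_right: "lor z (x - y) = lor z x - lor z y"
  by (simp add: lor_def algebra_simps)

lemma lor_scale_left: "lor (c *\<^sub>R x) z = c * lor x z"
  by (simp add: lor_def algebra_simps)

lemma lor_scale_right: "lor z (c *\<^sub>R x) = c * lor z x"
  by (simp add: lor_def algebra_simps)

lemmas lor_simps = lor_add_left lor_add_right lor_diff_left lor_diff_right lor_scale_left lor_scale_right

lemma cauchy_schwarz_3:
  fixes a b c x y z :: real
  shows "(a * x + b * y + c * z)\<^sup>2 \<le> (a\<^sup>2 + b\<^sup>2 + c\<^sup>2) * (x\<^sup>2 + y\<^sup>2 + z\<^sup>2)"
proof -
  have "(a\<^sup>2 + b\<^sup>2 + c\<^sup>2) * (x\<^sup>2 + y\<^sup>2 + z\<^sup>2) - (a * x + b * y + c * z)\<^sup>2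
      = (a * y - b * x)\<^sup>2 + (a * z - c * x)\<^sup>2 + (b * z - c * y)\<^sup>2"
    by (simp add: power2_eq_square algebra_simps)
  then show ?thesis
    by (smt (verit) zero_le_power2)
qed

lemma lor_orthogonal_pos:
  assumes y: "y \<in> hyperboloid" and orth: "lor u y = 0"
  shows "lor u u \<ge> 0" and "lor u u = 0 \<Longrightarrow> u = 0"
proof -
  define S where "S = (u$1)\<^sup>2 + (u$2)\<^sup>2 + (u$3)\<^sup>2"
  have y4: "(y$1)\<^sup>2 + (y$2)\<^sup>2 + (y$3)\<^sup>2 = (y$4)\<^sup>2 - 1" and pos: "y$4 > 0"
    using y by (auto simp: hyperboloid_def lor_def power2_eq_square)
  have uy: "u$1 * y$1 + u$2 * y$2 + u$3 * y$3 = u$4 * y$4"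
    using orth by (simp add: lor_def)
  have le: "(u$4 * y$4)\<^sup>2 \<le> S * ((y$4)\<^sup>2 - 1)"
    using cauchy_schwarz_3[of "u$1" "y$1" "u$2" "y$2" "u$3" "y$3"]
    by (simp only: uy S_def y4)
  have S0: "S \<ge> 0" by (simp add: S_def)
  have luu: "lor u u = S - (u$4)\<^sup>2"
    by (simp add: lor_def S_def power2_eq_square)
  have key: "S \<le> (y$4)\<^sup>2 * lor u u"
    using le by (simp add: luu power_mult_distrib algebra_simps)
  then show ge: "lor u u \<ge> 0"
    using S0 pos by (smt (verit) mult_pos_neg zero_less_power)
  assume z: "lor u u = 0"
  then have "S = 0" using key S0 by simp
  moreover then have "u$4 = 0" using luu z by simp
  ultimately have "u$1 = 0" "u$2 = 0" "u$3 = 0" "u$4 = 0"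
    by (simp_all add: S_def add_nonneg_eq_0_iff)
  then show "u = 0"
    by (simp add: vec_eq_iff forall_4)
qed

lemma lor_neg:
  assumes x: "x \<in> hyperboloid" and y: "y \<in> hyperboloid"
  shows "lor x y < 0"
proof -
  have x4: "(x$1)\<^sup>2 + (x$2)\<^sup>2 + (x$3)\<^sup>2 = (x$4)\<^sup>2 - 1" "x$4 > 0"
    and y4: "(y$1)\<^sup>2 + (y$2)\<^sup>2 + (y$3)\<^sup>2 = (y$4)\<^sup>2 - 1" "y$4 > 0"
    using x y by (auto simp: hyperboloid_def lor_def power2_eq_square)
  have nn: "(x$4)\<^sup>2 - 1 \<ge> 0" "(y$4)\<^sup>2 - 1 \<ge> 0"
    by (simp_all flip: x4(1) y4(1))
  have "(x$1 * y$1 + x$2 * y$2 + x$3 * y$3)\<^sup>2 \<le> ((x$4)\<^sup>2 - 1) * ((y$4)\<^sup>2 - 1)"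
    using cauchy_schwarz_3[of "x$1" "y$1" "x$2" "y$2" "x$3" "y$3"]
    by (simp only: x4 y4)
  also have "\<dots> < (x$4)\<^sup>2 * (y$4)\<^sup>2"
    using nn by (intro mult_strict_mono) auto
  also have "\<dots> = (x$4 * y$4)\<^sup>2" by (simp add: power_mult_distrib)
  finally have "\<bar>x$1 * y$1 + x$2 * y$2 + x$3 * y$3\<bar> < x$4 * y$4"
    using x4(2) y4(2) by (metis abs_le_square_iff abs_of_pos linorder_not_le mult_pos_pos)
  then show ?thesis by (simp add: lor_def)
qed

lemma lor_self: "x \<in> hyperboloid \<Longrightarrow> lor x x = -1"
  by (simp add: hyperboloid_def)

lemma lor_rejection:
  assumes x: "x \<in> hyperboloid" and y: "y \<in> hyperboloid"
  defines "u \<equiv> x + lor x y *\<^sub>R y"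
  shows "lor u y = 0" and "lor u u = (lor x y)\<^sup>2 - 1"
  using lor_self[OF x] lor_self[OF y] lor_commute[of y x]
  by (simp_all add: u_def lor_simps power2_eq_square)

lemma lor_le_minus_one:
  assumes x: "x \<in> hyperboloid" and y: "y \<in> hyperboloid"
  shows "lor x y \<le> -1"
  using lor_orthogonal_pos(1)[OF y lor_rejection(1)[OF x y]] lor_rejection(2)[OF x y] lor_neg[OF x y]
  by (metis abs_le_square_iff abs_of_neg abs_one diff_ge_0_iff_ge le_minus_iff one_power2)

lemma lor_eq_minus_one:
  assumes x: "x \<in> hyperboloid" and y: "y \<in> hyperboloid" and e: "lor x y = -1"
  shows "x = y"
  using lor_orthogonal_pos(2)[OF y lor_rejection(1)[OF x y]] lor_rejection(2)[OF x y] e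
  by simp

lemma lor_cauchy_schwarz:
  assumes y: "y \<in> hyperboloid" and u: "lor u y = 0" and w: "lor w y = 0"
  shows "(lor u w)\<^sup>2 \<le> lor u u * lor w w"
proof (cases "lor w w = 0")
  case True
  then have "w = 0" using lor_orthogonal_pos(2)[OF y w] by simp
  then show ?thesis by (simp add: lor_def)
next
  case False
  then have p: "lor w w > 0" using lor_orthogonal_pos(1)[OF y w] by simp
  define z where "z = lor w w *\<^sub>R u - lor u w *\<^sub>R w"
  have "lor z y = 0" by (simp add: z_def lor_simps u w)
  then have "0 \<le> lor z z" using lor_orthogonal_pos(1)[OF y] by simp
  also have "lor z z = lor w w * (lor w w * lor u u - (lor u w)\<^sup>2)"
    by (simp add: z_def lor_simps lor_commute[of w u] power2_eq_square algebra_simps)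
  finally show ?thesis
    using p by (simp add: zero_le_mult_iff mult.commute)
qed

lemma lor_triangle:
  assumes x: "x \<in> hyperboloid" and y: "y \<in> hyperboloid" and z: "z \<in> hyperboloid"
  shows "arcosh (- lor x z) \<le> arcosh (- lor x y) + arcosh (- lor y z)"
proof -
  define a b where "a = - lor x y" and "b = - lor z y"
  have ab: "a \<ge> 1" "b \<ge> 1"
    using lor_le_minus_one[OF x y] lor_le_minus_one[OF z y] by (auto simp: a_def b_def)
  define u w where "u = x + lor x y *\<^sub>R y" and "w = z + lor z y *\<^sub>R y"
  have u: "lor u y = 0" "lor u u = a\<^sup>2 - 1" and w: "lor w y = 0" "lor w w = b\<^sup>2 - 1"
    using lor_rejection[OF x y] lor_rejection[OF z y] by (auto simp: u_def w_def a_def b_def)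
  have "lor u w = lor x z + lor x y * lor z y"
    using lor_self[OF y]
    by (simp add: u_def w_def lor_simps lor_commute[of y z])
  then have eq: "- lor x z = a * b - lor u w" by (simp add: a_def b_def)
  have "\<bar>lor u w\<bar> = sqrt ((lor u w)\<^sup>2)" by simp
  also have "\<dots> \<le> sqrt ((a\<^sup>2 - 1) * (b\<^sup>2 - 1))"
    using lor_cauchy_schwarz[OF y u(1) w(1)] u(2) w(2) by (intro real_sqrt_le_mono) simp
  also have "\<dots> = sinh (arcosh a) * sinh (arcosh b)"
    using ab by (simp add: sinh_arcosh_real real_sqrt_mult)
  finally have "- lor x z \<le> cosh (arcosh a) * cosh (arcosh b) + sinh (arcosh a) * sinh (arcosh b)"
    using eq ab by simp
  also have "\<dots> = cosh (arcosh a + arcosh b)" by (simp add: cosh_add)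
  finally have "arcosh (- lor x z) \<le> arcosh (cosh (arcosh a + arcosh b))"
    using lor_le_minus_one[OF x z]
    by (smt (verit) arcosh_less_iff_real cosh_real_ge_1)
  also have "\<dots> = arcosh a + arcosh b"
    using ab by (intro arcosh_cosh_real) simp
  finally show ?thesis by (simp add: a_def b_def lor_commute[of y z])
qed

instantiation hyp3 :: metric_space
begin

definition dist_hyp3 :: "hyp3 \<Rightarrow> hyp3 \<Rightarrow> real" where
  "dist_hyp3 x y = arcosh (- lor (Rep_hyp3 x) (Rep_hyp3 y))"

definition uniformity_hyp3 :: "(hyp3 \<times> hyp3) filter" where
  "uniformity_hyp3 = (INF e\<in>{0<..}. principal {(x, y). dist x y < e})"

definition open_hyp3 :: "hyp3 set \<Rightarrow> bool" where
  "open_hyp3 U = (\<forall>x\<in>U. eventually (\<lambda>(x', y). x' = x \<longrightarrow> y \<in> U) uniformity)"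

instance
proof
  fix x y z :: hyp3
  have x: "Rep_hyp3 x \<in> hyperboloid" and y: "Rep_hyp3 y \<in> hyperboloid"
    and z: "Rep_hyp3 z \<in> hyperboloid"
    by (rule Rep_hyp3)+
  have ge: "- lor (Rep_hyp3 x) (Rep_hyp3 y) \<ge> 1"
    using lor_le_minus_one[OF x y] by simp
  have "dist x y = 0 \<longleftrightarrow> - lor (Rep_hyp3 x) (Rep_hyp3 y) = 1"
    unfolding dist_hyp3_def by (rule arcosh_eq_0_iff_real[OF ge])
  also have "\<dots> \<longleftrightarrow> x = y"
    using lor_eq_minus_one[OF x y] lor_self[OF x] by (auto simp: Rep_hyp3_inject)
  finally show "dist x y = 0 \<longleftrightarrow> x = y" .
  show "dist x y \<le> dist x z + dist y z"
    using lor_triangle[OF x z y]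
    by (simp add: dist_hyp3_def lor_commute[of "Rep_hyp3 z" "Rep_hyp3 y"])
qed (rule uniformity_hyp3_def open_hyp3_def)+

end

definition hyp_chart :: "real^3 \<Rightarrow> hyp3" where
  "hyp_chart p = Abs_hyp3 (vector [p$1, p$2, p$3, sqrt (1 + (norm p)\<^sup>2)])"

lemma Rep_hyp_chart: "Rep_hyp3 (hyp_chart p) = vector [p$1, p$2, p$3, sqrt (1 + (norm p)\<^sup>2)]"
proof -
  have "(norm p)\<^sup>2 = (p$1)\<^sup>2 + (p$2)\<^sup>2 + (p$3)\<^sup>2"
    by (simp add: norm_vec_def L2_set_def sum_3)
  then have "vector [p$1, p$2, p$3, sqrt (1 + (norm p)\<^sup>2)] \<in> hyperboloid"
    by (simp add: hyperboloid_def lor_def vector_def power2_eq_square add_pos_nonneg)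
  then show ?thesis by (simp add: hyp_chart_def Abs_hyp3_inverse)
qed

lemma continuous_hyp_chart: "continuous_on UNIV hyp_chart"
proof -
  have "(hyp_chart \<longlongrightarrow> hyp_chart p) (at p)" for p
  proof (subst tendsto_dist_iff)
    define g where "g q = - lor (Rep_hyp3 (hyp_chart q)) (Rep_hyp3 (hyp_chart p))" for q
    have g_ge: "g q \<ge> 1" for q
      using lor_le_minus_one[OF Rep_hyp3 Rep_hyp3, of "hyp_chart q" "hyp_chart p"]
      by (simp add: g_def)
    have "continuous_on UNIV g"
      unfolding g_def Rep_hyp_chart lor_def vector_def
      by (simp, intro continuous_intros)
    then have "continuous_on UNIV (\<lambda>q. arcosh (g q))"
      by (rule continuous_on_compose2[OF continuous_on_arcosh[OF order.refl]]) (use g_ge in auto)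
    then have "((\<lambda>q. arcosh (g q)) \<longlongrightarrow> arcosh (g p)) (at p)"
      by (simp add: continuous_on_def)
    moreover have "arcosh (g p) = 0"
      using lor_self[OF Rep_hyp3, of "hyp_chart p"] by (simp add: g_def)
    ultimately show "((\<lambda>q. dist (hyp_chart q) (hyp_chart p)) \<longlongrightarrow> 0) (at p)"
      by (simp add: dist_hyp3_def g_def)
  qed
  then show ?thesis by (simp add: continuous_on_def)
qed

text \<open>In the chart that forgets the timelike coordinate the Riemannian metric is
  \<open>I - p p\<^sup>T / (1 + |p|\<^sup>2)\<close>, whose determinant is \<open>1 / (1 + |p|\<^sup>2)\<close>.
  The measure is completed, as Lebesgue measure is.\<close>

definition hyp_vol :: "hyp3 measure" where
  "hyp_vol = completion
     (distr (density lborel (\<lambda>p. ennreal (1 / sqrt (1 + (norm p)\<^sup>2)))) borel hyp_chart)"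

text \<open>Tangent vectors at \<open>x\<close> are the vectors of \<open>\<real>\<^sup>4\<close> Lorentz orthogonal to \<open>x\<close>.  Only
  the values of a 3-form on tangent vectors matter.\<close>

definition tangent :: "hyp3 \<Rightarrow> (real^4) set" where
  "tangent x = {u. lor u (Rep_hyp3 x) = 0}"

type_synonym form3 = "hyp3 \<Rightarrow> real^4 \<Rightarrow> real^4 \<Rightarrow> real^4 \<Rightarrow> real"

definition vol_form :: form3 where
  "vol_form x u v w = det (vector [u, v, w, Rep_hyp3 x] :: real^4^4)"

definition has_hyp_derivative :: "(hyp3 \<Rightarrow> hyp3) \<Rightarrow> (real^4 \<Rightarrow> real^4) \<Rightarrow> hyp3 \<Rightarrow> bool" where
  "has_hyp_derivative F D x \<longleftrightarrow>
     ((\<lambda>p. Rep_hyp3 (F (Abs_hyp3 p))) has_derivative D) (at (Rep_hyp3 x) within hyperboloid)"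

text \<open>The derivative \<open>D\<close> is unique on the tangent space, so the choice below does not matter.
  A Lipschitz map is differentiable almost everywhere; at the remaining points the pullback
  is set to 0.\<close>

definition pullback :: "(hyp3 \<Rightarrow> hyp3) \<Rightarrow> form3 \<Rightarrow> form3" where
  "pullback F \<omega> x u v w =
     (if \<exists>D. has_hyp_derivative F D x
      then let D = (SOME D. has_hyp_derivative F D x) in \<omega> (F x) (D u) (D v) (D w)
      else 0)"

text \<open>The unique function \<open>c\<close> with \<open>\<omega> = c \<cdot> vol_form\<close> on tangent vectors.\<close>

definition form_density :: "form3 \<Rightarrow> hyp3 \<Rightarrow> real" where
  "form_density \<omega> x =
     (THE c. \<forall>u\<in>tangent x. \<forall>v\<in>tangent x. \<forall>w\<in>tangent x. \<omega> x u v w = c * vol_form x u v w)"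

definition isom_group :: "(hyp3 \<Rightarrow> hyp3) monoid" where
  "isom_group = \<lparr>carrier = {\<gamma>. bij \<gamma> \<and> (\<forall>x y. dist (\<gamma> x) (\<gamma> y) = dist x y)},
     mult = (\<circ>), one = id\<rparr>"

lemma group_isom_group: "group isom_group"
proof (rule groupI)
  fix \<gamma> :: "hyp3 \<Rightarrow> hyp3"
  assume "\<gamma> \<in> carrier isom_group"
  then have b: "bij \<gamma>" and d: "dist (\<gamma> x) (\<gamma> y) = dist x y" for x y
    by (auto simp: isom_group_def)
  have "dist (inv_into UNIV \<gamma> x) (inv_into UNIV \<gamma> y) = dist x y" for x y
    by (metis b bij_inv_eq_iff d)
  then have "inv_into UNIV \<gamma> \<in> carrier isom_group"
    using b by (simp add: isom_group_def bij_imp_bij_inv)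
  moreover have "inv_into UNIV \<gamma> \<circ> \<gamma> = id"
    using b by (simp add: bij_is_inj)
  ultimately show "\<exists>\<delta>\<in>carrier isom_group. \<delta> \<otimes>\<^bsub>isom_group\<^esub> \<gamma> = \<one>\<^bsub>isom_group\<^esub>"
    by (auto simp: isom_group_def)
qed (auto simp: isom_group_def bij_comp comp_assoc)

definition orientation_preserving :: "(hyp3 \<Rightarrow> hyp3) \<Rightarrow> bool" where
  "orientation_preserving \<gamma> \<longleftrightarrow> (\<forall>x. form_density (pullback \<gamma> vol_form) x > 0)"

definition hyp_plane :: "real^4 \<Rightarrow> hyp3 set" where
  "hyp_plane n = {x. lor (Rep_hyp3 x) n = 0}"

text \<open>Meaningful for \<open>lor n n = 1\<close>.\<close>

definition hyp_reflection :: "real^4 \<Rightarrow> hyp3 \<Rightarrow> hyp3" where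
  "hyp_reflection n x = Abs_hyp3 (Rep_hyp3 x - (2 * lor (Rep_hyp3 x) n) *\<^sub>R n)"

lemma Rep_hyp_reflection:
  assumes "lor n n = 1"
  shows "Rep_hyp3 (hyp_reflection n x) = Rep_hyp3 x - (2 * lor (Rep_hyp3 x) n) *\<^sub>R n"
proof -
  define y where "y = Rep_hyp3 x - (2 * lor (Rep_hyp3 x) n) *\<^sub>R n"
  have x: "Rep_hyp3 x \<in> hyperboloid" by (rule Rep_hyp3)
  have l: "lor y y = -1"
    using lor_self[OF x] assms
    by (simp add: y_def lor_simps lor_commute[of n "Rep_hyp3 x"] power2_eq_square algebra_simps)
  have c: "lor (Rep_hyp3 x) y = - 1 - 2 * (lor (Rep_hyp3 x) n)\<^sup>2"
    using lor_self[OF x] by (simp add: y_def lor_simps power2_eq_square)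
  have "(y$4)\<^sup>2 = 1 + ((y$1)\<^sup>2 + (y$2)\<^sup>2 + (y$3)\<^sup>2)"
    using l by (simp add: lor_def power2_eq_square)
  then have ne: "y$4 \<noteq> 0"
    by (smt (verit) zero_le_power2 zero_power2)
  have "y$4 > 0"
  proof (rule ccontr)
    assume "\<not> y$4 > 0"
    then have "- y \<in> hyperboloid"
      using ne l by (simp add: hyperboloid_def lor_def)
    then have "lor (Rep_hyp3 x) (- y) < 0" by (rule lor_neg[OF x])
    then have "lor (Rep_hyp3 x) y > 0" by (simp add: lor_def)
    then show False using c by (smt (verit) zero_le_power2)
  qed
  then have "y \<in> hyperboloid" using l by (simp add: hyperboloid_def)
  then show ?thesis by (simp add: hyp_reflection_def y_def Abs_hyp3_inverse)
qed

lemma hyp_reflection_isometry: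
  assumes n: "lor n n = 1"
  shows "hyp_reflection n \<in> carrier isom_group"
proof -
  have "hyp_reflection n (hyp_reflection n x) = x" for x
    using n by (simp add: Rep_hyp3_inject[symmetric] Rep_hyp_reflection lor_simps algebra_simps)
  then have "bij (hyp_reflection n)" by (metis bijI')
  moreover have "dist (hyp_reflection n x) (hyp_reflection n y) = dist x y" for x y
    using n by (simp add: dist_hyp3_def Rep_hyp_reflection lor_simps
        lor_commute[of n "Rep_hyp3 y"] algebra_simps)
  ultimately show ?thesis by (simp add: isom_group_def)
qed

text \<open>A tetrahedron is given by the outward unit normals \<open>n 1, \<dots>, n 4\<close> of its faces.
  The vectors \<open>p i\<close> represent the vertices, \<open>p i\<close> being opposite to the \<open>i\<close>-th face; a vertex is
  ideal if \<open>lor (p i) (p i) = 0\<close> and lies in hyperbolic space otherwise.\<close>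

definition is_tetrahedron :: "(nat \<Rightarrow> real^4) \<Rightarrow> bool" where
  "is_tetrahedron n \<longleftrightarrow>
     (\<forall>i\<in>{1..4}. lor (n i) (n i) = 1) \<and>
     (\<exists>p. \<forall>i\<in>{1..4}. lor (p i) (p i) \<le> 0 \<and> p i $ 4 > 0 \<and> lor (p i) (n i) < 0 \<and>
        (\<forall>k\<in>{1..4} - {i}. lor (p i) (n k) = 0))"

definition tetrahedron :: "(nat \<Rightarrow> real^4) \<Rightarrow> hyp3 set" where
  "tetrahedron n = {x. \<forall>i\<in>{1..4}. lor (Rep_hyp3 x) (n i) \<le> 0}"

definition face :: "(nat \<Rightarrow> real^4) \<Rightarrow> nat \<Rightarrow> hyp3 set" where
  "face n i = tetrahedron n \<inter> hyp_plane (n i)"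

text \<open>The interior angle along the edge common to the \<open>i\<close>-th and \<open>k\<close>-th face.\<close>

definition dihedral_angle :: "(nat \<Rightarrow> real^4) \<Rightarrow> nat \<Rightarrow> nat \<Rightarrow> real" where
  "dihedral_angle n i k = pi - arccos (lor (n i) (n k))"

definition tetrahedron_family :: "(nat \<Rightarrow> nat \<Rightarrow> real^4) \<Rightarrow> bool" where
  "tetrahedron_family N \<longleftrightarrow>
     (\<forall>j\<in>{2..6}. is_tetrahedron (N j) \<and>
        dihedral_angle (N j) 1 4 = pi / 2 \<and>
        dihedral_angle (N j) 2 4 = pi / 3 \<and>
        dihedral_angle (N j) 3 4 = pi / real j \<and>
        dihedral_angle (N j) 2 3 = pi / 2 \<and>
        dihedral_angle (N j) 1 3 = pi / 3 \<and>
        dihedral_angle (N j) 1 2 = pi / 5) \<and>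
     (\<exists>v. \<forall>j\<in>{2..6}. face (N j) 1 \<inter> face (N j) 2 \<inter> face (N j) 3 = {v}) \<and>
     (\<exists>P. \<forall>j\<in>{2..6}. \<forall>i\<in>{1..3}. hyp_plane (N j i) = P i) \<and>
     (\<forall>j\<in>{2..5}. tetrahedron (N j) \<subseteq> tetrahedron (N (Suc j)))"

definition reflection_group :: "(nat \<Rightarrow> real^4) \<Rightarrow> (hyp3 \<Rightarrow> hyp3) set" where
  "reflection_group n = generate isom_group ((\<lambda>i. hyp_reflection (n i)) ` {1..4})"

definition rotation_group :: "(nat \<Rightarrow> real^4) \<Rightarrow> (hyp3 \<Rightarrow> hyp3) set" where
  "rotation_group n = {\<gamma> \<in> reflection_group n. orientation_preserving \<gamma>}"

definition orb :: "(hyp3 \<Rightarrow> hyp3) set \<Rightarrow> hyp3 \<Rightarrow> hyp3 set" where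
  "orb \<Gamma> x = (\<lambda>\<gamma>. \<gamma> x) ` \<Gamma>"

text \<open>The points of the quotient are the orbits, and the quotient distance of two orbits is
  their \<^const>\<open>setdist\<close>.\<close>

definition orbifold :: "(hyp3 \<Rightarrow> hyp3) set \<Rightarrow> hyp3 set set" where
  "orbifold \<Gamma> = range (orb \<Gamma>)"

text \<open>The volume of a set \<open>A\<close> of orbits is the largest volume of a set that meets each orbit
  in \<open>A\<close> at most once and no other orbit.  If \<open>\<Gamma>\<close> is discrete then points with nontrivial stabiliser
  form a null set, and this is the volume of the part of a fundamental domain that lies over \<open>A\<close>.\<close>

definition orbifold_vol :: "(hyp3 \<Rightarrow> hyp3) set \<Rightarrow> hyp3 set measure" where
  "orbifold_vol \<Gamma> = measure_of (orbifold \<Gamma>)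
     {A. A \<subseteq> orbifold \<Gamma> \<and> \<Union>A \<in> sets hyp_vol}
     (\<lambda>A. SUP E\<in>{E \<in> sets hyp_vol. E \<subseteq> \<Union>A \<and> inj_on (orb \<Gamma>) E}. emeasure hyp_vol E)"

lemma space_hyp_vol: "space hyp_vol = UNIV"
  by (simp add: hyp_vol_def)

lemma
  assumes "subgroup \<Gamma> isom_group"
  shows space_orbifold_vol: "space (orbifold_vol \<Gamma>) = orbifold \<Gamma>"
    and sets_orbifold_vol: "sets (orbifold_vol \<Gamma>) = {A. A \<subseteq> orbifold \<Gamma> \<and> \<Union>A \<in> sets hyp_vol}"
    and emeasure_orbifold_vol:
      "\<lbrakk>A \<subseteq> orbifold \<Gamma>; \<Union>A \<in> sets hyp_vol\<rbrakk> \<Longrightarrow> emeasure (orbifold_vol \<Gamma>) A =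
         (SUP E\<in>{E \<in> sets hyp_vol. E \<subseteq> \<Union>A \<and> inj_on (orb \<Gamma>) E}. emeasure hyp_vol E)"
proof -
  let ?S = "{A. A \<subseteq> orbifold \<Gamma> \<and> \<Union>A \<in> sets hyp_vol}"
  define T where "T A = {E \<in> sets hyp_vol. E \<subseteq> \<Union>A \<and> inj_on (orb \<Gamma>) E}" for A
  define \<mu> where "\<mu> A = (SUP E\<in>T A. emeasure hyp_vol E)" for A
  have id: "id \<in> \<Gamma>" using subgroup.one_closed[OF assms] by (simp add: isom_group_def)
  have comp: "\<gamma> \<circ> \<delta> \<in> \<Gamma>" if "\<gamma> \<in> \<Gamma>" "\<delta> \<in> \<Gamma>" for \<gamma> \<delta>
    using subgroup.m_closed[OF assms that] by (simp add: isom_group_def)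
  have inverse: "\<exists>\<delta>\<in>\<Gamma>. \<delta> \<circ> \<gamma> = id" if "\<gamma> \<in> \<Gamma>" for \<gamma>
    using subgroup.m_inv_closed[OF assms that]
      group.l_inv[OF group_isom_group subgroup.mem_carrier[OF assms that]]
    by (auto simp: isom_group_def)
  have mem: "x \<in> orb \<Gamma> x" for x
    using imageI[OF id, of "\<lambda>\<gamma>. \<gamma> x"] by (simp add: orb_def)
  have sub: "orb \<Gamma> (\<gamma> x) \<subseteq> orb \<Gamma> x" if "\<gamma> \<in> \<Gamma>" for \<gamma> x
  proof
    fix y assume "y \<in> orb \<Gamma> (\<gamma> x)"
    then obtain \<delta> where "\<delta> \<in> \<Gamma>" "y = (\<delta> \<circ> \<gamma>) x" by (auto simp: orb_def)
    then show "y \<in> orb \<Gamma> x" using comp[OF _ that] unfolding orb_def by blast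
  qed
  have orb_eq: "orb \<Gamma> y = orb \<Gamma> x" if "y \<in> orb \<Gamma> x" for x y
  proof -
    obtain \<gamma> where \<gamma>: "\<gamma> \<in> \<Gamma>" "y = \<gamma> x" using \<open>y \<in> orb \<Gamma> x\<close> by (auto simp: orb_def)
    obtain \<delta> where \<delta>: "\<delta> \<in> \<Gamma>" "\<delta> \<circ> \<gamma> = id" using inverse[OF \<gamma>(1)] by blast
    have "\<delta> y = x" using \<gamma>(2) \<delta>(2) by (metis comp_apply id_apply)
    then show ?thesis using sub[OF \<gamma>(1), of x] sub[OF \<delta>(1), of y] \<gamma>(2)
      by (metis subset_antisym)
  qed
  have mem_Union: "x \<in> \<Union>A \<longleftrightarrow> orb \<Gamma> x \<in> A" if AM: "A \<subseteq> orbifold \<Gamma>" for A x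
  proof
    assume "x \<in> \<Union>A"
    then obtain y where "orb \<Gamma> y \<in> A" "x \<in> orb \<Gamma> y"
      using AM unfolding orbifold_def by blast
    then show "orb \<Gamma> x \<in> A" using orb_eq by metis
  qed (use mem in blast)
  have U: "\<Union>(orbifold \<Gamma>) = UNIV" using mem by (auto simp: orbifold_def)
  have compl: "\<Union>(orbifold \<Gamma> - A) = UNIV - \<Union>A" if "A \<subseteq> orbifold \<Gamma>" for A
    using mem_Union[OF that] mem_Union[of "orbifold \<Gamma> - A"] by (auto simp: orbifold_def)
  have U_sets: "UNIV \<in> sets hyp_vol" using sets.top[of hyp_vol] by (simp add: space_hyp_vol)
  have sa: "sigma_algebra (orbifold \<Gamma>) ?S"
  proof (rule sigma_algebra_iff2[THEN iffD2], intro conjI ballI allI impI)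
    fix A assume "A \<in> ?S"
    then show "orbifold \<Gamma> - A \<in> ?S"
      using compl U_sets by auto
  next
    fix B :: "nat \<Rightarrow> hyp3 set set" assume "range B \<subseteq> ?S"
    then have "\<Union>(\<Union>i. B i) = (\<Union>i. \<Union>(B i))" "\<And>i. \<Union>(B i) \<in> sets hyp_vol"
      "(\<Union>i. B i) \<subseteq> orbifold \<Gamma>" by auto
    then show "(\<Union>i. B i) \<in> ?S" by auto
  qed auto
  have ca: "countably_additive ?S \<mu>"
  proof (rule countably_additiveI)
    fix B :: "nat \<Rightarrow> hyp3 set set"
    assume B: "range B \<subseteq> ?S" and disj: "disjoint_family B"
    have BM: "B i \<subseteq> orbifold \<Gamma>" and Bs: "\<Union>(B i) \<in> sets hyp_vol" for i using B by auto
    have dU: "disjoint_family (\<lambda>i. \<Union>(B i))"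
      using disj mem_Union[OF BM] unfolding disjoint_family_on_def by blast
    have dE: "disjoint_family_on (\<lambda>i. E \<inter> \<Union>(B i)) I" for E I
      using dU unfolding disjoint_family_on_def by blast
    have T_ne: "T A \<noteq> {}" for A unfolding T_def by (auto intro!: exI[of _ "{}"])
    show "(\<Sum>i. \<mu> (B i)) = \<mu> (\<Union>i. B i)"
    proof (rule antisym)
      show "\<mu> (\<Union>i. B i) \<le> (\<Sum>i. \<mu> (B i))"
        unfolding \<mu>_def[of "\<Union>i. B i"]
      proof (rule SUP_least)
        fix E assume E: "E \<in> T (\<Union>i. B i)"
        have Ei: "E \<inter> \<Union>(B i) \<in> T (B i)" for i
          using E Bs[of i] by (auto simp: T_def intro: inj_on_subset)
        have "E = (\<Union>i. E \<inter> \<Union>(B i))" using E unfolding T_def by blast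
        then have "emeasure hyp_vol E = emeasure hyp_vol (\<Union>i. E \<inter> \<Union>(B i))" by simp
        also have "\<dots> = (\<Sum>i. emeasure hyp_vol (E \<inter> \<Union>(B i)))"
          using Ei by (intro suminf_emeasure[symmetric] dE) (auto simp: T_def)
        also have "\<dots> \<le> (\<Sum>i. \<mu> (B i))"
          using Ei by (intro suminf_le) (auto simp: \<mu>_def intro: SUP_upper)
        finally show "emeasure hyp_vol E \<le> (\<Sum>i. \<mu> (B i))" .
      qed
    next
      have fin: "(\<Sum>i<k. \<mu> (B i)) \<le> \<mu> (\<Union>i. B i)" for k
      proof -
        have "\<exists>E. E \<in> T (\<Union>i<k. B i) \<and> (\<forall>i<k. e i \<le> emeasure hyp_vol (E \<inter> \<Union>(B i)))"
          if "\<And>i. i < k \<Longrightarrow> \<exists>E\<in>T (B i). e i \<le> emeasure hyp_vol E" for e :: "nat \<Rightarrow> ennreal"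
        proof -
          obtain E where E: "\<And>i. i < k \<Longrightarrow> E i \<in> T (B i) \<and> e i \<le> emeasure hyp_vol (E i)"
            using \<open>\<And>i. i < k \<Longrightarrow> \<exists>E\<in>T (B i). e i \<le> emeasure hyp_vol E\<close> by metis
          have EB: "E i \<subseteq> \<Union>(B i)" if "i < k" for i
            using E[OF that] by (simp add: T_def)
          have inj: "inj_on (orb \<Gamma>) (\<Union>i<k. E i)"
          proof (rule inj_onI)
            fix x y assume "x \<in> (\<Union>i<k. E i)" "y \<in> (\<Union>i<k. E i)" and o: "orb \<Gamma> x = orb \<Gamma> y"
            then obtain i l where il: "i < k" "l < k" "x \<in> E i" "y \<in> E l" by auto
            then have "orb \<Gamma> x \<in> B i" "orb \<Gamma> y \<in> B l"
              using EB mem_Union[OF BM] by blast+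
            then have "i = l" using disj o unfolding disjoint_family_on_def by fastforce
            then show "x = y" using E[of i] il o unfolding T_def inj_on_def by blast
          qed
          have "(\<Union>i<k. E i) \<in> T (\<Union>i<k. B i)"
          proof -
            have "(\<Union>i<k. E i) \<in> sets hyp_vol"
              using E by (intro sets.finite_UN) (auto simp: T_def)
            moreover have "(\<Union>i<k. E i) \<subseteq> \<Union>(\<Union>i<k. B i)" using EB by blast
            ultimately show ?thesis using inj by (simp add: T_def)
          qed
          moreover have "e i \<le> emeasure hyp_vol ((\<Union>i<k. E i) \<inter> \<Union>(B i))" if "i < k" for i
          proof -
            have "E i \<subseteq> (\<Union>i<k. E i) \<inter> \<Union>(B i)" using EB that by blast
            moreover have "(\<Union>i<k. E i) \<inter> \<Union>(B i) \<in> sets hyp_vol"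
              using E Bs by (intro sets.Int sets.finite_UN) (auto simp: T_def)
            ultimately show ?thesis using E[OF that] by (meson emeasure_mono order_trans)
          qed
          ultimately show ?thesis by blast
        qed
        note pick = this
        have "(\<Sum>i<k. e i) \<le> \<mu> (\<Union>i. B i)"
          if e: "\<And>i. i < k \<Longrightarrow> \<exists>E\<in>T (B i). e i \<le> emeasure hyp_vol E" for e
        proof -
          obtain E where E: "E \<in> T (\<Union>i<k. B i)"
            "\<And>i. i < k \<Longrightarrow> e i \<le> emeasure hyp_vol (E \<inter> \<Union>(B i))"
            using pick[OF e] by blast
          have "(\<Sum>i<k. e i) \<le> (\<Sum>i<k. emeasure hyp_vol (E \<inter> \<Union>(B i)))"
            using E(2) by (intro sum_mono) auto
          also have "\<dots> = emeasure hyp_vol (\<Union>i<k. E \<inter> \<Union>(B i))"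
            using E(1) Bs by (intro sum_emeasure dE) (auto simp: T_def)
          also have "\<dots> \<le> emeasure hyp_vol E"
            using E(1) by (intro emeasure_mono) (auto simp: T_def)
          also have "emeasure hyp_vol E \<le> \<mu> (\<Union>i. B i)"
          proof -
            have "E \<in> T (\<Union>i. B i)" using E(1) unfolding T_def by blast
            then show ?thesis unfolding \<mu>_def by (rule SUP_upper)
          qed
          finally show ?thesis .
        qed
        note le = this
        have "(\<Sum>i<l. \<mu> (B i)) + (\<Sum>i\<in>{l..<k}. e i) \<le> \<mu> (\<Union>i. B i)"
          if "l \<le> k" "\<And>i. i < k \<Longrightarrow> \<exists>E\<in>T (B i). e i \<le> emeasure hyp_vol E" for l e
          using that
        proof (induction l arbitrary: e)
          case 0
          then show ?case using le[of e] by (simp add: lessThan_atLeast0)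
        next
          case (Suc l)
          let ?r = "(\<Sum>i<l. \<mu> (B i)) + (\<Sum>i\<in>{Suc l..<k}. e i)"
          have *: "emeasure hyp_vol E + ?r \<le> \<mu> (\<Union>i. B i)" if "E \<in> T (B l)" for E
          proof -
            define e' where "e' = e(l := emeasure hyp_vol E)"
            have "(\<Sum>i<l. \<mu> (B i)) + (\<Sum>i\<in>{l..<k}. e' i) \<le> \<mu> (\<Union>i. B i)"
              using Suc.prems that by (intro Suc.IH) (auto simp: e'_def)
            moreover have "(\<Sum>i\<in>{l..<k}. e' i) = emeasure hyp_vol E + (\<Sum>i\<in>{Suc l..<k}. e i)"
              using Suc.prems(1) by (simp add: sum.atLeast_Suc_lessThan e'_def)
            ultimately show ?thesis by (simp add: ac_simps)
          qed
          have "\<mu> (B l) + ?r = (SUP E\<in>T (B l). emeasure hyp_vol E + ?r)"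
            using T_ne by (simp add: \<mu>_def[of "B l"] ennreal_SUP_add_left)
          also have "\<dots> \<le> \<mu> (\<Union>i. B i)" using * by (intro SUP_least) auto
          finally show ?case by (simp add: ac_simps)
        qed
        from this[of k "\<lambda>_. 0"] show ?thesis using T_ne by fastforce
      qed
      show "(\<Sum>i. \<mu> (B i)) \<le> \<mu> (\<Union>i. B i)"
        by (rule suminf_le_const[OF summableI fin])
    qed
  qed
  have pos: "positive ?S \<mu>"
    by (auto simp: positive_def \<mu>_def T_def)
  have def: "orbifold_vol \<Gamma> = measure_of (orbifold \<Gamma>) ?S \<mu>"
    by (simp add: orbifold_vol_def \<mu>_def[abs_def] T_def)
  have Pow: "?S \<subseteq> Pow (orbifold \<Gamma>)" by auto
  show "space (orbifold_vol \<Gamma>) = orbifold \<Gamma>"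
    unfolding def by (rule space_measure_of[OF Pow])
  show "sets (orbifold_vol \<Gamma>) = ?S"
    unfolding def using sigma_algebra.sets_measure_of_eq[OF sa] by simp
  show "emeasure (orbifold_vol \<Gamma>) A =
      (SUP E\<in>{E \<in> sets hyp_vol. E \<subseteq> \<Union>A \<and> inj_on (orb \<Gamma>) E}. emeasure hyp_vol E)"
    if "A \<subseteq> orbifold \<Gamma>" "\<Union>A \<in> sets hyp_vol"
    using emeasure_measure_of_sigma[OF sa pos ca, of A] that
    by (simp add: def \<mu>_def T_def)
qed

text \<open>A 3-form on the quotient is represented by the \<open>\<Gamma>\<close>-invariant 3-form \<open>\<omega>\<close> that it pulls
  back to. For a group \<open>\<Gamma>\<close> of orientation preserving isometries the density of \<open>\<omega>\<close> is constant
  on orbits; \<^const>\<open>the_elem\<close> takes its value.\<close>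

definition orbifold_density :: "form3 \<Rightarrow> hyp3 set \<Rightarrow> real" where
  "orbifold_density \<omega> m = the_elem (form_density \<omega> ` m)"

definition orbifold_form_integrable :: "(hyp3 \<Rightarrow> hyp3) set \<Rightarrow> form3 \<Rightarrow> bool" where
  "orbifold_form_integrable \<Gamma> \<omega> \<longleftrightarrow> integrable (orbifold_vol \<Gamma>) (orbifold_density \<omega>)"

definition orbifold_form_integral :: "(hyp3 \<Rightarrow> hyp3) set \<Rightarrow> form3 \<Rightarrow> real" where
  "orbifold_form_integral \<Gamma> \<omega> = (LINT m|orbifold_vol \<Gamma>. orbifold_density \<omega> m)"

definition orbifold_volume :: "(hyp3 \<Rightarrow> hyp3) set \<Rightarrow> ennreal" where
  "orbifold_volume \<Gamma> = emeasure (orbifold_vol \<Gamma>) (orbifold \<Gamma>)"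

text \<open>The sphere at infinity: lightlike rays, normalised to have timelike coordinate 1.\<close>

definition ideal_points :: "(real^4) set" where
  "ideal_points = {\<xi>. lor \<xi> \<xi> = 0 \<and> \<xi> $ 4 = 1}"

text \<open>Convergence to an ideal point, in the projective model.\<close>

definition tends_to_ideal :: "(nat \<Rightarrow> hyp3) \<Rightarrow> real^4 \<Rightarrow> bool" where
  "tends_to_ideal s \<xi> \<longleftrightarrow> (\<lambda>k. (1 / Rep_hyp3 (s k) $ 4) *\<^sub>R Rep_hyp3 (s k)) \<longlonglongrightarrow> \<xi>"

definition fixes_ideal :: "(hyp3 \<Rightarrow> hyp3) \<Rightarrow> real^4 \<Rightarrow> bool" where
  "fixes_ideal \<gamma> \<xi> \<longleftrightarrow> (\<forall>s. tends_to_ideal s \<xi> \<longrightarrow> tends_to_ideal (\<gamma> \<circ> s) \<xi>)"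

definition parabolic :: "(hyp3 \<Rightarrow> hyp3) \<Rightarrow> bool" where
  "parabolic \<gamma> \<longleftrightarrow> \<gamma> \<in> carrier isom_group \<and> (\<forall>x. \<gamma> x \<noteq> x) \<and>
     (\<exists>!\<xi>. \<xi> \<in> ideal_points \<and> fixes_ideal \<gamma> \<xi>)"

text \<open>The cusps of the quotient are the \<open>\<Gamma>\<close>-orbits of the following ideal points.\<close>

definition cusp_points :: "(hyp3 \<Rightarrow> hyp3) set \<Rightarrow> (real^4) set" where
  "cusp_points \<Gamma> = {\<xi> \<in> ideal_points. \<exists>\<gamma>\<in>\<Gamma>. parabolic \<gamma> \<and> fixes_ideal \<gamma> \<xi>}"

definition horoball :: "real^4 \<Rightarrow> real \<Rightarrow> hyp3 set" where
  "horoball \<xi> r = {x. - lor (Rep_hyp3 x) \<xi> < r}"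

definition cusp_neighborhood :: "(hyp3 \<Rightarrow> hyp3) set \<Rightarrow> real^4 \<Rightarrow> hyp3 set set \<Rightarrow> bool" where
  "cusp_neighborhood \<Gamma> \<xi> U \<longleftrightarrow> U \<subseteq> orbifold \<Gamma> \<and> (\<exists>r>0. orb \<Gamma> ` horoball \<xi> r \<subseteq> U)"

end

theory Submission
  imports Defs
begin

text \<open>Both groups are generated by the reflections in the faces of a tetrahedron, so an equivariant map
  is determined by its values on \<open>T\<^sub>6\<close>. A map \<open>F0\<close> from \<open>T\<^sub>6\<close> to \<open>T\<^sub>2\<close> that sends each face into the
  corresponding face extends equivariantly: \<open>T\<^sub>6\<close> is a strict fundamental domain whose stabilisers
  are generated by the reflections in the faces through the point (\<open>chamber_fundamental\<close>, which
  rests on the theorem of Tits, \<open>pos_root\<close>). A geodesic can be cut at the walls, so the extension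
  has the Lipschitz constant of \<open>F0\<close> (\<open>lipschitz_from_chamber\<close>).

  The starting point for \<open>F0\<close> is the linear map \<open>M\<close> of \<open>\<real>\<^sup>4\<close> that takes the vertex vectors of \<open>T\<^sub>6\<close>
  to those of \<open>T\<^sub>2\<close>, each scaled to product \<open>-1\<close> with the normal of the opposite face; it also moves
  the ideal vertices into hyperbolic space. Let \<open>Q\<close> be the Lorentz form. The numerical heart of the
  proof is \<open>Q (M w) < 3 Q w\<close> for all nonzero \<open>w\<close> (\<open>contracting\<close>). Because three faces lie in common
  planes, \<open>M\<close> differs from the identity only in the direction of the common vertex, and the claim
  reduces to an inequality between the cosines of the angles. By compactness the inequality has a
  margin (\<open>contracting_perturbation\<close>), and an inequality of this kind makes the normalised map
  contract distances by a factor less than 1 (\<open>hmap_chord\<close>, \<open>hmap_M_contracting\<close>).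

  The margin allows a small perturbation of \<open>M\<close> after which each face lands strictly outside \<open>T\<^sub>2\<close>.
  Composing with the nearest point projection onto the compact tetrahedron \<open>T\<^sub>2\<close>, which does not
  increase distances (\<open>nearest_nonexpansive\<close>), gives \<open>F0\<close>. As no dihedral angle is obtuse, points
  beyond a face are projected into that face (\<open>nearest_on_face\<close>); so faces go to faces, and a
  neighbourhood of each vertex goes to a vertex.

  Hence there is a compact part of \<open>T\<^sub>6\<close>, the core, outside of which \<open>F0\<close> takes vertices as values.
  On the core, group elements without fixed points move points by at least some \<open>\<delta> > 0\<close>, while the
  square of a parabolic element moves points deep in a horoball at its fixed point by less than \<open>\<delta>\<close>.
  So these points are not equivalent to points of the core, \<open>F\<close> maps the horoball into a countable
  set, and by connectedness it is constant there (\<open>F_constant_on_horoball\<close>).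

  For the integral, the tetrahedron together with its mirror image is a fundamental domain of the
  rotation group. Where the projective map leaves \<open>T\<^sub>2\<close>, the map \<open>F\<close> takes values in a plane and the
  pulled back form vanishes; elsewhere in \<open>T\<^sub>6\<close> the map \<open>F\<close> is the projective map, which takes this
  region bijectively and with positive orientation to the interior of \<open>T\<^sub>2\<close>. Change of variables
  gives twice the volume of \<open>T\<^sub>2\<close> (\<open>degree_one\<close>).\<close>

section \<open>The Lorentz form\<close>

lemma bounded_bilinear_lor: "bounded_bilinear lor"
proof -
  have "bilinear lor"
    unfolding bilinear_def linear_iff by (simp add: lor_simps)
  then show ?thesis by (simp add: bilinear_conv_bounded_bilinear)
qed

interpretation lor: bounded_bilinear lor by (rule bounded_bilinear_lor)

lemmas continuous_on_lor [continuous_intros] = lor.continuous_on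

lemma lor_nondegenerate:
  assumes "\<And>y. lor x y = 0"
  shows "x = 0"
proof -
  have "x $ i = 0" for i
    using assms[of "axis i 1"] exhaust_4[of i] by (auto simp: lor_def axis_def)
  then show ?thesis by (simp add: vec_eq_iff)
qed

lemma lor_norm: "lor x x = (norm x)\<^sup>2 - 2 * (x$4)\<^sup>2"
  by (simp add: lor_def norm_vec_def L2_set_def sum_4 power2_eq_square)

definition causal :: "real^4 \<Rightarrow> bool" where
  "causal p \<longleftrightarrow> lor p p \<le> 0 \<and> p$4 > 0"

lemma spatial_product_le:
  assumes "causal p" "causal q"
  shows "p$1 * q$1 + p$2 * q$2 + p$3 * q$3 \<le> p$4 * q$4"
proof -
  have p: "(p$1)\<^sup>2 + (p$2)\<^sup>2 + (p$3)\<^sup>2 \<le> (p$4)\<^sup>2" "p$4 > 0"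
    and q: "(q$1)\<^sup>2 + (q$2)\<^sup>2 + (q$3)\<^sup>2 \<le> (q$4)\<^sup>2" "q$4 > 0"
    using assms by (auto simp: causal_def lor_def power2_eq_square)
  have "(p$1 * q$1 + p$2 * q$2 + p$3 * q$3)\<^sup>2
      \<le> ((p$1)\<^sup>2 + (p$2)\<^sup>2 + (p$3)\<^sup>2) * ((q$1)\<^sup>2 + (q$2)\<^sup>2 + (q$3)\<^sup>2)"
    by (rule cauchy_schwarz_3)
  also have "\<dots> \<le> (p$4)\<^sup>2 * (q$4)\<^sup>2" using p q by (intro mult_mono) auto
  also have "\<dots> = (p$4 * q$4)\<^sup>2" by (simp add: power_mult_distrib)
  finally show ?thesis
    using p(2) q(2) by (meson less_imp_le mult_pos_pos power2_le_imp_le)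
qed

lemma causal_lor_le: "causal p \<Longrightarrow> causal q \<Longrightarrow> lor p q \<le> 0"
  using spatial_product_le[of p q] by (simp add: lor_def)

text \<open>This is the case of equality in the reversed Cauchy--Schwarz inequality.\<close>

lemma causal_orthogonal_imp_parallel:
  assumes "causal p" "causal q" "lor p q = 0"
  shows "q$4 *\<^sub>R p = p$4 *\<^sub>R q"
proof -
  have p: "(p$1)\<^sup>2 + (p$2)\<^sup>2 + (p$3)\<^sup>2 \<le> (p$4)\<^sup>2" "p$4 > 0"
    and q: "(q$1)\<^sup>2 + (q$2)\<^sup>2 + (q$3)\<^sup>2 \<le> (q$4)\<^sup>2" "q$4 > 0"
    using assms by (auto simp: causal_def lor_def power2_eq_square)
  have pq: "p$1 * q$1 + p$2 * q$2 + p$3 * q$3 = p$4 * q$4" using assms by (simp add: lor_def)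
  have "(q$4 * p$1 - p$4 * q$1)\<^sup>2 + (q$4 * p$2 - p$4 * q$2)\<^sup>2 + (q$4 * p$3 - p$4 * q$3)\<^sup>2
      = (q$4)\<^sup>2 * ((p$1)\<^sup>2 + (p$2)\<^sup>2 + (p$3)\<^sup>2) + (p$4)\<^sup>2 * ((q$1)\<^sup>2 + (q$2)\<^sup>2 + (q$3)\<^sup>2)
        - 2 * (p$4 * q$4) * (p$1 * q$1 + p$2 * q$2 + p$3 * q$3)"
    by (simp add: power2_eq_square algebra_simps)
  also have "\<dots> \<le> (q$4)\<^sup>2 * (p$4)\<^sup>2 + (p$4)\<^sup>2 * (q$4)\<^sup>2 - 2 * (p$4 * q$4) * (p$4 * q$4)"
    unfolding pq using p q by (intro diff_mono add_mono mult_left_mono) auto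
  also have "\<dots> = 0" by (simp add: power2_eq_square)
  finally have "q$4 * p$1 = p$4 * q$1 \<and> q$4 * p$2 = p$4 * q$2 \<and> q$4 * p$3 = p$4 * q$3"
    by (smt (verit) zero_le_power2 power2_eq_iff_nonneg zero_eq_power2)
  then show ?thesis by (simp add: vec_eq_iff forall_4)
qed

lemma timelike_lor_neg:
  assumes "causal p" "causal q" "lor p p < 0"
  shows "lor p q < 0"
proof (rule ccontr)
  assume "\<not> lor p q < 0"
  then have 0: "lor p q = 0" using causal_lor_le[OF assms(1,2)] by simp
  have "q$4 * lor p p = lor p (q$4 *\<^sub>R p)" by (simp add: lor_simps)
  also have "\<dots> = lor p (p$4 *\<^sub>R q)"
    using causal_orthogonal_imp_parallel[OF assms(1,2) 0] by simp
  also have "\<dots> = 0" using 0 by (simp add: lor_simps)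
  finally show False using assms by (simp add: causal_def)
qed

lemma causal_add: "causal p \<Longrightarrow> causal q \<Longrightarrow> causal (p + q)"
  using causal_lor_le[of p q] by (simp add: causal_def lor_simps lor_commute[of q p])

lemma causal_scale: "causal p \<Longrightarrow> 0 < c \<Longrightarrow> causal (c *\<^sub>R p)"
  by (simp add: causal_def lor_simps mult_le_0_iff)

text \<open>If \<open>y\<close> were past then \<open>- y\<close> would be causal and its product with \<open>p\<close> could not be positive:
  the time orientation is read off from one product.\<close>

lemma timelike_future:
  assumes "lor y y < 0" and "causal p" and "lor y p < 0"
  shows "y$4 > 0"
proof (rule ccontr)
  assume *: "\<not> y$4 > 0"
  have "y$4 \<noteq> 0"
  proof
    assume "y$4 = 0"
    then have "lor y y = (y$1)\<^sup>2 + (y$2)\<^sup>2 + (y$3)\<^sup>2" by (simp add: lor_def power2_eq_square)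
    then show False using assms(1) by (smt (verit) zero_le_power2)
  qed
  then have "causal (- y)" using assms(1) * by (simp add: causal_def lor.minus_left lor.minus_right)
  from causal_lor_le[OF this assms(2)] assms(3) show False by (simp add: lor.minus_left)
qed

subsection \<open>Normalising timelike vectors\<close>

text \<open>A linear map acts on hyperbolic space by normalising the image vectors, where these are
  timelike and future: for Lorentz maps this is the isometric action, in general a projective map.\<close>

definition lnorm :: "real^4 \<Rightarrow> real" where
  "lnorm y = sqrt (- lor y y)"

definition hproj :: "real^4 \<Rightarrow> hyp3" where
  "hproj y = Abs_hyp3 ((1 / lnorm y) *\<^sub>R y)"

definition hmap :: "(real^4 \<Rightarrow> real^4) \<Rightarrow> hyp3 \<Rightarrow> hyp3" where
  "hmap M x = hproj (M (Rep_hyp3 x))"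

definition timelike :: "real^4 \<Rightarrow> bool" where
  "timelike y \<longleftrightarrow> lor y y < 0 \<and> y$4 > 0"

lemma lnorm_pos: "timelike y \<Longrightarrow> lnorm y > 0"
  by (simp add: lnorm_def timelike_def)

lemma lnorm_sq: "timelike y \<Longrightarrow> (lnorm y)\<^sup>2 = - lor y y"
  by (simp add: lnorm_def timelike_def)

lemma timelike_causal: "timelike y \<Longrightarrow> causal y"
  by (simp add: timelike_def causal_def)

lemma timelike_normalise: "timelike y \<Longrightarrow> (1 / lnorm y) *\<^sub>R y \<in> hyperboloid"
  using lnorm_pos[of y] lnorm_sq[of y]
  by (simp add: hyperboloid_def lor_simps timelike_def power2_eq_square field_simps)

lemma Rep_hproj: "timelike y \<Longrightarrow> Rep_hyp3 (hproj y) = (1 / lnorm y) *\<^sub>R y"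
  by (simp add: hproj_def timelike_normalise Abs_hyp3_inverse)

lemma timelike_Rep: "timelike (Rep_hyp3 x)"
  using Rep_hyp3[of x] by (simp add: hyperboloid_def timelike_def)

lemma causal_Rep: "causal (Rep_hyp3 x)"
  by (simp add: timelike_Rep timelike_causal)

lemma lor_Rep_self [simp]: "lor (Rep_hyp3 x) (Rep_hyp3 x) = -1"
  by (simp add: lor_self Rep_hyp3)

lemma lnorm_Rep [simp]: "lnorm (Rep_hyp3 x) = 1"
  by (simp add: lnorm_def)

lemma hproj_Rep [simp]: "hproj (Rep_hyp3 x) = x"
  by (simp add: hproj_def Rep_hyp3_inverse)

lemma timelike_scale: "timelike y \<Longrightarrow> 0 < c \<Longrightarrow> timelike (c *\<^sub>R y)"
  by (simp add: timelike_def lor_simps mult_less_0_iff zero_less_mult_iff)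

lemma timelike_add_causal: "timelike p \<Longrightarrow> causal q \<Longrightarrow> timelike (p + q)"
  using timelike_lor_neg[of p q] timelike_causal[of p]
  by (simp add: timelike_def lor_simps lor_commute[of q p] causal_def)

lemma hproj_scale: "timelike y \<Longrightarrow> 0 < c \<Longrightarrow> hproj (c *\<^sub>R y) = hproj y"
proof -
  assume y: "timelike y" and c: "0 < c"
  have "- lor (c *\<^sub>R y) (c *\<^sub>R y) = c\<^sup>2 * (- lor y y)"
    by (simp add: lor_simps power2_eq_square)
  then have "lnorm (c *\<^sub>R y) = c * lnorm y"
    using c by (simp only: lnorm_def real_sqrt_mult) simp
  then show "hproj (c *\<^sub>R y) = hproj y"
    using c by (simp add: hproj_def)
qed

lemma dist_hyp3_cosh: "cosh (dist x y) = - lor (Rep_hyp3 x) (Rep_hyp3 y)"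
  using lor_le_minus_one[OF Rep_hyp3 Rep_hyp3, of x y]
  by (simp add: dist_hyp3_def)

lemma dist_hyp3_le_iff: "dist x y \<le> dist z w \<longleftrightarrow> lor (Rep_hyp3 z) (Rep_hyp3 w) \<le> lor (Rep_hyp3 x) (Rep_hyp3 y)"
proof -
  have "dist x y \<le> dist z w \<longleftrightarrow> cosh (dist x y) \<le> cosh (dist z w)"
    by (simp add: cosh_real_nonneg_le_iff)
  then show ?thesis by (simp add: dist_hyp3_cosh)
qed

lemma lor_chord: "lor (Rep_hyp3 x - Rep_hyp3 y) (Rep_hyp3 x - Rep_hyp3 y) = 4 * (sinh (dist x y / 2))\<^sup>2"
proof -
  have "cosh (dist x y) = 1 + 2 * (sinh (dist x y / 2))\<^sup>2"
    using cosh_double[of "dist x y / 2"] cosh_square_eq[of "dist x y / 2"] by simp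
  then show ?thesis
    using dist_hyp3_cosh[of x y] by (simp add: lor_simps lor_commute[of "Rep_hyp3 y" "Rep_hyp3 x"])
qed

subsection \<open>Segments\<close>

text \<open>The nonnegative combinations of the vectors of two points are, up to scale, the points of
  the segment between them. The formulas for the hyperbolic sine and cosine of the two partial
  distances combine to the addition theorem.\<close>

lemma dist_through_combination:
  fixes x y :: hyp3
  assumes a: "0 \<le> a" and b: "0 \<le> b" and ab: "a + b > 0"
  defines "z \<equiv> hproj (a *\<^sub>R Rep_hyp3 x + b *\<^sub>R Rep_hyp3 y)"
  shows "timelike (a *\<^sub>R Rep_hyp3 x + b *\<^sub>R Rep_hyp3 y)" and "dist x z + dist z y = dist x y"
    and "lnorm (a *\<^sub>R Rep_hyp3 x + b *\<^sub>R Rep_hyp3 y) \<ge> a + b"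
proof -
  let ?y = "a *\<^sub>R Rep_hyp3 x + b *\<^sub>R Rep_hyp3 y"
  define C where "C = cosh (dist x y)"
  define S where "S = sinh (dist x y)"
  have C1: "C \<ge> 1" by (simp add: C_def cosh_real_ge_1)
  have S0: "S \<ge> 0" by (simp add: S_def)
  have CS: "S\<^sup>2 = C\<^sup>2 - 1" by (simp add: C_def S_def sinh_square_eq)
  have lxy: "lor (Rep_hyp3 x) (Rep_hyp3 y) = - C" by (simp add: C_def dist_hyp3_cosh)
  have Q: "- lor ?y ?y = a\<^sup>2 + b\<^sup>2 + 2 * a * b * C"
    by (simp add: lor_simps lxy lor_commute[of "Rep_hyp3 y" "Rep_hyp3 x"] power2_eq_square algebra_simps)
  have ge: "(a + b)\<^sup>2 \<le> - lor ?y ?y"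
    unfolding Q using mult_left_mono[OF C1, of "2 * a * b"] a b
    by (simp add: power2_eq_square algebra_simps)
  then have "lor ?y ?y < 0" using ab by (smt (verit) zero_less_power)
  moreover have "?y $ 4 > 0"
  proof (cases "a = 0")
    case True then show ?thesis using b ab causal_Rep[of y] by (simp add: causal_def)
  next
    case False then show ?thesis using a b causal_Rep[of x] causal_Rep[of y]
      by (simp add: causal_def add_pos_nonneg)
  qed
  ultimately show tl: "timelike ?y" by (simp add: timelike_def)
  define n where "n = lnorm ?y"
  have n: "n > 0" "n\<^sup>2 = a\<^sup>2 + b\<^sup>2 + 2 * a * b * C"
    using lnorm_pos[OF tl] lnorm_sq[OF tl] Q by (auto simp: n_def)
  show "lnorm ?y \<ge> a + b" using ge n Q a b unfolding n_def[symmetric]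
    by (metis less_imp_le power2_le_imp_le)
  have Rz: "Rep_hyp3 z = (1/n) *\<^sub>R ?y" using Rep_hproj[OF tl] by (simp add: z_def n_def)
  have c1: "cosh (dist x z) = (a + b * C) / n"
    by (simp add: dist_hyp3_cosh Rz lor_simps lxy add_divide_distrib algebra_simps)
  have c2: "cosh (dist z y) = (a * C + b) / n"
    by (simp add: dist_hyp3_cosh Rz lor_simps lxy add_divide_distrib algebra_simps)
  have "(a + b * C)\<^sup>2 - n\<^sup>2 = (b * S)\<^sup>2"
    by (simp add: n(2) CS power_mult_distrib) (simp add: power2_eq_square algebra_simps)
  then have "(sinh (dist x z))\<^sup>2 = (b * S / n)\<^sup>2"
    using n(1) by (simp add: sinh_square_eq c1 power_divide divide_simps)
  then have s1: "sinh (dist x z) = b * S / n"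
    using b S0 n(1) by (simp add: power2_eq_iff_nonneg)
  have "(a * C + b)\<^sup>2 - n\<^sup>2 = (a * S)\<^sup>2"
    by (simp add: n(2) CS power_mult_distrib) (simp add: power2_eq_square algebra_simps)
  then have "(sinh (dist z y))\<^sup>2 = (a * S / n)\<^sup>2"
    using n(1) by (simp add: sinh_square_eq c2 power_divide divide_simps)
  then have s2: "sinh (dist z y) = a * S / n"
    using a S0 n(1) by (simp add: power2_eq_iff_nonneg)
  have "cosh (dist x z + dist z y) = ((a + b * C) * (a * C + b) + a * b * S\<^sup>2) / n\<^sup>2"
    unfolding cosh_add c1 c2 s1 s2 using n(1) by (simp add: divide_simps power2_eq_square)
  also have "\<dots> = C"
  proof -
    have "(a + b * C) * (a * C + b) + a * b * S\<^sup>2 = C * n\<^sup>2"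
      by (simp add: CS n(2)) (simp add: power2_eq_square algebra_simps)
    then show ?thesis using n(1) by simp
  qed
  finally have "cosh (dist x z + dist z y) = cosh (dist x y)" by (simp add: C_def)
  then show "dist x z + dist z y = dist x y"
    by (metis add_nonneg_nonneg arcosh_cosh_real zero_le_dist)
qed

lemma midpoint_hyp3:
  fixes x y :: hyp3
  obtains z where "dist x z = dist x y / 2" "dist z y = dist x y / 2"
proof -
  define z where "z = hproj (1 *\<^sub>R Rep_hyp3 x + 1 *\<^sub>R Rep_hyp3 y)"
  note d = dist_through_combination[of 1 1 x y]
  have tl: "timelike (1 *\<^sub>R Rep_hyp3 x + 1 *\<^sub>R Rep_hyp3 y)" using d by simp
  have "cosh (dist x z) = cosh (dist z y)"
    unfolding z_def dist_hyp3_cosh Rep_hproj[OF tl]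
    by (simp add: lor_simps lor_commute[of "Rep_hyp3 y" "Rep_hyp3 x"])
  then have "dist x z = dist z y"
    by (metis arcosh_cosh_real zero_le_dist)
  moreover have "dist x z + dist z y = dist x y" using d by (simp add: z_def)
  ultimately show ?thesis using that[of z] by simp
qed

subsection \<open>Lorentz maps\<close>

definition lorentz :: "(real^4 \<Rightarrow> real^4) \<Rightarrow> bool" where
  "lorentz g \<longleftrightarrow> linear g \<and> (\<forall>x y. lor (g x) (g y) = lor x y) \<and> g ` hyperboloid \<subseteq> hyperboloid"

lemma lorentz_linear: "lorentz g \<Longrightarrow> linear g"
  and lorentz_lor: "lorentz g \<Longrightarrow> lor (g x) (g y) = lor x y"
  by (auto simp: lorentz_def)

lemma Rep_hmap_lorentz: "lorentz g \<Longrightarrow> Rep_hyp3 (hmap g x) = g (Rep_hyp3 x)"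
  using Rep_hyp3[of x]
  by (auto simp: lorentz_def hmap_def hproj_def lnorm_def Abs_hyp3_inverse)

lemma lorentz_compose: "lorentz g \<Longrightarrow> lorentz h \<Longrightarrow> lorentz (g \<circ> h)"
  unfolding lorentz_def by (auto simp: linear_compose image_subset_iff)

lemma lorentz_id: "lorentz id"
  by (simp add: lorentz_def linear_id)

lemma hmap_compose: "lorentz g \<Longrightarrow> lorentz h \<Longrightarrow> hmap (g \<circ> h) = hmap g \<circ> hmap h"
  by (auto simp: fun_eq_iff Rep_hmap_lorentz lorentz_compose simp flip: Rep_hyp3_inject)

lemma hmap_id: "hmap id = id"
  by (simp add: fun_eq_iff hmap_def)

lemma dist_hmap: "lorentz g \<Longrightarrow> dist (hmap g x) (hmap g y) = dist x y"
  by (simp add: dist_hyp3_def Rep_hmap_lorentz lorentz_lor)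

lemma lorentz_inj: "lorentz g \<Longrightarrow> inj g"
  unfolding linear_injective_0[OF lorentz_linear]
proof (intro allI impI)
  fix x assume g: "lorentz g" and "g x = 0"
  then have "lor x y = 0" for y using lorentz_lor[OF g, of x y] by (simp add: lor.zero_left)
  then show "x = 0" by (rule lor_nondegenerate)
qed

section \<open>Reflection groups and their chamber\<close>

subsection \<open>Words in reflections\<close>

definition lrefl :: "real^4 \<Rightarrow> real^4 \<Rightarrow> real^4" where
  "lrefl a x = x - (2 * lor x a) *\<^sub>R a"

text \<open>Words are kept as lists of indices, so that words in two reflection groups can be compared
  letter by letter.\<close>

primrec word :: "(nat \<Rightarrow> real^4) \<Rightarrow> nat list \<Rightarrow> real^4 \<Rightarrow> real^4" where
  "word n [] = id"
| "word n (i # is) = lrefl (n i) \<circ> word n is"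

lemma word_append: "word n (xs @ ys) = word n xs \<circ> word n ys"
  by (induction xs) (auto simp: comp_assoc)

lemma linear_refl: "linear (lrefl a)"
  by (auto simp: linear_iff lrefl_def lor_simps algebra_simps)

lemma lrefl_invol: "lor a a = 1 \<Longrightarrow> lrefl a (lrefl a x) = x"
  by (simp add: lrefl_def lor_simps algebra_simps)

lemma lrefl_lor: "lor a a = 1 \<Longrightarrow> lor (lrefl a x) (lrefl a y) = lor x y"
  by (simp add: lrefl_def lor_simps lor_commute[of a y] algebra_simps)

lemma lrefl_adjoint: "lor (lrefl a x) y = lor x (lrefl a y)"
  by (simp add: lrefl_def lor_simps lor_commute[of y a])

lemma lrefl_self: "lor a a = 1 \<Longrightarrow> lrefl a a = - a"
  by (simp add: lrefl_def scaleR_2)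

lemma lrefl_fixes: "lor x a = 0 \<Longrightarrow> lrefl a x = x"
  by (simp add: lrefl_def)

lemma lorentz_refl:
  assumes "lor a a = 1"
  shows "lorentz (lrefl a)"
proof -
  have "lrefl a x \<in> hyperboloid" if "x \<in> hyperboloid" for x
    using Rep_hyp_reflection[OF assms, of "Abs_hyp3 x"] that Rep_hyp3[of "hyp_reflection a (Abs_hyp3 x)"]
    by (simp add: Abs_hyp3_inverse lrefl_def)
  then show ?thesis using assms by (auto simp: lorentz_def linear_refl lrefl_lor)
qed

lemma hyp_reflection_hmap: "lor a a = 1 \<Longrightarrow> hyp_reflection a = hmap (lrefl a)"
  by (simp add: fun_eq_iff Rep_hmap_lorentz lorentz_refl Rep_hyp_reflection lrefl_def
      flip: Rep_hyp3_inject)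

lemma linear_word: "linear (word n xs)"
  by (induction xs) (simp_all only: word.simps linear_id linear_compose linear_refl)

lemma lorentz_word: "(\<And>i. i \<in> set xs \<Longrightarrow> lor (n i) (n i) = 1) \<Longrightarrow> lorentz (word n xs)"
  by (induction xs) (auto intro!: lorentz_id lorentz_compose lorentz_refl)

lemma word_rev_cancel:
  "(\<And>i. i \<in> set xs \<Longrightarrow> lor (n i) (n i) = 1) \<Longrightarrow> word n (rev xs) (word n xs x) = x"
  by (induction xs arbitrary: x) (auto simp: word_append lrefl_invol)

lemma word_rev_cancel':
  "(\<And>i. i \<in> set xs \<Longrightarrow> lor (n i) (n i) = 1) \<Longrightarrow> word n xs (word n (rev xs) x) = x"
  using word_rev_cancel[of "rev xs" n x] by simp

lemma word_adjoint: "lor (word n xs x) y = lor x (word n (rev xs) y)"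
  by (induction xs arbitrary: x y) (auto simp: word_append lrefl_adjoint)

lemma word_fixes: "(\<And>i. i \<in> set xs \<Longrightarrow> lor x (n i) = 0) \<Longrightarrow> word n xs x = x"
  by (induction xs) (auto simp: lrefl_fixes)

subsection \<open>Dihedral subgroups\<close>

text \<open>The recursion adds letters on the right, where dihedral factors are split off below.\<close>

primrec alt :: "'a \<Rightarrow> 'a \<Rightarrow> nat \<Rightarrow> 'a list" where
  "alt s t 0 = []"
| "alt s t (Suc k) = alt t s k @ [t]"

lemma length_alt [simp]: "length (alt s t k) = k"
  by (induction k arbitrary: s t) auto

lemma set_alt: "set (alt s t k) \<subseteq> {s, t}"
  by (induction k arbitrary: s t) auto

lemma alt_suffix: "m \<le> k \<Longrightarrow> \<exists>pre. set pre \<subseteq> {s, t} \<and> length pre = k - m \<and> alt s t k = pre @ alt s t m"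
proof (induction m arbitrary: s t k)
  case 0 then show ?case using set_alt[of s t k] by auto
next
  case (Suc m)
  then obtain k' where k: "k = Suc k'" "m \<le> k'" by (cases k) auto
  from Suc.IH[OF k(2), of t s] show ?case by (auto simp: k insert_commute)
qed

text \<open>A word in two letters that cannot be shortened has no repeated letter, so it alternates.\<close>

lemma minimal_word_alternates:
  assumes unit: "lor (n s) (n s) = 1" "lor (n t) (n t) = 1"
    and "set u \<subseteq> {s, t}"
    and "\<And>u'. set u' \<subseteq> {s, t} \<Longrightarrow> word n u' = word n u \<Longrightarrow> length u \<le> length u'"
    and "u \<noteq> [] \<Longrightarrow> last u = t"
  shows "u = alt s t (length u)"
  using assms
proof (induction u arbitrary: s t rule: rev_induct)
  case (snoc x u)
  have x: "x = t" using snoc.prems by simp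
  have min: "length u \<le> length u'" if "set u' \<subseteq> {t, s}" "word n u' = word n u" for u'
    using snoc.prems(4)[of "u' @ [x]"] that x by (auto simp: word_append)
  have "last u = s" if "u \<noteq> []"
  proof (rule ccontr)
    assume "last u \<noteq> s"
    moreover have "set u \<subseteq> {s, t}" using snoc.prems(3) by simp
    ultimately have "last u = t" using last_in_set[OF that] by blast
    then have u: "u = butlast u @ [t]" using append_butlast_last_id[OF that] by simp
    have "word n (u @ [x]) = word n (butlast u)"
      by (subst u) (simp add: x word_append fun_eq_iff lrefl_invol snoc.prems)
    moreover have "set (butlast u) \<subseteq> {s, t}" using snoc.prems(3) by (auto dest: in_set_butlastD)
    ultimately show False using snoc.prems(4)[of "butlast u"] by simp
  qed
  then have "u = alt t s (length u)"
    using snoc.prems min by (intro snoc.IH) auto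
  then show ?case using x by simp
qed simp

text \<open>The coordinates of the roots of a dihedral group: Chebyshev polynomials of the second kind
  in \<open>cos (pi / m)\<close>.\<close>

definition sinratio :: "nat \<Rightarrow> nat \<Rightarrow> real" where
  "sinratio m k = sin (real k * pi / real m) / sin (pi / real m)"

lemma sinratio_rec:
  assumes "m \<ge> 2"
  shows "sinratio m (Suc (Suc k)) = 2 * cos (pi / real m) * sinratio m (Suc k) - sinratio m k"
proof -
  let ?x = "pi / real m" and ?y = "real (Suc k) * pi / real m"
  have "sin (?y + ?x) + sin (?y - ?x) = 2 * cos ?x * sin ?y"
    by (simp add: sin_add sin_diff)
  moreover have "?y + ?x = real (Suc (Suc k)) * pi / real m" "?y - ?x = real k * pi / real m"
    using assms by (simp_all add: field_simps)
  ultimately have "sin (real (Suc (Suc k)) * pi / real m) = 2 * cos ?x * sin ?y - sin (real k * pi / real m)"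
    by simp
  then show ?thesis by (simp add: sinratio_def diff_divide_distrib)
qed

lemma sin_pi_over_pos: "m \<ge> 2 \<Longrightarrow> sin (pi / real m) > 0"
  by (intro sin_gt_zero) (auto simp: field_simps)

lemma sinratio_0 [simp]: "sinratio m 0 = 0"
  and sinratio_1: "m \<ge> 2 \<Longrightarrow> sinratio m (Suc 0) = 1"
  and sinratio_m: "m \<ge> 2 \<Longrightarrow> sinratio m m = 0"
  using sin_pi_over_pos[of m] by (auto simp: sinratio_def)

lemma sinratio_nonneg: "m \<ge> 2 \<Longrightarrow> k \<le> m \<Longrightarrow> sinratio m k \<ge> 0"
  unfolding sinratio_def using sin_pi_over_pos[of m]
  by (intro divide_nonneg_pos sin_ge_zero) (auto simp: field_simps)

lemma sinratio_pred: "m \<ge> 2 \<Longrightarrow> sinratio m (m - 1) = 1"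
proof -
  assume m: "m \<ge> 2"
  have "real (m - 1) * pi / real m = pi - pi / real m"
    using m by (simp add: field_simps of_nat_diff)
  then show ?thesis using sin_pi_over_pos[OF m] by (simp add: sinratio_def)
qed

lemma sinratio_Suc: "m \<ge> 2 \<Longrightarrow> sinratio m (Suc m) = -1"
proof -
  assume m: "m \<ge> 2"
  have "real (Suc m) * pi / real m = pi / real m + pi"
    using m by (simp add: field_simps)
  then show ?thesis using sin_pi_over_pos[OF m] by (simp add: sinratio_def)
qed

text \<open>The orbit of a simple root under a dihedral group, in coordinates with respect to the two
  simple roots.\<close>

lemma word_alt_root:
  assumes "lor (n s) (n s) = 1" "lor (n t) (n t) = 1" "lor (n s) (n t) = - cos (pi / real m)" "m \<ge> 2"
  shows "word n (alt s t k) (n s) =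
    (if even k then sinratio m (Suc k) *\<^sub>R n s + sinratio m k *\<^sub>R n t
     else sinratio m (Suc k) *\<^sub>R n t + sinratio m k *\<^sub>R n s)"
  using assms
proof (induction k arbitrary: s t rule: less_induct)
  case (less k)
  note pr = less.prems
  have pr': "lor (n t) (n s) = - cos (pi / real m)" using pr by (simp add: lor_commute)
  have rts: "lrefl (n t) (n s) = n s + (2 * cos (pi / real m)) *\<^sub>R n t"
    using pr by (simp add: lrefl_def)
  consider "k = 0" | "k = 1" | j where "k = Suc (Suc j)"
    by (metis One_nat_def not0_implies_Suc)
  then show ?case
  proof cases
    case 1 then show ?thesis using pr by (simp add: sinratio_1)
  next
    case 2 then show ?thesis using pr rts sinratio_rec[of m 0] by (simp add: sinratio_1)
  next
    case (3 j)
    have A: "word n (alt t s (Suc j)) (n t) =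
      (if even (Suc j) then sinratio m (Suc (Suc j)) *\<^sub>R n t + sinratio m (Suc j) *\<^sub>R n s
       else sinratio m (Suc (Suc j)) *\<^sub>R n s + sinratio m (Suc j) *\<^sub>R n t)"
      using less.IH[of "Suc j" t s] 3 pr pr' by simp
    have B: "word n (alt s t j) (n s) =
      (if even j then sinratio m (Suc j) *\<^sub>R n s + sinratio m j *\<^sub>R n t
       else sinratio m (Suc j) *\<^sub>R n t + sinratio m j *\<^sub>R n s)"
      using less.IH[of j s t] 3 pr by simp
    have C: "word n (alt t s (Suc j)) (n s) = - word n (alt s t j) (n s)"
      using pr by (simp add: word_append lrefl_self linear_neg[OF linear_word])
    have "word n (alt s t k) (n s) = word n (alt t s (Suc j)) (n s + (2 * cos (pi / real m)) *\<^sub>R n t)"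
      unfolding 3 by (subst alt.simps(2)) (simp add: word_append rts del: alt.simps(2))
    also have "\<dots> = - word n (alt s t j) (n s)
        + (2 * cos (pi / real m)) *\<^sub>R word n (alt t s (Suc j)) (n t)"
      by (simp add: linear_add[OF linear_word] linear_scale[OF linear_word] C del: alt.simps(2))
    also have "\<dots> = (if even k then sinratio m (Suc k) *\<^sub>R n s + sinratio m k *\<^sub>R n t
        else sinratio m (Suc k) *\<^sub>R n t + sinratio m k *\<^sub>R n s)"
      unfolding A B by (simp add: 3 sinratio_rec[OF pr(4), of "Suc j"] sinratio_rec[OF pr(4), of j] algebra_simps)
    finally show ?thesis .
  qed
qed

lemma braid_on_root:
  assumes "lor (n s) (n s) = 1" "lor (n t) (n t) = 1" "lor (n s) (n t) = - cos (pi / real m)" "m \<ge> 2"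
  shows "word n (alt s t m) (n s) = word n (alt t s m) (n s)"
proof -
  obtain k where k: "m = Suc k" using assms(4) by (cases m) auto
  have "word n (alt t s m) (n s) = - word n (alt s t k) (n s)"
    unfolding k using assms by (simp add: word_append lrefl_self linear_neg[OF linear_word])
  then show ?thesis
    using sinratio_m[OF assms(4)] sinratio_Suc[OF assms(4)] sinratio_pred[OF assms(4)]
      word_alt_root[OF assms, of m] word_alt_root[OF assms, of k]
    by (auto simp: k simp del: alt.simps)
qed

text \<open>Both sides are linear, fix the Lorentz complement of the two normals and agree on the
  normals.\<close>

lemma braid:
  assumes n: "lor (n s) (n s) = 1" "lor (n t) (n t) = 1" "lor (n s) (n t) = - cos (pi / real m)" "m \<ge> 2"
  shows "word n (alt s t m) = word n (alt t s m)"
proof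
  fix x
  define c where "c = cos (pi / real m)"
  have ts: "lor (n t) (n s) = - cos (pi / real m)" using n by (simp add: lor_commute)
  have D: "1 - c * c \<noteq> 0"
    using sin_pi_over_pos[OF n(4)] sin_cos_squared_add[of "pi / real m"]
    by (auto simp: c_def power2_eq_square)
  define a where "a = (lor x (n s) + c * lor x (n t)) / (1 - c * c)"
  define b where "b = (lor x (n t) + c * lor x (n s)) / (1 - c * c)"
  define y where "y = x - a *\<^sub>R n s - b *\<^sub>R n t"
  have "lor y (n s) = lor x (n s) - a + b * c" "lor y (n t) = lor x (n t) + a * c - b"
    using n ts by (simp_all add: y_def lor_simps c_def)
  moreover have "lor x (n s) - a + b * c = 0" "lor x (n t) + a * c - b = 0"
    using D by (simp_all add: a_def b_def field_simps)
  ultimately have y: "lor y (n s) = 0" "lor y (n t) = 0" by simp_all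
  have fix_y: "word n (alt s t m) y = y" "word n (alt t s m) y = y"
    using y set_alt[of s t m] set_alt[of t s m] by (auto intro!: word_fixes)
  have x: "x = y + a *\<^sub>R n s + b *\<^sub>R n t" by (simp add: y_def)
  show "word n (alt s t m) x = word n (alt t s m) x"
    unfolding x using fix_y braid_on_root[OF n] braid_on_root[OF n(2,1) ts n(4)]
    by (simp add: linear_add[OF linear_word] linear_scale[OF linear_word])
qed

subsection \<open>The length function and positive roots\<close>

text \<open>By the condition on the Gram matrix, the product of the \<open>i\<close>-th and the \<open>k\<close>-th reflection is
  a rotation of order \<open>e i k\<close>.\<close>

locale coxeter =
  fixes n :: "nat \<Rightarrow> real^4" and e :: "nat \<Rightarrow> nat \<Rightarrow> nat"
  assumes unit: "i \<in> {1..4} \<Longrightarrow> lor (n i) (n i) = 1"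
    and gram: "i \<in> {1..4} \<Longrightarrow> k \<in> {1..4} \<Longrightarrow> i \<noteq> k \<Longrightarrow> lor (n i) (n k) = - cos (pi / real (e i k))"
    and e2: "i \<in> {1..4} \<Longrightarrow> k \<in> {1..4} \<Longrightarrow> i \<noteq> k \<Longrightarrow> e i k \<ge> 2"
begin

definition W :: "(real^4 \<Rightarrow> real^4) set" where
  "W = word n ` lists {1..4}"

definition len :: "(real^4 \<Rightarrow> real^4) \<Rightarrow> nat" where
  "len w = (LEAST k. \<exists>xs\<in>lists {1..4}. length xs = k \<and> word n xs = w)"

lemma len_le: "xs \<in> lists {1..4} \<Longrightarrow> len (word n xs) \<le> length xs"
  unfolding len_def by (rule Least_le) blast

lemma len_attained:
  assumes "w \<in> W"
  obtains xs where "xs \<in> lists {1..4}" "word n xs = w" "length xs = len w"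
proof -
  have "\<exists>k. \<exists>xs\<in>lists {1..4}. length xs = k \<and> word n xs = w"
    using assms by (auto simp: W_def)
  from LeastI_ex[OF this] show ?thesis using that unfolding len_def by blast
qed

lemma W_word: "xs \<in> lists {1..4} \<Longrightarrow> word n xs \<in> W"
  by (simp add: W_def)

lemma W_compose: "v \<in> W \<Longrightarrow> w \<in> W \<Longrightarrow> v \<circ> w \<in> W"
proof -
  assume "v \<in> W" "w \<in> W"
  then obtain xs ys where "xs \<in> lists {1..4}" "v = word n xs" "ys \<in> lists {1..4}" "w = word n ys"
    unfolding W_def by blast
  then show ?thesis using W_word[of "xs @ ys"] by (simp add: word_append)
qed

lemma len_compose: "v \<in> W \<Longrightarrow> w \<in> W \<Longrightarrow> len (v \<circ> w) \<le> len v + len w"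
proof -
  assume "v \<in> W" "w \<in> W"
  then obtain xs ys where "xs \<in> lists {1..4}" "word n xs = v" "length xs = len v"
    "ys \<in> lists {1..4}" "word n ys = w" "length ys = len w" by (metis len_attained)
  then show ?thesis using len_le[of "xs @ ys"] by (simp add: word_append)
qed

lemma len_compose_word: "v \<in> W \<Longrightarrow> xs \<in> lists {1..4} \<Longrightarrow> len (v \<circ> word n xs) \<le> len v + length xs"
  using len_compose[of v "word n xs"] W_word[of xs] len_le[of xs] by linarith

text \<open>Positivity of a root is expressed by its values on the chamber, so that it visibly passes to
  nonnegative combinations.\<close>

definition pos :: "real^4 \<Rightarrow> bool" where
  "pos a \<longleftrightarrow> (\<forall>x. (\<forall>i\<in>{1..4}. lor x (n i) \<le> 0) \<longrightarrow> lor x a \<le> 0)"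

text \<open>Tits' theorem. Splitting off on the right a longest possible factor from the dihedral group
  generated by \<open>s\<close> and the last letter of a shortest word for \<open>w\<close> reduces the claim to shorter
  elements and to the dihedral group.\<close>

theorem pos_root:
  assumes "w \<in> W" "s \<in> {1..4}" "len w \<le> len (w \<circ> lrefl (n s))"
  shows "pos (w (n s))"
  using assms
proof (induction "len w" arbitrary: w s rule: less_induct)
  case less
  note w = less.prems(1) and s = less.prems(2) and le = less.prems(3)
  obtain xs where xs: "xs \<in> lists {1..4}" "word n xs = w" "length xs = len w"
    using len_attained[OF w] .
  show ?case
  proof (cases "xs = []")
    case True
    then show ?thesis using xs s by (auto simp: pos_def)
  next
    case False
    define t where "t = last xs"
    define v0 where "v0 = word n (butlast xs)"
    have xs_eq: "xs = butlast xs @ [t]" using False by (simp add: t_def)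
    have t: "t \<in> {1..4}" using xs(1) False by (auto simp: t_def in_lists_conv_set)
    have bl: "butlast xs \<in> lists {1..4}" using xs(1) by (auto simp: in_lists_conv_set dest: in_set_butlastD)
    have w_v0: "w = v0 \<circ> word n [t]"
      unfolding v0_def xs(2)[symmetric] by (subst xs_eq) (simp only: word_append)
    have v0: "v0 \<in> W" using bl by (simp add: v0_def W_word)
    have len_v0: "len v0 + length [t] = len w"
    proof -
      have "len v0 \<le> len w - 1" using len_le[OF bl] xs(3) by (simp add: v0_def)
      moreover have "len w \<le> len v0 + 1"
        using len_compose_word[OF v0, of "[t]"] t w_v0 by simp
      moreover have "len w > 0" using xs(3) False by (cases xs) auto
      ultimately show ?thesis by simp
    qed
    have w_t: "w \<circ> lrefl (n t) = v0"
      unfolding w_v0 using unit[OF t] by (simp add: fun_eq_iff lrefl_invol)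
    have st: "s \<noteq> t" using le len_v0 w_t by auto
    have us: "lor (n s) (n s) = 1" and ut: "lor (n t) (n t) = 1" using unit s t by auto
    define P where "P v u \<longleftrightarrow> v \<in> W \<and> set u \<subseteq> {s, t} \<and> w = v \<circ> word n u \<and> len v + length u = len w
        \<and> len v < len w" for v u
    have lists_u: "u \<in> lists {1..4}" if "set u \<subseteq> {s, t}" for u
      using that s t by (auto simp: in_lists_conv_set)
    have P0: "P v0 [t]" using v0 w_v0 len_v0 by (simp add: P_def)
    obtain v where v: "\<exists>u. P v u" and vmin: "\<And>v' u'. P v' u' \<Longrightarrow> len v \<le> len v'"
      using ex_has_least_nat[of "\<lambda>v. \<exists>u. P v u" v0 len] P0 by blast
    from v obtain u where P: "P v u" by blast
    then have vW: "v \<in> W" and u: "set u \<subseteq> {s, t}" and wvu: "w = v \<circ> word n u"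
      and lvu: "len v + length u = len w" and lvw: "len v < len w" by (auto simp: P_def)
    \<comment> \<open>Moving a letter from the left to the right factor contradicts the minimality of the left one.\<close>
    have no_shorter: "len v \<le> len (v \<circ> lrefl (n r))" if r: "r \<in> {s, t}" for r
    proof (rule ccontr)
      assume *: "\<not> len v \<le> len (v \<circ> lrefl (n r))"
      have r4: "r \<in> {1..4}" using r s t by auto
      have W': "v \<circ> lrefl (n r) \<in> W" using W_compose[OF vW W_word[of "[r]"]] r4 by simp
      have "w = (v \<circ> lrefl (n r)) \<circ> word n (r # u)"
        unfolding wvu using unit[OF r4] by (simp add: fun_eq_iff lrefl_invol)
      moreover from this have "len w \<le> len (v \<circ> lrefl (n r)) + length (r # u)"
        using len_compose_word[OF W' lists_u[of "r # u"]] r u by simp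
      ultimately have "P (v \<circ> lrefl (n r)) (r # u)"
        using W' r u * lvu lvw by (auto simp: P_def)
      from vmin[OF this] * show False by simp
    qed
    have pos_s: "pos (v (n s))" and pos_t: "pos (v (n t))"
      using less.hyps[OF lvw vW s] less.hyps[OF lvw vW t] no_shorter by auto
    \<comment> \<open>The right factor is reduced, and no shortest expression for it ends in \<open>s\<close>, as \<open>w\<close> is not shortened by \<open>s\<close>.\<close>
    have umin: "length u \<le> length u'" if "set u' \<subseteq> {s, t}" "word n u' = word n u" for u'
      using len_compose_word[OF vW lists_u[OF that(1)]] lvu that(2) wvu by simp
    have not_s: False if "word n u = word n (u' @ [s])" "set u' \<subseteq> {s, t}" "length u' < length u" for u'
    proof -
      have "w \<circ> lrefl (n s) = v \<circ> word n u'"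
        unfolding wvu that(1) using us by (simp add: fun_eq_iff word_append lrefl_invol)
      then have "len (w \<circ> lrefl (n s)) \<le> len v + length u'"
        using len_compose_word[OF vW lists_u[OF that(2)]] by simp
      then show False using le lvu that(3) by simp
    qed
    have "last u = t" if "u \<noteq> []"
    proof (rule ccontr)
      assume "last u \<noteq> t"
      then have "last u = s" using u last_in_set[OF that] by blast
      then have "u = butlast u @ [s]" using append_butlast_last_id[OF that] by simp
      moreover have "set (butlast u) \<subseteq> {s, t}" using u by (auto dest: in_set_butlastD)
      ultimately show False using not_s[of "butlast u"] that by (metis length_append_singleton lessI)
    qed
    then have alt: "u = alt s t (length u)"
      using minimal_word_alternates[OF us ut u umin] by blast
    define m where "m = e s t"
    have m: "m \<ge> 2" "lor (n s) (n t) = - cos (pi / real m)"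
      using e2[OF s t st] gram[OF s t st] by (auto simp: m_def)
    have "length u < m"
    proof (rule ccontr)
      assume "\<not> length u < m"
      then obtain pre where pre: "set pre \<subseteq> {s, t}" "length pre = length u - m"
        "alt s t (length u) = pre @ alt s t m"
        using alt_suffix[of m "length u" s t] by auto
      obtain j where j: "m = Suc j" using m(1) by (cases m) auto
      have "word n u = word n pre \<circ> word n (alt t s m)"
        by (subst alt, subst pre(3)) (simp only: word_append braid[OF us ut m(2,1)])
      also have "\<dots> = word n ((pre @ alt s t j) @ [s])"
        by (simp add: j word_append comp_assoc)
      finally have "word n u = word n ((pre @ alt s t j) @ [s])" .
      moreover have "set (pre @ alt s t j) \<subseteq> {s, t}" using pre(1) set_alt[of s t j] by simp
      moreover have "length (pre @ alt s t j) < length u"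
        using pre(2) j \<open>\<not> length u < m\<close> by simp
      ultimately show False by (rule not_s)
    qed
    then have nn: "sinratio m (Suc (length u)) \<ge> 0" "sinratio m (length u) \<ge> 0"
      using m(1) by (auto intro!: sinratio_nonneg)
    have linv: "linear v" using vW by (auto simp: W_def linear_word)
    have "w (n s) = v (word n (alt s t (length u)) (n s))"
      using alt by (simp add: wvu)
    also have "\<dots> = (if even (length u) then sinratio m (Suc (length u)) *\<^sub>R v (n s) + sinratio m (length u) *\<^sub>R v (n t)
     else sinratio m (Suc (length u)) *\<^sub>R v (n t) + sinratio m (length u) *\<^sub>R v (n s))"
      unfolding word_alt_root[OF us ut m(2,1)] using linv by (simp add: linear_add linear_scale)
    finally show ?thesis
      using nn pos_s pos_t unfolding pos_def
      by (auto simp: lor_simps intro!: add_nonpos_nonpos mult_nonneg_nonpos)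
  qed
qed

lemma len_inverse: "xs \<in> lists {1..4} \<Longrightarrow> len (word n (rev xs)) = len (word n xs)"
proof -
  have le: "len (word n (rev xs)) \<le> len (word n xs)" if xs: "xs \<in> lists {1..4}" for xs
  proof -
    obtain ys where ys: "ys \<in> lists {1..4}" "word n ys = word n xs" "length ys = len (word n xs)"
      using len_attained[OF W_word[OF xs]] .
    have "word n (rev ys) = word n (rev xs)"
    proof
      fix x
      have "word n (rev ys) x = word n (rev ys) (word n xs (word n (rev xs) x))"
        using xs unit by (subst word_rev_cancel') (auto simp: in_lists_conv_set)
      also have "\<dots> = word n (rev xs) x"
        unfolding ys(2)[symmetric] using ys unit by (subst word_rev_cancel) (auto simp: in_lists_conv_set)
      finally show "word n (rev ys) x = word n (rev xs) x" .
    qed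
    then show ?thesis using len_le[of "rev ys"] ys by (simp add: in_lists_conv_set)
  qed
  assume "xs \<in> lists {1..4}"
  then show ?thesis using le[of xs] le[of "rev xs"] by (simp add: in_lists_conv_set)
qed

text \<open>If the reflection in the wall did not shorten the word, then by Tits' theorem the normal of
  the wall, pulled back by the word, would be a positive root, and the image of the chamber would
  lie on the inner side of the wall.\<close>

lemma chamber_side:
  assumes xs: "xs \<in> lists {1..4}" and i: "i \<in> {1..4}"
    and x: "\<forall>k\<in>{1..4}. lor x (n k) \<le> 0" and side: "lor (word n xs x) (n i) > 0"
  shows "len (word n (i # xs)) < len (word n xs)"
proof (rule ccontr)
  assume "\<not> ?thesis"
  then have "len (word n (rev xs)) \<le> len (word n (rev (i # xs)))"
    using len_inverse[of xs] len_inverse[of "i # xs"] xs i by simp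
  then have "pos (word n (rev xs) (n i))"
    using xs i by (intro pos_root) (auto simp: word_append W_def in_lists_conv_set)
  then have "lor x (word n (rev xs) (n i)) \<le> 0" using x by (simp add: pos_def)
  then show False using side by (simp add: word_adjoint)
qed

text \<open>Induction on the length. If the image of \<open>x\<close> under a word lies in the chamber then, by the
  previous lemma, its last reflection cannot cross a wall, so it fixes the image under the shorter
  word.\<close>

theorem chamber_fundamental:
  assumes "xs \<in> lists {1..4}" and x: "\<forall>k\<in>{1..4}. lor x (n k) \<le> 0"
    and "\<forall>k\<in>{1..4}. lor (word n xs x) (n k) \<le> 0"
  shows "word n xs x = x \<and> (\<exists>ys. set ys \<subseteq> {i\<in>{1..4}. lor x (n i) = 0} \<and> word n ys = word n xs)"
  using assms(1,3)
proof (induction "len (word n xs)" arbitrary: xs rule: less_induct)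
  case less
  obtain zs where zs: "zs \<in> lists {1..4}" "word n zs = word n xs" "length zs = len (word n xs)"
    using len_attained[OF W_word[OF less.prems(1)]] .
  show ?case
  proof (cases zs)
    case Nil
    then have "word n xs = id" using zs(2) by simp
    then show ?thesis by (auto intro!: exI[of _ "[]"])
  next
    case (Cons i ws)
    then have i: "i \<in> {1..4}" and ws: "ws \<in> lists {1..4}" using zs(1) by auto
    have ri: "lrefl (n i) (word n (i # ws) y) = word n ws y" for y
      using unit[OF i] by (simp add: lrefl_invol)
    have shorter: "len (word n ws) < len (word n xs)"
      using len_le[OF ws] zs(3) Cons by simp
    \<comment> \<open>Otherwise the first letter would make the word shorter, although it belongs to a shortest word.\<close>
    have "lor (word n ws x) (n i) \<le> 0"
    proof (rule ccontr)
      assume "\<not> ?thesis"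
      then have "len (word n (i # ws)) < len (word n ws)"
        using chamber_side[OF ws i x] by simp
      then show False using shorter zs(2) Cons by simp
    qed
    moreover have eq: "word n xs x = lrefl (n i) (word n ws x)"
      using zs(2) Cons by (metis comp_apply word.simps(2))
    moreover have "lor (word n xs x) (n i) = - lor (word n ws x) (n i)"
      unfolding eq using unit[OF i] by (simp add: lrefl_def lor_simps)
    ultimately have 0: "lor (word n ws x) (n i) = 0" using less.prems(2) i by force
    then have eq': "word n xs x = word n ws x" using eq by (simp add: lrefl_fixes)
    obtain ys where ys: "word n ws x = x" "set ys \<subseteq> {i\<in>{1..4}. lor x (n i) = 0}" "word n ys = word n ws"
      using less.hyps[OF shorter ws] less.prems(2) eq' by auto
    have "word n (i # ys) = word n xs" using ys(3) zs(2) Cons by simp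
    moreover have "set (i # ys) \<subseteq> {i\<in>{1..4}. lor x (n i) = 0}" using ys i 0 by auto
    ultimately show ?thesis using eq' ys(1) by metis
  qed
qed

end

(* Keeps the generator with index 1 in the form in which {1..4} lists it. *)
declare One_nat_def [simp del]

section \<open>Topology of hyperbolic space\<close>

text \<open>On the orthogonal complement of a point the Lorentz form is positive definite, hence
  comparable to the Euclidean norm, with a constant that depends on the height of the point only.\<close>

lemma norm_orthogonal_le:
  assumes y: "y \<in> hyperboloid" and orth: "lor u y = 0"
  shows "(norm u)\<^sup>2 \<le> 2 * (y$4)\<^sup>2 * lor u u"
proof -
  define S where "S = (u$1)\<^sup>2 + (u$2)\<^sup>2 + (u$3)\<^sup>2"
  have y4: "(y$1)\<^sup>2 + (y$2)\<^sup>2 + (y$3)\<^sup>2 = (y$4)\<^sup>2 - 1"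
    using y by (auto simp: hyperboloid_def lor_def power2_eq_square)
  have uy: "u$1 * y$1 + u$2 * y$2 + u$3 * y$3 = u$4 * y$4"
    using orth by (simp add: lor_def)
  have le: "(u$4 * y$4)\<^sup>2 \<le> S * ((y$4)\<^sup>2 - 1)"
    using cauchy_schwarz_3[of "u$1" "y$1" "u$2" "y$2" "u$3" "y$3"]
    by (simp only: uy S_def y4)
  have luu: "lor u u = S - (u$4)\<^sup>2" by (simp add: lor_def S_def power2_eq_square)
  have "S \<le> (y$4)\<^sup>2 * lor u u"
    using le by (simp add: luu power_mult_distrib algebra_simps)
  moreover have "(norm u)\<^sup>2 = S + (u$4)\<^sup>2"
    by (simp add: norm_vec_def L2_set_def sum_4 S_def)
  moreover have "(u$4)\<^sup>2 \<le> S" using lor_orthogonal_pos(1)[OF y orth] luu by simp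
  ultimately show ?thesis by simp
qed

lemma norm_Rep_diff_le:
  "norm (Rep_hyp3 y - Rep_hyp3 x)
    \<le> sqrt 2 * Rep_hyp3 x $ 4 * sinh (dist y x) + (cosh (dist y x) - 1) * norm (Rep_hyp3 x)"
proof -
  let ?x = "Rep_hyp3 x" and ?y = "Rep_hyp3 y" and ?C = "cosh (dist y x)"
  define u where "u = ?y + lor ?y ?x *\<^sub>R ?x"
  have u: "lor u ?x = 0" "lor u u = (sinh (dist y x))\<^sup>2"
    using lor_rejection[OF Rep_hyp3 Rep_hyp3, of y x] dist_hyp3_cosh[of y x]
    by (auto simp: u_def sinh_square_eq)
  have x4: "?x $ 4 > 0" using causal_Rep[of x] by (simp add: causal_def)
  have "(norm u)\<^sup>2 \<le> 2 * (?x$4)\<^sup>2 * lor u u"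
    by (rule norm_orthogonal_le[OF Rep_hyp3 u(1)])
  also have "\<dots> = (sqrt 2 * ?x $ 4 * sinh (dist y x))\<^sup>2"
    by (simp add: u power_mult_distrib)
  finally have nu: "norm u \<le> sqrt 2 * ?x $ 4 * sinh (dist y x)"
    by (rule power2_le_imp_le) (use x4 in simp)
  have "?y - ?x = u + (?C - 1) *\<^sub>R ?x"
    by (simp add: u_def dist_hyp3_cosh algebra_simps)
  then have "norm (?y - ?x) \<le> norm u + norm ((?C - 1) *\<^sub>R ?x)" by (metis norm_triangle_ineq)
  also have "norm ((?C - 1) *\<^sub>R ?x) = (?C - 1) * norm ?x"
    by (simp add: cosh_real_ge_1)
  finally show ?thesis using nu by simp
qed

lemma continuous_on_Rep_hyp3: "continuous_on UNIV Rep_hyp3"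
proof -
  have "(Rep_hyp3 \<longlongrightarrow> Rep_hyp3 x) (at x)" for x
  proof -
    define h where "h d = sqrt 2 * Rep_hyp3 x $ 4 * sinh d + (cosh d - 1) * norm (Rep_hyp3 x)" for d :: real
    have "(h \<longlongrightarrow> h 0) (at 0)"
      unfolding h_def by (intro tendsto_intros)
    then have "isCont h 0" by (simp add: isCont_def)
    moreover have "((\<lambda>y. dist y x) \<longlongrightarrow> dist x x) (at x)" by (intro tendsto_intros)
    then have "((\<lambda>y. dist y x) \<longlongrightarrow> 0) (at x)" by simp
    ultimately have "((\<lambda>y. h (dist y x)) \<longlongrightarrow> h 0) (at x)"
      by (rule isCont_tendsto_compose)
    then have "((\<lambda>y. h (dist y x)) \<longlongrightarrow> 0) (at x)" by (simp add: h_def)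
    then have "((\<lambda>y. Rep_hyp3 y - Rep_hyp3 x) \<longlongrightarrow> 0) (at x)"
      by (rule Lim_null_comparison[rotated]) (simp add: h_def norm_Rep_diff_le)
    then show ?thesis by (simp add: LIM_zero_iff)
  qed
  then show ?thesis by (simp add: continuous_on_def)
qed

lemmas continuous_Rep [continuous_intros] = continuous_on_compose2[OF continuous_on_Rep_hyp3 _ subset_UNIV]

text \<open>A timelike vector is strictly inside the cone, so its product with a causal vector controls
  the time coordinate of the latter, which in turn controls the norm.\<close>

lemma causal_norm_bound:
  assumes "timelike y"
  obtains k where "k > 0" "\<And>x. causal x \<Longrightarrow> k * norm x \<le> - lor y x"
proof
  define Y where "Y = sqrt ((y$1)\<^sup>2 + (y$2)\<^sup>2 + (y$3)\<^sup>2)"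
  have Y2: "(y$1)\<^sup>2 + (y$2)\<^sup>2 + (y$3)\<^sup>2 = Y\<^sup>2" by (simp add: Y_def)
  have Y0: "Y \<ge> 0" by (simp add: Y_def)
  have y4: "y$4 > 0" "Y\<^sup>2 < (y$4)\<^sup>2"
    using assms Y2 by (auto simp: timelike_def lor_def power2_eq_square)
  then have Y4: "Y < y$4" by (meson less_imp_le power2_less_imp_less)
  then show "(y$4 - Y) / 2 > 0" by simp
  fix x assume x: "causal x"
  define X where "X = sqrt ((x$1)\<^sup>2 + (x$2)\<^sup>2 + (x$3)\<^sup>2)"
  have X2: "(x$1)\<^sup>2 + (x$2)\<^sup>2 + (x$3)\<^sup>2 = X\<^sup>2" and X0: "X \<ge> 0" by (simp_all add: X_def)
  have x4: "x$4 > 0" "X\<^sup>2 \<le> (x$4)\<^sup>2"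
    using x X2 by (auto simp: causal_def lor_def power2_eq_square)
  then have X4: "X \<le> x$4" by (meson less_imp_le power2_le_imp_le)
  have "(y$1 * x$1 + y$2 * x$2 + y$3 * x$3)\<^sup>2 \<le> (Y * X)\<^sup>2"
    using cauchy_schwarz_3[of "y$1" "x$1" "y$2" "x$2" "y$3" "x$3"]
    by (simp add: X2 Y2 power_mult_distrib)
  then have "y$1 * x$1 + y$2 * x$2 + y$3 * x$3 \<le> Y * X"
    using X0 Y0 by (meson mult_nonneg_nonneg power2_le_imp_le)
  also have "\<dots> \<le> Y * x$4" using X4 Y0 by (rule mult_left_mono)
  finally have "(y$4 - Y) * x$4 \<le> - lor y x" by (simp add: lor_def algebra_simps)
  moreover have "(norm x)\<^sup>2 \<le> (2 * x$4)\<^sup>2"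
  proof -
    have "(2 * x$4)\<^sup>2 = 4 * (x$4)\<^sup>2" by (simp add: power_mult_distrib)
    moreover have "(norm x)\<^sup>2 \<le> 2 * (x$4)\<^sup>2" using x lor_norm[of x] by (simp add: causal_def)
    ultimately show ?thesis using zero_le_power2[of "x$4"] by linarith
  qed
  then have "norm x \<le> 2 * x$4" by (rule power2_le_imp_le) (use x4 in simp)
  then have "(y$4 - Y) / 2 * norm x \<le> (y$4 - Y) * x$4"
    using Y4 mult_left_mono[of "norm x" "2 * x$4" "(y$4 - Y) / 2"] by simp
  ultimately show "(y$4 - Y) / 2 * norm x \<le> - lor y x" by linarith
qed

lemma bounded_Rep_image:
  fixes A :: "hyp3 set"
  assumes "\<And>x. x \<in> A \<Longrightarrow> dist x o' \<le> R"
  shows "bounded (Rep_hyp3 ` A)"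
proof -
  obtain k where k: "k > 0" "\<And>x. causal x \<Longrightarrow> k * norm x \<le> - lor (Rep_hyp3 o') x"
    using causal_norm_bound[OF timelike_Rep] by metis
  have "norm (Rep_hyp3 x) \<le> cosh R / k" if "x \<in> A" for x
  proof -
    have "k * norm (Rep_hyp3 x) \<le> cosh (dist o' x)"
      using k(2)[OF causal_Rep] by (simp add: dist_hyp3_cosh)
    also have "\<dots> \<le> cosh R"
      using assms[OF that] by (subst cosh_real_nonneg_le_iff) (auto simp: dist_commute intro: order_trans[OF zero_le_dist])
    finally show ?thesis using k(1) by (simp add: field_simps)
  qed
  then show ?thesis by (auto simp: bounded_iff)
qed

text \<open>The Euclidean length of a chord is at least its Lorentz length, so separated points have
  separated coordinate vectors, and a bounded set of these cannot accumulate.\<close>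

lemma finite_separated:
  fixes A :: "hyp3 set"
  assumes r: "r > 0" and sep: "\<And>x y. x \<in> A \<Longrightarrow> y \<in> A \<Longrightarrow> x \<noteq> y \<Longrightarrow> dist x y \<ge> r"
    and bdd: "\<And>x. x \<in> A \<Longrightarrow> dist x o' \<le> R"
  shows "finite A"
proof (rule ccontr)
  assume "infinite A"
  then have inf: "infinite (Rep_hyp3 ` A)"
    by (metis finite_imageD inj_onI Rep_hyp3_inject)
  define c where "c = 2 * sinh (r / 2)"
  have c: "c > 0" using r by (simp add: c_def)
  have sepR: "norm (Rep_hyp3 x - Rep_hyp3 y) \<ge> c" if "x \<in> A" "y \<in> A" "x \<noteq> y" for x y
  proof -
    have "c\<^sup>2 \<le> 4 * (sinh (dist x y / 2))\<^sup>2"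
      using sep[OF that] r by (auto simp: c_def power_mult_distrib intro!: power_mono)
    also have "\<dots> = lor (Rep_hyp3 x - Rep_hyp3 y) (Rep_hyp3 x - Rep_hyp3 y)" by (rule lor_chord[symmetric])
    also have "\<dots> \<le> (norm (Rep_hyp3 x - Rep_hyp3 y))\<^sup>2" by (simp add: lor_norm)
    finally show ?thesis using norm_ge_zero by (rule power2_le_imp_le)
  qed
  obtain l where l: "l islimpt Rep_hyp3 ` A"
    using bounded_infinite_imp_islimpt[OF order.refl bounded_Rep_image[OF bdd] inf] by blast
  have "infinite (Rep_hyp3 ` A \<inter> ball l (c / 2))"
    using l c by (simp add: islimpt_eq_infinite_ball)
  then obtain p q where "p \<in> Rep_hyp3 ` A \<inter> ball l (c / 2)" "q \<in> Rep_hyp3 ` A \<inter> ball l (c / 2)" "p \<noteq> q"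
    by (metis finite.emptyI finite_insert insertCI is_singletonI' is_singleton_the_elem)
  then obtain x y where "x \<in> A" "y \<in> A" "x \<noteq> y" "dist l (Rep_hyp3 x) < c / 2" "dist l (Rep_hyp3 y) < c / 2"
    by auto
  then show False
    using sepR[of x y] dist_triangle_half_r[of l "Rep_hyp3 x" c "Rep_hyp3 y"] by (simp add: dist_norm)
qed

section \<open>Coxeter tetrahedra\<close>

lemma one_to_four: "{1..4::nat} = {1, 2, 3, 4}"
  by auto

lemma sum_one_to_four: "(\<Sum>i\<in>{1..4::nat}. f i) = f 1 + f 2 + f 3 + f 4"
  by (simp add: one_to_four ac_simps)

locale coxeter_tetrahedron = coxeter +
  assumes tet: "is_tetrahedron n"
begin

lemma nonobtuse: "i \<in> {1..4} \<Longrightarrow> k \<in> {1..4} \<Longrightarrow> i \<noteq> k \<Longrightarrow> lor (n i) (n k) \<le> 0"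
proof -
  assume ik: "i \<in> {1..4}" "k \<in> {1..4}" "i \<noteq> k"
  have "cos (pi / real (e i k)) \<ge> 0"
    using e2[OF ik] by (intro cos_ge_zero) (auto simp: field_simps intro: order_trans[of _ 0])
  then show ?thesis using gram[OF ik] by simp
qed

text \<open>The vertices, scaled to the dual basis of the inward normals.\<close>

definition P :: "nat \<Rightarrow> real^4" where
  "P = (SOME p. \<forall>i\<in>{1..4}. causal (p i) \<and> lor (p i) (n i) = -1 \<and>
          (\<forall>k\<in>{1..4} - {i}. lor (p i) (n k) = 0))"

lemma P_ex: "\<forall>i\<in>{1..4}. causal (P i) \<and> lor (P i) (n i) = -1 \<and> (\<forall>k\<in>{1..4} - {i}. lor (P i) (n k) = 0)"
proof -
  obtain p where p: "\<forall>i\<in>{1..4}. lor (p i) (p i) \<le> 0 \<and> p i $ 4 > 0 \<and> lor (p i) (n i) < 0 \<and>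
        (\<forall>k\<in>{1..4} - {i}. lor (p i) (n k) = 0)"
    using tet by (auto simp: is_tetrahedron_def)
  define p' where "p' i = (1 / (- lor (p i) (n i))) *\<^sub>R p i" for i
  have "\<forall>i\<in>{1..4}. causal (p' i) \<and> lor (p' i) (n i) = -1 \<and> (\<forall>k\<in>{1..4} - {i}. lor (p' i) (n k) = 0)"
  proof (intro ballI conjI)
    fix i :: nat assume i: "i \<in> {1..4}"
    have a: "lor (p i) (n i) < 0" "causal (p i)" using p i by (auto simp: causal_def)
    show "causal (p' i)" unfolding p'_def using a by (intro causal_scale) auto
    show "lor (p' i) (n i) = -1" using a by (simp add: p'_def lor_scale_left lor.minus_left)
    show "lor (p' i) (n k) = 0" if "k \<in> {1..4} - {i}" for k
      using p i that by (auto simp: p'_def lor_scale_left lor.minus_left)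
  qed
  then have "\<exists>p. \<forall>i\<in>{1..4}. causal (p i) \<and> lor (p i) (n i) = -1 \<and> (\<forall>k\<in>{1..4} - {i}. lor (p i) (n k) = 0)"
    by blast
  then show ?thesis unfolding P_def by (rule someI_ex)
qed

lemma P_causal: "i \<in> {1..4} \<Longrightarrow> causal (P i)"
  and P_n: "i \<in> {1..4} \<Longrightarrow> k \<in> {1..4} \<Longrightarrow> lor (P i) (n k) = (if i = k then -1 else 0)"
  using P_ex by auto

text \<open>The products with the four normals determine a vector, because the vertex vectors show that
  they can be prescribed arbitrarily.\<close>

lemma P_expand: "x = (\<Sum>i\<in>{1..4}. (- lor x (n i)) *\<^sub>R P i)"
proof -
  define f where "f x = lor x (n 1) *\<^sub>R axis 1 1 + lor x (n 2) *\<^sub>R axis 2 1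
    + lor x (n 3) *\<^sub>R axis 3 1 + lor x (n 4) *\<^sub>R (axis 4 1 :: real^4)" for x
  have lin: "linear f" by (auto simp: linear_iff f_def lor_simps algebra_simps)
  have f: "f x $ 1 = lor x (n 1)" "f x $ 2 = lor x (n 2)" "f x $ 3 = lor x (n 3)" "f x $ 4 = lor x (n 4)" for x
    by (simp_all add: f_def axis_def)
  have "surj f"
  proof (rule surjI)
    fix y
    show "f (- (y$1 *\<^sub>R P 1 + y$2 *\<^sub>R P 2 + y$3 *\<^sub>R P 3 + y$4 *\<^sub>R P 4)) = y"
      by (simp add: vec_eq_iff forall_4 f lor.minus_left lor_simps P_n)
  qed
  then have inj: "inj f" using lin linear_surjective_imp_injective by blast
  have "f x = f (\<Sum>i\<in>{1..4}. (- lor x (n i)) *\<^sub>R P i)"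
    by (simp add: vec_eq_iff forall_4 f sum_one_to_four lor_simps lor.minus_left P_n)
  then show ?thesis using inj by (simp add: inj_eq)
qed

lemma eqI_n: "(\<And>i. i \<in> {1..4} \<Longrightarrow> lor x (n i) = lor y (n i)) \<Longrightarrow> x = y"
  using P_expand[of x] P_expand[of y] by simp

lemma lor_expand: "lor x y = (\<Sum>i\<in>{1..4}. (- lor x (n i)) * lor (P i) y)"
  by (subst P_expand[of x]) (simp add: lor.sum_left lor_simps lor.minus_left)

lemma P_P_neg: "i \<in> {1..4} \<Longrightarrow> k \<in> {1..4} \<Longrightarrow> i \<noteq> k \<Longrightarrow> lor (P i) (P k) < 0"
proof (rule ccontr)
  assume ik: "i \<in> {1..4}" "k \<in> {1..4}" "i \<noteq> k" and "\<not> lor (P i) (P k) < 0"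
  then have "lor (P i) (P k) = 0" using causal_lor_le[OF P_causal P_causal] by (simp add: order_antisym)
  then have "P k $ 4 *\<^sub>R P i = P i $ 4 *\<^sub>R P k"
    by (intro causal_orthogonal_imp_parallel P_causal ik)
  then have "P k $ 4 * lor (P i) (n i) = P i $ 4 * lor (P k) (n i)" by (metis lor_scale_left)
  then show False using P_n ik P_causal[of k] by (auto simp: causal_def)
qed

lemma in_tetrahedron: "x \<in> tetrahedron n \<longleftrightarrow> (\<forall>i\<in>{1..4}. lor (Rep_hyp3 x) (n i) \<le> 0)"
  by (simp add: tetrahedron_def)

lemma combination_causal:
  assumes "\<And>i. i \<in> {1..4} \<Longrightarrow> s i \<ge> 0" "k \<in> {1..4}" "s k > 0"
  shows "causal (\<Sum>i\<in>{1..4}. s i *\<^sub>R P i)"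
proof -
  have "(\<Sum>i\<in>A. s i *\<^sub>R P i) = 0 \<and> (\<forall>i\<in>A. s i = 0) \<or> causal (\<Sum>i\<in>A. s i *\<^sub>R P i)"
    if "finite A" "A \<subseteq> {1..4}" for A
    using that
  proof (induction A rule: finite_induct)
    case (insert i A)
    have "causal (s i *\<^sub>R P i)" if "s i \<noteq> 0"
      using insert.prems assms(1)[of i] that by (intro causal_scale P_causal) auto
    then show ?case using insert by (cases "s i = 0") (auto intro: causal_add)
  qed simp
  from this[of "{1..4}"] assms(2,3) show ?thesis by auto
qed

text \<open>An interior point of the tetrahedron; its orbit is free and serves to measure how far group
  elements move points.\<close>

definition base :: hyp3 where
  "base = hproj (\<Sum>i\<in>{1..4}. P i)"

lemma base: "timelike (\<Sum>i\<in>{1..4}. P i)" "i \<in> {1..4} \<Longrightarrow> lor (Rep_hyp3 base) (n i) < 0"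
proof -
  let ?s = "\<Sum>i\<in>{1..4}. P i"
  have c: "causal ?s" using combination_causal[of "\<lambda>_. 1" 1] by simp
  have sn: "lor ?s (n i) = -1" if "i \<in> {1..4}" for i
    using that by (simp add: lor.sum_left P_n)
  have "lor ?s ?s = lor (P 1) (P 1) + lor (P 2) (P 2) + lor (P 3) (P 3) + lor (P 4) (P 4)
      + 2 * (lor (P 1) (P 2) + lor (P 1) (P 3) + lor (P 1) (P 4)
        + lor (P 2) (P 3) + lor (P 2) (P 4) + lor (P 3) (P 4))"
    unfolding sum_one_to_four
    by (simp add: lor_simps lor_commute[of "P 2" "P 1"] lor_commute[of "P 3" "P 1"]
        lor_commute[of "P 4" "P 1"] lor_commute[of "P 3" "P 2"] lor_commute[of "P 4" "P 2"]
        lor_commute[of "P 4" "P 3"])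
  moreover have "lor (P 1) (P 1) \<le> 0" "lor (P 2) (P 2) \<le> 0" "lor (P 3) (P 3) \<le> 0" "lor (P 4) (P 4) \<le> 0"
    using P_causal by (simp_all add: causal_def)
  ultimately have "lor ?s ?s < 0"
    using P_P_neg[of 1 2] P_P_neg[of 1 3] P_P_neg[of 1 4] P_P_neg[of 2 3] P_P_neg[of 2 4] P_P_neg[of 3 4] by simp
  then show tl: "timelike ?s" using c by (simp add: timelike_def causal_def)
  show "lor (Rep_hyp3 base) (n i) < 0" if "i \<in> {1..4}"
    unfolding base_def Rep_hproj[OF tl] using lnorm_pos[OF tl] sn[OF that] by (simp add: lor_simps)
qed

subsection \<open>The reflection group acts with the tetrahedron as strict fundamental domain\<close>

lemma lorentz_W: "w \<in> W \<Longrightarrow> lorentz w"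
  using unit by (auto simp: W_def in_lists_conv_set intro!: lorentz_word)

lemma W_inverse: "w \<in> W \<Longrightarrow> \<exists>v\<in>W. v \<circ> w = id \<and> w \<circ> v = id"
proof -
  assume "w \<in> W"
  then obtain xs where xs: "xs \<in> lists {1..4}" "w = word n xs" by (auto simp: W_def)
  have "word n (rev xs) \<circ> w = id" "w \<circ> word n (rev xs) = id"
    using xs unit word_rev_cancel[of xs n] word_rev_cancel'[of xs n]
    by (auto simp: fun_eq_iff in_lists_conv_set)
  then show ?thesis using W_word[of "rev xs"] xs by (auto simp: in_lists_conv_set)
qed

lemma lrefl_W: "i \<in> {1..4} \<Longrightarrow> lrefl (n i) \<in> W"
  using W_word[of "[i]"] by simp

lemma id_W: "id \<in> W"
  using W_word[of "[]"] by simp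

lemma countable_W: "countable W"
  unfolding W_def by (intro countable_image countable_lists) auto

lemma reflection_group_hmap: "reflection_group n = hmap ` W"
proof
  have refl: "hyp_reflection (n i) = hmap (lrefl (n i))" if "i \<in> {1..4}" for i
    using unit[OF that] by (rule hyp_reflection_hmap)
  show "reflection_group n \<subseteq> hmap ` W"
  proof
    fix \<gamma> assume "\<gamma> \<in> reflection_group n"
    then have "\<gamma> \<in> generate isom_group ((\<lambda>i. hyp_reflection (n i)) ` {1..4})"
      by (simp add: reflection_group_def)
    then show "\<gamma> \<in> hmap ` W"
    proof induction
      case one
      then show ?case using id_W hmap_id by (auto simp: isom_group_def image_iff intro!: bexI[of _ id])
    next
      case (incl h)
      then show ?case using refl lrefl_W by auto
    next
      case (inv h)
      then obtain i where i: "i \<in> {1..4}" "h = hyp_reflection (n i)" by auto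
      have c: "h \<in> carrier isom_group" using i unit by (auto intro: hyp_reflection_isometry)
      have "h \<circ> h = id"
        unfolding i(2) refl[OF i(1)] using unit[OF i(1)]
        by (simp add: hmap_compose[symmetric] lorentz_refl hmap_id[symmetric]) (simp add: o_def lrefl_invol id_def)
      then have "h \<otimes>\<^bsub>isom_group\<^esub> h = \<one>\<^bsub>isom_group\<^esub>" by (simp add: isom_group_def)
      then have "inv\<^bsub>isom_group\<^esub> h = h"
        using group.inv_equality[OF group_isom_group] c by blast
      then show ?case using i refl lrefl_W by auto
    next
      case (eng h1 h2)
      then obtain v w where "v \<in> W" "w \<in> W" "h1 = hmap v" "h2 = hmap w" by auto
      then show ?case using W_compose[of v w] hmap_compose[of v w] lorentz_W
        by (auto simp: isom_group_def image_iff intro!: bexI[of _ "v \<circ> w"])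
    qed
  qed
  have "hmap (word n xs) \<in> reflection_group n" if "xs \<in> lists {1..4}" for xs
    using that
  proof (induction xs)
    case Nil
    have "hmap (word n []) = \<one>\<^bsub>isom_group\<^esub>" unfolding word.simps hmap_id isom_group_def by simp
    then show ?case by (simp only: reflection_group_def generate.one)
  next
    case (Cons i xs)
    then have i: "i \<in> {1..4}" and xs: "xs \<in> lists {1..4}" by auto
    have "hmap (word n (i # xs)) = hyp_reflection (n i) \<otimes>\<^bsub>isom_group\<^esub> hmap (word n xs)"
      unfolding refl[OF i] word.simps hmap_compose[OF lorentz_W[OF lrefl_W[OF i]] lorentz_W[OF W_word[OF xs]]]
      by (simp add: isom_group_def)
    moreover have "hyp_reflection (n i) \<in> generate isom_group ((\<lambda>i. hyp_reflection (n i)) ` {1..4})"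
      using i by (intro generate.incl) auto
    moreover have "hmap (word n xs) \<in> generate isom_group ((\<lambda>i. hyp_reflection (n i)) ` {1..4})"
      using Cons.IH xs by (simp only: reflection_group_def)
    ultimately show ?case
      by (simp only: reflection_group_def generate.eng)
  qed
  then show "hmap ` W \<subseteq> reflection_group n" by (auto simp: W_def)
qed

lemma subgroup_reflection_group: "subgroup (reflection_group n) isom_group"
  unfolding reflection_group_def
  using unit by (intro group.generate_is_subgroup[OF group_isom_group]) (auto intro: hyp_reflection_isometry)

text \<open>The theorem on chambers in \<open>\<real>\<^sup>4\<close>, for points of hyperbolic space.\<close>

lemma fundamental:
  assumes "xs \<in> lists {1..4}" "x \<in> tetrahedron n" "hmap (word n xs) x \<in> tetrahedron n"
  shows "hmap (word n xs) x = x"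
    and "\<exists>ys. set ys \<subseteq> {i\<in>{1..4}. lor (Rep_hyp3 x) (n i) = 0} \<and> word n ys = word n xs"
proof -
  have "Rep_hyp3 (hmap (word n xs) x) = word n xs (Rep_hyp3 x)"
    using assms(1) by (intro Rep_hmap_lorentz lorentz_W W_word)
  then show "hmap (word n xs) x = x"
    and "\<exists>ys. set ys \<subseteq> {i\<in>{1..4}. lor (Rep_hyp3 x) (n i) = 0} \<and> word n ys = word n xs"
    using chamber_fundamental[OF assms(1), of "Rep_hyp3 x"] assms(2,3)
    by (auto simp: in_tetrahedron simp flip: Rep_hyp3_inject)
qed

lemma free_on_interior:
  assumes "w \<in> W" "\<And>i. i \<in> {1..4} \<Longrightarrow> lor (Rep_hyp3 x) (n i) < 0" "hmap w x \<in> tetrahedron n"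
  shows "w = id"
proof -
  obtain xs where xs: "xs \<in> lists {1..4}" "w = word n xs" using assms(1) by (auto simp: W_def)
  have "x \<in> tetrahedron n" using assms(2) by (auto simp: in_tetrahedron intro: less_imp_le)
  then obtain ys where ys: "set ys \<subseteq> {i\<in>{1..4}. lor (Rep_hyp3 x) (n i) = 0}" "word n ys = word n xs"
    using fundamental(2)[OF xs(1)] assms(3) xs(2) by blast
  then have "ys = []" using assms(2) by (cases ys) force+
  then show ?thesis using ys xs by simp
qed

lemma open_halfspace: "open {x. lor (Rep_hyp3 x) a < 0}"
  by (intro open_Collect_less continuous_intros)

lemma closed_halfspace: "closed {x. lor (Rep_hyp3 x) a \<le> 0}"
  by (intro closed_Collect_le continuous_intros)

lemma closed_tetrahedron: "closed (tetrahedron n)"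
proof -
  have "tetrahedron n = (\<Inter>i\<in>{1..4}. {x. lor (Rep_hyp3 x) (n i) \<le> 0})"
    by (auto simp: in_tetrahedron)
  then show ?thesis by (simp add: closed_INT closed_halfspace)
qed

text \<open>Since the images of the open tetrahedron are disjoint, the orbit of an interior point is
  uniformly discrete.\<close>

lemma finite_moving_little: "finite {w \<in> W. dist (hmap w base) base \<le> R}"
proof -
  have "open (\<Inter>i\<in>{1..4}. {x. lor (Rep_hyp3 x) (n i) < 0})"
    by (intro open_INT) (auto simp: open_halfspace)
  moreover have "base \<in> (\<Inter>i\<in>{1..4}. {x. lor (Rep_hyp3 x) (n i) < 0})" using base by auto
  ultimately obtain r where r: "r > 0" "ball base r \<subseteq> (\<Inter>i\<in>{1..4}. {x. lor (Rep_hyp3 x) (n i) < 0})"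
    by (meson open_contains_ball)
  have *: "w = id" if "w \<in> W" "dist (hmap w base) base < r" for w
  proof -
    have "hmap w base \<in> ball base r" using that by (simp add: dist_commute)
    then have "hmap w base \<in> tetrahedron n" using r(2) by (force simp: in_tetrahedron intro: less_imp_le)
    then show ?thesis using free_on_interior[OF that(1)] base(2) by blast
  qed
  have sep: "v = w" if vw: "v \<in> W" "w \<in> W" "dist (hmap v base) (hmap w base) < r" for v w
  proof -
    obtain u where u: "u \<in> W" "u \<circ> v = id" "v \<circ> u = id" using W_inverse[OF vw(1)] by blast
    have "dist (hmap (u \<circ> w) base) base = dist (hmap u (hmap w base)) (hmap u (hmap v base))"
      using u vw by (simp add: hmap_compose lorentz_W) (metis comp_apply hmap_compose hmap_id id_apply lorentz_W u(1,2) vw(1))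
    also have "\<dots> < r" using vw(3) by (simp add: dist_hmap lorentz_W u dist_commute)
    finally have "u \<circ> w = id" using *[OF W_compose[OF u(1) vw(2)]] by simp
    then have "v \<circ> (u \<circ> w) = v" by simp
    then show ?thesis using u(3) by (simp add: comp_assoc[symmetric])
  qed
  let ?A = "{w \<in> W. dist (hmap w base) base \<le> R}"
  have inj: "inj_on (\<lambda>w. hmap w base) ?A"
    using sep r(1) by (auto simp: inj_on_def)
  have "finite ((\<lambda>w. hmap w base) ` ?A)"
  proof (rule finite_separated[OF r(1), of _ base R])
    fix x y assume "x \<in> (\<lambda>w. hmap w base) ` ?A" "y \<in> (\<lambda>w. hmap w base) ` ?A" "x \<noteq> y"
    then show "r \<le> dist x y" using sep by force
  qed auto
  then show ?thesis using inj by (rule finite_imageD)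
qed

lemma finite_moving_little':
  "finite {w \<in> W. dist (hmap w x) x \<le> R}"
proof (rule finite_subset[OF _ finite_moving_little[of "R + 2 * dist x base"]], safe)
  fix w assume w: "w \<in> W" "dist (hmap w x) x \<le> R"
  have "dist (hmap w base) base \<le> dist (hmap w base) (hmap w x) + dist (hmap w x) x + dist x base"
    by (smt (verit) dist_triangle)
  then show "dist (hmap w base) base \<le> R + 2 * dist x base"
    using w by (simp add: dist_hmap lorentz_W dist_commute)
qed

text \<open>An element of an orbit closest to an interior point of the tetrahedron lies in the
  tetrahedron, since otherwise a reflection in a face would bring it closer.\<close>

theorem tetrahedron_covers:
  obtains w where "w \<in> W" "hmap w z \<in> tetrahedron n"
proof -
  define A where "A = {w \<in> W. dist (hmap w z) base \<le> dist z base}"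
  have "A \<subseteq> {w \<in> W. dist (hmap w z) z \<le> 2 * dist z base}"
  proof
    fix w assume "w \<in> A"
    then have w: "w \<in> W" "dist (hmap w z) base \<le> dist z base" by (auto simp: A_def)
    have "dist (hmap w z) z \<le> dist (hmap w z) base + dist z base" by (metis dist_commute dist_triangle)
    then show "w \<in> {w \<in> W. dist (hmap w z) z \<le> 2 * dist z base}" using w by simp
  qed
  then have fin: "finite A" using finite_moving_little' finite_subset by blast
  have idA: "id \<in> A" using id_W by (simp add: A_def hmap_id)
  define w where "w = arg_min_on (\<lambda>w. dist (hmap w z) base) A"
  have ne: "A \<noteq> {}" using idA by blast
  have wA: "w \<in> A" unfolding w_def by (rule arg_min_if_finite(1)[OF fin ne])
  have wmin: "dist (hmap w z) base \<le> dist (hmap v z) base" if "v \<in> A" for v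
    unfolding w_def by (rule arg_min_least[OF fin ne that])
  have wW: "w \<in> W" using wA by (simp add: A_def)
  have "hmap w z \<in> tetrahedron n"
    unfolding in_tetrahedron
  proof (rule ccontr)
    assume "\<not> (\<forall>i\<in>{1..4}. lor (Rep_hyp3 (hmap w z)) (n i) \<le> 0)"
    then obtain i where i: "i \<in> {1..4}" "lor (Rep_hyp3 (hmap w z)) (n i) > 0" by force
    let ?v = "lrefl (n i) \<circ> w"
    have vW: "?v \<in> W" using i wW by (intro W_compose lrefl_W)
    have "lor (Rep_hyp3 (hmap ?v z)) (Rep_hyp3 base)
        = lor (Rep_hyp3 (hmap w z)) (Rep_hyp3 base)
          - 2 * lor (Rep_hyp3 (hmap w z)) (n i) * lor (Rep_hyp3 base) (n i)"
      using i wW by (simp add: hmap_compose lorentz_W lrefl_W Rep_hmap_lorentz lrefl_def lor_simps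
          lor_commute[of "n i" "Rep_hyp3 base"])
    also have "\<dots> > lor (Rep_hyp3 (hmap w z)) (Rep_hyp3 base)"
      using mult_pos_neg[OF i(2) base(2)[OF i(1)]] by (simp add: mult.commute)
    finally have less: "\<not> dist (hmap w z) base \<le> dist (hmap ?v z) base"
      by (simp add: dist_hyp3_le_iff)
    then have "?v \<in> A" using vW wA by (auto simp: A_def)
    then show False using wmin less by blast
  qed
  then show ?thesis using that wW by blast
qed

text \<open>A geodesic leaving the tetrahedron towards a point of another chamber crosses a wall that
  separates the two chambers, so an equivariant map can be estimated chamber by chamber along the
  geodesic.\<close>

theorem lipschitz_from_chamber:
  fixes G :: "hyp3 \<Rightarrow> hyp3"
  assumes K: "0 \<le> K"
    and inv: "\<And>i x y. i \<in> {1..4} \<Longrightarrow>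
        dist (G (hmap (lrefl (n i)) x)) (G (hmap (lrefl (n i)) y)) = dist (G x) (G y)"
    and lip: "\<And>x y. x \<in> tetrahedron n \<Longrightarrow> y \<in> tetrahedron n \<Longrightarrow> dist (G x) (G y) \<le> K * dist x y"
  shows "lipschitz_on K UNIV G"
proof (rule lipschitz_onI)
  have invw: "dist (G (hmap (word n xs) x)) (G (hmap (word n xs) y)) = dist (G x) (G y)"
    if "xs \<in> lists {1..4}" for xs x y
    using that
  proof (induction xs)
    case (Cons i xs)
    then have "hmap (word n (i # xs)) = hmap (lrefl (n i)) \<circ> hmap (word n xs)"
      using lorentz_W[OF lrefl_W] lorentz_W[OF W_word] by (simp add: hmap_compose)
    then show ?case using Cons inv by (simp del: word.simps)
  qed (simp add: hmap_id[unfolded id_def] hmap_id)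
  have main: "dist (G x) (G (hmap (word n xs) y)) \<le> K * dist x (hmap (word n xs) y)"
    if "xs \<in> lists {1..4}" "x \<in> tetrahedron n" "y \<in> tetrahedron n" for xs x y
    using that(1,2)
  proof (induction "len (word n xs)" arbitrary: xs x rule: less_induct)
    case less
    define y' where "y' = hmap (word n xs) y"
    define a where "a i = lor (Rep_hyp3 x) (n i)" for i
    define b where "b i = lor (Rep_hyp3 y') (n i)" for i
    have a: "a i \<le> 0" if "i \<in> {1..4}" for i using less.prems(2) that by (simp add: a_def in_tetrahedron)
    show ?case
    proof (cases "y' \<in> tetrahedron n")
      case True
      then show ?thesis using lip less.prems unfolding y'_def by blast
    next
      case False
      define J where "J = {i\<in>{1..4}. b i > 0}"
      obtain i0 where "i0 \<in> {1..4}" "b i0 > 0" using False unfolding in_tetrahedron b_def by force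
      then have J: "finite J" "J \<noteq> {}" by (auto simp: J_def)
      \<comment> \<open>The segment to \<open>y'\<close> meets the plane of the face \<open>i\<close> at the parameter \<open>t i\<close>, and it leaves the tetrahedron at the first one.\<close>
      define t where "t i = - a i / (b i - a i)" for i
      define i where "i = arg_min_on t J"
      have iJ: "i \<in> J" unfolding i_def by (rule arg_min_if_finite(1)[OF J])
      have imin: "t i \<le> t k" if "k \<in> J" for k unfolding i_def by (rule arg_min_least[OF J that])
      have i: "i \<in> {1..4}" "b i > 0" using iJ by (auto simp: J_def)
      have t: "0 \<le> t i" "t i \<le> 1" using a[OF i(1)] i(2) by (auto simp: t_def field_simps)
      let ?u = "(1 - t i) *\<^sub>R Rep_hyp3 x + t i *\<^sub>R Rep_hyp3 y'"
      define z where "z = hproj ?u"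
      note seg = dist_through_combination[of "1 - t i" "t i" x y']
      have tl: "timelike ?u" and dz: "dist x z + dist z y' = dist x y'"
        using seg t by (auto simp: z_def)
      have un: "lor ?u (n k) = a k + t i * (b k - a k)" for k
        by (simp add: lor_simps a_def b_def algebra_simps)
      have ui: "lor ?u (n i) = 0"
        unfolding un using a[OF i(1)] i(2) by (simp add: t_def field_simps)
      have "lor ?u (n k) \<le> 0" if k: "k \<in> {1..4}" for k
      proof (cases "b k > 0")
        case True
        then have "t i \<le> t k" using imin k by (simp add: J_def)
        moreover have "b k - a k > 0" using True a[OF k] by simp
        ultimately show ?thesis unfolding un by (simp add: t_def field_simps)
      next
        case False
        have "a k + t i * (b k - a k) = (1 - t i) * a k + t i * b k" by (simp add: algebra_simps)
        also have "\<dots> \<le> 0" using t a[OF k] False by (intro add_nonpos_nonpos mult_nonneg_nonpos) auto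
        finally show ?thesis unfolding un .
      qed
      then have zT: "z \<in> tetrahedron n"
        unfolding in_tetrahedron z_def Rep_hproj[OF tl] using lnorm_pos[OF tl]
        by (simp add: lor_simps mult_le_0_iff divide_nonpos_pos)
      have zi: "hmap (lrefl (n i)) z = z"
      proof -
        have "lor (Rep_hyp3 z) (n i) = 0" unfolding z_def Rep_hproj[OF tl] using ui by (simp add: lor_simps)
        then show ?thesis
          using lorentz_W[OF lrefl_W[OF i(1)]]
          by (simp add: Rep_hmap_lorentz lrefl_fixes flip: Rep_hyp3_inject)
      qed
      have shorter: "len (word n (i # xs)) < len (word n xs)"
      proof (rule chamber_side[OF less.prems(1) i(1)])
        show "\<forall>k\<in>{1..4}. lor (Rep_hyp3 y) (n k) \<le> 0" using that(3) by (simp add: in_tetrahedron)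
        show "0 < lor (word n xs (Rep_hyp3 y)) (n i)"
          using i(2) lorentz_W[OF W_word[OF less.prems(1)]] by (simp add: b_def y'_def Rep_hmap_lorentz)
      qed
      have sy: "hmap (word n (i # xs)) y = hmap (lrefl (n i)) y'"
        using lorentz_W[OF lrefl_W[OF i(1)]] lorentz_W[OF W_word[OF less.prems(1)]]
        by (simp add: hmap_compose y'_def)
      have "dist (G z) (G (hmap (lrefl (n i)) y')) \<le> K * dist z (hmap (lrefl (n i)) y')"
        using less.hyps[OF shorter _ zT] i(1) less.prems(1) unfolding sy by simp
      moreover have "dist (G z) (G (hmap (lrefl (n i)) y')) = dist (G z) (G y')"
        using inv[OF i(1), of z y'] zi by simp
      moreover have "dist z (hmap (lrefl (n i)) y') = dist z y'"
        using dist_hmap[OF lorentz_W[OF lrefl_W[OF i(1)]], of z y'] zi by simp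
      ultimately have "dist (G z) (G y') \<le> K * dist z y'" by simp
      moreover have "dist (G x) (G z) \<le> K * dist x z" using lip less.prems(2) zT by blast
      ultimately have "dist (G x) (G y') \<le> K * (dist x z + dist z y')"
        using dist_triangle[of "G x" "G y'" "G z"] by (simp add: distrib_left)
      then show ?thesis using dz by (simp add: y'_def)
    qed
  qed
  fix x y :: hyp3
  obtain v where v: "v \<in> W" "hmap v x \<in> tetrahedron n" by (rule tetrahedron_covers)
  obtain w where w: "w \<in> W" "hmap w y \<in> tetrahedron n" by (rule tetrahedron_covers)
  obtain w' where w': "w' \<in> W" "w' \<circ> w = id" using W_inverse[OF w(1)] by blast
  obtain xs where xs: "xs \<in> lists {1..4}" "v = word n xs" using v by (auto simp: W_def)
  obtain ys where ys: "ys \<in> lists {1..4}" "v \<circ> w' = word n ys"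
    using W_compose[OF v(1) w'(1)] by (auto simp: W_def)
  have wy: "hmap (word n ys) (hmap w y) = hmap v y"
  proof -
    have "hmap w' (hmap w y) = hmap (w' \<circ> w) y"
      using w(1) w'(1) lorentz_W by (simp add: hmap_compose)
    then have "hmap w' (hmap w y) = y" unfolding w'(2) by (simp add: hmap_id)
    moreover have "hmap (v \<circ> w') = hmap v \<circ> hmap w'"
      using v(1) w'(1) lorentz_W by (simp add: hmap_compose)
    ultimately show ?thesis using ys(2) by (metis comp_apply)
  qed
  have "dist (G x) (G y) = dist (G (hmap v x)) (G (hmap v y))" using invw[OF xs(1)] xs(2) by simp
  also have "\<dots> \<le> K * dist (hmap v x) (hmap v y)" using main[OF ys(1) v(2) w(2)] wy by simp
  also have "\<dots> = K * dist x y" using v by (simp add: dist_hmap lorentz_W)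
  finally show "dist (G x) (G y) \<le> K * dist x y" .
qed (rule K)

end

section \<open>Compact tetrahedra and the nearest point projection\<close>

definition pr3 :: "real^4 \<Rightarrow> real^3" where
  "pr3 x = vector [x$1, x$2, x$3]"

lemma pr3_nth [simp]: "pr3 x $ 1 = x $ 1" "pr3 x $ 2 = x $ 2" "pr3 x $ 3 = x $ 3"
  by (simp_all add: pr3_def)

lemma linear_pr3: "linear pr3"
  by (auto simp: linear_iff vec_eq_iff forall_3)

lemma norm_pr3: "(norm (pr3 x))\<^sup>2 = (x$1)\<^sup>2 + (x$2)\<^sup>2 + (x$3)\<^sup>2"
  by (simp add: norm_vec_def L2_set_def sum_3)

lemma vec4_nth [simp]:
  "(vector [a, b, c, d] :: 'a::zero^4) $ 1 = a" "(vector [a, b, c, d] :: 'a^4) $ 2 = b"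
  "(vector [a, b, c, d] :: 'a^4) $ 3 = c" "(vector [a, b, c, d] :: 'a^4) $ 4 = d"
  by (simp_all add: vector_def)

lemma hyp_chart_pr3 [simp]: "hyp_chart (pr3 (Rep_hyp3 x)) = x"
proof -
  have "Rep_hyp3 x $ 4 > 0" using causal_Rep[of x] by (simp add: causal_def)
  moreover have "(norm (pr3 (Rep_hyp3 x)))\<^sup>2 = (Rep_hyp3 x $ 4)\<^sup>2 - 1"
    unfolding norm_pr3 using lor_Rep_self[of x] by (simp add: lor_def power2_eq_square)
  ultimately have "Rep_hyp3 (hyp_chart (pr3 (Rep_hyp3 x))) = Rep_hyp3 x"
    by (simp add: Rep_hyp_chart vec_eq_iff forall_4)
  then show ?thesis by (simp add: Rep_hyp3_inject)
qed

lemma pr3_hyp_chart [simp]: "pr3 (Rep_hyp3 (hyp_chart p)) = p"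
  by (simp add: Rep_hyp_chart vec_eq_iff forall_3)

text \<open>The chart carries compact subsets of \<open>\<real>\<^sup>3\<close> to compact sets.\<close>

lemma compact_hyp3:
  assumes "closed A" "bounded (Rep_hyp3 ` A)"
  shows "compact A"
proof -
  have eq: "hyp_chart -` A = pr3 ` Rep_hyp3 ` A"
  proof
    show "hyp_chart -` A \<subseteq> pr3 ` Rep_hyp3 ` A"
      by (metis image_eqI pr3_hyp_chart subsetI vimageE)
  qed auto
  have "closed (hyp_chart -` A)"
    using continuous_hyp_chart assms(1) by (simp add: continuous_on_closed_vimage)
  moreover have "bounded (hyp_chart -` A)"
    unfolding eq using assms(2) linear_pr3 linear_conv_bounded_linear bounded_linear_image by blast
  ultimately have "compact (hyp_chart ` (hyp_chart -` A))"
    by (intro compact_continuous_image continuous_on_subset[OF continuous_hyp_chart])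
      (auto simp: compact_eq_bounded_closed)
  moreover have "hyp_chart ` (hyp_chart -` A) = A"
    by (force intro: image_eqI[of _ _ "pr3 (Rep_hyp3 _)"])
  ultimately show ?thesis by simp
qed

lemma (in coxeter_tetrahedron) bounded_by_coefficients:
  assumes "A \<subseteq> tetrahedron n"
    and B: "\<And>x i. x \<in> A \<Longrightarrow> i \<in> {1..4} \<Longrightarrow> - lor (Rep_hyp3 x) (n i) \<le> B"
  shows "bounded (Rep_hyp3 ` A)"
proof -
  have "norm (Rep_hyp3 x) \<le> (\<Sum>i\<in>{1..4}. B * norm (P i))" if x: "x \<in> A" for x
  proof -
    have "norm (Rep_hyp3 x) \<le> (\<Sum>i\<in>{1..4}. norm ((- lor (Rep_hyp3 x) (n i)) *\<^sub>R P i))"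
      by (subst (1) P_expand) (rule norm_sum)
    also have "\<dots> \<le> (\<Sum>i\<in>{1..4}. B * norm (P i))"
    proof (rule sum_mono)
      fix i :: nat assume i: "i \<in> {1..4}"
      have "norm ((- lor (Rep_hyp3 x) (n i)) *\<^sub>R P i) = (- lor (Rep_hyp3 x) (n i)) * norm (P i)"
        using assms(1) x i by (auto simp: in_tetrahedron)
      also have "\<dots> \<le> B * norm (P i)" using B[OF x i] by (intro mult_right_mono) auto
      finally show "norm ((- lor (Rep_hyp3 x) (n i)) *\<^sub>R P i) \<le> B * norm (P i)" .
    qed
    finally show ?thesis .
  qed
  then show ?thesis by (auto simp: bounded_iff)
qed

locale compact_coxeter_tetrahedron = coxeter_tetrahedron +
  assumes vertex_timelike: "i \<in> {1..4} \<Longrightarrow> lor (P i) (P i) < 0"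
begin

text \<open>Expanding \<open>lor x x = -1\<close> in the vertex vectors gives a sum of nonnegative terms, since
  causal vectors have nonpositive products. The term with the square of the \<open>i\<close>-th coefficient has a
  factor that is positive because the vertex is not ideal.\<close>

lemma coefficients_bounded:
  obtains B where "\<And>x i. x \<in> tetrahedron n \<Longrightarrow> i \<in> {1..4} \<Longrightarrow> - lor (Rep_hyp3 x) (n i) \<le> B"
proof -
  define k where "k = Min ((\<lambda>i. - lor (P i) (P i)) ` {1..4})"
  have k: "k > 0" using vertex_timelike by (auto simp: k_def)
  have kle: "k \<le> - lor (P i) (P i)" if "i \<in> {1..4}" for i using that by (auto simp: k_def intro!: Min_le)
  have "- lor (Rep_hyp3 x) (n i) \<le> 1 / sqrt k" if x: "x \<in> tetrahedron n" and i: "i \<in> {1..4}" for x i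
  proof -
    define s where "s i = - lor (Rep_hyp3 x) (n i)" for i
    have s: "s i \<ge> 0" if "i \<in> {1..4}" for i using x that by (simp add: s_def in_tetrahedron)
    have le: "lor (P i) (P k) \<le> 0" if "i \<in> {1..4}" "k \<in> {1..4}" for i k
      using causal_lor_le[OF P_causal P_causal] that by blast
    have "1 = - lor (Rep_hyp3 x) (Rep_hyp3 x)" by simp
    also have "\<dots> = (\<Sum>i\<in>{1..4}. s i * (- lor (Rep_hyp3 x) (P i)))"
      by (subst (1) lor_expand) (simp add: s_def lor_commute[of "P _"] sum_negf)
    also have "\<dots> \<ge> s i * (- lor (Rep_hyp3 x) (P i))"
      using s i causal_lor_le[OF causal_Rep P_causal]
      by (intro member_le_sum) (auto intro!: mult_nonneg_nonneg mult_nonneg_nonpos)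
    finally have 1: "s i * (- lor (Rep_hyp3 x) (P i)) \<le> 1" .
    have "- lor (Rep_hyp3 x) (P i) = (\<Sum>k\<in>{1..4}. s k * (- lor (P k) (P i)))"
      by (subst lor_expand) (simp add: s_def sum_negf)
    also have "\<dots> \<ge> s i * (- lor (P i) (P i))"
      using s i le by (intro member_le_sum) (auto intro!: mult_nonneg_nonneg mult_nonneg_nonpos)
    finally have "s i * k \<le> - lor (Rep_hyp3 x) (P i)"
      using mult_left_mono[OF kle[OF i] s[OF i]] by simp
    then have "s i * (s i * k) \<le> 1" using mult_left_mono[of "s i * k" "- lor (Rep_hyp3 x) (P i)" "s i"] s[OF i] 1 by linarith
    then have "(s i)\<^sup>2 \<le> (1 / sqrt k)\<^sup>2" using k by (simp add: power_divide power2_eq_square field_simps)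
    then show ?thesis unfolding s_def[symmetric] by (rule power2_le_imp_le) (use k in simp)
  qed
  then show ?thesis using that by blast
qed

lemma compact_tetrahedron: "compact (tetrahedron n)"
proof (rule compact_hyp3[OF closed_tetrahedron])
  obtain B where B: "\<And>x i. x \<in> tetrahedron n \<Longrightarrow> i \<in> {1..4} \<Longrightarrow> - lor (Rep_hyp3 x) (n i) \<le> B"
    by (rule coefficients_bounded) blast
  then show "bounded (Rep_hyp3 ` tetrahedron n)" by (rule bounded_by_coefficients[OF order.refl])
qed

definition nearest :: "hyp3 \<Rightarrow> hyp3" where
  "nearest x = (SOME y. y \<in> tetrahedron n \<and> (\<forall>z\<in>tetrahedron n. dist x y \<le> dist x z))"

lemma base_in: "base \<in> tetrahedron n"
  using base(2) by (auto simp: in_tetrahedron intro: less_imp_le)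

lemma nearest: "nearest x \<in> tetrahedron n" "z \<in> tetrahedron n \<Longrightarrow> dist x (nearest x) \<le> dist x z"
proof -
  have "\<exists>y\<in>tetrahedron n. \<forall>z\<in>tetrahedron n. dist x y \<le> dist x z"
    using base_in by (intro continuous_attains_inf compact_tetrahedron continuous_intros) auto
  then have "\<exists>y. y \<in> tetrahedron n \<and> (\<forall>z\<in>tetrahedron n. dist x y \<le> dist x z)" by blast
  from someI_ex[OF this] show "nearest x \<in> tetrahedron n" "z \<in> tetrahedron n \<Longrightarrow> dist x (nearest x) \<le> dist x z"
    unfolding nearest_def by blast+
qed

lemma nearest_self: "x \<in> tetrahedron n \<Longrightarrow> nearest x = x"
  using nearest(2)[of x x] by simp

text \<open>The angle at the nearest point towards any other point of the convex set is at least a right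
  angle; in terms of the Lorentz form this is the following inequality.\<close>

lemma nearest_obtuse:
  assumes z: "z \<in> tetrahedron n"
  shows "lor (Rep_hyp3 x) (Rep_hyp3 (nearest x)) * lor (Rep_hyp3 (nearest x)) (Rep_hyp3 z)
    \<le> - lor (Rep_hyp3 x) (Rep_hyp3 z)"
proof (rule ccontr)
  define y where "y = nearest x"
  have y: "y \<in> tetrahedron n" by (simp add: y_def nearest)
  define A where "A = - lor (Rep_hyp3 x) (Rep_hyp3 y)"
  define B where "B = - lor (Rep_hyp3 x) (Rep_hyp3 z)"
  define C where "C = - lor (Rep_hyp3 y) (Rep_hyp3 z)"
  have A1: "A \<ge> 1" and B1: "B \<ge> 1"
    using lor_le_minus_one[OF Rep_hyp3 Rep_hyp3] by (force simp: A_def B_def)+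
  have *: "A\<^sup>2 * (1 + 2 * t * C + t\<^sup>2) \<le> (A + t * B)\<^sup>2" if t: "t > 0" for t
  proof -
    let ?u = "1 *\<^sub>R Rep_hyp3 y + t *\<^sub>R Rep_hyp3 z"
    have tl: "timelike ?u" using dist_through_combination(1)[of 1 t y z] t by simp
    have "hproj ?u \<in> tetrahedron n"
      unfolding in_tetrahedron Rep_hproj[OF tl] using lnorm_pos[OF tl] y z t
      by (auto simp: in_tetrahedron lor_simps divide_le_0_iff intro!: add_nonpos_nonpos mult_nonneg_nonpos)
    from nearest(2)[OF this, of x] have "lor (Rep_hyp3 x) (Rep_hyp3 (hproj ?u)) \<le> - A"
      by (simp add: dist_hyp3_le_iff y_def A_def)
    then have "A * lnorm ?u \<le> A + t * B"
      unfolding Rep_hproj[OF tl] using lnorm_pos[OF tl]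
      by (simp add: lor_simps A_def B_def field_simps)
    then have "(A * lnorm ?u)\<^sup>2 \<le> (A + t * B)\<^sup>2"
      using A1 lnorm_pos[OF tl] by (intro power_mono mult_nonneg_nonneg) auto
    moreover have "(lnorm ?u)\<^sup>2 = 1 + 2 * t * C + t\<^sup>2"
      unfolding lnorm_sq[OF tl]
      by (simp add: lor_simps C_def lor_commute[of "Rep_hyp3 z" "Rep_hyp3 y"] power2_eq_square algebra_simps)
    ultimately show ?thesis by (simp add: power_mult_distrib)
  qed
  assume "\<not> ?thesis"
  then have less: "B < A * C" by (simp add: A_def B_def C_def y_def)
  define \<delta> where "\<delta> = 2 * A * (A * C - B)"
  have \<delta>: "\<delta> > 0" using less A1 by (simp add: \<delta>_def)
  define t where "t = \<delta> / (B\<^sup>2 + 1)"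
  have B2: "B\<^sup>2 + 1 > 0" by (simp add: add_nonneg_pos)
  have t: "t > 0" using \<delta> B2 by (simp add: t_def)
  have "t * \<delta> \<le> t * (t * (B\<^sup>2 - A\<^sup>2))"
    using *[OF t] by (simp add: \<delta>_def power2_eq_square algebra_simps)
  then have "\<delta> \<le> t * (B\<^sup>2 - A\<^sup>2)" using t by (simp add: mult_le_cancel_left_pos)
  also have "\<dots> < t * (B\<^sup>2 + 1)"
    by (rule mult_strict_left_mono[OF _ t]) (use zero_le_power2[of A] in linarith)
  also have "\<dots> = \<delta>" using B2 by (simp add: t_def)
  finally show False by simp
qed

text \<open>Let \<open>y\<close>, \<open>y'\<close> be the points nearest to \<open>x\<close>, \<open>x'\<close>. Split the vectors of \<open>x\<close> and \<open>x'\<close> along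
  \<open>y\<close> and \<open>y'\<close>, their components \<open>u\<close>, \<open>u'\<close> orthogonal to these, and the components of \<open>u\<close>, \<open>u'\<close> in
  the direction of the segment from \<open>y\<close> to \<open>y'\<close>. The latter point away from the segment by the
  previous lemma, so that the mixed terms in the product of \<open>x\<close> and \<open>x'\<close> only increase their
  distance; the rest is estimated by the Cauchy--Schwarz inequality on the orthogonal complement of
  \<open>y\<close> and \<open>y'\<close>.\<close>

theorem nearest_nonexpansive: "dist (nearest x) (nearest x') \<le> dist x x'"
proof -
  define y y' where "y = nearest x" and "y' = nearest x'"
  define X X' Y Y' where "X = Rep_hyp3 x" and "X' = Rep_hyp3 x'" and "Y = Rep_hyp3 y" and "Y' = Rep_hyp3 y'"
  define a a' where "a = dist x y" and "a' = dist x' y'"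
  define e where "e = cosh (dist y y')"
  have e1: "e \<ge> 1" by (simp add: e_def cosh_real_ge_1)
  have YY': "lor Y Y' = - e" "lor Y' Y = - e" by (simp_all add: e_def dist_hyp3_cosh Y_def Y'_def lor_commute)
  have XY: "lor X Y = - cosh a" "lor X' Y' = - cosh a'"
    by (simp_all add: a_def a'_def dist_hyp3_cosh X_def X'_def Y_def Y'_def)
  have YX: "lor Y X = - cosh a" "lor Y' X' = - cosh a'" using XY by (simp_all add: lor_commute)
  have self: "lor X X = -1" "lor X' X' = -1" "lor Y Y = -1" "lor Y' Y' = -1"
    by (simp_all add: X_def X'_def Y_def Y'_def)
  have Yh: "Y \<in> hyperboloid" by (simp add: Y_def Rep_hyp3)
  show ?thesis
  proof (cases "e = 1")
    case True
    then have "dist y y' = 0" using YY'(1) lor_eq_minus_one[OF Rep_hyp3 Rep_hyp3, of y y']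
      by (simp add: Y_def Y'_def Rep_hyp3_inject)
    then show ?thesis by (simp add: y_def y'_def)
  next
    case False
    then have e: "e > 1" using e1 by simp
    define k where "k = e\<^sup>2 - 1"
    have k: "k > 0" using e by (simp add: k_def one_less_power)
    define u u' where "u = X - cosh a *\<^sub>R Y" and "u' = X' - cosh a' *\<^sub>R Y'"
    have uY: "lor u Y = 0" "lor u' Y' = 0" by (simp_all add: u_def u'_def lor_simps XY self)
    have uu: "lor u u = (sinh a)\<^sup>2" "lor u' u' = (sinh a')\<^sup>2"
      by (simp_all add: u_def u'_def lor_simps XY YX self sinh_square_eq flip: power2_eq_square)
    define b b' where "b = - lor u Y'" and "b' = - lor u' Y"
    have b: "b \<ge> 0"
      using nearest_obtuse[OF nearest(1), of x x']
      by (simp add: b_def u_def lor_simps XY YY' dist_hyp3_cosh a_def e_def X_def Y_def Y'_def y_def y'_def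
          lor_commute)
    have b': "b' \<ge> 0"
      using nearest_obtuse[OF nearest(1), of x' x]
      by (simp add: b'_def u'_def lor_simps XY YY' dist_hyp3_cosh a'_def e_def X'_def Y_def Y'_def y_def y'_def
          lor_commute)
    define \<tau> \<tau>' where "\<tau> = Y' - e *\<^sub>R Y" and "\<tau>' = Y - e *\<^sub>R Y'"
    define p p' where "p = u + (b / k) *\<^sub>R \<tau>" and "p' = u' + (b' / k) *\<^sub>R \<tau>'"
    have \<tau>Y: "lor \<tau> Y = 0" "lor \<tau> Y' = k" "lor \<tau>' Y' = 0" "lor \<tau>' Y = k"
      by (simp_all add: \<tau>_def \<tau>'_def lor_simps YY' self k_def power2_eq_square)
    have pY: "lor p Y = 0" "lor p Y' = 0" "lor p' Y = 0" "lor p' Y' = 0"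
      using k by (simp_all add: p_def p'_def lor_simps uY \<tau>Y) (simp_all add: b_def b'_def)
    have p\<tau>: "lor p \<tau> = 0" "lor p' \<tau> = 0" "lor p \<tau>' = 0" "lor p' \<tau>' = 0"
      by (simp_all add: \<tau>_def \<tau>'_def lor_simps pY)
    have \<tau>\<tau>: "lor \<tau> \<tau> = k" "lor \<tau>' \<tau>' = k" "lor \<tau> \<tau>' = - e * k"
      by (simp_all add: \<tau>_def \<tau>'_def lor_simps YY' self k_def power2_eq_square algebra_simps)
    have uu': "lor u u' = lor p p' - e * b * b' / k"
    proof -
      have "lor u u' = lor (p - (b / k) *\<^sub>R \<tau>) (p' - (b' / k) *\<^sub>R \<tau>')" by (simp add: p_def p'_def)
      also have "\<dots> = lor p p' - e * b * b' / k"
        using k p\<tau> by (simp add: lor_simps \<tau>\<tau> lor_commute[of \<tau> p'] lor_commute[of \<tau>' p])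
      finally show ?thesis .
    qed
    have up: "lor u u = lor p p + b\<^sup>2 / k" "lor u' u' = lor p' p' + b'\<^sup>2 / k"
    proof -
      have "lor u u = lor (p - (b / k) *\<^sub>R \<tau>) (p - (b / k) *\<^sub>R \<tau>)"
        "lor u' u' = lor (p' - (b' / k) *\<^sub>R \<tau>') (p' - (b' / k) *\<^sub>R \<tau>')" by (simp_all add: p_def p'_def)
      then show "lor u u = lor p p + b\<^sup>2 / k" "lor u' u' = lor p' p' + b'\<^sup>2 / k"
        using k p\<tau> by (simp_all add: lor_simps \<tau>\<tau> lor_commute[of \<tau> p] lor_commute[of \<tau>' p'] power2_eq_square)
    qed
    have pp: "lor p p \<le> (sinh a)\<^sup>2" "lor p' p' \<le> (sinh a')\<^sup>2"
      using up uu divide_nonneg_pos[OF zero_le_power2[of b] k] divide_nonneg_pos[OF zero_le_power2[of b'] k]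
      by linarith+
    have "(lor p p')\<^sup>2 \<le> lor p p * lor p' p'"
      by (rule lor_cauchy_schwarz[OF Yh pY(1,3)])
    also have "\<dots> \<le> (sinh a)\<^sup>2 * (sinh a')\<^sup>2"
      using pp lor_orthogonal_pos(1)[OF Yh pY(1)] lor_orthogonal_pos(1)[OF Yh pY(3)]
      by (intro mult_mono) auto
    also have "\<dots> = (sinh a * sinh a')\<^sup>2" by (simp add: power_mult_distrib)
    finally have "lor p p' \<le> sinh a * sinh a'"
      by (rule power2_le_imp_le) (simp add: a_def a'_def)
    moreover have "0 \<le> e * b * b' / k" using e b b' k by simp
    ultimately have le: "lor u u' \<le> sinh a * sinh a'" using uu' by linarith
    have "- lor X X' = - lor (u + cosh a *\<^sub>R Y) (u' + cosh a' *\<^sub>R Y')" by (simp add: u_def u'_def)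
    also have "\<dots> = cosh a * cosh a' * e + cosh a * b' + cosh a' * b - lor u u'"
      by (simp add: lor_simps YY' b_def b'_def lor_commute[of Y u'] algebra_simps)
    finally have XX: "- lor X X' = cosh a * cosh a' * e + cosh a * b' + cosh a' * b - lor u u'" .
    have "0 \<le> cosh a * b'" "0 \<le> cosh a' * b" using b b' by (simp_all add: cosh_real_nonneg)
    then have "cosh a * cosh a' * e - sinh a * sinh a' \<le> - lor X X'" unfolding XX using le by linarith
    moreover have "e * (cosh a * cosh a' - sinh a * sinh a') \<le> cosh a * cosh a' * e - sinh a * sinh a'"
      using mult_right_mono[OF e1, of "sinh a * sinh a'"] by (simp add: a_def a'_def algebra_simps)
    moreover have "e \<le> e * (cosh a * cosh a' - sinh a * sinh a')"
      using mult_left_mono[OF cosh_real_ge_1[of "a - a'"], of e] e1 by (simp add: cosh_diff)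
    ultimately have "e \<le> - lor X X'" by linarith
    then show ?thesis
      by (simp add: dist_hyp3_le_iff e_def dist_hyp3_cosh X_def X'_def y_def y'_def)
  qed
qed

text \<open>Since no dihedral angle is obtuse, a point that is not strictly inside the half space of a face
  has its nearest point on that face: moving along the normal of the face would come closer and
  would not leave the other half spaces.\<close>

lemma nearest_on_face:
  assumes i: "i \<in> {1..4}" and x: "lor (Rep_hyp3 x) (n i) \<ge> 0"
  shows "lor (Rep_hyp3 (nearest x)) (n i) = 0"
proof (rule ccontr)
  define y where "y = nearest x"
  have y: "y \<in> tetrahedron n" by (simp add: y_def nearest)
  define c where "c = - lor (Rep_hyp3 y) (n i)"
  assume "lor (Rep_hyp3 (nearest x)) (n i) \<noteq> 0"
  then have c: "c > 0" using y i by (force simp: c_def y_def in_tetrahedron)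
  let ?u = "Rep_hyp3 y + c *\<^sub>R n i"
  have Q: "- lor ?u ?u = 1 + c\<^sup>2"
    using unit[OF i] by (simp add: lor_simps lor_commute[of "n i" "Rep_hyp3 y"] c_def power2_eq_square)
  have pos: "1 + c\<^sup>2 > 0" by (simp add: add_pos_nonneg)
  have "lor ?u (Rep_hyp3 y) = - 1 - c\<^sup>2"
    by (simp add: lor_simps lor_commute[of "n i" "Rep_hyp3 y"] c_def power2_eq_square)
  then have tl: "timelike ?u"
    using timelike_future[OF _ causal_Rep[of y], of ?u] Q pos by (simp add: timelike_def)
  have ln: "lnorm ?u > 1" using Q c by (simp add: lnorm_def)
  have "hproj ?u \<in> tetrahedron n"
  proof -
    have "lor ?u (n j) \<le> 0" if j: "j \<in> {1..4}" for j
    proof (cases "j = i")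
      case True then show ?thesis using unit[OF i] by (simp add: lor_simps c_def)
    next
      case False
      then show ?thesis
        using nonobtuse[OF i j] y j c by (auto simp: lor_simps in_tetrahedron intro!: add_nonpos_nonpos mult_nonneg_nonpos)
    qed
    then show ?thesis
      unfolding in_tetrahedron Rep_hproj[OF tl] using lnorm_pos[OF tl]
      by (simp add: lor_scale_left divide_le_0_iff)
  qed
  from nearest(2)[OF this, of x]
  have "lor (Rep_hyp3 x) ((1 / lnorm ?u) *\<^sub>R ?u) \<le> lor (Rep_hyp3 x) (Rep_hyp3 y)"
    unfolding dist_hyp3_le_iff y_def[symmetric] Rep_hproj[OF tl] .
  then have "lnorm ?u * ((1 / lnorm ?u) * lor (Rep_hyp3 x) ?u) \<le> lnorm ?u * lor (Rep_hyp3 x) (Rep_hyp3 y)"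
    unfolding lor_scale_right using ln by (intro mult_left_mono) auto
  then have "lor (Rep_hyp3 x) ?u \<le> lnorm ?u * lor (Rep_hyp3 x) (Rep_hyp3 y)"
    using ln by simp
  moreover have "lor (Rep_hyp3 x) ?u \<ge> lor (Rep_hyp3 x) (Rep_hyp3 y)"
    using x c by (simp add: lor_simps)
  ultimately have "(lnorm ?u - 1) * (- lor (Rep_hyp3 x) (Rep_hyp3 y)) \<le> 0" by (simp add: algebra_simps)
  moreover have "(lnorm ?u - 1) * (- lor (Rep_hyp3 x) (Rep_hyp3 y)) > 0"
    using ln lor_neg[OF Rep_hyp3 Rep_hyp3] by (intro mult_pos_pos) auto
  ultimately show False by simp
qed

end

section \<open>Contracting projective maps\<close>

text \<open>Write \<open>Q\<close> for the Lorentz form. The chord between the normalised images of \<open>x\<close> and \<open>y\<close> is a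
  multiple of \<open>M (x - r y)\<close>, where \<open>r\<close> is the ratio of the lengths of \<open>M x\<close> and \<open>M y\<close>. So an
  inequality \<open>Q (M w) \<le> \<mu> Q w\<close> for all \<open>w\<close>, spacelike or timelike, controls chords in terms of a
  lower bound for these lengths.\<close>

lemma hmap_chord:
  assumes M: "linear M" and le: "\<And>w. lor (M w) (M w) \<le> \<mu> * lor w w" and \<mu>: "\<mu> \<ge> 0" "\<nu> > 0"
    and tl: "\<And>x. timelike (M (Rep_hyp3 x))" and ge: "\<And>x. \<nu> \<le> (lnorm (M (Rep_hyp3 x)))\<^sup>2"
  shows "(sinh (dist (hmap M x) (hmap M y) / 2))\<^sup>2 \<le> \<mu> / \<nu> * (sinh (dist x y / 2))\<^sup>2"
proof -
  define a b where "a = lnorm (M (Rep_hyp3 x))" and "b = lnorm (M (Rep_hyp3 y))"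
  have ab: "a > 0" "b > 0" using lnorm_pos[OF tl] by (auto simp: a_def b_def)
  have ab\<nu>: "\<nu> \<le> a * b"
  proof -
    have "\<nu> * \<nu> \<le> a\<^sup>2 * b\<^sup>2" using ge[of x] ge[of y] \<mu> by (intro mult_mono) (auto simp: a_def b_def)
    then have "\<nu>\<^sup>2 \<le> (a * b)\<^sup>2" by (simp add: power2_eq_square mult_ac)
    then show ?thesis by (rule power2_le_imp_le) (use ab in simp)
  qed
  define r where "r = a / b"
  define w where "w = Rep_hyp3 x - r *\<^sub>R Rep_hyp3 y"
  have chord: "Rep_hyp3 (hmap M x) - Rep_hyp3 (hmap M y) = (1 / a) *\<^sub>R M w"
    using ab by (simp add: hmap_def Rep_hproj[OF tl] w_def r_def a_def b_def
        linear_diff[OF M] linear_scale[OF M] scaleR_diff_right)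
  have "4 * (sinh (dist (hmap M x) (hmap M y) / 2))\<^sup>2 = (1 / a)\<^sup>2 * lor (M w) (M w)"
    unfolding lor_chord[symmetric] chord by (simp add: lor_simps power2_eq_square)
  also have "\<dots> \<le> (1 / a)\<^sup>2 * (\<mu> * lor w w)" by (intro mult_left_mono le) simp
  also have "lor w w = r * (4 * (sinh (dist x y / 2))\<^sup>2) - (1 - r)\<^sup>2"
    unfolding lor_chord[symmetric] w_def
    by (simp add: lor_simps lor_commute[of "Rep_hyp3 y" "Rep_hyp3 x"] power2_eq_square algebra_simps)
  also have "(1 / a)\<^sup>2 * (\<mu> * \<dots>) \<le> (1 / a)\<^sup>2 * (\<mu> * (r * (4 * (sinh (dist x y / 2))\<^sup>2)))"
    using \<mu> by (intro mult_left_mono) auto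
  also have "\<dots> = \<mu> / (a * b) * (4 * (sinh (dist x y / 2))\<^sup>2)"
    using ab by (simp add: r_def power2_eq_square field_simps)
  also have "\<dots> \<le> \<mu> / \<nu> * (4 * (sinh (dist x y / 2))\<^sup>2)"
    using ab\<nu> \<mu> by (intro mult_right_mono divide_left_mono) auto
  also have "\<dots> = 4 * (\<mu> / \<nu> * (sinh (dist x y / 2))\<^sup>2)" by simp
  finally show ?thesis by linarith
qed

lemma le_sinh:
  assumes "0 \<le> x"
  shows "x \<le> sinh (x::real)"
proof -
  have "sinh 0 - 0 \<le> sinh x - x"
  proof (rule DERIV_nonneg_imp_nondecreasing[OF assms])
    fix t :: real
    show "\<exists>d. ((\<lambda>x. sinh x - x) has_real_derivative d) (at t) \<and> 0 \<le> d"
      by (rule exI[of _ "cosh t - 1"]) (auto intro!: derivative_eq_intros simp: cosh_real_ge_1)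
  qed
  then show ?thesis by simp
qed

text \<open>For short segments, chord and distance agree up to a factor close to 1; a long segment is
  halved until its parts are short.\<close>

lemma lipschitz_of_chord:
  fixes G :: "hyp3 \<Rightarrow> hyp3"
  assumes \<kappa>: "0 < \<kappa>" "\<kappa> < K"
    and chord: "\<And>x y. sinh (dist (G x) (G y) / 2) \<le> \<kappa> * sinh (dist x y / 2)"
  shows "dist (G x) (G y) \<le> K * dist x y"
proof -
  have "(sinh has_real_derivative cosh 0) (at (0::real))"
    by (auto intro!: derivative_eq_intros)
  then have "((\<lambda>h. sinh h / h) \<longlongrightarrow> 1) (at (0::real))" by (simp add: DERIV_def)
  moreover have "1 < K / \<kappa>" using \<kappa> by (simp add: field_simps)
  ultimately have "\<forall>\<^sub>F h in at (0::real). sinh h / h < K / \<kappa>" by (rule order_tendstoD)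
  then obtain d where d: "d > 0" "\<And>h::real. h \<noteq> 0 \<Longrightarrow> dist h 0 < d \<Longrightarrow> sinh h / h < K / \<kappa>"
    by (auto simp: eventually_at)
  have small: "dist (G x) (G y) \<le> K * dist x y" if "dist x y \<le> d" for x y
  proof (cases "x = y")
    case False
    define h where "h = dist x y / 2"
    have h: "h > 0" "h < d" using False that d(1) by (auto simp: h_def)
    have "dist (G x) (G y) / 2 \<le> sinh (dist (G x) (G y) / 2)"
      by (rule le_sinh) simp
    also have "\<dots> \<le> \<kappa> * sinh h" using chord[of x y] by (simp add: h_def)
    also have "\<dots> \<le> \<kappa> * (K / \<kappa> * h)"
      using d(2)[of h] h \<kappa> by (intro mult_left_mono) (auto simp: field_simps)
    finally show ?thesis using \<kappa> by (simp add: h_def)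
  qed simp
  have "dist x y \<le> 2 ^ k * d \<Longrightarrow> dist (G x) (G y) \<le> K * dist x y" for k x y
  proof (induction k arbitrary: x y)
    case 0 then show ?case using small by simp
  next
    case (Suc k)
    obtain z where z: "dist x z = dist x y / 2" "dist z y = dist x y / 2" by (rule midpoint_hyp3)
    have "dist (G x) (G y) \<le> dist (G x) (G z) + dist (G z) (G y)" by (rule dist_triangle)
    also have "\<dots> \<le> K * dist x z + K * dist z y"
      using Suc.prems z by (intro add_mono Suc.IH) auto
    also have "\<dots> = K * dist x y" by (simp add: z)
    finally show ?case .
  qed
  moreover obtain k where "dist x y / d < 2 ^ k" using real_arch_pow[of 2 "dist x y / d"] by auto
  then have "dist x y \<le> 2 ^ k * d" using d(1) by (simp add: field_simps)
  ultimately show ?thesis by blast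
qed

text \<open>The inequality makes all images of timelike vectors timelike. If one image were past, then
  on the segment to \<open>x0\<close> some image would have time coordinate 0, which is impossible.\<close>

lemma contracting_timelike:
  assumes M: "linear M" and less: "\<And>w. w \<noteq> 0 \<Longrightarrow> lor (M w) (M w) < \<mu> * lor w w" and \<mu>: "\<mu> > 0"
    and x0: "timelike (M (Rep_hyp3 x0))"
  shows "timelike (M (Rep_hyp3 x))"
proof -
  have neg: "lor (M y) (M y) < 0" if "timelike y" for y
    using less[of y] that mult_pos_neg[OF \<mu>, of "lor y y"] by (force simp: timelike_def)
  have "M (Rep_hyp3 x) $ 4 > 0"
  proof (rule ccontr)
    assume "\<not> M (Rep_hyp3 x) $ 4 > 0"
    then have le: "- (M (Rep_hyp3 x) $ 4) \<ge> 0" by simp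
    define c where "c = - (M (Rep_hyp3 x) $ 4) / (M (Rep_hyp3 x0) $ 4)"
    have p: "M (Rep_hyp3 x0) $ 4 > 0" using x0 by (simp add: timelike_def)
    have c: "c \<ge> 0" unfolding c_def by (rule divide_nonneg_pos[OF le p])
    define y where "y = Rep_hyp3 x + c *\<^sub>R Rep_hyp3 x0"
    have "timelike y"
      using dist_through_combination(1)[of 1 c x x0] c by (simp add: y_def)
    then have "lor (M y) (M y) < 0" by (rule neg)
    moreover have "M y $ 4 = 0"
    proof -
      have "M y = M (Rep_hyp3 x) + c *\<^sub>R M (Rep_hyp3 x0)"
        by (simp add: y_def linear_add[OF M] linear_scale[OF M])
      then show ?thesis using p by (simp add: c_def)
    qed
    ultimately have "(norm (M y))\<^sup>2 < 0" by (simp add: lor_norm)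
    then show False by simp
  qed
  then show ?thesis using neg[OF timelike_Rep] by (simp add: timelike_def)
qed

text \<open>The inequality is homogeneous, so on the compact unit sphere it holds with a margin, which
  dominates small perturbations.\<close>

lemma contracting_perturbation:
  assumes M: "linear M" and E: "linear E"
    and less: "\<And>w. w \<noteq> 0 \<Longrightarrow> lor (M w) (M w) < \<mu> * lor w w"
  obtains \<delta> c where "\<delta> > 0" "c > 0"
    "\<And>\<epsilon> w. 0 \<le> \<epsilon> \<Longrightarrow> \<epsilon> \<le> \<delta> \<Longrightarrow>
       lor (M w - \<epsilon> *\<^sub>R E w) (M w - \<epsilon> *\<^sub>R E w) \<le> \<mu> * lor w w - c * (norm w)\<^sup>2"
proof -
  define g where "g w = \<mu> * lor w w - lor (M w) (M w)" for w
  define h where "h w = 2 * \<bar>lor (M w) (E w)\<bar> + \<bar>lor (E w) (E w)\<bar>" for w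
  let ?S = "sphere 0 1 :: (real^4) set"
  have cM: "continuous_on A M" and cE: "continuous_on A E" for A
    using M E by (auto intro: linear_continuous_on simp: linear_conv_bounded_linear)
  have cg: "continuous_on ?S g" and ch: "continuous_on ?S h"
    unfolding g_def h_def by (intro continuous_intros cM cE)+
  have ne: "?S \<noteq> {}" by simp
  obtain w0 where w0: "w0 \<in> ?S" "\<And>w. w \<in> ?S \<Longrightarrow> g w0 \<le> g w"
    using continuous_attains_inf[OF compact_sphere ne cg] by blast
  obtain w1 where w1: "w1 \<in> ?S" "\<And>w. w \<in> ?S \<Longrightarrow> h w \<le> h w1"
    using continuous_attains_sup[OF compact_sphere ne ch] by blast
  define c where "c = g w0 / 2"
  have "w0 \<noteq> 0" using w0(1) by auto
  then have c: "c > 0" using less[of w0] by (simp add: c_def g_def)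
  define B where "B = h w1 + 1"
  have B: "B > 0" by (simp add: B_def h_def add_nonneg_pos)
  define \<delta> where "\<delta> = min 1 (c / B)"
  have \<delta>: "\<delta> > 0" "\<delta> \<le> 1" "\<delta> * B \<le> c" using c B by (auto simp: \<delta>_def min_def field_simps)
  have "lor (M w - \<epsilon> *\<^sub>R E w) (M w - \<epsilon> *\<^sub>R E w) \<le> \<mu> * lor w w - c * (norm w)\<^sup>2"
    if \<epsilon>: "0 \<le> \<epsilon>" "\<epsilon> \<le> \<delta>" for \<epsilon> w
  proof (cases "w = 0")
    case True then show ?thesis using linear_0[OF M] linear_0[OF E] by (simp add: lor.zero_left)
  next
    case False
    define v where "v = (1 / norm w) *\<^sub>R w"
    have v: "v \<in> ?S" using False by (simp add: v_def)
    have w: "w = norm w *\<^sub>R v" using False by (simp add: v_def)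
    have "lor (M v - \<epsilon> *\<^sub>R E v) (M v - \<epsilon> *\<^sub>R E v)
        = lor (M v) (M v) - 2 * \<epsilon> * lor (M v) (E v) + \<epsilon>\<^sup>2 * lor (E v) (E v)"
      by (simp add: lor_simps lor_commute[of "E v" "M v"] power2_eq_square algebra_simps)
    also have "\<dots> \<le> lor (M v) (M v) + \<epsilon> * h v"
    proof -
      have "\<epsilon>\<^sup>2 * lor (E v) (E v) \<le> \<epsilon> * \<bar>lor (E v) (E v)\<bar>"
      proof -
        have "\<epsilon>\<^sup>2 \<le> \<epsilon>" using \<epsilon> \<delta>(2) by (simp add: power2_eq_square mult_left_le)
        then have "\<epsilon>\<^sup>2 * \<bar>lor (E v) (E v)\<bar> \<le> \<epsilon> * \<bar>lor (E v) (E v)\<bar>" by (intro mult_right_mono) auto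
        moreover have "\<epsilon>\<^sup>2 * lor (E v) (E v) \<le> \<epsilon>\<^sup>2 * \<bar>lor (E v) (E v)\<bar>" by (intro mult_left_mono) auto
        ultimately show ?thesis by linarith
      qed
      moreover have "- (2 * \<epsilon> * lor (M v) (E v)) \<le> \<epsilon> * (2 * \<bar>lor (M v) (E v)\<bar>)"
      proof -
        have "(2 * \<epsilon>) * (- lor (M v) (E v)) \<le> (2 * \<epsilon>) * \<bar>lor (M v) (E v)\<bar>"
          by (rule mult_left_mono) (use \<epsilon>(1) in linarith)+
        then show ?thesis by (simp only: mult.assoc mult.left_commute mult_minus_right)
      qed
      ultimately show ?thesis unfolding h_def distrib_left by linarith
    qed
    also have "\<epsilon> * h v \<le> \<delta> * B"
      using \<epsilon> \<delta> w1(2)[OF v] by (intro mult_mono) (auto simp: B_def h_def)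
    also have "lor (M v) (M v) + \<delta> * B \<le> \<mu> * lor v v - c"
    proof -
      have "2 * c \<le> \<mu> * lor v v - lor (M v) (M v)"
        using w0(2)[OF v] by (simp add: c_def g_def)
      then show ?thesis using \<delta>(3) c by linarith
    qed
    finally have "(norm w)\<^sup>2 * lor (M v - \<epsilon> *\<^sub>R E v) (M v - \<epsilon> *\<^sub>R E v) \<le> (norm w)\<^sup>2 * (\<mu> * lor v v - c)"
      by (intro mult_left_mono) auto
    also have "\<dots> = \<mu> * lor w w - c * (norm w)\<^sup>2"
    proof -
      have "lor w w = (norm w)\<^sup>2 * lor v v"
        using False by (simp add: v_def lor_simps power2_eq_square)
      then show ?thesis by (simp only: right_diff_distrib mult.left_commute mult.commute)
    qed
    also have "(norm w)\<^sup>2 * lor (M v - \<epsilon> *\<^sub>R E v) (M v - \<epsilon> *\<^sub>R E v)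
        = lor (M w - \<epsilon> *\<^sub>R E w) (M w - \<epsilon> *\<^sub>R E w)"
    proof -
      have "M w = norm w *\<^sub>R M v" "E w = norm w *\<^sub>R E v"
        using False by (simp_all add: v_def linear_scale[OF M] linear_scale[OF E])
      then have "M w - \<epsilon> *\<^sub>R E w = norm w *\<^sub>R (M v - \<epsilon> *\<^sub>R E v)"
        by (simp add: algebra_simps)
      then show ?thesis by (simp add: lor_scale_left lor_scale_right power2_eq_square)
    qed
    finally show ?thesis .
  qed
  then show ?thesis using that \<delta>(1) c by blast
qed

section \<open>The equivariant contraction\<close>

text \<open>A linear map is prescribed by the images of the vertex vectors.  For \<open>\<epsilon> = 0\<close> the following map takes the
  tetrahedron \<open>n\<close> to the tetrahedron with dual basis \<open>p\<close>, vertex by vertex.  For small \<open>\<epsilon> > 0\<close> each face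
  lands strictly outside the target, and the vertices land in the region from which
  the nearest point projection leads to a single vertex.\<close>

definition vertex_map :: "(nat \<Rightarrow> real^4) \<Rightarrow> (nat \<Rightarrow> real^4) \<Rightarrow> real \<Rightarrow> real^4 \<Rightarrow> real^4" where
  "vertex_map n p \<epsilon> w = (\<Sum>i\<in>{1..4}. (\<epsilon> * (\<Sum>k\<in>{1..4}. lor w (n k)) - lor w (n i)) *\<^sub>R p i)"

lemma linear_vertex_map: "linear (vertex_map n p \<epsilon>)"
  unfolding vertex_map_def
proof (intro linear_compose_sum ballI)
  fix i
  show "linear (\<lambda>w. (\<epsilon> * (\<Sum>k\<in>{1..4}. lor w (n k)) - lor w (n i)) *\<^sub>R p i)"
    unfolding linear_iff
    by (simp add: lor_simps sum.distrib algebra_simps flip: sum_distrib_left)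
qed

text \<open>The data for an equivariant contraction from the tetrahedron \<open>n\<close> to the compact tetrahedron
  \<open>m\<close>: the strict inequality for the vertex map, and the fact that each relation between the
  reflections of \<open>n\<close> holds for those of \<open>m\<close>.\<close>

locale tetrahedron_pair =
  S: coxeter_tetrahedron n e + T: compact_coxeter_tetrahedron m f for n e m f +
  fixes \<mu> :: real
  assumes \<mu>: "\<mu> > 0"
    and contr: "w \<noteq> 0 \<Longrightarrow> lor (vertex_map n T.P 0 w) (vertex_map n T.P 0 w) < \<mu> * lor w w"
    and rel: "xs \<in> lists {1..4} \<Longrightarrow> ys \<in> lists {1..4} \<Longrightarrow> word n xs = word n ys \<Longrightarrow>
        hmap (word m xs) = hmap (word m ys)"
begin

definition admissible :: "real \<Rightarrow> bool" where
  "admissible \<epsilon> \<longleftrightarrow> 0 < \<epsilon> \<and> \<epsilon> < 1 / 4 \<and> (\<exists>c>0. \<forall>w.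
     lor (vertex_map n T.P \<epsilon> w) (vertex_map n T.P \<epsilon> w) \<le> \<mu> * lor w w - c * (norm w)\<^sup>2)"

lemma ex_admissible: "\<exists>\<epsilon>. admissible \<epsilon>"
proof -
  define E where "E w = (\<Sum>i\<in>{1..4}. (- (\<Sum>k\<in>{1..4}. lor w (n k))) *\<^sub>R T.P i)" for w
  have eq: "vertex_map n T.P \<epsilon> w = vertex_map n T.P 0 w - \<epsilon> *\<^sub>R E w" for \<epsilon> w
    by (simp add: vertex_map_def E_def scaleR_sum_right sum_subtractf scaleR_diff_left sum_negf)
  have "E = (\<lambda>w. vertex_map n T.P 0 w - vertex_map n T.P 1 w)"
    using eq[of 1] by auto
  then have "linear E"
    using linear_compose_sub[OF linear_vertex_map[of n T.P 0] linear_vertex_map[of n T.P 1]] by simp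
  then obtain \<delta> c where *: "\<delta> > 0" "c > 0"
    "\<And>\<epsilon> w. 0 \<le> \<epsilon> \<Longrightarrow> \<epsilon> \<le> \<delta> \<Longrightarrow> lor (vertex_map n T.P 0 w - \<epsilon> *\<^sub>R E w)
        (vertex_map n T.P 0 w - \<epsilon> *\<^sub>R E w) \<le> \<mu> * lor w w - c * (norm w)\<^sup>2"
    using contracting_perturbation[OF linear_vertex_map _ contr] by blast
  have "admissible (min \<delta> (1/8))"
    unfolding admissible_def eq[of "min \<delta> (1/8)"] using *(1,2) *(3)[of "min \<delta> (1/8)"]
    by (auto intro!: exI[of _ c])
  then show ?thesis ..
qed

definition eps :: real where
  "eps = (SOME \<epsilon>. admissible \<epsilon>)"

definition M :: "real^4 \<Rightarrow> real^4" where
  "M = vertex_map n T.P eps"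

lemma eps: "0 < eps" "eps < 1 / 4"
  and eps_contr: "\<exists>c>0. \<forall>w. lor (M w) (M w) \<le> \<mu> * lor w w - c * (norm w)\<^sup>2"
  using someI_ex[OF ex_admissible] by (auto simp: eps_def admissible_def M_def)

lemma linear_M: "linear M"
  by (simp add: M_def linear_vertex_map)

lemma lor_M: "i \<in> {1..4} \<Longrightarrow> lor (M w) (m i) = lor w (n i) - eps * (\<Sum>k\<in>{1..4}. lor w (n k))"
  by (simp add: M_def vertex_map_def lor.sum_left lor_scale_left T.P_n if_distrib[of "\<lambda>x. _ * x"] sum.delta
      cong: if_cong)

text \<open>One point suffices by \<open>contracting_timelike\<close>: the sum of the vertex vectors is mapped to a
  positive multiple of the sum of the target vertex vectors.\<close>

lemma timelike_M: "timelike (M (Rep_hyp3 x))"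
proof (rule contracting_timelike[OF linear_M _ \<mu>])
  obtain c where c: "c > 0" "\<And>w. lor (M w) (M w) \<le> \<mu> * lor w w - c * (norm w)\<^sup>2"
    using eps_contr by blast
  show less: "lor (M w) (M w) < \<mu> * lor w w" if "w \<noteq> 0" for w
    using c(2)[of w] mult_pos_pos[OF c(1), of "(norm w)\<^sup>2"] that by simp
  let ?s = "\<Sum>i\<in>{1..4}. S.P i"
  have sn: "lor ?s (n i) = -1" if "i \<in> {1..4}" for i using that by (simp add: lor.sum_left S.P_n)
  have Ms: "M ?s = (1 - 4 * eps) *\<^sub>R (\<Sum>i\<in>{1..4}. T.P i)"
  proof (rule T.eqI_n)
    fix i :: nat assume i: "i \<in> {1..4}"
    have "lor (\<Sum>i\<in>{1..4}. T.P i) (m i) = -1" using i by (simp add: lor.sum_left T.P_n)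
    then show "lor (M ?s) (m i) = lor ((1 - 4 * eps) *\<^sub>R (\<Sum>i\<in>{1..4}. T.P i)) (m i)"
      using i by (simp add: lor_M sn lor_scale_left del: lor.sum_left)
  qed
  have "Rep_hyp3 S.base = (1 / lnorm ?s) *\<^sub>R ?s"
    unfolding S.base_def by (rule Rep_hproj[OF S.base(1)])
  then have "M (Rep_hyp3 S.base) = ((1 / lnorm ?s) * (1 - 4 * eps)) *\<^sub>R (\<Sum>i\<in>{1..4}. T.P i)"
    by (simp add: linear_scale[OF linear_M] Ms)
  then show "timelike (M (Rep_hyp3 S.base))"
    using timelike_scale[OF T.base(1), of "(1 / lnorm ?s) * (1 - 4 * eps)"] lnorm_pos[OF S.base(1)] eps
    by simp
qed

lemma lor_Rep_hmap_M:
  "i \<in> {1..4} \<Longrightarrow> lor (Rep_hyp3 (hmap M x)) (m i) =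
     (lor (Rep_hyp3 x) (n i) - eps * (\<Sum>k\<in>{1..4}. lor (Rep_hyp3 x) (n k))) / lnorm (M (Rep_hyp3 x))"
  by (simp add: hmap_def Rep_hproj[OF timelike_M] lor_scale_left lor_M)

text \<open>The margin \<open>c\<close> makes the squared length of \<open>M x\<close> at least \<open>\<mu> + c\<close>, so squared chords shrink
  by the factor \<open>\<mu> / (\<mu> + c)\<close>.\<close>

theorem hmap_M_contracting: "\<exists>K. 0 < K \<and> K < 1 \<and> (\<forall>x y. dist (hmap M x) (hmap M y) \<le> K * dist x y)"
proof -
  obtain c where c: "c > 0" "\<And>w. lor (M w) (M w) \<le> \<mu> * lor w w - c * (norm w)\<^sup>2"
    using eps_contr by blast
  have "lor (M w) (M w) \<le> \<mu> * lor w w" for w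
  proof -
    have "0 \<le> c * (norm w)\<^sup>2" using c(1) by simp
    then show ?thesis using c(2)[of w] by linarith
  qed
  moreover have "\<mu> + c \<le> (lnorm (M (Rep_hyp3 x)))\<^sup>2" for x
  proof -
    have "1 \<le> (norm (Rep_hyp3 x))\<^sup>2"
    proof -
      have "(Rep_hyp3 x $ 4)\<^sup>2 \<le> (norm (Rep_hyp3 x))\<^sup>2"
        using component_le_norm_cart[of "Rep_hyp3 x" 4] by (metis abs_ge_zero power2_abs power_mono)
      then show ?thesis using lor_norm[of "Rep_hyp3 x"] by simp
    qed
    then have "c \<le> c * (norm (Rep_hyp3 x))\<^sup>2" using mult_left_mono[of 1 _ c] c(1) by simp
    then show ?thesis using c(2)[of "Rep_hyp3 x"] by (simp add: lnorm_sq[OF timelike_M])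
  qed
  ultimately have chord2: "(sinh (dist (hmap M x) (hmap M y) / 2))\<^sup>2 \<le> \<mu> / (\<mu> + c) * (sinh (dist x y / 2))\<^sup>2" for x y
    using hmap_chord[OF linear_M _ _ _ timelike_M, of \<mu> "\<mu> + c" x y] \<mu> c(1) by simp
  define \<kappa> where "\<kappa> = sqrt (\<mu> / (\<mu> + c))"
  have \<kappa>: "0 < \<kappa>" "\<kappa> < 1" using \<mu> c(1) by (simp_all add: \<kappa>_def)
  have "sinh (dist (hmap M x) (hmap M y) / 2) \<le> \<kappa> * sinh (dist x y / 2)" for x y
  proof (rule power2_le_imp_le)
    show "(sinh (dist (hmap M x) (hmap M y) / 2))\<^sup>2 \<le> (\<kappa> * sinh (dist x y / 2))\<^sup>2"
      using chord2[of x y] \<mu> c(1) by (simp add: \<kappa>_def power_mult_distrib)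
  qed (use \<kappa> in simp)
  then have "dist (hmap M x) (hmap M y) \<le> ((1 + \<kappa>) / 2) * dist x y" for x y
    using \<kappa> by (intro lipschitz_of_chord[of \<kappa>]) auto
  then show ?thesis using \<kappa> by (intro exI[of _ "(1 + \<kappa>) / 2"]) auto
qed

definition F0 :: "hyp3 \<Rightarrow> hyp3" where
  "F0 x = T.nearest (hmap M x)"

text \<open>Here the projective map takes \<open>x\<close> to the closed half space beyond the face, from which the
  nearest point lies on the face.\<close>

lemma F0_on_face:
  assumes "i \<in> {1..4}" "lor (Rep_hyp3 x) (n i) \<ge> eps * (\<Sum>k\<in>{1..4}. lor (Rep_hyp3 x) (n k))"
  shows "lor (Rep_hyp3 (F0 x)) (m i) = 0"
  unfolding F0_def using assms lnorm_pos[OF timelike_M]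
  by (intro T.nearest_on_face) (simp_all add: lor_Rep_hmap_M less_imp_le)

lemma F0_face:
  assumes "x \<in> tetrahedron n" "i \<in> {1..4}" "lor (Rep_hyp3 x) (n i) = 0"
  shows "lor (Rep_hyp3 (F0 x)) (m i) = 0"
proof (rule F0_on_face[OF assms(2)])
  have "(\<Sum>k\<in>{1..4}. lor (Rep_hyp3 x) (n k)) \<le> 0"
    using assms(1) by (intro sum_nonpos) (auto simp: S.in_tetrahedron)
  then show "lor (Rep_hyp3 x) (n i) \<ge> eps * (\<Sum>k\<in>{1..4}. lor (Rep_hyp3 x) (n k))"
    using eps assms(3) by (simp add: mult_nonneg_nonpos)
qed

subsection \<open>Extension by equivariance\<close>

lemma lorentz_word_n: "xs \<in> lists {1..4} \<Longrightarrow> lorentz (word n xs)"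
  and lorentz_word_m: "xs \<in> lists {1..4} \<Longrightarrow> lorentz (word m xs)"
  using S.lorentz_W S.W_word T.lorentz_W T.W_word by auto

lemma hmap_word_append_n: "xs \<in> lists {1..4} \<Longrightarrow> ys \<in> lists {1..4} \<Longrightarrow>
    hmap (word n (xs @ ys)) x = hmap (word n xs) (hmap (word n ys) x)"
  and hmap_word_append_m: "xs \<in> lists {1..4} \<Longrightarrow> ys \<in> lists {1..4} \<Longrightarrow>
    hmap (word m (xs @ ys)) x = hmap (word m xs) (hmap (word m ys) x)"
  by (simp_all add: word_append hmap_compose lorentz_word_n lorentz_word_m)

lemma rev_lists: "xs \<in> lists A \<Longrightarrow> rev xs \<in> lists A"
  by (simp add: in_lists_conv_set)

lemma hmap_word_rev_n: "xs \<in> lists {1..4} \<Longrightarrow> hmap (word n (rev xs)) (hmap (word n xs) x) = x"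
  and hmap_word_rev_m': "xs \<in> lists {1..4} \<Longrightarrow> hmap (word m xs) (hmap (word m (rev xs)) x) = x"
  using word_rev_cancel[of xs n] word_rev_cancel'[of xs m] S.unit T.unit
  by (auto simp: Rep_hmap_lorentz lorentz_word_n lorentz_word_m rev_lists in_lists_conv_set
      simp flip: Rep_hyp3_inject)

text \<open>The choice of the word and of the point in the tetrahedron does not affect the value, by
  \<open>F_word\<close> below.\<close>

definition F :: "hyp3 \<Rightarrow> hyp3" where
  "F z = (case SOME (xs, x). xs \<in> lists {1..4} \<and> x \<in> tetrahedron n \<and> z = hmap (word n xs) x
          of (xs, x) \<Rightarrow> hmap (word m xs) (F0 x))"

lemma chamber_ex: "\<exists>xs x. xs \<in> lists {1..4} \<and> x \<in> tetrahedron n \<and> z = hmap (word n xs) x"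
proof -
  obtain w where w: "w \<in> S.W" "hmap w z \<in> tetrahedron n" by (rule S.tetrahedron_covers)
  then obtain xs where xs: "xs \<in> lists {1..4}" "w = word n xs" by (auto simp: S.W_def)
  then show ?thesis using w(2) hmap_word_rev_n[OF xs(1), of z] rev_lists[OF xs(1)]
    by (intro exI[of _ "rev xs"] exI[of _ "hmap w z"]) auto
qed

text \<open>Two representations of a point differ by an element that fixes the point of the tetrahedron,
  hence by a product of reflections in faces through that point. Its image under \<open>F0\<close> lies on the
  corresponding faces of the target, so it is fixed by the corresponding product.\<close>

lemma F_word:
  assumes xs: "xs \<in> lists {1..4}" and x: "x \<in> tetrahedron n"
  shows "F (hmap (word n xs) x) = hmap (word m xs) (F0 x)"
proof -
  define z where "z = hmap (word n xs) x"
  define q where "q = (SOME (xs, x). xs \<in> lists {1..4} \<and> x \<in> tetrahedron n \<and> z = hmap (word n xs) x)"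
  obtain xs' x' where q: "q = (xs', x')" by (cases q)
  have "case q of (xs, x) \<Rightarrow> xs \<in> lists {1..4} \<and> x \<in> tetrahedron n \<and> z = hmap (word n xs) x"
    unfolding q_def by (rule someI_ex) (use chamber_ex[of z] in auto)
  then have xs': "xs' \<in> lists {1..4}" and x': "x' \<in> tetrahedron n" and z': "z = hmap (word n xs') x'"
    by (auto simp: q)
  let ?g = "rev xs' @ xs"
  have g: "?g \<in> lists {1..4}" using xs rev_lists[OF xs'] by simp
  have gx: "hmap (word n ?g) x = x'"
    unfolding hmap_word_append_n[OF rev_lists[OF xs'] xs] z_def[symmetric] z'
    by (rule hmap_word_rev_n[OF xs'])
  obtain ys where ys: "set ys \<subseteq> {i\<in>{1..4}. lor (Rep_hyp3 x) (n i) = 0}" "word n ys = word n ?g"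
    using S.fundamental(2)[OF g x] gx x' by auto
  have xx: "x' = x" using S.fundamental(1)[OF g x] gx x' by simp
  have ys4: "ys \<in> lists {1..4}" using ys(1) by (auto simp: in_lists_conv_set)
  have "hmap (word m ys) (F0 x) = F0 x"
    using ys(1) F0_face[OF x]
    by (auto simp: Rep_hmap_lorentz lorentz_word_m ys4 simp flip: Rep_hyp3_inject intro!: word_fixes)
  then have "hmap (word m ?g) (F0 x) = F0 x" using rel[OF ys4 g ys(2)] by simp
  then have "hmap (word m xs') (hmap (word m (rev xs')) (hmap (word m xs) (F0 x))) = hmap (word m xs') (F0 x)"
    by (simp add: hmap_word_append_m rev_lists xs xs')
  then have "hmap (word m xs) (F0 x) = hmap (word m xs') (F0 x)"
    by (simp add: hmap_word_rev_m' xs')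
  then show ?thesis
    unfolding F_def z_def[symmetric] q_def[symmetric] by (simp add: q xx)
qed

lemma F_equivariant: "xs \<in> lists {1..4} \<Longrightarrow> F (hmap (word n xs) z) = hmap (word m xs) (F z)"
proof -
  assume xs: "xs \<in> lists {1..4}"
  obtain ys x where ys: "ys \<in> lists {1..4}" "x \<in> tetrahedron n" "z = hmap (word n ys) x"
    using chamber_ex by blast
  then show ?thesis
    using F_word[of "xs @ ys" x] F_word[of ys x] xs
    by (simp add: hmap_word_append_n hmap_word_append_m)
qed

lemma F_eq_F0: "x \<in> tetrahedron n \<Longrightarrow> F x = F0 x"
  using F_word[of "[]" x] hmap_id by (simp add: id_def)

theorem F_lipschitz: "\<exists>K. 0 < K \<and> K < 1 \<and> lipschitz_on K UNIV F"
proof -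
  obtain K where K: "0 < K" "K < 1" "\<And>x y. dist (hmap M x) (hmap M y) \<le> K * dist x y"
    using hmap_M_contracting by blast
  have "lipschitz_on K UNIV F"
  proof (rule S.lipschitz_from_chamber)
    fix i x y assume i: "i \<in> {1..4::nat}"
    have "F (hmap (lrefl (n i)) x) = hmap (lrefl (m i)) (F x)" for x
      using F_equivariant[of "[i]" x] i by simp
    then show "dist (F (hmap (lrefl (n i)) x)) (F (hmap (lrefl (n i)) y)) = dist (F x) (F y)"
      using dist_hmap[OF T.lorentz_W[OF T.lrefl_W[OF i]]] by simp
  next
    fix x y assume "x \<in> tetrahedron n" "y \<in> tetrahedron n"
    then have "dist (F x) (F y) \<le> dist (hmap M x) (hmap M y)"
      by (simp add: F_eq_F0 F0_def T.nearest_nonexpansive)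
    then show "dist (F x) (F y) \<le> K * dist x y" using K(3)[of x y] by linarith
  qed (use K in simp)
  then show ?thesis using K by blast
qed

subsection \<open>Neighbourhoods of the vertices\<close>

text \<open>At a point outside the core the condition of \<open>F0_on_face\<close> holds for three faces, so that \<open>F\<close>
  takes a vertex as value.\<close>

definition core :: "hyp3 set" where
  "core = {x \<in> tetrahedron n. \<forall>i\<in>{1..4}. \<exists>k\<in>{1..4} - {i}.
     lor (Rep_hyp3 x) (n k) \<le> eps * (\<Sum>j\<in>{1..4}. lor (Rep_hyp3 x) (n j))}"

lemma outside_core:
  assumes "x \<in> tetrahedron n" "x \<notin> core"
  shows "\<exists>i\<in>{1..4}. F x = hproj (T.P i)"
proof -
  obtain i where i: "i \<in> {1..4}" "\<And>k. k \<in> {1..4} - {i} \<Longrightarrow>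
      lor (Rep_hyp3 x) (n k) > eps * (\<Sum>j\<in>{1..4}. lor (Rep_hyp3 x) (n j))"
    using assms by (force simp: core_def not_le)
  define s where "s = - lor (Rep_hyp3 (F0 x)) (m i)"
  have 0: "lor (Rep_hyp3 (F0 x)) (m k) = 0" if "k \<in> {1..4} - {i}" for k
    using i(2)[OF that] that by (intro F0_on_face) auto
  have eq: "Rep_hyp3 (F0 x) = s *\<^sub>R T.P i"
  proof (rule T.eqI_n)
    fix k :: nat assume "k \<in> {1..4}"
    then show "lor (Rep_hyp3 (F0 x)) (m k) = lor (s *\<^sub>R T.P i) (m k)"
      using 0[of k] i(1) by (auto simp: s_def lor_scale_left lor.minus_left T.P_n)
  qed
  have tl: "timelike (T.P i)"
    using T.P_causal[OF i(1)] T.vertex_timelike[OF i(1)] by (simp add: timelike_def causal_def)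
  have "s > 0"
    using eq causal_Rep[of "F0 x"] tl by (auto simp: causal_def timelike_def zero_less_mult_iff)
  have "F x = hproj (Rep_hyp3 (F0 x))" using assms(1) by (simp add: F_eq_F0)
  also have "\<dots> = hproj (T.P i)" unfolding eq by (rule hproj_scale[OF tl \<open>s > 0\<close>])
  finally show ?thesis using i(1) by blast
qed

text \<open>The products of distinct vertex vectors are negative, even for ideal vertices. So if one
  coordinate of a point of the hyperboloid is large then the other three are small in comparison,
  and the point is not in the core.\<close>

lemma compact_core: "compact core"
proof (rule compact_hyp3)
  have "core = tetrahedron n \<inter> (\<Inter>i\<in>{1..4}. \<Union>k\<in>{1..4} - {i}. {x.
     lor (Rep_hyp3 x) (n k) \<le> eps * (\<Sum>j\<in>{1..4}. lor (Rep_hyp3 x) (n j))})"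
    by (auto simp: core_def)
  moreover have "closed {x. lor (Rep_hyp3 x) (n k) \<le> eps * (\<Sum>j\<in>{1..4}. lor (Rep_hyp3 x) (n j))}" for k
    by (intro closed_Collect_le continuous_intros)
  ultimately show "closed core" using S.closed_tetrahedron by (auto intro!: closed_Int closed_INT closed_UN)
next
  define I where "I = {(i, k). i \<in> {1..4} \<and> k \<in> {1..4::nat} \<and> i \<noteq> k}"
  define a where "a = Min ((\<lambda>(i, k). - lor (S.P i) (S.P k)) ` I)"
  have fI: "finite I" by (rule finite_subset[of _ "{1..4} \<times> {1..4}"]) (auto simp: I_def)
  have "(1, 2) \<in> I" by (simp add: I_def)
  then have ne: "I \<noteq> {}" by blast
  have "\<forall>y\<in>(\<lambda>(i, k). - lor (S.P i) (S.P k)) ` I. 0 < y" using S.P_P_neg by (auto simp: I_def)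
  then have a: "a > 0" unfolding a_def using fI ne by (subst Min_gr_iff) simp_all
  have ale: "a \<le> - lor (S.P i) (S.P k)" if "i \<in> {1..4}" "k \<in> {1..4}" "i \<noteq> k" for i k
    unfolding a_def using fI that by (intro Min_le) (auto simp: I_def image_iff intro!: bexI[of _ "(i, k)"])
  have "- lor (Rep_hyp3 x) (n j) \<le> 1 / sqrt (eps * a)" if x: "x \<in> core" and j: "j \<in> {1..4}" for x j
  proof -
    define s where "s i = - lor (Rep_hyp3 x) (n i)" for i
    have xT: "x \<in> tetrahedron n" using x by (simp add: core_def)
    have s: "s i \<ge> 0" if "i \<in> {1..4}" for i using xT that by (simp add: s_def S.in_tetrahedron)
    obtain i where i: "i \<in> {1..4}" "\<And>j. j \<in> {1..4} \<Longrightarrow> s j \<le> s i"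
    proof -
      have "Max (s ` {1..4}) \<in> s ` {1..4}" by (rule Max_in) auto
      then obtain i where "i \<in> {1..4}" "s i = Max (s ` {1..4})" by (metis imageE)
      then show ?thesis using that Max_ge[of "s ` {1..4}"] by (metis finite_atLeastAtMost finite_imageI imageI)
    qed
    obtain k where k: "k \<in> {1..4} - {i}" "lor (Rep_hyp3 x) (n k) \<le> eps * (\<Sum>j\<in>{1..4}. lor (Rep_hyp3 x) (n j))"
      using x i(1) unfolding core_def by blast
    have "s i \<le> sum s {1..4}" using s i(1) by (intro member_le_sum) auto
    then have "eps * s i \<le> eps * sum s {1..4}" using eps by simp
    also have "eps * sum s {1..4} \<le> s k"
      using k(2) by (simp add: s_def sum_negf)
    finally have ki: "eps * s i \<le> s k" .
    have le: "lor (S.P i) (S.P k) \<le> 0" if "i \<in> {1..4}" "k \<in> {1..4}" for i k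
      using causal_lor_le[OF S.P_causal S.P_causal] that by blast
    have "1 = - lor (Rep_hyp3 x) (Rep_hyp3 x)" by simp
    also have "\<dots> = (\<Sum>i\<in>{1..4}. s i * (- lor (S.P i) (Rep_hyp3 x)))"
      by (subst (1) S.lor_expand) (simp add: s_def sum_negf)
    also have "\<dots> \<ge> s i * (- lor (S.P i) (Rep_hyp3 x))"
      using s i(1) causal_lor_le[OF S.P_causal causal_Rep]
      by (intro member_le_sum) (auto intro!: mult_nonneg_nonneg mult_nonneg_nonpos)
    finally have 1: "s i * (- lor (S.P i) (Rep_hyp3 x)) \<le> 1" .
    have "- lor (Rep_hyp3 x) (S.P i) = (\<Sum>k\<in>{1..4}. s k * (- lor (S.P k) (S.P i)))"
      by (subst S.lor_expand) (simp add: s_def sum_negf)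
    also have "\<dots> \<ge> s k * (- lor (S.P k) (S.P i))"
      using s i(1) k(1) le by (intro member_le_sum) (auto intro!: mult_nonneg_nonneg mult_nonneg_nonpos)
    finally have "s k * (- lor (S.P k) (S.P i)) \<le> - lor (S.P i) (Rep_hyp3 x)"
      by (simp add: lor_commute[of "S.P i"])
    moreover have "s k * a \<le> s k * (- lor (S.P k) (S.P i))"
      using k(1) i(1) s by (intro mult_left_mono ale) auto
    ultimately have "s k * a \<le> - lor (S.P i) (Rep_hyp3 x)" by linarith
    then have "s i * (s k * a) \<le> 1" using mult_left_mono[OF _ s[OF i(1)]] 1 by (meson order_trans)
    moreover have "s i * (eps * s i * a) \<le> s i * (s k * a)"
      using ki a s[OF i(1)] by (intro mult_left_mono mult_right_mono) auto
    ultimately have "s i * (eps * s i * a) \<le> 1" by linarith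
    then have "(s i)\<^sup>2 \<le> (1 / sqrt (eps * a))\<^sup>2"
      using a eps by (simp add: power_divide power2_eq_square field_simps)
    then have "s i \<le> 1 / sqrt (eps * a)" by (rule power2_le_imp_le) (use a eps in simp)
    then show ?thesis using i(2)[OF j] by (simp add: s_def)
  qed
  then show "bounded (Rep_hyp3 ` core)"
    by (intro S.bounded_by_coefficients) (auto simp: core_def)
qed

end

section \<open>Parabolic isometries and cusps\<close>

lemma ideal_lor: "\<xi> \<in> ideal_points \<Longrightarrow> lor \<xi> \<xi> = 0"
  and ideal_4: "\<xi> \<in> ideal_points \<Longrightarrow> \<xi> $ 4 = 1"
  and ideal_causal: "\<xi> \<in> ideal_points \<Longrightarrow> causal \<xi>"
  by (auto simp: ideal_points_def causal_def)

lemma lor_Rep_ideal_neg: "\<xi> \<in> ideal_points \<Longrightarrow> lor (Rep_hyp3 x) \<xi> < 0"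
  using timelike_lor_neg[OF causal_Rep ideal_causal] by simp

lemma lorentz_4_pos: "lorentz g \<Longrightarrow> g (Rep_hyp3 x) $ 4 > 0"
  using causal_Rep[of "hmap g x"] by (simp add: Rep_hmap_lorentz causal_def)

lemma continuous_linear4:
  fixes g :: "real^4 \<Rightarrow> real^4"
  assumes "linear g" "(f \<longlongrightarrow> l) X"
  shows "((\<lambda>k. g (f k)) \<longlongrightarrow> g l) X"
  using linear_continuous_at[of g l] assms isCont_tendsto_compose[of l g f X]
  by (simp add: linear_conv_bounded_linear)

text \<open>Along a sequence that converges to \<open>\<xi>\<close>, the normalised images converge to \<open>\<xi>\<close> by assumption
  and to the direction of \<open>g \<xi>\<close> by continuity.\<close>

lemma fixes_ideal_eigenvector:
  assumes g: "lorentz g" and \<xi>: "\<xi> \<in> ideal_points" and fx: "fixes_ideal (hmap g) \<xi>"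
  obtains \<beta> where "\<beta> > 0" "g \<xi> = \<beta> *\<^sub>R \<xi>"
proof -
  define o1 where "o1 = (axis 4 1 :: real^4)"
  have o1: "timelike o1" by (simp add: o1_def timelike_def lor_def axis_def)
  define y where "y k = o1 + real (Suc k) *\<^sub>R \<xi>" for k
  define z where "z k = (1 / (1 + real (Suc k))) *\<^sub>R y k" for k
  have tl: "timelike (y k)" for k
    unfolding y_def using ideal_causal[OF \<xi>] by (intro timelike_add_causal o1 causal_scale) auto
  have y4: "y k $ 4 = 1 + real (Suc k)" for k
    by (simp add: y_def o1_def axis_def ideal_4[OF \<xi>])
  define s where "s k = hproj (y k)" for k
  have norm_s: "(1 / h (Rep_hyp3 (s k)) $ 4) *\<^sub>R h (Rep_hyp3 (s k)) = (1 / h (z k) $ 4) *\<^sub>R h (z k)"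
    if "linear h" for h :: "real^4 \<Rightarrow> real^4" and k
    using lnorm_pos[OF tl[of k]]
    by (simp add: s_def Rep_hproj[OF tl] z_def linear_scale[OF that])
  have z4: "z k $ 4 = 1" for k by (simp add: z_def y4 del: of_nat_Suc)
  have zeq: "z k = \<xi> + (1 / (1 + real (Suc k))) *\<^sub>R (o1 - \<xi>)" for k
  proof -
    have "y k = (1 + real (Suc k)) *\<^sub>R \<xi> + (o1 - \<xi>)" by (simp add: y_def scaleR_add_left del: of_nat_Suc)
    then show ?thesis by (simp add: z_def scaleR_add_right del: of_nat_Suc)
  qed
  have "(\<lambda>k. 1 / (1 + real (Suc k))) \<longlonglongrightarrow> 0"
    using LIMSEQ_ignore_initial_segment[OF lim_inverse_n, of 2] by (simp add: inverse_eq_divide add_ac)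
  then have "(\<lambda>k. \<xi> + (1 / (1 + real (Suc k))) *\<^sub>R (o1 - \<xi>)) \<longlonglongrightarrow> \<xi> + 0 *\<^sub>R (o1 - \<xi>)"
    by (intro tendsto_intros)
  moreover have "z = (\<lambda>k. \<xi> + (1 / (1 + real (Suc k))) *\<^sub>R (o1 - \<xi>))" by (rule ext) (rule zeq)
  ultimately have z: "z \<longlonglongrightarrow> \<xi>" by simp
  have "tends_to_ideal s \<xi>"
  proof -
    have "(1 / Rep_hyp3 (s k) $ 4) *\<^sub>R Rep_hyp3 (s k) = z k" for k
      using norm_s[OF linear_id, of k] z4[of k] by simp
    then show ?thesis unfolding tends_to_ideal_def using z by simp
  qed
  then have "tends_to_ideal (hmap g \<circ> s) \<xi>" using fx by (simp add: fixes_ideal_def)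
  then have lim: "(\<lambda>k. (1 / g (z k) $ 4) *\<^sub>R g (z k)) \<longlonglongrightarrow> \<xi>"
    unfolding tends_to_ideal_def by (simp add: Rep_hmap_lorentz[OF g] norm_s[OF lorentz_linear[OF g]])
  have gz: "(\<lambda>k. g (z k)) \<longlonglongrightarrow> g \<xi>" by (rule continuous_linear4[OF lorentz_linear[OF g] z])
  then have gz4: "(\<lambda>k. g (z k) $ 4) \<longlonglongrightarrow> g \<xi> $ 4" by (rule tendsto_vec_nth)
  have pos: "g (z k) $ 4 > 0" for k
    using lorentz_4_pos[OF g, of "s k"] lnorm_pos[OF tl[of k]]
    by (simp add: s_def Rep_hproj[OF tl] z_def linear_scale[OF lorentz_linear[OF g]] zero_less_divide_iff)
  have "(\<lambda>k. g (z k) $ 4 *\<^sub>R ((1 / g (z k) $ 4) *\<^sub>R g (z k))) \<longlonglongrightarrow> g \<xi> $ 4 *\<^sub>R \<xi>"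
    by (intro tendsto_scaleR gz4 lim)
  moreover have "(\<lambda>k. g (z k) $ 4 *\<^sub>R ((1 / g (z k) $ 4) *\<^sub>R g (z k))) = (\<lambda>k. g (z k))"
    using pos by (intro ext) (simp add: less_imp_neq[OF pos, symmetric])
  ultimately have "(\<lambda>k. g (z k)) \<longlonglongrightarrow> g \<xi> $ 4 *\<^sub>R \<xi>" by (simp only:)
  then have eq: "g \<xi> = g \<xi> $ 4 *\<^sub>R \<xi>" by (rule LIMSEQ_unique[OF gz])
  have "g \<xi> $ 4 \<ge> 0" using pos by (intro LIMSEQ_le_const[OF gz4]) (auto intro: less_imp_le)
  moreover have "g \<xi> $ 4 \<noteq> 0"
  proof
    assume "g \<xi> $ 4 = 0"
    then have "g \<xi> = g 0" using linear_0[OF lorentz_linear[OF g]] by (subst eq) simp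
    then have "\<xi> = 0" using lorentz_inj[OF g] by (simp add: inj_eq)
    then show False using ideal_4[OF \<xi>] by simp
  qed
  ultimately have "g \<xi> $ 4 > 0" by linarith
  then show ?thesis by (rule that[OF _ eq])
qed

lemma eigenvector_fixes_ideal:
  assumes g: "lorentz g" and \<zeta>: "\<zeta> \<in> ideal_points" and eq: "g \<zeta> = \<beta> *\<^sub>R \<zeta>" and \<beta>: "\<beta> \<noteq> 0"
  shows "fixes_ideal (hmap g) \<zeta>"
  unfolding fixes_ideal_def tends_to_ideal_def
proof (intro allI impI)
  fix s :: "nat \<Rightarrow> hyp3"
  define z where "z k = (1 / Rep_hyp3 (s k) $ 4) *\<^sub>R Rep_hyp3 (s k)" for k
  assume "(\<lambda>k. (1 / Rep_hyp3 (s k) $ 4) *\<^sub>R Rep_hyp3 (s k)) \<longlonglongrightarrow> \<zeta>"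
  then have z: "z \<longlonglongrightarrow> \<zeta>" by (simp add: z_def[abs_def])
  have gz: "(\<lambda>k. g (z k)) \<longlonglongrightarrow> \<beta> *\<^sub>R \<zeta>" using continuous_linear4[OF lorentz_linear[OF g] z] eq by simp
  then have gz4: "(\<lambda>k. g (z k) $ 4) \<longlonglongrightarrow> \<beta>" using tendsto_vec_nth[OF gz, of 4] ideal_4[OF \<zeta>] by simp
  have "(\<lambda>k. (1 / g (z k) $ 4) *\<^sub>R g (z k)) \<longlonglongrightarrow> (1 / \<beta>) *\<^sub>R (\<beta> *\<^sub>R \<zeta>)"
    using \<beta> by (intro tendsto_intros gz gz4)
  moreover have "(1 / g (z k) $ 4) *\<^sub>R g (z k)
      = (1 / Rep_hyp3 ((hmap g \<circ> s) k) $ 4) *\<^sub>R Rep_hyp3 ((hmap g \<circ> s) k)" for k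
    using causal_Rep[of "s k"]
    by (simp add: z_def Rep_hmap_lorentz[OF g] linear_scale[OF lorentz_linear[OF g]] causal_def)
  ultimately show "(\<lambda>k. (1 / Rep_hyp3 ((hmap g \<circ> s) k) $ 4) *\<^sub>R Rep_hyp3 ((hmap g \<circ> s) k)) \<longlonglongrightarrow> \<zeta>"
    using \<beta> by simp
qed

lemma linear_not_surj_kernel:
  fixes h :: "real^4 \<Rightarrow> real^4"
  assumes "linear h" "\<not> surj h"
  obtains w where "w \<noteq> 0" "h w = 0"
  using assms linear_injective_imp_surjective[of h] by (auto simp: linear_injective_0)

text \<open>If the eigenvalue of the fixed lightlike vector were not 1, then its inverse would be an eigenvalue as
  well, since the form is preserved, and there would be a second fixed ideal point.\<close>

lemma parabolic_fixes_vector: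
  assumes g: "lorentz g" and par: "parabolic (hmap g)" and \<xi>: "\<xi> \<in> ideal_points"
    and fx: "fixes_ideal (hmap g) \<xi>"
  shows "g \<xi> = \<xi>"
proof -
  note lin = lorentz_linear[OF g]
  obtain \<beta> where \<beta>: "\<beta> > 0" "g \<xi> = \<beta> *\<^sub>R \<xi>" by (rule fixes_ideal_eigenvector[OF g \<xi> fx])
  define h where "h x = g x - (1 / \<beta>) *\<^sub>R x" for x
  have linh: "linear h"
    unfolding h_def using lin by (auto simp: linear_iff algebra_simps)
  have "lor (h x) \<xi> = 0" for x
  proof -
    have "lor (g x) (\<beta> *\<^sub>R \<xi>) = lor x \<xi>" using lorentz_lor[OF g, of x \<xi>] \<beta> by simp
    then show ?thesis using \<beta>(1) by (simp add: h_def lor_simps field_simps)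
  qed
  then have "h x \<noteq> Rep_hyp3 y" for x y using lor_Rep_ideal_neg[OF \<xi>, of y] by (metis less_irrefl)
  then have "\<not> surj h" by (metis surjD)
  then obtain \<zeta> where \<zeta>: "\<zeta> \<noteq> 0" "h \<zeta> = 0" by (rule linear_not_surj_kernel[OF linh])
  then have g\<zeta>: "g \<zeta> = (1 / \<beta>) *\<^sub>R \<zeta>" by (simp add: h_def)
  show ?thesis
  proof (rule ccontr)
    assume "g \<xi> \<noteq> \<xi>"
    then have \<beta>1: "\<beta> \<noteq> 1" using \<beta>(2) by auto
    then have \<beta>2: "\<beta>\<^sup>2 \<noteq> 1" using \<beta>(1) by (simp add: power2_eq_1_iff)
    have "lor \<zeta> \<zeta> = lor (g \<zeta>) (g \<zeta>)" using lorentz_lor[OF g] by simp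
    also have "\<dots> = lor \<zeta> \<zeta> / \<beta>\<^sup>2" by (simp add: g\<zeta> lor_simps power2_eq_square)
    finally have "lor \<zeta> \<zeta> * (\<beta>\<^sup>2 - 1) = 0" using \<beta>(1) by (simp add: field_simps)
    then have Q: "lor \<zeta> \<zeta> = 0" using \<beta>2 by simp
    then have z4: "\<zeta> $ 4 \<noteq> 0" using \<zeta>(1) lor_norm[of \<zeta>] by auto
    define \<zeta>' where "\<zeta>' = (1 / \<zeta> $ 4) *\<^sub>R \<zeta>"
    have \<zeta>': "\<zeta>' \<in> ideal_points" using Q z4 by (simp add: ideal_points_def \<zeta>'_def lor_simps)
    have g\<zeta>': "g \<zeta>' = (1 / \<beta>) *\<^sub>R \<zeta>'" by (simp add: \<zeta>'_def linear_scale[OF lin] g\<zeta>)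
    have "fixes_ideal (hmap g) \<zeta>'" using eigenvector_fixes_ideal[OF g \<zeta>' g\<zeta>'] \<beta>(1) by simp
    then have "\<zeta>' = \<xi>" using par \<xi> \<zeta>' fx unfolding parabolic_def by blast
    then have "\<beta> *\<^sub>R \<xi> = (1 / \<beta>) *\<^sub>R \<xi>" using \<beta>(2) g\<zeta>' by simp
    then have "\<beta> * \<xi> $ 4 = (1 / \<beta>) * \<xi> $ 4" by (metis vector_scaleR_component real_scaleR_def)
    then show False using ideal_4[OF \<xi>] \<beta>(1) \<beta>2 by (simp add: power2_eq_square field_simps)
  qed
qed

lemma future_of_orthogonal:
  assumes "lor y y < 0" "\<xi> \<in> ideal_points" "lor y \<xi> < 0"
  shows "timelike y"
  using timelike_future[OF assms(1) ideal_causal[OF assms(2)] assms(3)] assms(1) by (simp add: timelike_def)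

lemma parabolic_no_fixed_timelike:
  assumes g: "lorentz g" and par: "parabolic (hmap g)" and y: "timelike y"
  shows "g y \<noteq> y"
proof
  assume "g y = y"
  then have "hmap g (hproj y) = hproj y"
    by (simp add: Rep_hmap_lorentz[OF g] Rep_hproj[OF y] linear_scale[OF lorentz_linear[OF g]] flip: Rep_hyp3_inject)
  then show False using par unfolding parabolic_def by blast
qed

text \<open>On the Euclidean plane \<open>\<xi>\<^sup>\<bottom> / \<xi>\<close> a parabolic isometry acts as an orthogonal map with a nonzero fixed
  vector, because otherwise one could solve for a fixed point in hyperbolic space.\<close>

lemma parabolic_fixed_direction:
  assumes g: "lorentz g" and par: "parabolic (hmap g)" and \<xi>: "\<xi> \<in> ideal_points" and g\<xi>: "g \<xi> = \<xi>"
  obtains w c where "lor w \<xi> = 0" "lor w w > 0" "g w = w + c *\<^sub>R \<xi>"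
proof -
  note lin = lorentz_linear[OF g]
  define x0 where "x0 = Rep_hyp3 (hproj (axis 4 1))"
  have x0: "lor x0 \<xi> < 0" unfolding x0_def by (rule lor_Rep_ideal_neg[OF \<xi>])
  have x0H: "x0 \<in> hyperboloid" by (simp add: x0_def Rep_hyp3)
  have inv: "lor (g w) \<xi> = lor w \<xi>" for w using lorentz_lor[OF g, of w \<xi>] g\<xi> by simp
  \<comment> \<open>On \<open>\<xi>\<^sup>\<bottom>\<close> this is \<open>g w - w\<close> up to multiples of \<open>\<xi>\<close>; the third term detects \<open>lor w \<xi>\<close>, the fourth keeps \<open>\<xi>\<close> itself out of the kernel.\<close>
  define h where "h w = g w - w + lor w \<xi> *\<^sub>R x0 + lor w x0 *\<^sub>R \<xi>" for w
  have linh: "linear h"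
    unfolding h_def using lin by (auto simp: linear_iff lor_simps algebra_simps)
  have h\<xi>: "lor (h w) \<xi> = lor w \<xi> * lor x0 \<xi>" for w
    by (simp add: h_def lor_simps inv ideal_lor[OF \<xi>])
  show ?thesis
  proof (cases "surj h")
    case True
    then obtain w where w: "h w = - (g x0 - x0)" by (metis surjD)
    have "lor w \<xi> * lor x0 \<xi> = 0"
      unfolding h\<xi>[symmetric] w by (simp add: lor.minus_left lor_simps inv)
    then have w\<xi>: "lor w \<xi> = 0" using x0 by simp
    define c where "c = - lor w x0"
    define y where "y = x0 + w"
    have gy: "g y = y + c *\<^sub>R \<xi>"
      using w by (simp add: h_def w\<xi> y_def linear_add[OF lin] c_def algebra_simps)
    have y\<xi>: "lor y \<xi> = lor x0 \<xi>" by (simp add: y_def lor_simps w\<xi>)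
    have "lor y y = lor (g y) (g y)" by (simp add: lorentz_lor[OF g])
    also have "\<dots> = lor y y + 2 * c * lor y \<xi>"
      unfolding gy by (simp add: lor_simps ideal_lor[OF \<xi>] lor_commute[of \<xi> y] algebra_simps)
    finally have "c = 0" using y\<xi> x0 by simp
    define t where "t = - (1 + lor y y) / (2 * lor y \<xi>)"
    define z where "z = y + t *\<^sub>R \<xi>"
    have "lor z z = lor y y + t * (2 * lor y \<xi>)"
      by (simp add: z_def lor_simps ideal_lor[OF \<xi>] lor_commute[of \<xi> y] algebra_simps)
    also have "\<dots> = -1" using y\<xi> x0 by (simp add: t_def)
    finally have "lor z z = -1" .
    moreover have "lor z \<xi> < 0" by (simp add: z_def lor_simps ideal_lor[OF \<xi>] y\<xi> x0)
    ultimately have "timelike z" using future_of_orthogonal[OF _ \<xi>, of z] by simp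
    moreover have "g z = z" using gy \<open>c = 0\<close> by (simp add: z_def linear_add[OF lin] linear_scale[OF lin] g\<xi>)
    ultimately show ?thesis using parabolic_no_fixed_timelike[OF g par] by blast
  next
    case False
    then obtain w where w: "w \<noteq> 0" "h w = 0" by (rule linear_not_surj_kernel[OF linh])
    have w\<xi>: "lor w \<xi> = 0" using h\<xi>[of w] w(2) x0 by (simp add: lor.zero_left)
    have gw: "g w = w + (- lor w x0) *\<^sub>R \<xi>" using w(2) by (simp add: h_def w\<xi> algebra_simps)
    define u where "u = w - (lor w x0 / lor x0 \<xi>) *\<^sub>R \<xi>"
    have u0: "lor u x0 = 0" using x0 by (simp add: u_def lor_simps lor_commute[of \<xi> x0])
    have Q: "lor u u = lor w w" by (simp add: u_def lor_simps ideal_lor[OF \<xi>] w\<xi> lor_commute[of \<xi> w])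
    have "lor w w > 0"
    proof (rule ccontr)
      assume "\<not> lor w w > 0"
      then have "lor u u = 0" using lor_orthogonal_pos(1)[OF x0H u0] Q by simp
      then have "u = 0" by (rule lor_orthogonal_pos(2)[OF x0H u0])
      then have "w = (lor w x0 / lor x0 \<xi>) *\<^sub>R \<xi>" by (simp add: u_def)
      then obtain k where k: "w = k *\<^sub>R \<xi>" by blast
      then have "g w = w" by (simp add: linear_scale[OF lin] g\<xi>)
      then have "lor w x0 *\<^sub>R \<xi> = 0" using gw by simp
      then have "lor w x0 = 0" using ideal_4[OF \<xi>] by force
      then have "k * lor x0 \<xi> = 0" unfolding k by (simp add: lor_simps lor_commute[of \<xi> x0])
      then show False using x0 k w(1) by simp
    qed
    then show ?thesis using that w\<xi> gw by blast
  qed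
qed

text \<open>Hence it acts on that plane as the identity or as a reflection, and its square acts as the identity.\<close>

lemma parabolic_square_unipotent:
  assumes g: "lorentz g" and par: "parabolic (hmap g)" and \<xi>: "\<xi> \<in> ideal_points" and g\<xi>: "g \<xi> = \<xi>"
    and w: "lor w \<xi> = 0"
  shows "\<exists>c. g (g w) = w + c *\<^sub>R \<xi>"
proof -
  note lin = lorentz_linear[OF g]
  have inv: "lor (g w) \<xi> = lor w \<xi>" for w using lorentz_lor[OF g, of w \<xi>] g\<xi> by simp
  obtain b c where b: "lor b \<xi> = 0" "lor b b > 0" "g b = b + c *\<^sub>R \<xi>"
    by (rule parabolic_fixed_direction[OF g par \<xi> g\<xi>])
  define x0 where "x0 = Rep_hyp3 (hproj (axis 4 1))"
  have x0: "lor x0 \<xi> < 0" unfolding x0_def by (rule lor_Rep_ideal_neg[OF \<xi>])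
  have x0H: "x0 \<in> hyperboloid" by (simp add: x0_def Rep_hyp3)
  have \<xi>0: "\<xi> \<noteq> 0" using ideal_4[OF \<xi>] by auto
  have positive: "lor u u > 0" if "lor u \<xi> = 0" "\<nexists>k. u = k *\<^sub>R \<xi>" for u
  proof -
    define u' where "u' = u - (lor u x0 / lor x0 \<xi>) *\<^sub>R \<xi>"
    have u0: "lor u' x0 = 0" using x0 by (simp add: u'_def lor_simps lor_commute[of \<xi> x0])
    have Q: "lor u' u' = lor u u" by (simp add: u'_def lor_simps ideal_lor[OF \<xi>] that lor_commute[of \<xi> u])
    have "u' \<noteq> 0" using that(2) unfolding u'_def by (metis eq_iff_diff_eq_0)
    then show ?thesis using lor_orthogonal_pos[OF x0H u0] Q by (metis order_le_less)
  qed
  \<comment> \<open>The orthogonal complement of \<open>\<xi>\<close> and \<open>b\<close> is two-dimensional and contains \<open>\<xi>\<close>.\<close>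
  have plane: "\<exists>k l. v = k *\<^sub>R u + l *\<^sub>R \<xi>"
    if u: "lor u \<xi> = 0" "lor u b = 0" "lor u u > 0" and v: "lor v \<xi> = 0" "lor v b = 0" for u v
  proof (rule ccontr)
    assume no: "\<nexists>k l. v = k *\<^sub>R u + l *\<^sub>R \<xi>"
    define v' where "v' = v - (lor v u / lor u u) *\<^sub>R u"
    have v': "lor v' \<xi> = 0" "lor v' b = 0" "lor v' u = 0"
      using u v by (simp_all add: v'_def lor_simps)
    have "\<nexists>k. v' = k *\<^sub>R \<xi>" using no unfolding v'_def by (metis add.commute diff_add_cancel)
    then have v'2: "lor v' v' > 0" using positive v'(1) by blast
    define h where "h y = y$1 *\<^sub>R b + y$2 *\<^sub>R u + y$3 *\<^sub>R v' + y$4 *\<^sub>R \<xi>" for y :: "real^4"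
    have linh: "linear h" by (auto simp: linear_iff h_def algebra_simps)
    have "inj h"
      unfolding linear_injective_0[OF linh]
    proof (intro allI impI)
      fix y assume y: "h y = 0"
      have "lor (h y) b = y$1 * lor b b" "lor (h y) u = y$2 * lor u u" "lor (h y) v' = y$3 * lor v' v'"
        using b u v' by (simp_all add: h_def lor_simps lor_commute[of b u] lor_commute[of b v']
            lor_commute[of u v'] lor_commute[of \<xi> b] lor_commute[of \<xi> u] lor_commute[of \<xi> v'])
      then have "y$1 = 0" "y$2 = 0" "y$3 = 0"
        unfolding y using b(2) u(3) v'2 by (auto simp: lor.zero_left)
      moreover from this have "y$4 = 0" using y \<xi>0 by (simp add: h_def)
      ultimately show "y = 0" by (simp add: vec_eq_iff forall_4)
    qed
    then have "surj h" using linh linear_injective_imp_surjective by blast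
    then obtain y where "x0 = h y" by (metis surjD)
    then have "lor x0 \<xi> = 0" using b u v' ideal_lor[OF \<xi>] by (simp add: h_def lor_simps)
    then show False using x0 by simp
  qed
  have ggb: "g (g b) = b + (2 * c) *\<^sub>R \<xi>"
  proof -
    have "c *\<^sub>R \<xi> + c *\<^sub>R \<xi> = (2 * c) *\<^sub>R \<xi>" by (simp flip: scaleR_add_left)
    then show ?thesis by (simp add: b(3) linear_add[OF lin] linear_scale[OF lin] g\<xi> add.assoc)
  qed
  define u where "u = w - (lor w b / lor b b) *\<^sub>R b"
  have u: "lor u \<xi> = 0" "lor u b = 0" using w b by (simp_all add: u_def lor_simps)
  have "\<exists>d. g (g u) = u + d *\<^sub>R \<xi>"
  proof (cases "\<exists>k. u = k *\<^sub>R \<xi>")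
    case True
    then show ?thesis by (auto simp: linear_scale[OF lin] g\<xi> intro!: exI[of _ 0])
  next
    case False
    then have uu: "lor u u > 0" using positive u(1) by blast
    have gu: "lor (g u) \<xi> = 0" using inv u(1) by simp
    have "lor (g u) b = lor (g u) (g b) - c * lor (g u) \<xi>" by (simp add: b(3) lor_simps)
    then have gub: "lor (g u) b = 0" using gu u(2) by (simp add: lorentz_lor[OF g])
    obtain k l where kl: "g u = k *\<^sub>R u + l *\<^sub>R \<xi>" using plane[OF u uu gu gub] by blast
    have "lor u u = lor (g u) (g u)" by (simp add: lorentz_lor[OF g])
    also have "\<dots> = k\<^sup>2 * lor u u"
      unfolding kl by (simp add: lor_simps u ideal_lor[OF \<xi>] lor_commute[of \<xi> u] power2_eq_square)
    finally have k2: "k\<^sup>2 = 1" using uu by simp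
    have "g (g u) = k\<^sup>2 *\<^sub>R u + (k * l + l) *\<^sub>R \<xi>"
      by (simp add: kl linear_add[OF lin] linear_scale[OF lin] g\<xi> power2_eq_square algebra_simps)
    then show ?thesis using k2 by (metis scaleR_one)
  qed
  then obtain d where d: "g (g u) = u + d *\<^sub>R \<xi>" by blast
  define a where "a = lor w b / lor b b"
  have w_eq: "w = u + a *\<^sub>R b" by (simp add: u_def a_def)
  have "g (g w) = g (g u) + a *\<^sub>R g (g b)"
    by (simp add: w_eq linear_add[OF lin] linear_scale[OF lin])
  also have "\<dots> = w + (d + a * (2 * c)) *\<^sub>R \<xi>"
    unfolding d ggb w_eq by (simp only: scaleR_add_left scaleR_add_right scaleR_scaleR add_ac)
  finally have "g (g w) = w + (d + a * (2 * c)) *\<^sub>R \<xi>" .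
  then show ?thesis by blast
qed

text \<open>For points \<open>x\<close>, \<open>y\<close> the vectors \<open>x / lor x \<xi>\<close> and \<open>y / lor y \<xi>\<close> differ by an element of
  \<open>\<xi>\<^sup>\<bottom>\<close>, which the square of \<open>g\<close> moves by a multiple of \<open>\<xi>\<close> only. So the length of the displacement
  is proportional to \<open>lor x \<xi>\<close>, with the same factor for all points.\<close>

lemma parabolic_displacement:
  assumes g: "lorentz g" and par: "parabolic (hmap g)" and \<xi>: "\<xi> \<in> ideal_points" and g\<xi>: "g \<xi> = \<xi>"
  obtains C where "C \<ge> 0"
    "\<And>x. cosh (dist x (hmap (g \<circ> g) x)) = 1 + C * (lor (Rep_hyp3 x) \<xi>)\<^sup>2"
proof -
  note lin = lorentz_linear[OF g]
  define h where "h = g \<circ> g"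
  have h: "lorentz h" unfolding h_def by (rule lorentz_compose[OF g g])
  have h\<xi>: "h \<xi> = \<xi>" by (simp add: h_def g\<xi>)
  have inv: "lor (h w) \<xi> = lor w \<xi>" for w using lorentz_lor[OF h, of w \<xi>] h\<xi> by simp
  define x0 where "x0 = Rep_hyp3 (hproj (axis 4 1))"
  have x0: "lor x0 \<xi> < 0" unfolding x0_def by (rule lor_Rep_ideal_neg[OF \<xi>])
  define q where "q x = lor (h x - x) (h x - x)" for x
  define C where "C = q x0 / (2 * (lor x0 \<xi>)\<^sup>2)"
  have disp: "cosh (dist x (hmap h x)) = 1 + q (Rep_hyp3 x) / 2" for x
    using lorentz_lor[OF h, of "Rep_hyp3 x" "Rep_hyp3 x"]
    by (simp add: dist_hyp3_cosh Rep_hmap_lorentz[OF h] q_def lor_simps lor_commute[of "h (Rep_hyp3 x)" "Rep_hyp3 x"] field_simps)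
  have q: "q (Rep_hyp3 x) = (lor (Rep_hyp3 x) \<xi> / lor x0 \<xi>)\<^sup>2 * q x0" for x
  proof -
    define r where "r = lor (Rep_hyp3 x) \<xi> / lor x0 \<xi>"
    define w where "w = Rep_hyp3 x - r *\<^sub>R x0"
    have "lor w \<xi> = 0" using x0 by (simp add: w_def r_def lor_simps)
    then obtain c where c: "h w = w + c *\<^sub>R \<xi>"
      using parabolic_square_unipotent[OF g par \<xi> g\<xi>] by (auto simp: h_def)
    have xw: "Rep_hyp3 x = w + r *\<^sub>R x0" by (simp add: w_def)
    have hx: "h (Rep_hyp3 x) - Rep_hyp3 x = c *\<^sub>R \<xi> + r *\<^sub>R (h x0 - x0)"
      unfolding xw by (simp add: linear_add[OF lorentz_linear[OF h]] linear_scale[OF lorentz_linear[OF h]] c algebra_simps)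
    have "lor (h x0 - x0) \<xi> = 0" by (simp add: lor_simps inv)
    then have "lor (c *\<^sub>R \<xi> + r *\<^sub>R (h x0 - x0)) (c *\<^sub>R \<xi> + r *\<^sub>R (h x0 - x0))
        = r\<^sup>2 * lor (h x0 - x0) (h x0 - x0)"
      using ideal_lor[OF \<xi>]
      by (simp only: lor_add_left lor_add_right lor_scale_left lor_scale_right lor_commute[of \<xi> "h x0 - x0"])
        (simp add: power2_eq_square)
    then show ?thesis unfolding q_def hx r_def .
  qed
  have "cosh (dist x (hmap h x)) = 1 + C * (lor (Rep_hyp3 x) \<xi>)\<^sup>2" for x
    unfolding disp q C_def by (simp add: power_divide mult.commute)
  moreover have "C \<ge> 0"
  proof -
    have "q x0 \<ge> 0" unfolding x0_def using disp[of "hproj (axis 4 1)"] cosh_real_ge_1[of "dist (hproj (axis 4 1)) (hmap h (hproj (axis 4 1)))"]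
      by simp
    then show ?thesis by (simp add: C_def)
  qed
  ultimately show ?thesis using that by (auto simp: h_def)
qed

text \<open>If the square fixed \<open>x\<close> then \<open>g\<close> would fix the midpoint of \<open>x\<close> and its image.\<close>

lemma square_fixed_point_free:
  assumes g: "lorentz g" and free: "\<And>x. hmap g x \<noteq> x"
  shows "hmap (g \<circ> g) x \<noteq> x"
proof
  assume eq: "hmap (g \<circ> g) x = x"
  define y where "y = 1 *\<^sub>R Rep_hyp3 x + 1 *\<^sub>R Rep_hyp3 (hmap g x)"
  have tl: "timelike y" using dist_through_combination(1)[of 1 1 x "hmap g x"] by (simp add: y_def)
  have "g (g (Rep_hyp3 x)) = Rep_hyp3 x"
    using arg_cong[OF eq, of Rep_hyp3] by (simp add: Rep_hmap_lorentz[OF lorentz_compose[OF g g]])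
  then have "g y = y" by (simp add: y_def Rep_hmap_lorentz[OF g] linear_add[OF lorentz_linear[OF g]])
  then have "hmap g (hproj y) = hproj y"
    by (simp add: Rep_hmap_lorentz[OF g] Rep_hproj[OF tl] linear_scale[OF lorentz_linear[OF g]] flip: Rep_hyp3_inject)
  then show False using free by blast
qed

lemma continuous_on_hproj: "continuous_on {y. timelike y} hproj"
proof -
  have "continuous_on {y. timelike y} (\<lambda>y. pr3 ((1 / lnorm y) *\<^sub>R y))"
  proof (rule continuous_on_compose2[of UNIV pr3])
    show "continuous_on UNIV pr3" using linear_pr3 by (simp add: linear_continuous_on linear_conv_bounded_linear)
    show "continuous_on {y. timelike y} (\<lambda>y. (1 / lnorm y) *\<^sub>R y)"
      unfolding lnorm_def by (intro continuous_intros) (auto simp: timelike_def)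
  qed auto
  then have "continuous_on {y. timelike y} (\<lambda>y. hyp_chart (pr3 ((1 / lnorm y) *\<^sub>R y)))"
    by (rule continuous_on_compose2[OF continuous_hyp_chart]) auto
  moreover have "hyp_chart (pr3 ((1 / lnorm y) *\<^sub>R y)) = hproj y" if "timelike y" for y
    using hyp_chart_pr3[of "hproj y"] by (simp only: Rep_hproj[OF that])
  ultimately show ?thesis using continuous_on_eq[of "{y. timelike y}" _ hproj] by blast
qed

text \<open>The product with \<open>\<xi>\<close> is affine in \<open>t\<close>, and normalising a convex combination divides it by a
  length of at least 1.\<close>

lemma horoball_segment:
  assumes "\<xi> \<in> ideal_points" "x \<in> horoball \<xi> r" "y \<in> horoball \<xi> r" "0 \<le> t" "t \<le> 1"
  shows "hproj ((1 - t) *\<^sub>R Rep_hyp3 x + t *\<^sub>R Rep_hyp3 y) \<in> horoball \<xi> r"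
proof -
  let ?u = "(1 - t) *\<^sub>R Rep_hyp3 x + t *\<^sub>R Rep_hyp3 y"
  have tl: "timelike ?u" and ln: "lnorm ?u \<ge> 1"
    using dist_through_combination[of "1 - t" t x y] assms by auto
  have "- lor ?u \<xi> = (1 - t) * (- lor (Rep_hyp3 x) \<xi>) + t * (- lor (Rep_hyp3 y) \<xi>)"
    by (simp add: lor_simps)
  also have "\<dots> < r"
    using assms by (intro convex_bound_lt) (auto simp: horoball_def)
  finally have less: "- lor ?u \<xi> < r" .
  have "0 \<le> - lor ?u \<xi>" using causal_lor_le[OF timelike_causal[OF tl] ideal_causal[OF assms(1)]] by simp
  then have "- lor ?u \<xi> / lnorm ?u \<le> - lor ?u \<xi>"
    using divide_left_mono[OF ln, of "- lor ?u \<xi>"] ln by simp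
  then show ?thesis using less by (simp add: horoball_def Rep_hproj[OF tl] lor_scale_left)
qed

context tetrahedron_pair
begin

text \<open>Only finitely many elements move some point of the compact core by at most 1, and each of
  those without fixed points has a positive minimal displacement on the core.\<close>

lemma core_displacement:
  obtains \<delta> where "\<delta> > 0"
    "\<And>w x. w \<in> S.W \<Longrightarrow> (\<And>y. hmap w y \<noteq> y) \<Longrightarrow> x \<in> core \<Longrightarrow> \<delta> \<le> dist x (hmap w x)"
proof -
  obtain R where R: "\<And>x. x \<in> core \<Longrightarrow> dist x S.base \<le> R"
    using compact_imp_bounded[OF compact_core] by (auto simp: bounded_any_center[of _ S.base] dist_commute)
  define A where "A = {w \<in> S.W. (\<forall>y. hmap w y \<noteq> y) \<and> (\<exists>x\<in>core. dist x (hmap w x) \<le> 1)}"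
  have "A \<subseteq> {w \<in> S.W. dist (hmap w S.base) S.base \<le> 2 * R + 1}"
  proof
    fix w assume "w \<in> A"
    then obtain x where x: "w \<in> S.W" "x \<in> core" "dist x (hmap w x) \<le> 1" by (auto simp: A_def)
    have "dist (hmap w S.base) S.base \<le> dist (hmap w S.base) (hmap w x) + dist x (hmap w x) + dist x S.base"
      by (smt (verit) dist_triangle dist_commute)
    then show "w \<in> {w \<in> S.W. dist (hmap w S.base) S.base \<le> 2 * R + 1}"
      using x R[OF x(2)] by (simp add: dist_hmap S.lorentz_W dist_commute)
  qed
  then have fin: "finite A" using S.finite_moving_little finite_subset by blast
  have "\<exists>d>0. \<forall>x\<in>core. d \<le> dist x (hmap w x)" if "w \<in> A" for w
  proof -
    have w: "w \<in> S.W" "\<And>y. hmap w y \<noteq> y" "core \<noteq> {}" using that by (auto simp: A_def)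
    have "continuous_on core (hmap w)"
      by (rule lipschitz_on_continuous_on[of 1])
        (auto simp: lipschitz_on_def dist_hmap S.lorentz_W w)
    then have "continuous_on core (\<lambda>x. dist x (hmap w x))" by (intro continuous_intros)
    then obtain x where x: "x \<in> core" "\<And>y. y \<in> core \<Longrightarrow> dist x (hmap w x) \<le> dist y (hmap w y)"
      using continuous_attains_inf[OF compact_core w(3)] by blast
    then show ?thesis using w(2)[of x] by (intro exI[of _ "dist x (hmap w x)"]) auto
  qed
  then obtain d where d: "\<And>w. w \<in> A \<Longrightarrow> d w > 0 \<and> (\<forall>x\<in>core. d w \<le> dist x (hmap w x))" by metis
  define \<delta> where "\<delta> = Min (insert 1 (d ` A))"
  have "\<delta> > 0" using fin d by (simp add: \<delta>_def)
  moreover have "\<delta> \<le> dist x (hmap w x)" if "w \<in> S.W" "\<And>y. hmap w y \<noteq> y" "x \<in> core" for w x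
  proof (cases "w \<in> A")
    case True
    then have "\<delta> \<le> d w" using fin by (simp add: \<delta>_def)
    then show ?thesis using d[OF True] that(3) by force
  next
    case False
    then have "1 < dist x (hmap w x)" using that by (auto simp: A_def)
    moreover have "\<delta> \<le> 1" using fin by (simp add: \<delta>_def)
    ultimately show ?thesis by simp
  qed
  ultimately show ?thesis using that by blast
qed

text \<open>Deep in the horoball the square of \<open>g\<close> moves points by less than the bound for the core.
  After conjugation this shows that no such point is equivalent to a point of the core, so \<open>F\<close> maps
  the horoball into the countable set of images of vertices. A continuous image of a segment with
  more than one point would be uncountable.\<close>

theorem F_constant_on_horoball:
  assumes g: "g \<in> S.W" and par: "parabolic (hmap g)" and \<xi>: "\<xi> \<in> ideal_points"
    and fx: "fixes_ideal (hmap g) \<xi>"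
  obtains r c where "r > 0" "F ` horoball \<xi> r = {c}"
proof -
  have gl: "lorentz g" using g by (rule S.lorentz_W)
  have g\<xi>: "g \<xi> = \<xi>" by (rule parabolic_fixes_vector[OF gl par \<xi> fx])
  obtain C where C: "C \<ge> 0" "\<And>x. cosh (dist x (hmap (g \<circ> g) x)) = 1 + C * (lor (Rep_hyp3 x) \<xi>)\<^sup>2"
    using parabolic_displacement[OF gl par \<xi> g\<xi>] by blast
  have free: "hmap (g \<circ> g) x \<noteq> x" for x
    using par by (intro square_fixed_point_free[OF gl]) (auto simp: parabolic_def)
  have ggW: "g \<circ> g \<in> S.W" by (rule S.W_compose[OF g g])
  obtain \<delta> where \<delta>: "\<delta> > 0"
    "\<And>w x. w \<in> S.W \<Longrightarrow> (\<And>y. hmap w y \<noteq> y) \<Longrightarrow> x \<in> core \<Longrightarrow> \<delta> \<le> dist x (hmap w x)"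
    using core_displacement by blast
  \<comment> \<open>Chosen such that \<open>C * r\<^sup>2 < cosh \<delta> - 1\<close>; the summand 1 allows for \<open>C = 0\<close>.\<close>
  define r where "r = sqrt ((cosh \<delta> - 1) / (C + 1))"
  have cd: "cosh \<delta> > 1" using \<delta>(1) cosh_real_strict_mono[of 0 \<delta>] by simp
  have r: "r > 0" using cd C(1) by (simp add: r_def)
  have r2: "C * r\<^sup>2 < cosh \<delta> - 1"
  proof -
    have "r\<^sup>2 = (cosh \<delta> - 1) / (C + 1)" using cd C(1) by (simp add: r_def)
    then have "C * r\<^sup>2 = (cosh \<delta> - 1) * (C / (C + 1))" by simp
    also have "\<dots> < (cosh \<delta> - 1) * 1" using cd C(1) by (intro mult_strict_left_mono) auto
    finally show ?thesis by simp
  qed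
  have small: "dist x (hmap (g \<circ> g) x) < \<delta>" if x: "x \<in> horoball \<xi> r" for x
  proof -
    have "(lor (Rep_hyp3 x) \<xi>)\<^sup>2 \<le> r\<^sup>2"
    proof -
      have "\<bar>lor (Rep_hyp3 x) \<xi>\<bar> \<le> \<bar>r\<bar>"
        using x lor_Rep_ideal_neg[OF \<xi>, of x] by (simp add: horoball_def)
      then show ?thesis by (simp add: abs_le_square_iff)
    qed
    then have "cosh (dist x (hmap (g \<circ> g) x)) < cosh \<delta>"
      using C(2)[of x] mult_left_mono[OF _ C(1), of "(lor (Rep_hyp3 x) \<xi>)\<^sup>2" "r\<^sup>2"] r2 by simp
    then show ?thesis using \<delta>(1) by (simp add: cosh_real_nonneg_less_iff)
  qed
  define V where "V = (\<lambda>(w, i). hmap w (hproj (T.P i))) ` (T.W \<times> {1..4})"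
  have cV: "countable V" unfolding V_def using T.countable_W by (intro countable_image countable_SIGMA) auto
  have inV: "F x \<in> V" if x: "x \<in> horoball \<xi> r" for x
  proof -
    obtain xs x' where xs: "xs \<in> lists {1..4}" "x' \<in> tetrahedron n" "x = hmap (word n xs) x'"
      using chamber_ex by blast
    have "x' \<notin> core"
    proof
      assume core: "x' \<in> core"
      define v where "v = word n (rev xs)"
      define w where "w = word n xs"
      have vw: "v \<in> S.W" "w \<in> S.W" "lorentz v" "lorentz w"
        using S.W_word[OF xs(1)] S.W_word[OF rev_lists[OF xs(1)]]
          lorentz_word_n[OF xs(1)] lorentz_word_n[OF rev_lists[OF xs(1)]]
        by (simp_all only: v_def w_def)
      have vwx: "hmap v (hmap w y) = y" for y using hmap_word_rev_n[OF xs(1)] by (simp add: v_def w_def)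
      have wvx: "hmap w (hmap v y) = y" for y
        using hmap_word_rev_n[OF rev_lists[OF xs(1)]] by (simp add: v_def w_def)
      have eq: "hmap (v \<circ> (g \<circ> g) \<circ> w) y = hmap v (hmap (g \<circ> g) (hmap w y))" for y
        using vw gl lorentz_compose by (simp add: hmap_compose)
      have "\<delta> \<le> dist x' (hmap (v \<circ> (g \<circ> g) \<circ> w) x')"
      proof (rule \<delta>(2)[OF _ _ core])
        show "v \<circ> (g \<circ> g) \<circ> w \<in> S.W" by (rule S.W_compose[OF S.W_compose[OF vw(1) ggW] vw(2)])
        show "hmap (v \<circ> (g \<circ> g) \<circ> w) y \<noteq> y" for y
          unfolding eq using free[of "hmap w y"] wvx by metis
      qed
      also have "\<dots> = dist (hmap v x) (hmap v (hmap (g \<circ> g) x))"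
        unfolding eq using xs(3) vwx by (simp add: w_def)
      also have "\<dots> = dist x (hmap (g \<circ> g) x)" by (rule dist_hmap[OF vw(3)])
      also have "\<dots> < \<delta>" by (rule small[OF x])
      finally show False by simp
    qed
    then obtain i where i: "i \<in> {1..4}" "F x' = hproj (T.P i)" using outside_core[OF xs(2)] by blast
    have "F x = hmap (word m xs) (hproj (T.P i))" using F_equivariant[OF xs(1)] xs(3) i(2) by simp
    then show ?thesis using i(1) T.W_word[OF xs(1)] by (auto simp: V_def)
  qed
  have cF: "continuous_on UNIV F" using F_lipschitz lipschitz_on_continuous_on by blast
  have const: "F x = F y" if xy: "x \<in> horoball \<xi> r" "y \<in> horoball \<xi> r" for x y
  proof (rule ccontr)
    assume ne: "F x \<noteq> F y"
    define p where "p t = hproj ((1 - t) *\<^sub>R Rep_hyp3 x + t *\<^sub>R Rep_hyp3 y)" for t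
    have cp: "continuous_on {0..1} p"
      unfolding p_def
    proof (rule continuous_on_compose2[OF continuous_on_hproj])
      show "(\<lambda>t. (1 - t) *\<^sub>R Rep_hyp3 x + t *\<^sub>R Rep_hyp3 y) ` {0..1} \<subseteq> {y. timelike y}"
        using dist_through_combination(1)[of "1 - _" _ x y] by auto
    qed (intro continuous_intros)
    have "connected ((F \<circ> p) ` {0..1})"
      by (intro connected_continuous_image continuous_on_compose cp continuous_on_subset[OF cF]) auto
    moreover have "F x \<in> (F \<circ> p) ` {0..1}" "F y \<in> (F \<circ> p) ` {0..1}"
    proof -
      have "p 0 = x" "p 1 = y" by (simp_all add: p_def)
      then show "F x \<in> (F \<circ> p) ` {0..1}" "F y \<in> (F \<circ> p) ` {0..1}"
        by (force intro: image_eqI[of _ _ 0], force intro: image_eqI[of _ _ 1])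
    qed
    ultimately have "uncountable ((F \<circ> p) ` {0..1})" using ne connected_uncountable by blast
    moreover have "(F \<circ> p) ` {0..1} \<subseteq> V"
      using inV horoball_segment[OF \<xi> xy] by (auto simp: p_def)
    ultimately show False using cV countable_subset by blast
  qed
  have "horoball \<xi> r \<noteq> {}"
  proof -
    \<comment> \<open>A point on the ray from the origin towards \<open>\<xi>\<close>, far enough out.\<close>
    define o1 where "o1 = (axis 4 1 :: real^4)"
    define t where "t = 1 / r\<^sup>2"
    have t: "t > 0" using r by (simp add: t_def)
    have o1: "timelike o1" "lor o1 o1 = -1" "lor o1 \<xi> = -1"
      using ideal_4[OF \<xi>] by (simp_all add: o1_def timelike_def lor_def axis_def)
    let ?u = "o1 + t *\<^sub>R \<xi>"
    have tl: "timelike ?u" using o1(1) ideal_causal[OF \<xi>] t by (intro timelike_add_causal causal_scale)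
    have "lnorm ?u = sqrt (1 + 2 * t)"
      by (simp add: lnorm_def lor_simps o1 ideal_lor[OF \<xi>] lor_commute[of \<xi> o1])
    also have "\<dots> > sqrt t" using t by simp
    finally have "1 / lnorm ?u < 1 / sqrt t" using t lnorm_pos[OF tl] by (intro divide_strict_left_mono mult_pos_pos) auto
    also have "\<dots> = r" using r by (simp add: t_def real_sqrt_divide)
    finally have "hproj ?u \<in> horoball \<xi> r"
      by (simp add: horoball_def Rep_hproj[OF tl] lor_simps o1 ideal_lor[OF \<xi>])
    then show ?thesis by blast
  qed
  then obtain x where x: "x \<in> horoball \<xi> r" by blast
  have "F y = F x" if "y \<in> horoball \<xi> r" for y by (rule const[OF that x])
  then have "F ` horoball \<xi> r = {F x}" using x by blast
  then show ?thesis using that r by blast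
qed

end

section \<open>Volume\<close>

subsection \<open>Determinants and the volume form\<close>

lemma det_4:
  fixes A :: "'a::comm_ring_1^4^4"
  shows "det A =
    A$1$4 * - (A$2$1 * (A$3$2 * A$4$3 - A$3$3 * A$4$2) - A$2$2 * (A$3$1 * A$4$3 - A$3$3 * A$4$1)
        + A$2$3 * (A$3$1 * A$4$2 - A$3$2 * A$4$1))
    + A$2$4 * (A$1$1 * (A$3$2 * A$4$3 - A$3$3 * A$4$2) - A$1$2 * (A$3$1 * A$4$3 - A$3$3 * A$4$1)
        + A$1$3 * (A$3$1 * A$4$2 - A$3$2 * A$4$1))
    + A$3$4 * - (A$1$1 * (A$2$2 * A$4$3 - A$2$3 * A$4$2) - A$1$2 * (A$2$1 * A$4$3 - A$2$3 * A$4$1)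
        + A$1$3 * (A$2$1 * A$4$2 - A$2$2 * A$4$1))
    + A$4$4 * (A$1$1 * (A$2$2 * A$3$3 - A$2$3 * A$3$2) - A$1$2 * (A$2$1 * A$3$3 - A$2$3 * A$3$1)
        + A$1$3 * (A$2$1 * A$3$2 - A$2$2 * A$3$1))"
proof -
  have f1234: "finite {2::4, 3, 4}" "1 \<notin> {2::4, 3, 4}" and f234: "finite {3::4, 4}" "2 \<notin> {3::4, 4}"
    and f34: "finite {4::4}" "3 \<notin> {4::4}"
    by auto
  show ?thesis
    unfolding det_def UNIV_4
    unfolding sum_over_permutations_insert[OF f1234] sum_over_permutations_insert[OF f234]
      sum_over_permutations_insert[OF f34]
    unfolding permutes_sing
    by (simp add: sign_swap_id permutation_swap_id sign_compose sign_id swap_id_eq permutation_compose) (simp add: algebra_simps)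
qed

lemma det_rows_linear:
  fixes A :: "real^'n^'n"
  assumes "linear M"
  shows "det (\<chi> i. M (A $ i)) = det (matrix M) * det A"
proof -
  have "(\<chi> i. M (A $ i)) = A ** transpose (matrix M)"
  proof (simp add: vec_eq_iff, intro allI)
    fix i j
    have "M (A $ i) = matrix M *v (A $ i)" by (simp add: matrix_works assms)
    then show "M (A $ i) $ j = (A ** transpose (matrix M)) $ i $ j"
      by (simp add: matrix_matrix_mult_def matrix_vector_mult_def transpose_def mult.commute)
  qed
  then show ?thesis by (simp add: det_mul)
qed

lemma det_vector_linear4:
  assumes "linear M"
  shows "det (vector [M u, M v, M w, M x] :: real^4^4) = det (matrix M) * det (vector [u, v, w, x] :: real^4^4)"
proof -
  have "(vector [M u, M v, M w, M x] :: real^4^4) = (\<chi> i. M ((vector [u, v, w, x] :: real^4^4) $ i))"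
    by (simp add: vec_eq_iff[where 'b = 4] forall_4)
  then show ?thesis by (simp only: det_rows_linear[OF assms])
qed

lemma det_vector_linear3:
  assumes "linear (M :: real^3 \<Rightarrow> real^3)"
  shows "det (vector [M u, M v, M w] :: real^3^3) = det (matrix M) * det (vector [u, v, w] :: real^3^3)"
proof -
  have "(vector [M u, M v, M w] :: real^3^3) = (\<chi> i. M ((vector [u, v, w] :: real^3^3) $ i))"
    by (simp add: vec_eq_iff[where 'b = 3] forall_3)
  then show ?thesis by (simp only: det_rows_linear[OF assms])
qed

text \<open>The time coordinate of a tangent vector is a combination of its spatial coordinates.
  Subtracting this combination of columns in the determinant leaves the factor \<open>1 / Rep_hyp3 x $ 4\<close>
  in the corner.\<close>

lemma vol_form_chart:
  assumes "u \<in> tangent x" "v \<in> tangent x" "w \<in> tangent x"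
  shows "vol_form x u v w = det (vector [pr3 u, pr3 v, pr3 w] :: real^3^3) / Rep_hyp3 x $ 4"
proof -
  define X where "X = Rep_hyp3 x"
  have X4: "X$4 > 0" using causal_Rep[of x] by (simp add: X_def causal_def)
  have XX: "X$4 * X$4 = X$1 * X$1 + X$2 * X$2 + X$3 * X$3 + 1"
    using lor_Rep_self[of x] by (simp add: lor_def X_def)
  have t: "u$4 * X$4 = u$1 * X$1 + u$2 * X$2 + u$3 * X$3"
    "v$4 * X$4 = v$1 * X$1 + v$2 * X$2 + v$3 * X$3"
    "w$4 * X$4 = w$1 * X$1 + w$2 * X$2 + w$3 * X$3"
    using assms by (simp_all add: tangent_def lor_def X_def)
  define a b c d where
    "a = - (v$1 * (w$2 * X$3 - w$3 * X$2) - v$2 * (w$1 * X$3 - w$3 * X$1) + v$3 * (w$1 * X$2 - w$2 * X$1))"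
    and "b = u$1 * (w$2 * X$3 - w$3 * X$2) - u$2 * (w$1 * X$3 - w$3 * X$1) + u$3 * (w$1 * X$2 - w$2 * X$1)"
    and "c = - (u$1 * (v$2 * X$3 - v$3 * X$2) - u$2 * (v$1 * X$3 - v$3 * X$1) + u$3 * (v$1 * X$2 - v$2 * X$1))"
    and "d = u$1 * (v$2 * w$3 - v$3 * w$2) - u$2 * (v$1 * w$3 - v$3 * w$1) + u$3 * (v$1 * w$2 - v$2 * w$1)"
  have det: "vol_form x u v w = u$4 * a + v$4 * b + w$4 * c + X$4 * d"
    unfolding vol_form_def det_4 X_def[symmetric] a_def b_def c_def d_def by simp
  have "X$4 * vol_form x u v w = (u$4 * X$4) * a + (v$4 * X$4) * b + (w$4 * X$4) * c + (X$4 * X$4) * d"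
    unfolding det by (simp add: algebra_simps)
  also have "\<dots> = d"
    unfolding t XX a_def b_def c_def d_def by (simp add: algebra_simps)
  also have "d = det (vector [pr3 u, pr3 v, pr3 w] :: real^3^3)"
    unfolding d_def det_3 by (simp add: vector_3 algebra_simps)
  finally show ?thesis using X4 by (simp add: X_def field_simps)
qed

subsection \<open>Derivatives in the chart\<close>

text \<open>The derivative at \<open>p\<close> of the inverse chart.\<close>

definition dchart :: "real^3 \<Rightarrow> real^3 \<Rightarrow> real^4" where
  "dchart p h = vector [h$1, h$2, h$3, (p \<bullet> h) / sqrt (1 + (norm p)\<^sup>2)]"

lemma pr3_dchart [simp]: "pr3 (dchart p h) = h"
  by (simp add: vec_eq_iff forall_3 dchart_def)

lemma has_derivative_Rep_hyp_chart: "((\<lambda>p. Rep_hyp3 (hyp_chart p)) has_derivative dchart p) (at p)"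
proof -
  define incl where "incl p = (vector [p$1, p$2, p$3, 0] :: real^4)" for p :: "real^3"
  have lin: "linear incl" by (auto simp: linear_iff incl_def vec_eq_iff forall_4)
  then have bl: "bounded_linear incl" by (simp add: linear_conv_bounded_linear)
  have pos: "1 + p \<bullet> p > 0" by (simp add: add_pos_nonneg)
  have "((\<lambda>p. incl p + sqrt (1 + p \<bullet> p) *\<^sub>R axis 4 1) has_derivative
      (\<lambda>h. incl h + ((h \<bullet> p + p \<bullet> h) / (2 * sqrt (1 + p \<bullet> p))) *\<^sub>R axis 4 1)) (at p)"
    by (rule derivative_eq_intros bounded_linear_imp_has_derivative[OF bl] refl | simp add: pos)+
       (simp add: fun_eq_iff inverse_eq_divide inner_commute add.commute mult.commute)
  moreover have "(\<lambda>p. incl p + sqrt (1 + p \<bullet> p) *\<^sub>R axis 4 1) = (\<lambda>p. Rep_hyp3 (hyp_chart p))"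
    by (simp add: fun_eq_iff Rep_hyp_chart vec_eq_iff forall_4 incl_def axis_def power2_norm_eq_inner)
  moreover have "(\<lambda>h. incl h + ((h \<bullet> p + p \<bullet> h) / (2 * sqrt (1 + p \<bullet> p))) *\<^sub>R axis 4 1) = dchart p"
  proof
    fix h
    have "(h \<bullet> p + p \<bullet> h) / (2 * sqrt (1 + p \<bullet> p)) = (p \<bullet> h) / sqrt (1 + p \<bullet> p)"
      by (simp add: inner_commute[of h p])
    then show "incl h + ((h \<bullet> p + p \<bullet> h) / (2 * sqrt (1 + p \<bullet> p))) *\<^sub>R axis 4 1 = dchart p h"
      by (simp add: vec_eq_iff forall_4 incl_def axis_def dchart_def power2_norm_eq_inner)
  qed
  ultimately show ?thesis by simp
qed

lemma Rep_4_chart: "Rep_hyp3 (hyp_chart p) $ 4 = sqrt (1 + (norm p)\<^sup>2)"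
  by (simp add: Rep_hyp_chart)

lemma dchart_tangent: "dchart p h \<in> tangent (hyp_chart p)"
proof -
  have "sqrt (1 + (norm p)\<^sup>2) > 0" by (simp add: add_pos_nonneg)
  moreover have "p \<bullet> h = p$1 * h$1 + p$2 * h$2 + p$3 * h$3" by (simp add: inner_vec_def sum_3)
  ultimately show ?thesis
    by (simp add: tangent_def lor_def dchart_def Rep_hyp_chart mult.commute)
qed

lemma tangent_eq_dchart:
  assumes "u \<in> tangent x"
  shows "u = dchart (pr3 (Rep_hyp3 x)) (pr3 u)"
proof -
  let ?p = "pr3 (Rep_hyp3 x)"
  have x4: "Rep_hyp3 x $ 4 > 0" using causal_Rep[of x] by (simp add: causal_def)
  have s: "sqrt (1 + (norm ?p)\<^sup>2) = Rep_hyp3 x $ 4" using Rep_4_chart[of ?p] by simp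
  have "u $ 4 * Rep_hyp3 x $ 4 = ?p \<bullet> pr3 u"
    using assms by (simp add: tangent_def lor_def inner_vec_def sum_3 mult.commute)
  then have "u $ 4 = (?p \<bullet> pr3 u) / Rep_hyp3 x $ 4" using x4 by (simp add: field_simps)
  then show ?thesis by (simp add: vec_eq_iff forall_4 dchart_def s)
qed

text \<open>Composition with the chart turns a derivative within the hyperboloid, which is determined on
  tangent vectors only, into an ordinary derivative on \<open>\<real>\<^sup>3\<close>.\<close>

lemma chart_derivative:
  assumes "has_hyp_derivative G D x"
  shows "((\<lambda>p. Rep_hyp3 (G (hyp_chart p))) has_derivative (\<lambda>h. D (dchart (pr3 (Rep_hyp3 x)) h)))
    (at (pr3 (Rep_hyp3 x)))"
proof -
  let ?p = "pr3 (Rep_hyp3 x)"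
  have d: "((\<lambda>p. Rep_hyp3 (G (Abs_hyp3 p))) has_derivative D) (at (Rep_hyp3 x) within hyperboloid)"
    using assms by (simp add: has_hyp_derivative_def)
  have sub: "range (\<lambda>p. Rep_hyp3 (hyp_chart p)) \<subseteq> hyperboloid" using Rep_hyp3 by blast
  have "((\<lambda>p. Rep_hyp3 (G (Abs_hyp3 p))) has_derivative D) (at (Rep_hyp3 (hyp_chart ?p)) within range (\<lambda>p. Rep_hyp3 (hyp_chart p)))"
    using has_derivative_subset[OF d sub] by simp
  from has_derivative_in_compose[OF has_derivative_Rep_hyp_chart this]
  show ?thesis by (simp add: Rep_hyp3_inverse)
qed

lemma derivative_tangent:
  assumes G: "has_hyp_derivative G D x" and u: "u \<in> tangent x"
  shows "D u \<in> tangent (G x)"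
proof -
  let ?p = "pr3 (Rep_hyp3 x)" and ?f = "\<lambda>p. Rep_hyp3 (G (hyp_chart p))"
  note d = chart_derivative[OF G]
  have "((\<lambda>p. lor (?f p) (?f p)) has_derivative
      (\<lambda>h. lor (?f ?p) (D (dchart ?p h)) + lor (D (dchart ?p h)) (?f ?p))) (at ?p)"
    by (rule lor.FDERIV[OF d d])
  moreover have "((\<lambda>p. lor (?f p) (?f p)) has_derivative (\<lambda>h. 0)) (at ?p)" by simp
  ultimately have "(\<lambda>h. lor (?f ?p) (D (dchart ?p h)) + lor (D (dchart ?p h)) (?f ?p)) = (\<lambda>h. 0)"
    by (rule has_derivative_unique)
  from fun_cong[OF this, of "pr3 u"] show ?thesis
    unfolding tangent_eq_dchart[OF u, symmetric]
    by (simp add: tangent_def lor_commute[of "Rep_hyp3 (G x)"])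
qed

lemma derivative_unique_tangent:
  assumes "has_hyp_derivative G D x" "has_hyp_derivative G D' x" "u \<in> tangent x"
  shows "D u = D' u"
  using fun_cong[OF has_derivative_unique[OF chart_derivative[OF assms(1)] chart_derivative[OF assms(2)]], of "pr3 u"]
  unfolding tangent_eq_dchart[OF assms(3), symmetric] .

lemma pullback_eq:
  assumes "has_hyp_derivative G D x" "u \<in> tangent x" "v \<in> tangent x" "w \<in> tangent x"
  shows "pullback G \<omega> x u v w = \<omega> (G x) (D u) (D v) (D w)"
proof -
  have "has_hyp_derivative G (SOME D. has_hyp_derivative G D x) x"
    using assms(1) by (rule someI[where P = "\<lambda>D. has_hyp_derivative G D x"])
  then show ?thesis
    using assms(1) derivative_unique_tangent[OF _ assms(1)] assms(2-4)
    unfolding pullback_def Let_def by (auto simp: ex_in_conv)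
qed

lemma vol_form_nonzero: "\<exists>u\<in>tangent x. \<exists>v\<in>tangent x. \<exists>w\<in>tangent x. vol_form x u v w \<noteq> 0"
proof -
  let ?p = "pr3 (Rep_hyp3 x)"
  have t: "dchart ?p h \<in> tangent x" for h using dchart_tangent[of ?p h] by simp
  have "vol_form x (dchart ?p (axis 1 1)) (dchart ?p (axis 2 1)) (dchart ?p (axis 3 1)) = 1 / Rep_hyp3 x $ 4"
    by (subst vol_form_chart[OF t t t]) (simp add: det_3 vector_3 axis_def)
  moreover have "Rep_hyp3 x $ 4 > 0" using causal_Rep[of x] by (simp add: causal_def)
  ultimately show ?thesis using t by (metis divide_eq_0_iff less_irrefl zero_neq_one)
qed

lemma form_density_eqI:
  assumes "\<And>u v w. u \<in> tangent x \<Longrightarrow> v \<in> tangent x \<Longrightarrow> w \<in> tangent x \<Longrightarrow> \<omega> x u v w = c * vol_form x u v w"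
  shows "form_density \<omega> x = c"
  unfolding form_density_def
proof (rule the_equality)
  show "\<forall>u\<in>tangent x. \<forall>v\<in>tangent x. \<forall>w\<in>tangent x. \<omega> x u v w = c * vol_form x u v w" using assms by blast
  fix c' assume c': "\<forall>u\<in>tangent x. \<forall>v\<in>tangent x. \<forall>w\<in>tangent x. \<omega> x u v w = c' * vol_form x u v w"
  obtain u v w where uvw: "u \<in> tangent x" "v \<in> tangent x" "w \<in> tangent x" "vol_form x u v w \<noteq> 0"
    using vol_form_nonzero by blast
  then have "c' * vol_form x u v w = c * vol_form x u v w" using c' assms by metis
  then show "c' = c" using uvw(4) by simp
qed

lemma form_density_not_differentiable:
  "(\<And>D. \<not> has_hyp_derivative G D x) \<Longrightarrow> form_density (pullback G \<omega>) x = 0"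
  by (rule form_density_eqI) (simp add: pullback_def)

text \<open>Derivatives map tangent vectors to tangent vectors, so the volume form can be written in the
  chart at both ends; comparing the two expressions gives the Jacobian determinant in the chart.\<close>

lemma form_density_chart:
  assumes "has_hyp_derivative G D x"
  defines "g' \<equiv> \<lambda>h. pr3 (D (dchart (pr3 (Rep_hyp3 x)) h))"
  shows "\<And>u v w. u \<in> tangent x \<Longrightarrow> v \<in> tangent x \<Longrightarrow> w \<in> tangent x \<Longrightarrow>
      pullback G vol_form x u v w = form_density (pullback G vol_form) x * vol_form x u v w"
    and "det (matrix g') = form_density (pullback G vol_form) x * Rep_hyp3 (G x) $ 4 / Rep_hyp3 x $ 4"
proof -
  let ?p = "pr3 (Rep_hyp3 x)"
  have x4: "Rep_hyp3 x $ 4 > 0" "Rep_hyp3 (G x) $ 4 > 0" using causal_Rep by (auto simp: causal_def)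
  have ling: "linear g'"
    using has_derivative_linear[OF chart_derivative[OF assms(1)]]
    unfolding g'_def by (rule linear_compose[OF _ linear_pr3, unfolded o_def])
  define c where "c = det (matrix g') * Rep_hyp3 x $ 4 / Rep_hyp3 (G x) $ 4"
  have eq: "pullback G vol_form x u v w = c * vol_form x u v w"
    if "u \<in> tangent x" "v \<in> tangent x" "w \<in> tangent x" for u v w
  proof -
    have g': "pr3 (D u) = g' (pr3 u)" if "u \<in> tangent x" for u
      unfolding g'_def tangent_eq_dchart[OF that, symmetric] ..
    have "pullback G vol_form x u v w = vol_form (G x) (D u) (D v) (D w)"
      by (rule pullback_eq[OF assms(1) that])
    also have "\<dots> = det (vector [g' (pr3 u), g' (pr3 v), g' (pr3 w)] :: real^3^3) / Rep_hyp3 (G x) $ 4"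
      by (subst vol_form_chart) (simp_all add: derivative_tangent[OF assms(1)] that g')
    also have "\<dots> = c * vol_form x u v w"
      unfolding vol_form_chart[OF that] det_vector_linear3[OF ling] c_def using x4 by simp
    finally show ?thesis .
  qed
  then have c: "form_density (pullback G vol_form) x = c" by (rule form_density_eqI)
  show "pullback G vol_form x u v w = form_density (pullback G vol_form) x * vol_form x u v w"
    if "u \<in> tangent x" "v \<in> tangent x" "w \<in> tangent x" for u v w
    using eq[OF that] c by simp
  show "det (matrix g') = form_density (pullback G vol_form) x * Rep_hyp3 (G x) $ 4 / Rep_hyp3 x $ 4"
    unfolding c c_def using x4 by simp
qed

subsection \<open>Projective maps\<close>

lemma has_derivative_normalise:
  fixes M :: "real^4 \<Rightarrow> real^4"
  assumes M: "linear M" and tl: "timelike (M x)"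
  obtains k where "((\<lambda>p. (1 / lnorm (M p)) *\<^sub>R M p) has_derivative
      (\<lambda>h. (1 / lnorm (M x)) *\<^sub>R M h + k h *\<^sub>R M x)) (at x within S)"
proof -
  have bl: "bounded_linear M" using M by (simp add: linear_conv_bounded_linear)
  have dM: "(M has_derivative M) (at x within S)" by (rule bounded_linear_imp_has_derivative[OF bl])
  have Q: "- lor (M x) (M x) > 0" using tl by (simp add: timelike_def)
  have "((\<lambda>p. lor (M p) (M p)) has_derivative (\<lambda>h. lor (M x) (M h) + lor (M h) (M x))) (at x within S)"
    by (rule lor.FDERIV[OF dM dM])
  then have "((\<lambda>p. 1 / lnorm (M p)) has_derivative
      (\<lambda>h. (- lor (M x) (M h) - lor (M h) (M x)) / (sqrt (- lor (M x) (M x)) * 2 * lor (M x) (M x))))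
      (at x within S)"
    unfolding lnorm_def using Q
    by (auto intro!: derivative_eq_intros simp: inverse_eq_divide)
  from has_derivative_scaleR[OF this dM] show ?thesis by (rule that)
qed

text \<open>The density of a projective map: the factor \<open>det M\<close> comes from the linear map, and each of the four
  vectors in the volume form is divided by the length of \<open>M x\<close>.\<close>

lemma projective_density:
  assumes M: "linear M" and tl: "timelike (M (Rep_hyp3 x))" and U: "open U" "Rep_hyp3 x \<in> U"
    and G: "\<And>y. Rep_hyp3 y \<in> U \<Longrightarrow> timelike (M (Rep_hyp3 y)) \<and> G y = hmap M y"
  shows "\<exists>D. has_hyp_derivative G D x"
    and "form_density (pullback G vol_form) x = det (matrix M) / (lnorm (M (Rep_hyp3 x)))^4"
proof -
  let ?x = "Rep_hyp3 x"
  obtain k where k: "((\<lambda>p. (1 / lnorm (M p)) *\<^sub>R M p) has_derivative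
      (\<lambda>h. (1 / lnorm (M ?x)) *\<^sub>R M h + k h *\<^sub>R M ?x)) (at ?x within hyperboloid)"
    using has_derivative_normalise[OF M tl] by blast
  define D where "D h = (1 / lnorm (M ?x)) *\<^sub>R M h + k h *\<^sub>R M ?x" for h
  have D: "has_hyp_derivative G D x"
  proof -
    obtain r where r: "r > 0" "ball ?x r \<subseteq> U" using U open_contains_ball by blast
    have eq: "(1 / lnorm (M p)) *\<^sub>R M p = Rep_hyp3 (G (Abs_hyp3 p))" if "p \<in> hyperboloid" "dist p ?x < r" for p
    proof -
      have "Rep_hyp3 (Abs_hyp3 p) = p" using that(1) by (rule Abs_hyp3_inverse)
      moreover have "p \<in> U" using r(2) that(2) by (auto simp: dist_commute)
      ultimately show ?thesis using G[of "Abs_hyp3 p"] by (simp add: hmap_def Rep_hproj)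
    qed
    show ?thesis
      unfolding has_hyp_derivative_def
      by (rule has_derivative_transform_within[OF k[folded D_def] r(1) Rep_hyp3 eq])
  qed
  then show "\<exists>D. has_hyp_derivative G D x" by blast
  define a where "a = lnorm (M ?x)"
  have a: "a > 0" using lnorm_pos[OF tl] by (simp add: a_def)
  have Gx: "Rep_hyp3 (G x) = (1 / a) *\<^sub>R M ?x" using G[of x] U(2) Rep_hproj[OF tl] by (simp add: hmap_def a_def)
  show "form_density (pullback G vol_form) x = det (matrix M) / (lnorm (M ?x))^4"
  proof (rule form_density_eqI)
    fix u v w assume uvw: "u \<in> tangent x" "v \<in> tangent x" "w \<in> tangent x"
    have "pullback G vol_form x u v w = vol_form (G x) (D u) (D v) (D w)"
      by (rule pullback_eq[OF D uvw])
    also have "\<dots> = det (vector [M u, M v, M w, M ?x] :: real^4^4) / a^4"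
      using a unfolding vol_form_def det_4 D_def Gx a_def[symmetric]
      by (simp add: divide_simps) (simp add: power_numeral_reduce algebra_simps)
    also have "\<dots> = det (matrix M) / a^4 * vol_form x u v w"
      by (simp add: det_vector_linear4[OF M] vol_form_def)
    finally show "pullback G vol_form x u v w = det (matrix M) / (lnorm (M ?x))^4 * vol_form x u v w"
      by (simp add: a_def)
  qed
qed

subsection \<open>Change of variables\<close>

text \<open>The change of variables formula for absolutely integrable functions says that one side is
  integrable if and only if the other is; for nonnegative functions this turns it into an equation
  of possibly infinite integrals.\<close>

lemma nn_integral_change_of_variables:
  fixes f :: "real^'m::{finite,wellorder} \<Rightarrow> real" and g :: "real^'m::_ \<Rightarrow> real^'m::_"
  assumes S: "S \<in> sets borel" and gS: "g ` S \<in> sets borel"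
    and der: "\<And>x. x \<in> S \<Longrightarrow> (g has_derivative g' x) (at x)" and inj: "inj_on g S"
    and f: "f \<in> borel_measurable borel" "\<And>x. f x \<ge> 0"
    and meas: "h \<in> borel_measurable borel" "\<And>x. x \<in> S \<Longrightarrow> h x = \<bar>det (matrix (g' x))\<bar> * f (g x)"
  shows "(\<integral>\<^sup>+x. ennreal (h x) * indicator S x \<partial>lborel) = (\<integral>\<^sup>+y. ennreal (f y) * indicator (g ` S) y \<partial>lborel)"
proof -
  let ?h = "\<lambda>x. \<bar>det (matrix (g' x))\<bar> * f (g x)"
  define h1 where "h1 x = indicator S x *\<^sub>R h x" for x
  define f1 where "f1 y = indicator (g ` S) y *\<^sub>R f y" for y
  have h1m: "h1 \<in> borel_measurable borel" unfolding h1_def using S meas(1) by measurable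
  have f1m: "f1 \<in> borel_measurable borel" unfolding f1_def using gS f(1) by measurable
  have h0: "h1 x \<ge> 0" for x using meas(2) f(2) by (simp add: h1_def indicator_def)
  have f0: "f1 x \<ge> 0" for x using f(2) by (simp add: f1_def)
  have I1: "(\<integral>\<^sup>+x. ennreal (h x) * indicator S x \<partial>lborel) = (\<integral>\<^sup>+x. ennreal (h1 x) \<partial>lborel)"
    by (rule nn_integral_cong) (simp add: h1_def indicator_def)
  have I2: "(\<integral>\<^sup>+y. ennreal (f y) * indicator (g ` S) y \<partial>lborel) = (\<integral>\<^sup>+x. ennreal (f1 x) \<partial>lborel)"
    by (rule nn_integral_cong) (simp add: f1_def indicator_def)
  have iff: "?h absolutely_integrable_on S \<and> integral S ?h = b \<longleftrightarrow>
      f absolutely_integrable_on (g ` S) \<and> integral (g ` S) f = b" for b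
  proof -
    have "(\<lambda>x. \<bar>det (matrix (g' x))\<bar> *\<^sub>R (vec (f (g x)) :: real^1)) absolutely_integrable_on S \<and>
        integral S (\<lambda>x. \<bar>det (matrix (g' x))\<bar> *\<^sub>R (vec (f (g x)) :: real^1)) = vec b \<longleftrightarrow>
      (\<lambda>y. vec (f y) :: real^1) absolutely_integrable_on (g ` S) \<and> integral (g ` S) (\<lambda>y. vec (f y) :: real^1) = vec b"
      using S der by (intro has_absolute_integral_change_of_variables inj)
        (auto intro: has_derivative_at_withinI)
    then show ?thesis by (simp add: absolutely_integrable_on_1_iff integral_on_1_eq)
  qed
  have hi: "?h absolutely_integrable_on S \<longleftrightarrow> integrable lborel h1"
  proof -
    have "?h absolutely_integrable_on S \<longleftrightarrow> integrable lebesgue h1"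
      unfolding set_integrable_def by (intro Bochner_Integration.integrable_cong refl) (auto simp: h1_def indicator_def meas(2))
    then show ?thesis using h1m by (simp add: integrable_completion)
  qed
  have fi: "f absolutely_integrable_on (g ` S) \<longleftrightarrow> integrable lborel f1"
    unfolding set_integrable_def f1_def[symmetric] using f1m by (simp add: integrable_completion)
  have hv: "integral S ?h = integral\<^sup>L lborel h1" if "?h absolutely_integrable_on S"
  proof -
    have "integral S ?h = (LINT x:S|lebesgue. ?h x)" by (rule set_lebesgue_integral_eq_integral(2)[OF that, symmetric])
    also have "\<dots> = integral\<^sup>L lebesgue h1"
      unfolding set_lebesgue_integral_def by (rule Bochner_Integration.integral_cong) (auto simp: h1_def indicator_def meas(2))
    finally show ?thesis using h1m by (simp add: integral_completion)
  qed
  have fv: "integral (g ` S) f = integral\<^sup>L lborel f1" if "f absolutely_integrable_on (g ` S)"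
    using set_lebesgue_integral_eq_integral(2)[OF that] f1m
    unfolding set_lebesgue_integral_def f1_def[symmetric] by (simp add: integral_completion)
  show ?thesis
  proof (cases "integrable lborel h1")
    case True
    then have "f absolutely_integrable_on (g ` S) \<and> integral (g ` S) f = integral\<^sup>L lborel h1"
      using iff hi hv by blast
    then have "integrable lborel f1" "integral\<^sup>L lborel f1 = integral\<^sup>L lborel h1" using fi fv by auto
    then show ?thesis unfolding I1 I2 using True h0 f0 by (simp add: nn_integral_eq_integral)
  next
    case False
    then have "\<not> integrable lborel f1" using iff hi fi by blast
    then show ?thesis
      unfolding I1 I2 using False h0 f0 h1m f1m
      by (simp add: integrable_iff_bounded not_less top_unique)
  qed
qed

subsection \<open>The hyperbolic measure\<close>

definition chart_weight :: "real^3 \<Rightarrow> real" where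
  "chart_weight p = 1 / sqrt (1 + (norm p)\<^sup>2)"

definition hyp_borel :: "hyp3 measure" where
  "hyp_borel = distr (density lborel (\<lambda>p. ennreal (chart_weight p))) borel hyp_chart"

lemma hyp_vol_completion: "hyp_vol = completion hyp_borel"
  by (simp add: hyp_vol_def hyp_borel_def chart_weight_def)

lemma sets_hyp_borel [simp]: "sets hyp_borel = sets borel"
  and space_hyp_borel [simp]: "space hyp_borel = UNIV"
  by (simp_all add: hyp_borel_def)

lemma chart_weight_nonneg: "chart_weight p \<ge> 0"
  by (simp add: chart_weight_def)

lemma chart_weight_measurable: "chart_weight \<in> borel_measurable borel"
proof -
  have "1 + (norm p)\<^sup>2 > 0" for p :: "real^3" by (simp add: add_pos_nonneg)
  then have "1 + (norm p)\<^sup>2 \<noteq> 0" for p :: "real^3" by (metis less_irrefl)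
  then show ?thesis
    unfolding chart_weight_def by (intro borel_measurable_continuous_onI continuous_intros) simp
qed

lemma hyp_chart_measurable: "hyp_chart \<in> borel_measurable borel"
  by (rule borel_measurable_continuous_onI[OF continuous_hyp_chart])

lemma chart_weight_pr3: "chart_weight (pr3 (Rep_hyp3 x)) = 1 / Rep_hyp3 x $ 4"
  using Rep_4_chart[of "pr3 (Rep_hyp3 x)"] by (simp add: chart_weight_def)

lemma nn_integral_hyp_vol:
  assumes "f \<in> borel_measurable borel"
  shows "(\<integral>\<^sup>+x. f x \<partial>hyp_vol) = (\<integral>\<^sup>+p. ennreal (chart_weight p) * f (hyp_chart p) \<partial>lborel)"
proof -
  have "(\<integral>\<^sup>+x. f x \<partial>hyp_vol) = (\<integral>\<^sup>+p. f (hyp_chart p) \<partial>density lborel (\<lambda>p. ennreal (chart_weight p)))"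
    unfolding hyp_vol_completion nn_integral_completion hyp_borel_def
    using assms hyp_chart_measurable by (intro nn_integral_distr) auto
  also have "\<dots> = (\<integral>\<^sup>+p. ennreal (chart_weight p) * f (hyp_chart p) \<partial>lborel)"
    using assms hyp_chart_measurable chart_weight_measurable
    by (intro nn_integral_density) auto
  finally show ?thesis .
qed

lemma borel_in_hyp_vol: "A \<in> sets borel \<Longrightarrow> A \<in> sets hyp_vol"
  by (simp add: hyp_vol_completion)

lemma emeasure_hyp_vol:
  assumes "A \<in> sets borel"
  shows "emeasure hyp_vol A = (\<integral>\<^sup>+p. ennreal (chart_weight p) * indicator (hyp_chart -` A) p \<partial>lborel)"
proof -
  have "emeasure hyp_vol A = (\<integral>\<^sup>+x. indicator A x \<partial>hyp_vol)"
    using assms by (simp add: borel_in_hyp_vol)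
  also have "\<dots> = (\<integral>\<^sup>+p. ennreal (chart_weight p) * indicator A (hyp_chart p) \<partial>lborel)"
    using assms by (intro nn_integral_hyp_vol) auto
  finally show ?thesis by (simp add: indicator_def)
qed

lemma emeasure_hyp_vol_compact:
  assumes "compact A"
  shows "emeasure hyp_vol A < \<infinity>"
proof -
  have A: "A \<in> sets borel" using assms by (simp add: compact_imp_closed)
  have cont: "continuous_on A (\<lambda>x. pr3 (Rep_hyp3 x))"
  proof (rule continuous_on_compose2[of UNIV pr3])
    show "continuous_on UNIV pr3" using linear_pr3 by (simp add: linear_continuous_on linear_conv_bounded_linear)
  qed (auto intro: continuous_intros)
  have eq: "hyp_chart -` A = (\<lambda>x. pr3 (Rep_hyp3 x)) ` A"
  proof
    show "hyp_chart -` A \<subseteq> (\<lambda>x. pr3 (Rep_hyp3 x)) ` A"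
      by (metis image_eqI pr3_hyp_chart subsetI vimageE)
  qed auto
  have c: "compact (hyp_chart -` A)"
    unfolding eq by (rule compact_continuous_image[OF cont assms])
  have "emeasure hyp_vol A \<le> (\<integral>\<^sup>+p. indicator (hyp_chart -` A) p \<partial>lborel)"
    unfolding emeasure_hyp_vol[OF A]
  proof (rule nn_integral_mono)
    fix p :: "real^3"
    have "1 \<le> sqrt (1 + (norm p)\<^sup>2)" by simp
    then have "chart_weight p \<le> 1" unfolding chart_weight_def by (subst divide_le_eq_1_pos) linarith+
    then have "ennreal (chart_weight p) \<le> 1" by (simp add: ennreal_le_1)
    then show "ennreal (chart_weight p) * indicator (hyp_chart -` A) p \<le> indicator (hyp_chart -` A) p"
      using mult_right_mono[of "ennreal (chart_weight p)" 1 "indicator (hyp_chart -` A) p"] by simp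
  qed
  also have "\<dots> = emeasure lborel (hyp_chart -` A)" using c by (simp add: compact_imp_closed)
  also have "\<dots> < \<infinity>" by (rule emeasure_compact_finite[OF c])
  finally show ?thesis .
qed

lemma open_timelike: "open {y. timelike y}"
  unfolding timelike_def by (intro open_Collect_conj open_Collect_less continuous_intros)

text \<open>In the chart this is the change of variables formula of \<open>\<real>\<^sup>3\<close>, with the Jacobian from
  \<open>projective_density\<close> and \<open>form_density_chart\<close>.\<close>

theorem hyp_vol_hmap_image:
  assumes M: "linear M" "det (matrix M) \<noteq> 0" and E: "E \<in> sets borel" "hmap M ` E \<in> sets borel"
    and tl: "\<And>x. x \<in> E \<Longrightarrow> timelike (M (Rep_hyp3 x))"
  shows "emeasure hyp_vol (hmap M ` E) =
    (\<integral>\<^sup>+x. ennreal (\<bar>det (matrix M)\<bar> / lnorm (M (Rep_hyp3 x)) ^ 4) * indicator E x \<partial>hyp_vol)"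
proof -
  let ?dens = "\<lambda>x. \<bar>det (matrix M)\<bar> / lnorm (M (Rep_hyp3 x)) ^ 4"
  define S where "S = hyp_chart -` E"
  define g where "g p = pr3 (Rep_hyp3 (hmap M (hyp_chart p)))" for p
  define h where "h p = ?dens (hyp_chart p) * chart_weight p" for p
  have contM: "continuous_on A M" for A using M(1) by (simp add: linear_continuous_on linear_conv_bounded_linear)
  have "\<exists>D. has_hyp_derivative (hmap M) D x" "form_density (pullback (hmap M) vol_form) x = det (matrix M) / lnorm (M (Rep_hyp3 x)) ^ 4"
    if "x \<in> E" for x
  proof -
    have o: "open {y. timelike (M y)}"
      using open_vimage[OF open_timelike contM] by (simp add: vimage_def)
    show "\<exists>D. has_hyp_derivative (hmap M) D x" "form_density (pullback (hmap M) vol_form) x = det (matrix M) / lnorm (M (Rep_hyp3 x)) ^ 4"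
      using projective_density[OF M(1) tl[OF that] o, of "hmap M"] tl[OF that] by auto
  qed
  then obtain D where D: "\<And>x. x \<in> E \<Longrightarrow> has_hyp_derivative (hmap M) (D x) x"
    and dens: "\<And>x. x \<in> E \<Longrightarrow> form_density (pullback (hmap M) vol_form) x = det (matrix M) / lnorm (M (Rep_hyp3 x)) ^ 4"
    by metis
  define g' where "g' p h = pr3 (D (hyp_chart p) (dchart p h))" for p h
  have injM: "inj M" using M by (simp add: det_nz_iff_inj)
  have injh: "x = y" if xy: "x \<in> E" "y \<in> E" "hmap M x = hmap M y" for x y
  proof -
    define a b where "a = 1 / lnorm (M (Rep_hyp3 x))" and "b = 1 / lnorm (M (Rep_hyp3 y))"
    have ab: "a > 0" "b > 0" using lnorm_pos tl xy by (auto simp: a_def b_def)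
    have "a *\<^sub>R M (Rep_hyp3 x) = b *\<^sub>R M (Rep_hyp3 y)"
      using arg_cong[OF xy(3), of Rep_hyp3] by (simp add: hmap_def Rep_hproj tl xy a_def b_def)
    then have "M (a *\<^sub>R Rep_hyp3 x) = M (b *\<^sub>R Rep_hyp3 y)" by (simp add: linear_scale[OF M(1)])
    then have "a *\<^sub>R Rep_hyp3 x = b *\<^sub>R Rep_hyp3 y" using injM by (simp add: inj_eq)
    then have "hproj (a *\<^sub>R Rep_hyp3 x) = hproj (b *\<^sub>R Rep_hyp3 y)" by simp
    then show ?thesis using ab by (simp add: hproj_scale timelike_Rep)
  qed
  have gS: "g ` S = hyp_chart -` (hmap M ` E)"
  proof
    show "hyp_chart -` (hmap M ` E) \<subseteq> g ` S"
    proof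
      fix q assume "q \<in> hyp_chart -` (hmap M ` E)"
      then obtain x where x: "x \<in> E" "hyp_chart q = hmap M x" by auto
      have "q = g (pr3 (Rep_hyp3 x))" unfolding g_def using arg_cong[OF x(2), of "\<lambda>y. pr3 (Rep_hyp3 y)"] by simp
      moreover have "pr3 (Rep_hyp3 x) \<in> S" using x(1) by (simp add: S_def)
      ultimately show "q \<in> g ` S" by blast
    qed
  qed (auto simp: g_def S_def)
  have Sb: "S \<in> sets borel" "g ` S \<in> sets borel"
    unfolding gS unfolding S_def using measurable_sets[OF hyp_chart_measurable] E by auto
  have "emeasure hyp_vol (hmap M ` E) = (\<integral>\<^sup>+q. ennreal (chart_weight q) * indicator (g ` S) q \<partial>lborel)"
    unfolding gS by (rule emeasure_hyp_vol[OF E(2)])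
  also have "\<dots> = (\<integral>\<^sup>+p. ennreal (h p) * indicator S p \<partial>lborel)"
  proof (rule nn_integral_change_of_variables[symmetric, where g' = g'])
    show "(g has_derivative g' p) (at p)" if "p \<in> S" for p
    proof -
      have x: "hyp_chart p \<in> E" using that by (simp add: S_def)
      have "bounded_linear pr3" using linear_pr3 by (simp add: linear_conv_bounded_linear)
      from bounded_linear.has_derivative[OF this chart_derivative[OF D[OF x]]]
      show ?thesis unfolding g_def[abs_def] g'_def[abs_def] by simp
    qed
    show "inj_on g S"
    proof (rule inj_onI)
      fix p q assume pq: "p \<in> S" "q \<in> S" "g p = g q"
      then have "hmap M (hyp_chart p) = hmap M (hyp_chart q)"
        unfolding g_def by (metis hyp_chart_pr3)
      then have "hyp_chart p = hyp_chart q" using injh pq by (auto simp: S_def)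
      then show "p = q" by (metis pr3_hyp_chart)
    qed
    show "h p = \<bar>det (matrix (g' p))\<bar> * chart_weight (g p)" if "p \<in> S" for p
    proof -
      let ?x = "hyp_chart p"
      have x: "?x \<in> E" using that by (simp add: S_def)
      have pos: "Rep_hyp3 ?x $ 4 > 0" "Rep_hyp3 (hmap M ?x) $ 4 > 0" using causal_Rep by (auto simp: causal_def)
      have "det (matrix (g' p)) = det (matrix M) / lnorm (M (Rep_hyp3 ?x)) ^ 4 * Rep_hyp3 (hmap M ?x) $ 4 / Rep_hyp3 ?x $ 4"
        using form_density_chart(2)[OF D[OF x]] dens[OF x] by (simp add: g'_def[abs_def])
      moreover have "chart_weight (g p) = 1 / Rep_hyp3 (hmap M ?x) $ 4"
        unfolding g_def by (rule chart_weight_pr3)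
      moreover have "chart_weight p = 1 / Rep_hyp3 ?x $ 4"
        using chart_weight_pr3[of ?x] by simp
      ultimately show ?thesis using pos lnorm_pos[OF tl[OF x]] by (simp add: h_def abs_mult)
    qed
    have "(\<lambda>p. lnorm (M (Rep_hyp3 (hyp_chart p)))) \<in> borel_measurable borel"
      unfolding lnorm_def
      by (intro borel_measurable_continuous_onI continuous_intros continuous_on_compose2[OF contM] continuous_hyp_chart) auto
    then show "h \<in> borel_measurable borel"
      unfolding h_def using chart_weight_measurable by measurable
  qed (use Sb chart_weight_measurable chart_weight_nonneg in auto)
  also have "\<dots> = (\<integral>\<^sup>+p. ennreal (chart_weight p) * (ennreal (?dens (hyp_chart p)) * indicator E (hyp_chart p)) \<partial>lborel)"
  proof (rule nn_integral_cong)
    fix p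
    have "ennreal (h p) = ennreal (chart_weight p) * ennreal (?dens (hyp_chart p))"
      unfolding h_def by (subst mult.commute) (rule ennreal_mult'[OF chart_weight_nonneg])
    then show "ennreal (h p) * indicator S p
        = ennreal (chart_weight p) * (ennreal (?dens (hyp_chart p)) * indicator E (hyp_chart p))"
      by (simp add: S_def indicator_def)
  qed
  also have "\<dots> = (\<integral>\<^sup>+x. ennreal (?dens x) * indicator E x \<partial>hyp_vol)"
  proof (rule nn_integral_hyp_vol[symmetric])
    have "(\<lambda>x. lnorm (M (Rep_hyp3 x))) \<in> borel_measurable borel"
      unfolding lnorm_def
      by (intro borel_measurable_continuous_onI continuous_intros continuous_on_compose2[OF contM]) auto
    then show "(\<lambda>x. ennreal (?dens x) * indicator E x) \<in> borel_measurable borel"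
      using E(1) by measurable
  qed
  finally show ?thesis .
qed

subsection \<open>Isometries preserve the measure\<close>

lemma det_lrefl: "lor a a = 1 \<Longrightarrow> det (matrix (lrefl a)) = -1"
proof -
  assume a: "lor a a = 1"
  have "det (matrix (lrefl a)) = 1 - 2 * lor a a"
    unfolding det_4 by (simp add: matrix_def lrefl_def lor_def axis_def algebra_simps)
  then show ?thesis using a by simp
qed

lemma det_word:
  "(\<And>i. i \<in> set xs \<Longrightarrow> lor (n i) (n i) = 1) \<Longrightarrow> det (matrix (word n xs)) = (-1) ^ length xs"
proof (induction xs)
  case (Cons i xs)
  have "matrix (word n (i # xs)) = matrix (lrefl (n i)) ** matrix (word n xs)"
    unfolding word.simps by (rule matrix_compose[OF linear_word linear_refl])
  then show ?case using Cons by (simp add: det_mul det_lrefl del: word.simps)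
qed (simp add: matrix_id)

lemma hmap_image_borel:
  assumes g: "lorentz g" "lorentz h" and inv: "\<And>x. h (g x) = x" "\<And>x. g (h x) = x" and A: "A \<in> sets borel"
  shows "hmap g ` A \<in> sets borel"
proof -
  have "hmap g ` A = hmap h -` A"
  proof
    have hg: "hmap h (hmap g x) = x" "hmap g (hmap h x) = x" for x
      using g inv by (simp_all add: Rep_hmap_lorentz flip: Rep_hyp3_inject)
    show "hmap g ` A \<subseteq> hmap h -` A" using hg by auto
    show "hmap h -` A \<subseteq> hmap g ` A" using hg by (metis image_eqI subsetI vimageE)
  qed
  moreover have "continuous_on UNIV (hmap h)"
    by (rule lipschitz_on_continuous_on[of 1]) (simp add: lipschitz_on_def dist_hmap[OF g(2)])
  then have "hmap h -` A \<in> sets borel"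
    using measurable_sets[OF borel_measurable_continuous_onI A, of "hmap h"] by simp
  ultimately show ?thesis by simp
qed

locale isometry_pair =
  fixes g h :: "real^4 \<Rightarrow> real^4"
  assumes g: "lorentz g" and h: "lorentz h" and hg: "h (g x) = x" and gh: "g (h x) = x"
    and det_g: "\<bar>det (matrix g)\<bar> = 1"
begin

lemma hmap_hg: "hmap h (hmap g x) = x" and hmap_gh: "hmap g (hmap h x) = x"
  using g h hg gh by (simp_all add: Rep_hmap_lorentz flip: Rep_hyp3_inject)

lemma image_borel: "A \<in> sets borel \<Longrightarrow> hmap g ` A \<in> sets borel"
  by (rule hmap_image_borel[OF g h hg gh])

lemma emeasure_image_borel:
  assumes A: "A \<in> sets borel"
  shows "emeasure hyp_vol (hmap g ` A) = emeasure hyp_vol A"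
proof -
  have tl: "timelike (g (Rep_hyp3 x))" for x using timelike_Rep[of "hmap g x"] by (simp add: Rep_hmap_lorentz g)
  have ln: "lnorm (g (Rep_hyp3 x)) = 1" for x by (simp add: lnorm_def lorentz_lor[OF g])
  have "emeasure hyp_vol (hmap g ` A)
      = (\<integral>\<^sup>+x. ennreal (\<bar>det (matrix g)\<bar> / lnorm (g (Rep_hyp3 x)) ^ 4) * indicator A x \<partial>hyp_vol)"
    using det_g by (intro hyp_vol_hmap_image lorentz_linear[OF g] A image_borel tl) auto
  also have "\<dots> = emeasure hyp_vol A" using A by (simp add: ln det_g borel_in_hyp_vol)
  finally show ?thesis .
qed

lemma image_sets:
  assumes "A \<in> sets hyp_vol"
  shows "hmap g ` A \<in> sets hyp_vol" and "emeasure hyp_vol (hmap g ` A) = emeasure hyp_vol A"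
proof -
  obtain S N N' where SN: "A = S \<union> N" "N \<subseteq> N'" "N' \<in> null_sets hyp_borel" "S \<in> sets hyp_borel"
    using assms unfolding hyp_vol_completion by (rule sets_completionE)
  have N': "N' \<in> sets borel" "emeasure hyp_vol N' = 0"
    using SN(3) by (auto simp: hyp_vol_completion null_sets_def)
  have S: "S \<in> sets borel" using SN(4) by simp
  have gN': "hmap g ` N' \<in> null_sets hyp_borel"
    using image_borel[OF N'(1)] emeasure_image_borel[OF N'(1)] N'(2)
    by (simp add: null_sets_def hyp_vol_completion)
  have eq: "hmap g ` A = hmap g ` S \<union> hmap g ` N" using SN(1) by auto
  show "hmap g ` A \<in> sets hyp_vol"
    unfolding hyp_vol_completion using SN(2) image_borel[OF S] gN'
    by (intro sets_completionI[OF eq]) auto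
  have null: "N \<in> null_sets hyp_vol" "hmap g ` N \<in> null_sets hyp_vol"
    unfolding hyp_vol_completion null_sets_completion_iff2 using SN(2)
    by (blast intro: bexI[OF _ SN(3)], blast intro: bexI[OF _ gN'])
  show "emeasure hyp_vol (hmap g ` A) = emeasure hyp_vol A"
    unfolding eq SN(1) using null S image_borel[OF S] emeasure_image_borel[OF S]
    by (simp add: emeasure_Un_null_set borel_in_hyp_vol image_Un)
qed

lemma vimage_eq: "hmap h -` A = hmap g ` A"
  using hmap_hg hmap_gh by (auto intro: image_eqI[of _ _ "hmap h _"])

lemma measurable_hmap: "hmap h \<in> measurable hyp_vol hyp_vol"
  by (rule measurableI) (simp_all add: space_hyp_vol vimage_eq image_sets)

lemma distr_hmap: "distr hyp_vol hyp_vol (hmap h) = hyp_vol"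
proof (rule measure_eqI)
  fix A assume "A \<in> sets (distr hyp_vol hyp_vol (hmap h))"
  then have A: "A \<in> sets hyp_vol" by simp
  then show "emeasure (distr hyp_vol hyp_vol (hmap h)) A = emeasure hyp_vol A"
    by (simp add: emeasure_distr[OF measurable_hmap] space_hyp_vol vimage_eq image_sets)
qed simp

lemma nn_integral_hmap:
  "f \<in> borel_measurable hyp_vol \<Longrightarrow> (\<integral>\<^sup>+x. f (hmap h x) \<partial>hyp_vol) = (\<integral>\<^sup>+x. f x \<partial>hyp_vol)"
  using nn_integral_distr[OF measurable_hmap, of f] by (simp add: distr_hmap)

end

subsection \<open>Planes are null sets\<close>

text \<open>In the chart a plane is either a linear hyperplane or meets each ray from the origin at most
  once.\<close>

lemma null_plane:
  assumes "k \<noteq> 0"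
  shows "{x. lor (Rep_hyp3 x) k = 0} \<in> null_sets hyp_vol"
proof -
  let ?A = "{x. lor (Rep_hyp3 x) k = 0}"
  define S where "S = {p. pr3 k \<bullet> p = k$4 * sqrt (1 + (norm p)\<^sup>2)}"
  have closed: "closed ?A" by (intro closed_Collect_eq continuous_intros)
  have vS: "hyp_chart -` ?A = S"
    by (auto simp: S_def lor_def Rep_hyp_chart inner_vec_def sum_3 algebra_simps)
  have "negligible S"
  proof (cases "k$4 = 0")
    case True
    then have "pr3 k \<noteq> 0" using assms by (auto simp: vec_eq_iff forall_3 forall_4)
    then show ?thesis using negligible_hyperplane[of "pr3 k" 0] True by (simp add: S_def)
  next
    case False
    show ?thesis
    proof (rule starlike_negligible[of S 0])
      show "closed S" unfolding S_def by (intro closed_Collect_eq continuous_intros)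
      fix c x assume c: "0 + c *\<^sub>R x \<in> S" "0 \<le> c" "0 + x \<in> S"
      have 1: "pr3 k \<bullet> x = k$4 * sqrt (1 + (norm x)\<^sup>2)" using c(3) by (simp add: S_def)
      have 2: "c * (pr3 k \<bullet> x) = k$4 * sqrt (1 + (norm (c *\<^sub>R x))\<^sup>2)" using c(1) by (simp add: S_def)
      have e1: "(pr3 k \<bullet> x)\<^sup>2 = (k$4)\<^sup>2 * (1 + (norm x)\<^sup>2)"
        unfolding 1 by (simp add: power_mult_distrib)
      have "(c * (pr3 k \<bullet> x))\<^sup>2 = (k$4)\<^sup>2 * (1 + (norm (c *\<^sub>R x))\<^sup>2)"
        unfolding 2 by (simp add: power_mult_distrib)
      then have "c\<^sup>2 * ((k$4)\<^sup>2 * (1 + (norm x)\<^sup>2)) = (k$4)\<^sup>2 * (1 + c\<^sup>2 * (norm x)\<^sup>2)"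
        by (simp add: power_mult_distrib e1)
      then have "(k$4)\<^sup>2 * (c\<^sup>2 - 1) = 0" by (simp add: algebra_simps)
      then have "c\<^sup>2 = 1" using False by simp
      then show "c = 1" using c(2) by (simp add: power2_eq_1_iff)
    qed
  qed
  then have "S \<in> null_sets lborel"
    using closed_Collect_eq[of "\<lambda>p. pr3 k \<bullet> p" "\<lambda>p. k$4 * sqrt (1 + (norm p)\<^sup>2)"]
    by (simp add: negligible_iff_null_sets null_sets_completion_iff S_def continuous_intros)
  then have "AE p in lborel. p \<notin> S" by (rule AE_not_in)
  then have "AE p in lborel. ennreal (chart_weight p) * indicator S p = 0" by eventually_elim simp
  then have "(\<integral>\<^sup>+p. ennreal (chart_weight p) * indicator S p \<partial>lborel) = (\<integral>\<^sup>+(p::real^3). 0 \<partial>lborel)"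
    by (rule nn_integral_cong_AE)
  then have "emeasure hyp_vol ?A = 0"
    using emeasure_hyp_vol[of ?A] closed unfolding vS by simp
  then show ?thesis using closed by (simp add: null_sets_def borel_in_hyp_vol)
qed

section \<open>The orbifold of the rotation group\<close>

lemma null_subset: "B \<in> null_sets hyp_vol \<Longrightarrow> A \<subseteq> B \<Longrightarrow> A \<in> null_sets hyp_vol"
  unfolding hyp_vol_completion null_sets_completion_iff2 by blast

lemma (in isometry_pair) image_open: "open A \<Longrightarrow> open (hmap g ` A)"
proof -
  assume "open A"
  moreover have "continuous_on UNIV (hmap h)"
    by (rule lipschitz_on_continuous_on[of 1]) (simp add: lipschitz_on_def dist_hmap[OF h])
  ultimately have "open (hmap h -` A)" by (rule open_vimage)
  then show ?thesis by (simp add: vimage_eq)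
qed

lemma (in isometry_pair) image_null: "A \<in> null_sets hyp_vol \<Longrightarrow> hmap g ` A \<in> null_sets hyp_vol"
  using image_sets[of A] by (auto simp: null_sets_def)

lemma orb_eqI:
  assumes "subgroup \<Gamma> isom_group" "\<gamma> \<in> \<Gamma>"
  shows "orb \<Gamma> (\<gamma> x) = orb \<Gamma> x"
proof -
  have comp: "\<alpha> \<circ> \<beta> \<in> \<Gamma>" if "\<alpha> \<in> \<Gamma>" "\<beta> \<in> \<Gamma>" for \<alpha> \<beta>
    using subgroup.m_closed[OF assms(1) that] by (simp add: isom_group_def)
  obtain \<delta> where \<delta>: "\<delta> \<in> \<Gamma>" "\<delta> \<circ> \<gamma> = id"
    using subgroup.m_inv_closed[OF assms]
      group.l_inv[OF group_isom_group subgroup.mem_carrier[OF assms]]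
    by (auto simp: isom_group_def)
  have "\<alpha> (\<gamma> x) \<in> orb \<Gamma> x" if "\<alpha> \<in> \<Gamma>" for \<alpha>
    using comp[OF that assms(2)] unfolding orb_def by (metis comp_apply imageI)
  moreover have "\<alpha> x \<in> orb \<Gamma> (\<gamma> x)" if "\<alpha> \<in> \<Gamma>" for \<alpha>
  proof -
    have "\<alpha> x = (\<alpha> \<circ> \<delta>) (\<gamma> x)" using \<delta>(2) by (metis comp_apply id_apply)
    then show ?thesis using comp[OF that \<delta>(1)] unfolding orb_def by blast
  qed
  ultimately show ?thesis unfolding orb_def by blast
qed

lemma orb_self: "subgroup \<Gamma> isom_group \<Longrightarrow> x \<in> orb \<Gamma> x"
  using subgroup.one_closed[of \<Gamma> isom_group] unfolding orb_def
  by (auto simp: isom_group_def image_iff intro!: bexI[of _ id])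

lemma mem_Union_orbits:
  assumes \<Gamma>: "subgroup \<Gamma> isom_group" and A: "A \<subseteq> orbifold \<Gamma>"
  shows "x \<in> \<Union>A \<longleftrightarrow> orb \<Gamma> x \<in> A"
proof
  assume "x \<in> \<Union>A"
  then obtain y where y: "orb \<Gamma> y \<in> A" "x \<in> orb \<Gamma> y" using A unfolding orbifold_def by blast
  then obtain \<gamma> where "\<gamma> \<in> \<Gamma>" "x = \<gamma> y" unfolding orb_def by blast
  then show "orb \<Gamma> x \<in> A" using orb_eqI[OF \<Gamma>] y(1) by simp
qed (use orb_self[OF \<Gamma>] in blast)

context coxeter_tetrahedron
begin

lemma det_W: "w \<in> W \<Longrightarrow> det (matrix w) = 1 \<or> det (matrix w) = -1"
proof -
  assume "w \<in> W"
  then obtain xs where xs: "xs \<in> lists {1..4}" "w = word n xs" by (auto simp: W_def)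
  have "det (matrix w) = (-1) ^ length xs"
    unfolding xs(2) using xs(1) unit by (intro det_word) (auto simp: in_lists_conv_set)
  then show ?thesis by (metis neg_one_even_power neg_one_odd_power)
qed

lemma det_compose_W: "v \<in> W \<Longrightarrow> w \<in> W \<Longrightarrow> det (matrix (v \<circ> w)) = det (matrix v) * det (matrix w)"
  using matrix_compose[OF lorentz_linear lorentz_linear, OF lorentz_W lorentz_W, of w v] by (simp add: det_mul)

lemma isometry_pair_W:
  assumes "w \<in> W" "v \<in> W" "v \<circ> w = id" "w \<circ> v = id"
  shows "isometry_pair w v"
  using assms det_W[OF assms(1)] lorentz_W
  by unfold_locales (auto simp: fun_eq_iff)

text \<open>The linear maps that induce the rotation group.\<close>

definition Wp :: "(real^4 \<Rightarrow> real^4) set" where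
  "Wp = {w \<in> W. det (matrix w) = 1}"

lemma Wp_W: "w \<in> Wp \<Longrightarrow> w \<in> W"
  by (simp add: Wp_def)

lemma countable_Wp: "countable Wp"
  using countable_W by (rule countable_subset[rotated]) (auto simp: Wp_def)

lemma form_density_hmap:
  assumes "w \<in> W"
  shows "form_density (pullback (hmap w) vol_form) x = det (matrix w)"
proof -
  note l = lorentz_W[OF assms]
  have tl: "timelike (w (Rep_hyp3 y))" for y using timelike_Rep[of "hmap w y"] by (simp add: Rep_hmap_lorentz l)
  have "lnorm (w (Rep_hyp3 x)) = 1" by (simp add: lnorm_def lorentz_lor[OF l])
  then show ?thesis
    using projective_density(2)[OF lorentz_linear[OF l] tl open_UNIV, of x "hmap w"] tl by simp
qed

lemma rotation_group_hmap: "rotation_group n = hmap ` Wp"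
proof -
  have "orientation_preserving (hmap w) \<longleftrightarrow> w \<in> Wp" if "w \<in> W" for w
    using det_W[OF that] that by (auto simp: orientation_preserving_def form_density_hmap Wp_def)
  then show ?thesis unfolding rotation_group_def reflection_group_hmap by (auto simp: Wp_def)
qed

lemma Wp_inverse:
  assumes "w \<in> Wp"
  obtains v where "v \<in> Wp" "v \<circ> w = id" "w \<circ> v = id"
proof -
  obtain v where v: "v \<in> W" "v \<circ> w = id" "w \<circ> v = id" using W_inverse Wp_W[OF assms] by blast
  have "det (matrix v) * det (matrix w) = det (matrix (v \<circ> w))"
    using v(1) Wp_W[OF assms] by (simp add: det_compose_W)
  also have "\<dots> = 1" unfolding v(2) by (simp add: matrix_id)
  finally have "v \<in> Wp" using assms v(1) by (simp add: Wp_def)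
  then show ?thesis using that v by blast
qed

lemma Wp_compose: "v \<in> Wp \<Longrightarrow> w \<in> Wp \<Longrightarrow> v \<circ> w \<in> Wp"
  by (simp add: Wp_def W_compose det_compose_W)

lemma subgroup_rotation_group: "subgroup (rotation_group n) isom_group"
proof (rule group.subgroupI[OF group_isom_group])
  show sub: "rotation_group n \<subseteq> carrier isom_group"
    using subgroup.subset[OF subgroup_reflection_group] by (auto simp: rotation_group_def)
  have "id \<in> Wp" using id_W by (simp add: Wp_def matrix_id)
  then show "rotation_group n \<noteq> {}" unfolding rotation_group_hmap by blast
  show "inv\<^bsub>isom_group\<^esub> \<gamma> \<in> rotation_group n" if \<gamma>: "\<gamma> \<in> rotation_group n" for \<gamma>
  proof -
    obtain w where w: "w \<in> Wp" "\<gamma> = hmap w" using \<gamma> by (auto simp: rotation_group_hmap)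
    obtain v where v: "v \<in> Wp" "v \<circ> w = id" by (rule Wp_inverse[OF w(1)])
    have "hmap v \<circ> \<gamma> = id"
      using v w lorentz_W[OF Wp_W] by (metis hmap_compose hmap_id)
    then have "inv\<^bsub>isom_group\<^esub> \<gamma> = hmap v"
      using sub \<gamma> v(1) by (intro group.inv_equality[OF group_isom_group])
        (auto simp: isom_group_def rotation_group_hmap)
    then show ?thesis using v(1) by (simp add: rotation_group_hmap)
  qed
  show "\<gamma> \<otimes>\<^bsub>isom_group\<^esub> \<delta> \<in> rotation_group n" if gd: "\<gamma> \<in> rotation_group n" "\<delta> \<in> rotation_group n" for \<gamma> \<delta>
  proof -
    obtain v w where vw: "v \<in> Wp" "w \<in> Wp" "\<gamma> = hmap v" "\<delta> = hmap w"
      using gd by (auto simp: rotation_group_hmap)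
    then have "\<gamma> \<otimes>\<^bsub>isom_group\<^esub> \<delta> = hmap (v \<circ> w)"
      using lorentz_W[OF Wp_W] by (simp add: isom_group_def hmap_compose)
    then show ?thesis using Wp_compose[OF vw(1,2)] by (simp add: rotation_group_hmap)
  qed
qed

subsection \<open>A fundamental domain\<close>

text \<open>The rotation group has the union of the open tetrahedron and its mirror image in one face as
  fundamental domain, up to a null set.\<close>

definition chamber :: "hyp3 set" where
  "chamber = {x. \<forall>i\<in>{1..4}. lor (Rep_hyp3 x) (n i) < 0}"

definition mirror :: "real^4 \<Rightarrow> real^4" where
  "mirror = lrefl (n 1)"

definition dom :: "hyp3 set" where
  "dom = chamber \<union> hmap mirror ` chamber"

lemma mirror: "mirror \<in> W" "det (matrix mirror) = -1" "mirror \<circ> mirror = id"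
  using lrefl_W[of 1] det_lrefl[OF unit[of 1]] lrefl_invol[OF unit[of 1]]
  by (auto simp: mirror_def fun_eq_iff)

lemma isometry_pair_mirror: "isometry_pair mirror mirror"
  by (rule isometry_pair_W) (simp_all add: mirror)

lemma open_chamber: "open chamber"
proof -
  have "chamber = (\<Inter>i\<in>{1..4}. {x. lor (Rep_hyp3 x) (n i) < 0})" by (auto simp: chamber_def)
  then show ?thesis by (auto intro: open_halfspace)
qed

lemma open_dom: "open dom"
  unfolding dom_def using open_chamber isometry_pair.image_open[OF isometry_pair_mirror] by blast

lemma dom_sets: "dom \<in> sets hyp_vol" and chamber_sets: "chamber \<in> sets hyp_vol"
  using open_dom open_chamber by (auto intro: borel_in_hyp_vol)

lemma chamber_free: "w \<in> W \<Longrightarrow> x \<in> chamber \<Longrightarrow> hmap w x \<in> chamber \<Longrightarrow> w = id"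
  by (rule free_on_interior[of w x]) (auto simp: chamber_def in_tetrahedron intro: less_imp_le)

lemma mem_dom: "x \<in> dom \<longleftrightarrow> (\<exists>a\<in>{id, mirror}. \<exists>y\<in>chamber. x = hmap a y)"
  by (auto simp: dom_def hmap_id)

text \<open>After moving both points into the chamber by the mirror if necessary, the element that
  relates them is the identity; the determinant shows that either both have been reflected or none.\<close>

lemma dom_free:
  assumes w: "w \<in> Wp" and "x \<in> dom" "hmap w x \<in> dom"
  shows "w = id"
proof -
  obtain a y where a: "a \<in> {id, mirror}" "y \<in> chamber" "x = hmap a y" using assms(2) mem_dom by blast
  obtain b z where b: "b \<in> {id, mirror}" "z \<in> chamber" "hmap w x = hmap b z" using assms(3) mem_dom by blast
  have W: "a \<in> W" "b \<in> W" "w \<in> W" using a b w id_W mirror(1) Wp_W by auto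
  have bb: "b \<circ> b = id" using b(1) mirror(3) by auto
  have "hmap (b \<circ> w \<circ> a) y = hmap b (hmap w (hmap a y))"
    using W lorentz_W lorentz_compose by (simp add: hmap_compose)
  also have "\<dots> = hmap (b \<circ> b) z"
    using W lorentz_W b(3) a(3) by (simp add: hmap_compose)
  also have "\<dots> = z" by (simp add: bb hmap_id)
  finally have bwa: "b \<circ> w \<circ> a = id"
    using chamber_free[of "b \<circ> w \<circ> a" y] a(2) b(2) W W_compose by auto
  have "det (matrix b) * det (matrix w) * det (matrix a) = det (matrix (b \<circ> w \<circ> a))"
    using W by (simp add: det_compose_W W_compose)
  also have "\<dots> = 1" unfolding bwa by (simp add: matrix_id)
  finally have "det (matrix a) = det (matrix b)"
    using w det_W[OF W(1)] det_W[OF W(2)] by (auto simp: Wp_def)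
  then have "a = b" using a(1) b(1) mirror(2) by (auto simp: matrix_id)
  then have "w = b \<circ> (b \<circ> w \<circ> a) \<circ> a" using bb by (auto simp: fun_eq_iff)
  also have "\<dots> = id" using bwa bb \<open>a = b\<close> by simp
  finally show ?thesis .
qed

text \<open>The points that are missed lie on translates of the four planes of the faces, a countable
  union of null sets.\<close>

lemma dom_covers: "UNIV - (\<Union>w\<in>Wp. hmap w ` dom) \<in> null_sets hyp_vol"
proof (rule null_subset)
  define B where "B = (\<Union>i\<in>{1..4}. {x. lor (Rep_hyp3 x) (n i) = 0})"
  have "n i \<noteq> 0" if "i \<in> {1..4}" for i using unit[OF that] by (auto simp: lor.zero_left)
  then have B: "B \<in> null_sets hyp_vol" unfolding B_def by (intro null_sets_UN') (auto intro: null_plane)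
  show "(\<Union>w\<in>W. hmap w ` B) \<in> null_sets hyp_vol"
  proof (rule null_sets_UN'[OF countable_W])
    fix w assume w: "w \<in> W"
    obtain v where "v \<in> W" "v \<circ> w = id" "w \<circ> v = id" using W_inverse[OF w] by blast
    then show "hmap w ` B \<in> null_sets hyp_vol"
      using isometry_pair.image_null[OF isometry_pair_W B] w by blast
  qed
  show "UNIV - (\<Union>w\<in>Wp. hmap w ` dom) \<subseteq> (\<Union>w\<in>W. hmap w ` B)"
  proof
    fix z assume z: "z \<in> UNIV - (\<Union>w\<in>Wp. hmap w ` dom)"
    obtain w where w: "w \<in> W" "hmap w z \<in> tetrahedron n" by (rule tetrahedron_covers)
    obtain v where v: "v \<in> W" "v \<circ> w = id" "w \<circ> v = id" using W_inverse[OF w(1)] by blast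
    have vz: "hmap v (hmap w z) = z"
      using v w lorentz_W hmap_compose[of v w] by (metis comp_apply hmap_id id_apply)
    show "z \<in> (\<Union>w\<in>W. hmap w ` B)"
    proof (rule ccontr)
      assume "z \<notin> (\<Union>w\<in>W. hmap w ` B)"
      then have "hmap w z \<notin> B" using v(1) vz by (metis UN_I imageI)
      then have ch: "hmap w z \<in> chamber"
        using w(2) by (force simp: B_def chamber_def in_tetrahedron)
      have "\<exists>u\<in>Wp. z \<in> hmap u ` dom"
      proof (cases "det (matrix v) = 1")
        case True
        then have "v \<in> Wp" using v(1) by (simp add: Wp_def)
        then show ?thesis using ch vz by (metis UnI1 dom_def imageI)
      next
        case False
        then have "v \<circ> mirror \<in> Wp"
          using det_W[OF v(1)] v(1) mirror W_compose by (simp add: Wp_def det_compose_W)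
        moreover have "z = hmap (v \<circ> mirror) (hmap mirror (hmap w z))"
        proof -
          have "hmap (v \<circ> mirror) (hmap mirror (hmap w z)) = hmap v (hmap (mirror \<circ> mirror) (hmap w z))"
            using v(1) mirror(1) lorentz_W by (simp add: hmap_compose del: mirror(3))
          then show ?thesis using vz mirror(3) by (simp add: hmap_id)
        qed
        moreover have "hmap mirror (hmap w z) \<in> dom" using ch by (simp add: dom_def)
        ultimately show ?thesis by blast
      qed
      then show False using z by blast
    qed
  qed
qed

subsection \<open>The measure on the orbifold\<close>

lemma inj_on_dom: "inj_on (orb (rotation_group n)) dom"
proof (rule inj_onI)
  fix x y assume xy: "x \<in> dom" "y \<in> dom" "orb (rotation_group n) x = orb (rotation_group n) y"
  then have "y \<in> orb (rotation_group n) x" using orb_self[OF subgroup_rotation_group, of y] by simp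
  then obtain w where w: "w \<in> Wp" "y = hmap w x" by (auto simp: orb_def rotation_group_hmap)
  then have "w = id" using dom_free xy by blast
  then show "x = y" using w(2) by (simp add: hmap_id)
qed

text \<open>A set that meets each orbit at most once can be cut along the translates of the domain, and
  its pieces moved into the domain are disjoint. So up to null sets none is larger than the part of
  the domain over \<open>A\<close>, which is itself such a set.\<close>

theorem emeasure_orbifold_dom:
  assumes A: "A \<subseteq> orbifold (rotation_group n)" "\<Union>A \<in> sets hyp_vol"
  shows "emeasure (orbifold_vol (rotation_group n)) A = emeasure hyp_vol (\<Union>A \<inter> dom)"
proof -
  let ?\<Gamma> = "rotation_group n"
  note sub = subgroup_rotation_group
  have AD: "\<Union>A \<inter> dom \<in> sets hyp_vol" using A(2) dom_sets by blast
  show ?thesis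
    unfolding emeasure_orbifold_vol[OF sub A]
  proof (rule antisym)
    show "emeasure hyp_vol (\<Union>A \<inter> dom)
        \<le> (SUP E\<in>{E \<in> sets hyp_vol. E \<subseteq> \<Union>A \<and> inj_on (orb ?\<Gamma>) E}. emeasure hyp_vol E)"
      using AD inj_on_subset[OF inj_on_dom] by (intro SUP_upper) auto
    show "(SUP E\<in>{E \<in> sets hyp_vol. E \<subseteq> \<Union>A \<and> inj_on (orb ?\<Gamma>) E}. emeasure hyp_vol E)
        \<le> emeasure hyp_vol (\<Union>A \<inter> dom)"
    proof (rule SUP_least)
      fix E assume "E \<in> {E \<in> sets hyp_vol. E \<subseteq> \<Union>A \<and> inj_on (orb ?\<Gamma>) E}"
      then have E: "E \<in> sets hyp_vol" "E \<subseteq> \<Union>A" "inj_on (orb ?\<Gamma>) E" by auto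
      \<comment> \<open>\<open>X w\<close> is the piece of \<open>E\<close> in the translate of the domain by \<open>w\<close>, moved back into the domain.\<close>
      define X where "X w = {x \<in> dom. hmap w x \<in> E}" for w
      have iso: "isometry_pair w v" "isometry_pair v w" if "w \<in> Wp" "v \<in> Wp" "v \<circ> w = id" "w \<circ> v = id" for v w
        using that by (auto intro!: isometry_pair_W Wp_W)
      have X: "X w \<in> sets hyp_vol" "hmap w ` X w \<in> sets hyp_vol"
        "emeasure hyp_vol (hmap w ` X w) = emeasure hyp_vol (X w)" if w: "w \<in> Wp" for w
      proof -
        obtain v where v: "v \<in> Wp" "v \<circ> w = id" "w \<circ> v = id" by (rule Wp_inverse[OF w])
        have "X w = dom \<inter> hmap v ` E"
          using isometry_pair.vimage_eq[OF iso(2)[OF w v], of E] by (auto simp: X_def)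
        then show s: "X w \<in> sets hyp_vol"
          using isometry_pair.image_sets(1)[OF iso(2)[OF w v] E(1)] dom_sets by simp
        show "hmap w ` X w \<in> sets hyp_vol" "emeasure hyp_vol (hmap w ` X w) = emeasure hyp_vol (X w)"
          using isometry_pair.image_sets[OF iso(1)[OF w v] s] by auto
      qed
      have orbE: "orb ?\<Gamma> (hmap w x) = orb ?\<Gamma> x" if "w \<in> Wp" for w x
        using orb_eqI[OF sub, of "hmap w" x] that by (simp add: rotation_group_hmap)
      have same: "v = w" if vw: "v \<in> Wp" "w \<in> Wp" "x \<in> dom" "y \<in> dom" "hmap v x = hmap w y" for v w x y
      proof -
        obtain u where u: "u \<in> Wp" "u \<circ> v = id" "v \<circ> u = id" by (rule Wp_inverse[OF vw(1)])
        have uw: "u \<circ> w \<in> Wp" by (rule Wp_compose[OF u(1) vw(2)])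
        have "hmap (u \<circ> w) y = hmap u (hmap v x)"
          using lorentz_W[OF Wp_W[OF u(1)]] lorentz_W[OF Wp_W[OF vw(2)]] vw(5) by (simp add: hmap_compose)
        also have "\<dots> = hmap (u \<circ> v) x"
          using lorentz_W[OF Wp_W[OF u(1)]] lorentz_W[OF Wp_W[OF vw(1)]] by (simp add: hmap_compose)
        also have "\<dots> = x" by (simp add: u(2) hmap_id)
        finally have "u \<circ> w = id" using dom_free[OF uw vw(4)] vw(3) by simp
        then have "v \<circ> (u \<circ> w) = v" by simp
        then show ?thesis using u(3) by (simp add: comp_assoc[symmetric])
      qed
      have dX: "disjoint_family_on X Wp"
      proof (unfold disjoint_family_on_def, intro ballI impI, rule ccontr)
        fix v w assume vw: "v \<in> Wp" "w \<in> Wp" "v \<noteq> w" and "X v \<inter> X w \<noteq> {}"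
        then obtain x where x: "x \<in> dom" "hmap v x \<in> E" "hmap w x \<in> E" by (auto simp: X_def)
        have "hmap v x = hmap w x" using inj_onD[OF E(3) _ x(2,3)] orbE vw by simp
        then show False using same vw x(1) by blast
      qed
      have dY: "disjoint_family_on (\<lambda>w. hmap w ` X w) Wp"
      proof (unfold disjoint_family_on_def, intro ballI impI, rule ccontr)
        fix v w assume vw: "v \<in> Wp" "w \<in> Wp" "v \<noteq> w" and "hmap v ` X v \<inter> hmap w ` X w \<noteq> {}"
        then obtain x y where "x \<in> dom" "y \<in> dom" "hmap v x = hmap w y" by (auto simp: X_def)
        then show False using same vw by blast
      qed
      have "E \<subseteq> (\<Union>w\<in>Wp. hmap w ` X w) \<union> (UNIV - (\<Union>w\<in>Wp. hmap w ` dom))"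
        by (auto simp: X_def)
      then have "emeasure hyp_vol E \<le> emeasure hyp_vol ((\<Union>w\<in>Wp. hmap w ` X w) \<union> (UNIV - (\<Union>w\<in>Wp. hmap w ` dom)))"
        using X(2) dom_covers countable_Wp by (intro emeasure_mono) (auto intro!: sets.countable_UN')
      also have "\<dots> = emeasure hyp_vol (\<Union>w\<in>Wp. hmap w ` X w)"
        using X(2) countable_Wp by (intro emeasure_Un_null_set dom_covers sets.countable_UN') auto
      also have "\<dots> = (\<integral>\<^sup>+w. emeasure hyp_vol (hmap w ` X w) \<partial>count_space Wp)"
        using X(2) countable_Wp dY by (intro emeasure_UN_countable) auto
      also have "\<dots> = (\<integral>\<^sup>+w. emeasure hyp_vol (X w) \<partial>count_space Wp)"
        by (intro nn_integral_cong) (simp add: X(3))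
      also have "\<dots> = emeasure hyp_vol (\<Union>w\<in>Wp. X w)"
        using X(1) countable_Wp dX by (intro emeasure_UN_countable[symmetric]) auto
      also have "\<dots> \<le> emeasure hyp_vol (\<Union>A \<inter> dom)"
      proof (rule emeasure_mono[OF _ AD])
        show "(\<Union>w\<in>Wp. X w) \<subseteq> \<Union>A \<inter> dom"
        proof
          fix x assume "x \<in> (\<Union>w\<in>Wp. X w)"
          then obtain w where w: "w \<in> Wp" "x \<in> dom" "hmap w x \<in> E" by (auto simp: X_def)
          then have "orb ?\<Gamma> (hmap w x) \<in> A" using E(2) mem_Union_orbits[OF sub A(1)] by blast
          then show "x \<in> \<Union>A \<inter> dom" using orbE[OF w(1)] mem_Union_orbits[OF sub A(1)] w(2) by simp
        qed
      qed
      finally show "emeasure hyp_vol E \<le> emeasure hyp_vol (\<Union>A \<inter> dom)" .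
    qed
  qed
qed

lemma Union_orbifold: "\<Union>(orbifold (rotation_group n)) = UNIV"
  using orb_self[OF subgroup_rotation_group] by (auto simp: orbifold_def)

lemma measurable_orb:
  "orb (rotation_group n) \<in> measurable (restrict_space hyp_vol dom) (orbifold_vol (rotation_group n))"
proof (rule measurableI)
  note sub = subgroup_rotation_group
  show "orb (rotation_group n) x \<in> space (orbifold_vol (rotation_group n))" for x
    by (simp add: space_orbifold_vol[OF sub] orbifold_def)
  fix A assume "A \<in> sets (orbifold_vol (rotation_group n))"
  then have A: "A \<subseteq> orbifold (rotation_group n)" "\<Union>A \<in> sets hyp_vol" by (auto simp: sets_orbifold_vol[OF sub])
  have "orb (rotation_group n) -` A = \<Union>A" using mem_Union_orbits[OF sub A(1)] by blast
  then show "orb (rotation_group n) -` A \<inter> space (restrict_space hyp_vol dom) \<in> sets (restrict_space hyp_vol dom)"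
    using A(2) by (auto simp: space_restrict_space space_hyp_vol sets_restrict_space)
qed

lemma orbifold_vol_distr:
  "orbifold_vol (rotation_group n) =
    distr (restrict_space hyp_vol dom) (orbifold_vol (rotation_group n)) (orb (rotation_group n))"
proof (rule measure_eqI)
  note sub = subgroup_rotation_group
  fix A assume A': "A \<in> sets (orbifold_vol (rotation_group n))"
  then have A: "A \<subseteq> orbifold (rotation_group n)" "\<Union>A \<in> sets hyp_vol" by (auto simp: sets_orbifold_vol[OF sub])
  have v: "orb (rotation_group n) -` A = \<Union>A" using mem_Union_orbits[OF sub A(1)] by blast
  have "emeasure (distr (restrict_space hyp_vol dom) (orbifold_vol (rotation_group n)) (orb (rotation_group n))) A
      = emeasure (restrict_space hyp_vol dom) (\<Union>A \<inter> dom)"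
    unfolding emeasure_distr[OF measurable_orb A'] v by (simp add: space_restrict_space space_hyp_vol)
  also have "\<dots> = emeasure hyp_vol (\<Union>A \<inter> dom)"
    using dom_sets by (intro emeasure_restrict_space) (auto simp: space_hyp_vol)
  finally show "emeasure (orbifold_vol (rotation_group n)) A =
     emeasure (distr (restrict_space hyp_vol dom) (orbifold_vol (rotation_group n)) (orb (rotation_group n))) A"
    using emeasure_orbifold_dom[OF A] by simp
qed simp

lemma orbifold_form:
  assumes c: "form_density \<omega> \<in> borel_measurable hyp_vol"
    and inv: "\<And>w x. w \<in> Wp \<Longrightarrow> form_density \<omega> (hmap w x) = form_density \<omega> x"
  shows "orbifold_form_integrable (rotation_group n) \<omega> \<longleftrightarrow>
      integrable hyp_vol (\<lambda>x. indicator dom x *\<^sub>R form_density \<omega> x)"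
    and "orbifold_form_integral (rotation_group n) \<omega> = (LINT x|hyp_vol. indicator dom x *\<^sub>R form_density \<omega> x)"
proof -
  let ?\<Gamma> = "rotation_group n"
  note sub = subgroup_rotation_group
  have d: "orbifold_density \<omega> (orb ?\<Gamma> x) = form_density \<omega> x" for x
  proof -
    have "form_density \<omega> ` orb ?\<Gamma> x = {form_density \<omega> x}"
      using inv orb_self[OF sub, of x] by (auto simp: orb_def rotation_group_hmap)
    then show ?thesis by (simp add: orbifold_density_def)
  qed
  have m: "orbifold_density \<omega> \<in> borel_measurable (orbifold_vol ?\<Gamma>)"
  proof (rule measurableI)
    fix B :: "real set" assume B: "B \<in> sets borel"
    let ?A = "orbifold_density \<omega> -` B \<inter> space (orbifold_vol ?\<Gamma>)"
    have sA: "?A \<subseteq> orbifold ?\<Gamma>" by (simp add: space_orbifold_vol[OF sub])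
    have "\<Union>?A = form_density \<omega> -` B"
    proof (rule Set.set_eqI)
      fix x
      show "x \<in> \<Union>?A \<longleftrightarrow> x \<in> form_density \<omega> -` B"
        unfolding mem_Union_orbits[OF sub sA] using d[of x] by (simp add: space_orbifold_vol[OF sub] orbifold_def)
    qed
    then show "?A \<in> sets (orbifold_vol ?\<Gamma>)"
      using measurable_sets[OF c B] sA by (simp add: sets_orbifold_vol[OF sub] space_hyp_vol)
  qed simp
  have ds: "dom \<inter> space hyp_vol \<in> sets hyp_vol" using dom_sets by (simp add: space_hyp_vol)
  show "orbifold_form_integrable ?\<Gamma> \<omega> \<longleftrightarrow> integrable hyp_vol (\<lambda>x. indicator dom x *\<^sub>R form_density \<omega> x)"
    unfolding orbifold_form_integrable_def
    by (subst orbifold_vol_distr) (simp add: integrable_distr_eq[OF measurable_orb m] d integrable_restrict_space[OF ds])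
  show "orbifold_form_integral ?\<Gamma> \<omega> = (LINT x|hyp_vol. indicator dom x *\<^sub>R form_density \<omega> x)"
    unfolding orbifold_form_integral_def
    by (subst orbifold_vol_distr) (simp add: integral_distr[OF measurable_orb m] d integral_restrict_space[OF ds])
qed

lemma nn_integral_dom:
  assumes \<phi>: "\<phi> \<in> borel_measurable hyp_vol" and inv: "\<And>x. \<phi> (hmap mirror x) = \<phi> x"
  shows "(\<integral>\<^sup>+x. \<phi> x * indicator dom x \<partial>hyp_vol) = 2 * (\<integral>\<^sup>+x. \<phi> x * indicator chamber x \<partial>hyp_vol)"
proof -
  interpret m: isometry_pair mirror mirror by (rule isometry_pair_mirror)
  let ?C' = "hmap mirror ` chamber"
  have C': "?C' \<in> sets hyp_vol" by (rule m.image_sets(1)[OF chamber_sets])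
  have disj: "chamber \<inter> ?C' = {}"
  proof (rule ccontr)
    assume "chamber \<inter> ?C' \<noteq> {}"
    then obtain y where "y \<in> chamber" "hmap mirror y \<in> chamber" by blast
    then have "mirror = id" using chamber_free mirror(1) by blast
    then show False using mirror(2) by (simp add: matrix_id)
  qed
  have "(\<integral>\<^sup>+x. \<phi> x * indicator dom x \<partial>hyp_vol)
      = (\<integral>\<^sup>+x. \<phi> x * indicator chamber x + \<phi> x * indicator ?C' x \<partial>hyp_vol)"
    using disj by (intro nn_integral_cong) (auto simp: dom_def indicator_def)
  also have "\<dots> = (\<integral>\<^sup>+x. \<phi> x * indicator chamber x \<partial>hyp_vol) + (\<integral>\<^sup>+x. \<phi> x * indicator ?C' x \<partial>hyp_vol)"
    using \<phi> chamber_sets C' by (intro nn_integral_add) auto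
  also have "(\<integral>\<^sup>+x. \<phi> x * indicator ?C' x \<partial>hyp_vol)
      = (\<integral>\<^sup>+x. \<phi> (hmap mirror x) * indicator ?C' (hmap mirror x) \<partial>hyp_vol)"
    using \<phi> C' by (intro m.nn_integral_hmap[symmetric]) auto
  also have "\<dots> = (\<integral>\<^sup>+x. \<phi> x * indicator chamber x \<partial>hyp_vol)"
  proof (intro nn_integral_cong)
    fix x
    have "hmap mirror x \<in> ?C' \<longleftrightarrow> x \<in> chamber" using m.hmap_hg by (metis image_iff)
    then show "\<phi> (hmap mirror x) * indicator ?C' (hmap mirror x) = \<phi> x * indicator chamber x"
      by (simp add: inv indicator_def)
  qed
  finally show ?thesis by (simp add: mult_2)
qed

lemma orbifold_volume: "orbifold_volume (rotation_group n) = 2 * emeasure hyp_vol chamber"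
proof -
  have "orbifold_volume (rotation_group n) = emeasure hyp_vol dom"
    using emeasure_orbifold_dom[OF order.refl] borel_in_hyp_vol[of UNIV]
    by (simp add: orbifold_volume_def Union_orbifold)
  also have "\<dots> = (\<integral>\<^sup>+x. 1 * indicator dom x \<partial>hyp_vol)" using dom_sets by simp
  also have "\<dots> = 2 * (\<integral>\<^sup>+x. 1 * indicator chamber x \<partial>hyp_vol)" by (rule nn_integral_dom) auto
  finally show ?thesis using chamber_sets by simp
qed

end

section \<open>The degree of the contraction\<close>

context tetrahedron_pair
begin

abbreviation density :: "hyp3 \<Rightarrow> real" where
  "density \<equiv> form_density (pullback F vol_form)"

lemma word_derivative:
  assumes xs: "xs \<in> lists {1..4}" and D: "has_hyp_derivative F D x"
  shows "has_hyp_derivative F (\<lambda>u. word m xs (D (word n (rev xs) u))) (hmap (word n xs) x)"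
proof -
  let ?g = "word n xs" and ?h = "word n (rev xs)" and ?g' = "word m xs"
  note rl = rev_lists[OF xs]
  have lg: "lorentz ?g" "lorentz ?h" "lorentz ?g'" using xs rl by (simp_all add: lorentz_word_n lorentz_word_m)
  have bl: "bounded_linear ?h" "bounded_linear ?g'" using linear_word by (simp_all add: linear_conv_bounded_linear)
  let ?X = "Rep_hyp3 (hmap ?g x)"
  have hX: "?h ?X = Rep_hyp3 x"
    using arg_cong[OF hmap_word_rev_n[OF xs, of x], of Rep_hyp3] by (simp add: Rep_hmap_lorentz lg(2))
  have sub: "?h ` hyperboloid \<subseteq> hyperboloid" using lg(2) by (simp add: lorentz_def)
  have d1: "(?h has_derivative ?h) (at ?X within hyperboloid)" by (rule bounded_linear_imp_has_derivative[OF bl(1)])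
  have "((\<lambda>p. Rep_hyp3 (F (Abs_hyp3 p))) has_derivative D) (at (?h ?X) within ?h ` hyperboloid)"
    unfolding hX using D unfolding has_hyp_derivative_def by (rule has_derivative_subset[OF _ sub])
  from has_derivative_in_compose[OF d1 this]
  have "((\<lambda>p. ?g' (Rep_hyp3 (F (Abs_hyp3 (?h p))))) has_derivative (\<lambda>u. ?g' (D (?h u)))) (at ?X within hyperboloid)"
    by (rule bounded_linear.has_derivative[OF bl(2)])
  then show ?thesis
    unfolding has_hyp_derivative_def
  proof (rule has_derivative_transform[rotated 2])
    show "?X \<in> hyperboloid" by (rule Rep_hyp3)
    fix p assume p: "p \<in> hyperboloid"
    define y where "y = Abs_hyp3 p"
    have y: "Rep_hyp3 y = p" using p by (simp add: y_def Abs_hyp3_inverse)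
    have "Abs_hyp3 (?h p) = hmap ?h y"
      using Rep_hyp3_inverse[of "hmap ?h y"] by (simp add: Rep_hmap_lorentz lg(2) y)
    then have "?g' (Rep_hyp3 (F (Abs_hyp3 (?h p)))) = Rep_hyp3 (hmap ?g' (F (hmap ?h y)))"
      by (simp add: Rep_hmap_lorentz lg(3))
    also have "\<dots> = Rep_hyp3 (F (hmap ?g (hmap ?h y)))" by (simp add: F_equivariant[OF xs])
    also have "hmap ?g (hmap ?h y) = y" using hmap_word_rev_n[OF rl, of y] by simp
    finally show "Rep_hyp3 (F (Abs_hyp3 p)) = ?g' (Rep_hyp3 (F (Abs_hyp3 (?h p))))" by (simp add: y_def)
  qed
qed

text \<open>An element of the reflection group and its image have the same determinant, so the density of the
  pulled back volume form is invariant under the whole group.\<close>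

lemma density_word:
  assumes xs: "xs \<in> lists {1..4}"
  shows "density (hmap (word n xs) x) = density x"
proof -
  let ?g = "word n xs" and ?h = "word n (rev xs)" and ?g' = "word m xs"
  note rl = rev_lists[OF xs]
  have lg: "lorentz ?g" "lorentz ?h" "lorentz ?g'" using xs rl by (simp_all add: lorentz_word_n lorentz_word_m)
  show ?thesis
  proof (cases "\<exists>D. has_hyp_derivative F D x")
    case True
    then obtain D where D: "has_hyp_derivative F D x" by blast
    note D' = word_derivative[OF xs D]
    have gh: "?g (?h u) = u" for u using word_rev_cancel'[of xs n] xs S.unit by (auto simp: in_lists_conv_set)
    have dets: "det (matrix ?h) = (-1) ^ length xs" "det (matrix ?g') = (-1) ^ length xs"
      using det_word[of "rev xs" n] det_word[of xs m] xs S.unit T.unit by (auto simp: in_lists_conv_set)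
    show ?thesis
    proof (rule form_density_eqI)
      fix u v w assume t: "u \<in> tangent (hmap ?g x)" "v \<in> tangent (hmap ?g x)" "w \<in> tangent (hmap ?g x)"
      have ht: "?h u \<in> tangent x" if "u \<in> tangent (hmap ?g x)" for u
        using that lorentz_lor[OF lg(1), of "?h u" "Rep_hyp3 x"] by (simp add: tangent_def Rep_hmap_lorentz lg(1) gh)
      have hX: "?h (Rep_hyp3 (hmap ?g x)) = Rep_hyp3 x"
        using arg_cong[OF hmap_word_rev_n[OF xs, of x], of Rep_hyp3] by (simp add: Rep_hmap_lorentz lg(2))
      have "pullback F vol_form (hmap ?g x) u v w
          = vol_form (F (hmap ?g x)) (?g' (D (?h u))) (?g' (D (?h v))) (?g' (D (?h w)))"
        by (rule pullback_eq[OF D' t])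
      also have "\<dots> = det (matrix ?g') * vol_form (F x) (D (?h u)) (D (?h v)) (D (?h w))"
        unfolding vol_form_def F_equivariant[OF xs] Rep_hmap_lorentz[OF lg(3)]
        by (rule det_vector_linear4[OF linear_word])
      also have "vol_form (F x) (D (?h u)) (D (?h v)) (D (?h w)) = pullback F vol_form x (?h u) (?h v) (?h w)"
        by (rule pullback_eq[OF D ht[OF t(1)] ht[OF t(2)] ht[OF t(3)], symmetric])
      also have "\<dots> = density x * vol_form x (?h u) (?h v) (?h w)"
        by (rule form_density_chart(1)[OF D ht[OF t(1)] ht[OF t(2)] ht[OF t(3)]])
      also have "vol_form x (?h u) (?h v) (?h w) = det (matrix ?h) * vol_form (hmap ?g x) u v w"
        unfolding vol_form_def hX[symmetric] by (rule det_vector_linear4[OF linear_word])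
      finally show "pullback F vol_form (hmap ?g x) u v w = density x * vol_form (hmap ?g x) u v w"
        by (simp add: dets flip: power_mult_distrib)
    qed
  next
    case False
    then have "\<not> has_hyp_derivative F D (hmap ?g x)" for D
      using word_derivative[OF rl, of D "hmap ?g x"] hmap_word_rev_n[OF xs, of x] by auto
    then show ?thesis using False by (simp add: form_density_not_differentiable)
  qed
qed

lemma density_W: "w \<in> S.W \<Longrightarrow> density (hmap w x) = density x"
  using density_word by (auto simp: S.W_def)

subsection \<open>Where the density vanishes and where it does not\<close>

text \<open>On the inner part \<open>F\<close> agrees with the projective map, on the outer part it takes values in
  the planes of the faces.\<close>

definition inner_part :: "hyp3 set" where
  "inner_part = {x \<in> S.chamber. \<forall>i\<in>{1..4}. lor (M (Rep_hyp3 x)) (m i) < 0}"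

definition outer_part :: "hyp3 set" where
  "outer_part = {x \<in> S.chamber. \<exists>i\<in>{1..4}. lor (M (Rep_hyp3 x)) (m i) > 0}"

text \<open>The Jacobian of the projective map, see \<open>projective_density\<close>.\<close>

definition proj_density :: "hyp3 \<Rightarrow> real" where
  "proj_density x = det (matrix M) / lnorm (M (Rep_hyp3 x)) ^ 4"

lemma continuous_M [continuous_intros]: "continuous_on A h \<Longrightarrow> continuous_on A (\<lambda>x. M (h x))"
  using linear_M continuous_on_compose2[of UNIV M A h]
  by (simp add: linear_continuous_on linear_conv_bounded_linear)

lemma open_parts: "open inner_part" "open outer_part"
proof -
  have "inner_part = S.chamber \<inter> (\<Inter>i\<in>{1..4}. {x. lor (M (Rep_hyp3 x)) (m i) < 0})"
    by (auto simp: inner_part_def)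
  moreover have "open {x. lor (M (Rep_hyp3 x)) (m i) < 0}" for i
    by (intro open_Collect_less continuous_intros)
  ultimately show "open inner_part" using S.open_chamber by (auto intro!: open_Int open_INT)
  have "outer_part = S.chamber \<inter> (\<Union>i\<in>{1..4}. {x. lor (M (Rep_hyp3 x)) (m i) > 0})"
    by (auto simp: outer_part_def)
  moreover have "open {x. lor (M (Rep_hyp3 x)) (m i) > 0}" for i
    by (intro open_Collect_less continuous_intros)
  ultimately show "open outer_part" using S.open_chamber by (auto intro!: open_Int open_UN)
qed

lemma chamber_tetrahedron: "x \<in> S.chamber \<Longrightarrow> x \<in> tetrahedron n"
  by (auto simp: S.chamber_def S.in_tetrahedron intro: less_imp_le)

lemma hmap_M_sign: "i \<in> {1..4} \<Longrightarrow> lor (Rep_hyp3 (hmap M x)) (m i) = lor (M (Rep_hyp3 x)) (m i) / lnorm (M (Rep_hyp3 x))"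
  by (simp add: hmap_def Rep_hproj[OF timelike_M] lor_scale_left)

lemma inner_part_chamber: "x \<in> inner_part \<Longrightarrow> x \<in> S.chamber"
  by (simp add: inner_part_def)

lemma parts_disjoint: "x \<in> inner_part \<Longrightarrow> x \<notin> outer_part"
  by (force simp: inner_part_def outer_part_def)

text \<open>Near such a point \<open>F\<close> is the projective map, since the nearest point projection fixes the
  target.\<close>

lemma density_inner:
  assumes "x \<in> inner_part"
  shows "density x = proj_density x"
proof -
  let ?U = "{p. (\<forall>i\<in>{1..4}. lor p (n i) < 0) \<and> (\<forall>i\<in>{1..4}. lor (M p) (m i) < 0)}"
  have "?U = (\<Inter>i\<in>{1..4}. {p. lor p (n i) < 0} \<inter> {p. lor (M p) (m i) < 0})" by auto
  moreover have "open ({p. lor p (n i) < 0} \<inter> {p. lor (M p) (m i) < 0})" for i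
    by (intro open_Int open_Collect_less continuous_intros)
  ultimately have U: "open ?U" by auto
  have x: "Rep_hyp3 x \<in> ?U" using assms by (auto simp: inner_part_def S.chamber_def)
  have "F y = hmap M y" if "Rep_hyp3 y \<in> ?U" for y
  proof -
    have "y \<in> tetrahedron n" using that by (auto simp: S.in_tetrahedron intro: less_imp_le)
    moreover have "hmap M y \<in> tetrahedron m"
      using that lnorm_pos[OF timelike_M[of y]]
      by (auto simp: T.in_tetrahedron hmap_M_sign divide_le_0_iff intro: less_imp_le)
    ultimately show ?thesis by (simp add: F_eq_F0 F0_def T.nearest_self)
  qed
  then show ?thesis
    unfolding proj_density_def
    using projective_density(2)[OF linear_M timelike_M U x, of F] timelike_M by simp
qed

text \<open>On the open set where the projective map leaves the target through a given face, the map \<open>F\<close> takes values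
  in the plane of that face, so its derivative is degenerate wherever it exists.\<close>

lemma density_outer:
  assumes "x \<in> outer_part"
  shows "density x = 0"
proof (cases "\<exists>D. has_hyp_derivative F D x")
  case False
  then show ?thesis by (simp add: form_density_not_differentiable)
next
  case True
  then obtain D where D: "has_hyp_derivative F D x" by blast
  obtain i where i: "i \<in> {1..4}" "lor (M (Rep_hyp3 x)) (m i) > 0" "x \<in> S.chamber"
    using assms by (auto simp: outer_part_def)
  define U where "U = S.chamber \<inter> {y. lor (M (Rep_hyp3 y)) (m i) > 0}"
  have "open {y. lor (M (Rep_hyp3 y)) (m i) > 0}" by (intro open_Collect_less continuous_intros)
  then have U: "open U" "x \<in> U" using S.open_chamber i by (auto simp: U_def)
  have plane: "lor (Rep_hyp3 (F y)) (m i) = 0" if "y \<in> U" for y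
    using that i(1) F_eq_F0[OF chamber_tetrahedron] F0_on_face[OF i(1), of y]
    by (auto simp: U_def lor_M)
  let ?p = "pr3 (Rep_hyp3 x)" and ?f = "\<lambda>p. lor (Rep_hyp3 (F (hyp_chart p))) (m i)"
  have oV: "open (hyp_chart -` U)" using open_vimage[OF U(1) continuous_hyp_chart] .
  have pV: "?p \<in> hyp_chart -` U" using U(2) by simp
  have "(?f has_derivative (\<lambda>h. lor (D (dchart ?p h)) (m i))) (at ?p)"
    using bounded_linear.has_derivative[OF lor.bounded_linear_left chart_derivative[OF D]] .
  moreover have "(?f has_derivative (\<lambda>h. 0)) (at ?p)"
    by (rule has_derivative_transform_within_open[OF has_derivative_const oV pV]) (use plane in auto)
  ultimately have eq: "(\<lambda>h. lor (D (dchart ?p h)) (m i)) = (\<lambda>h. 0)" by (rule has_derivative_unique)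
  have Dt: "lor (D u) (m i) = 0" if "u \<in> tangent x" for u
    using fun_cong[OF eq, of "pr3 u"] unfolding tangent_eq_dchart[OF that, symmetric] .
  show ?thesis
  proof (rule form_density_eqI)
    fix u v w assume t: "u \<in> tangent x" "v \<in> tangent x" "w \<in> tangent x"
    let ?A = "vector [D u, D v, D w, Rep_hyp3 (F x)] :: real^4^4"
    define k where "k = (vector [m i $ 1, m i $ 2, m i $ 3, - (m i $ 4)] :: real^4)"
    have k0: "k \<noteq> 0"
    proof
      assume "k = 0"
      then have "k $ 1 = 0" "k $ 2 = 0" "k $ 3 = 0" "k $ 4 = 0" by simp_all
      then show False using T.unit[OF i(1)] by (simp add: k_def lor_def)
    qed
    have "(?A *v k) $ j = lor (?A $ j) (m i)" for j
      by (simp add: matrix_vector_mult_def sum_4 lor_def k_def)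
    then have "?A *v k = 0"
      using Dt t plane[OF U(2)] by (simp add: vec_eq_iff[where 'b = 4] forall_4)
    then have "det ?A = 0"
      using k0 invertible_det_nz[of ?A] matrix_left_invertible_ker[of ?A] invertible_left_inverse[of ?A] by blast
    then show "pullback F vol_form x u v w = 0 * vol_form x u v w"
      by (simp add: pullback_eq[OF D t] vol_form_def)
  qed
qed

text \<open>The remaining points lie on a plane of a face, or on the inverse image of a plane of the
  target under \<open>M\<close>, which is the plane of \<open>k i\<close>.\<close>

lemma parts_cover: "tetrahedron n - (inner_part \<union> outer_part) \<in> null_sets hyp_vol"
proof -
  define k where "k i = n i - eps *\<^sub>R (\<Sum>j\<in>{1..4}. n j)" for i
  have k: "lor w (k i) = lor (M w) (m i)" if "i \<in> {1..4}" for w i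
    by (simp add: k_def lor_simps lor.sum_right lor_M[OF that])
  have k0: "k i \<noteq> 0" if i: "i \<in> {1..4}" for i
  proof -
    have "lor (S.P i) (k i) = -1 - eps * (\<Sum>j\<in>{1..4}. lor (S.P i) (n j))"
      by (simp add: k_def lor_simps lor.sum_right S.P_n[OF i i])
    also have "(\<Sum>j\<in>{1..4}. lor (S.P i) (n j)) = (\<Sum>j\<in>{1..4}. if i = j then -1 else 0)"
      using i by (intro sum.cong) (auto simp: S.P_n)
    also have "\<dots> = -1" using i by simp
    finally have "lor (S.P i) (k i) = eps - 1" by simp
    then show ?thesis using eps by (auto simp: lor.zero_right)
  qed
  have n0: "n i \<noteq> 0" if "i \<in> {1..4}" for i using S.unit[OF that] by (auto simp: lor.zero_left)
  define B where "B = (\<Union>i\<in>{1..4}. {x. lor (Rep_hyp3 x) (n i) = 0} \<union> {x. lor (Rep_hyp3 x) (k i) = 0})"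
  have "B \<in> null_sets hyp_vol"
    unfolding B_def using k0 n0 by (intro null_sets_UN' null_sets.Un null_plane) auto
  moreover have "tetrahedron n - (inner_part \<union> outer_part) \<subseteq> B"
  proof
    fix x assume x: "x \<in> tetrahedron n - (inner_part \<union> outer_part)"
    show "x \<in> B"
    proof (rule ccontr)
      assume nB: "x \<notin> B"
      then have ch: "x \<in> S.chamber"
        using x by (force simp: B_def S.chamber_def S.in_tetrahedron)
      have "lor (M (Rep_hyp3 x)) (m i) < 0" if "i \<in> {1..4}" for i
      proof -
        have "lor (Rep_hyp3 x) (k i) \<noteq> 0" using nB that by (auto simp: B_def)
        then have "lor (M (Rep_hyp3 x)) (m i) \<noteq> 0" unfolding k[OF that] .
        moreover have "\<not> lor (M (Rep_hyp3 x)) (m i) > 0" using x ch that by (auto simp: outer_part_def)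
        ultimately show ?thesis by linarith
      qed
      then show False using x ch by (auto simp: inner_part_def)
    qed
  qed
  ultimately show ?thesis by (rule null_subset)
qed

lemma proj_density_measurable: "proj_density \<in> borel_measurable borel"
proof -
  have "(\<lambda>x. lnorm (M (Rep_hyp3 x))) \<in> borel_measurable borel"
    unfolding lnorm_def by (intro borel_measurable_continuous_onI continuous_intros)
  then show ?thesis unfolding proj_density_def by measurable
qed

text \<open>Up to a null set, the translates of the inner and the outer part cover hyperbolic space, and
  on each of these open sets the density is known.\<close>

lemma density_measurable: "density \<in> borel_measurable hyp_vol"
proof (rule measurableI)
  fix B :: "real set" assume B: "B \<in> sets borel"
  define Z where "Z = {x \<in> inner_part. proj_density x \<in> B} \<union> (if 0 \<in> B then outer_part else {})"
  have Z: "Z \<in> sets borel"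
  proof -
    have "{x \<in> inner_part. proj_density x \<in> B} = inner_part \<inter> (proj_density -` B \<inter> space borel)" by auto
    also have "\<dots> \<in> sets borel"
      using open_parts(1) measurable_sets[OF proj_density_measurable B] by (intro sets.Int) auto
    finally show ?thesis using open_parts(2) by (auto simp: Z_def)
  qed
  have ZB: "x \<in> Z \<longleftrightarrow> density x \<in> B" if "x \<in> inner_part \<union> outer_part" for x
    using that density_inner[of x] density_outer[of x] parts_disjoint[of x] by (auto simp: Z_def)
  define N where "N = (\<Union>w\<in>S.W. hmap w ` (tetrahedron n - (inner_part \<union> outer_part)))"
  have iso: "\<exists>v. isometry_pair w v" if "w \<in> S.W" for w
    using S.W_inverse[OF that] S.isometry_pair_W[OF that] by blast
  have N: "N \<in> null_sets hyp_vol"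
    unfolding N_def using iso isometry_pair.image_null[OF _ parts_cover]
    by (intro null_sets_UN' S.countable_W) blast
  have UZ: "(\<Union>w\<in>S.W. hmap w ` Z) \<in> sets hyp_vol"
    using iso isometry_pair.image_sets(1)[OF _ borel_in_hyp_vol[OF Z]] S.countable_W
    by (intro sets.countable_UN') blast+
  have sub: "(\<Union>w\<in>S.W. hmap w ` Z) \<subseteq> density -` B"
  proof
    fix z assume "z \<in> (\<Union>w\<in>S.W. hmap w ` Z)"
    then obtain w x where w: "w \<in> S.W" "x \<in> Z" "z = hmap w x" by blast
    then have "density x \<in> B" using ZB[of x] by (auto simp: Z_def split: if_splits)
    then show "z \<in> density -` B" using w density_W[OF w(1), of x] by simp
  qed
  have "density -` B \<subseteq> (\<Union>w\<in>S.W. hmap w ` Z) \<union> N"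
  proof
    fix z assume z: "z \<in> density -` B"
    obtain xs x where xs: "xs \<in> lists {1..4}" "x \<in> tetrahedron n" "z = hmap (word n xs) x" using chamber_ex by blast
    have dx: "density x \<in> B" using z xs density_word by simp
    show "z \<in> (\<Union>w\<in>S.W. hmap w ` Z) \<union> N"
    proof (cases "x \<in> inner_part \<union> outer_part")
      case True
      then have "x \<in> Z" using dx ZB by blast
      then show ?thesis using xs(3) S.W_word[OF xs(1)] by blast
    next
      case False
      then have "z \<in> N" unfolding N_def using xs(2,3) S.W_word[OF xs(1)] by blast
      then show ?thesis by blast
    qed
  qed
  then have "density -` B = (\<Union>w\<in>S.W. hmap w ` Z) \<union> (density -` B \<inter> N)" using sub by blast
  moreover have "density -` B \<inter> N \<in> sets hyp_vol" using null_subset[OF N, of "density -` B \<inter> N"] by auto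
  ultimately have "density -` B \<in> sets hyp_vol" using UZ by (metis sets.Un)
  then show "density -` B \<inter> space hyp_vol \<in> sets hyp_vol" by (simp add: space_hyp_vol)
qed simp

text \<open>Onto: the coordinates \<open>u\<close> of a point with respect to the target vertices arise from the
  coordinates \<open>s\<close>, obtained by inverting the matrix \<open>I - eps J\<close>, where \<open>J\<close> has all entries 1; the
  inverse has positive entries.\<close>

lemma image_inner: "hmap M ` inner_part = T.chamber"
proof
  show "hmap M ` inner_part \<subseteq> T.chamber"
    using lnorm_pos[OF timelike_M] by (auto simp: inner_part_def T.chamber_def hmap_M_sign divide_less_0_iff)
  show "T.chamber \<subseteq> hmap M ` inner_part"
  proof
    fix z assume z: "z \<in> T.chamber"
    define u where "u i = - lor (Rep_hyp3 z) (m i)" for i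
    have u: "u i > 0" if "i \<in> {1..4}" for i using z that by (simp add: u_def T.chamber_def)
    define s where "s i = u i + eps / (1 - 4 * eps) * sum u {1..4}" for i
    have s: "s i > 0" if "i \<in> {1..4}" for i
    proof -
      have "sum u {1..4} \<ge> 0" using u by (intro sum_nonneg) (auto intro: less_imp_le)
      then have "eps / (1 - 4 * eps) * sum u {1..4} \<ge> 0" using eps by (intro mult_nonneg_nonneg) auto
      then show ?thesis using u[OF that] by (simp add: s_def)
    qed
    define y where "y = (\<Sum>i\<in>{1..4}. s i *\<^sub>R S.P i)"
    have yn: "lor y (n i) = - s i" if "i \<in> {1..4}" for i
    proof -
      have "lor y (n i) = (\<Sum>k\<in>{1..4}. if k = i then - s k else 0)"
        unfolding y_def lor.sum_left using that by (intro sum.cong) (auto simp: lor_scale_left S.P_n)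
      also have "\<dots> = - s i" using that by simp
      finally show ?thesis .
    qed
    have cy: "causal y" unfolding y_def using s by (intro S.combination_causal[of s 1]) (auto intro: less_imp_le)
    have "lor y (S.P 1) < 0"
    proof -
      have "lor y (S.P 1) = (\<Sum>k\<in>{1..4}. s k * lor (S.P k) (S.P 1))"
        by (simp add: y_def lor.sum_left lor_scale_left)
      also have "\<dots> < 0"
      proof (rule sum_strict_mono_ex1[where g = "\<lambda>_. 0", simplified])
        show "\<forall>k\<in>{1..4}. s k * lor (S.P k) (S.P 1) \<le> 0"
          using s causal_lor_le[OF S.P_causal S.P_causal] by (fastforce intro!: mult_nonneg_nonpos intro: less_imp_le)
        show "\<exists>k\<in>{1..4}. s k * lor (S.P k) (S.P 1) < 0"
          using s[of 2] S.P_P_neg[of 2 1] by (intro bexI[of _ 2]) (auto intro: mult_pos_neg)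
      qed simp
      finally show ?thesis .
    qed
    have "lor y y < 0"
    proof -
      have "lor y y = (\<Sum>k\<in>{1..4}. s k * lor (S.P k) y)"
        by (subst (1) y_def) (simp add: lor.sum_left lor_scale_left)
      also have "\<dots> < 0"
      proof (rule sum_strict_mono_ex1[where g = "\<lambda>_. 0", simplified])
        show "\<forall>k\<in>{1..4}. s k * lor (S.P k) y \<le> 0"
          using s causal_lor_le[OF S.P_causal cy] by (fastforce intro!: mult_nonneg_nonpos intro: less_imp_le)
        show "\<exists>k\<in>{1..4}. s k * lor (S.P k) y < 0"
          using s[of 1] \<open>lor y (S.P 1) < 0\<close> by (intro bexI[of _ 1]) (auto simp: lor_commute[of y] intro: mult_pos_neg)
      qed simp
      finally show ?thesis .
    qed
    then have tl: "timelike y" using cy by (simp add: timelike_def causal_def)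
    have My: "M y = Rep_hyp3 z"
    proof (rule T.eqI_n)
      fix i :: nat assume i: "i \<in> {1..4}"
      have ss: "sum s {1..4} = sum u {1..4} / (1 - 4 * eps)"
      proof -
        have "sum s {1..4} = sum u {1..4} + 4 * (eps / (1 - 4 * eps) * sum u {1..4})"
          by (simp add: s_def sum.distrib)
        then show ?thesis using eps by (simp add: field_simps)
      qed
      have "(\<Sum>k\<in>{1..4}. lor y (n k)) = - sum s {1..4}" by (simp add: yn sum_negf)
      then have "lor (M y) (m i) = - s i + eps * sum s {1..4}" using i by (simp add: lor_M yn)
      also have "\<dots> = - u i" unfolding ss by (simp add: s_def)
      finally show "lor (M y) (m i) = lor (Rep_hyp3 z) (m i)" by (simp add: u_def)
    qed
    define x where "x = hproj y"
    have x: "Rep_hyp3 x = (1 / lnorm y) *\<^sub>R y" by (simp add: x_def Rep_hproj[OF tl])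
    have ln: "lnorm y > 0" by (rule lnorm_pos[OF tl])
    have Mx': "M ((1 / lnorm y) *\<^sub>R y) = (1 / lnorm y) *\<^sub>R Rep_hyp3 z" by (simp add: linear_scale[OF linear_M] My)
    have Mx: "M (Rep_hyp3 x) = (1 / lnorm y) *\<^sub>R Rep_hyp3 z" by (simp add: x linear_scale[OF linear_M] My)
    have "hmap M x = z" using ln by (simp add: hmap_def Mx hproj_scale timelike_Rep)
    moreover have "x \<in> inner_part"
      using ln s z by (auto simp: inner_part_def S.chamber_def Mx' x lor_scale_left yn T.chamber_def divide_neg_pos)
    ultimately show "z \<in> hmap M ` inner_part" by blast
  qed
qed

end

locale oriented_tetrahedron_pair = tetrahedron_pair +
  assumes orientation: "det (vector [n 1, n 2, n 3, n 4] :: real^4^4) * det (vector [m 1, m 2, m 3, m 4] :: real^4^4) > 0"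
begin

text \<open>In terms of the products with the normals, \<open>M\<close> is the matrix \<open>I - eps J\<close>, where \<open>J\<close> has all
  entries 1; its determinant \<open>1 - 4 eps\<close> is positive.\<close>

lemma det_M_pos: "det (matrix M) > 0"
proof -
  define eta where "eta x = (vector [x$1, x$2, x$3, - (x$4)] :: real^4)" for x :: "real^4"
  have lin: "linear eta" by (auto simp: linear_iff eta_def vec_eq_iff forall_4)
  have deta: "det (matrix eta) = -1"
    unfolding det_4 by (simp add: matrix_def eta_def axis_def)
  define A B S' where "A = (vector [eta (n 1), eta (n 2), eta (n 3), eta (n 4)] :: real^4^4)"
    and "B = (vector [eta (m 1), eta (m 2), eta (m 3), eta (m 4)] :: real^4^4)"
    and "S' = (\<chi> i j. (if i = j then 1 else 0) - eps :: real^4^4)"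
  have Ay: "A *v y = vector [lor y (n 1), lor y (n 2), lor y (n 3), lor y (n 4)]"
    and By: "B *v y = vector [lor y (m 1), lor y (m 2), lor y (m 3), lor y (m 4)]" for y
    by (simp_all add: A_def B_def vec_eq_iff[where 'b = 4] forall_4 matrix_vector_mult_def sum_4 eta_def lor_def mult.commute)
  have "(B ** matrix M) *v y = (S' ** A) *v y" for y
  proof -
    have "(B ** matrix M) *v y = B *v M y"
      using linear_M by (simp add: matrix_works flip: matrix_vector_mul_assoc)
    also have "\<dots> = S' *v (A *v y)"
      unfolding Ay By
      by (simp add: vec_eq_iff[where 'b = 4] forall_4 matrix_vector_mult_def sum_4 S'_def lor_M sum_one_to_four algebra_simps)
    finally show ?thesis by (simp add: matrix_vector_mul_assoc)
  qed
  then have eq: "B ** matrix M = S' ** A" by (simp add: matrix_eq)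
  have detS: "det S' = 1 - 4 * eps"
    unfolding det_4 by (simp add: S'_def) (simp add: algebra_simps)
  define a b where "a = det (vector [n 1, n 2, n 3, n 4] :: real^4^4)" and "b = det (vector [m 1, m 2, m 3, m 4] :: real^4^4)"
  have "det B * det (matrix M) = det S' * det A" using arg_cong[OF eq, of det] by (simp add: det_mul)
  then have "b * det (matrix M) = (1 - 4 * eps) * a"
    unfolding A_def B_def detS det_vector_linear4[OF lin] deta a_def b_def by simp
  then have "b * (b * det (matrix M)) = b * ((1 - 4 * eps) * a)" by simp
  then have "b\<^sup>2 * det (matrix M) = (1 - 4 * eps) * (a * b)" by (simp add: power2_eq_square mult_ac)
  moreover have "(1 - 4 * eps) * (a * b) > 0" using eps orientation by (simp add: a_def b_def)
  ultimately have "b\<^sup>2 * det (matrix M) > 0" by simp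
  then show ?thesis by (metis zero_less_mult_pos zero_le_power2 zero_less_mult_iff linorder_not_less)
qed

lemma density_nonneg_chamber: "AE x in hyp_vol. x \<in> S.chamber \<longrightarrow> density x = proj_density x * indicator inner_part x"
proof (rule AE_I'[OF parts_cover])
  show "{x \<in> space hyp_vol. \<not> (x \<in> S.chamber \<longrightarrow> density x = proj_density x * indicator inner_part x)}
      \<subseteq> tetrahedron n - (inner_part \<union> outer_part)"
    using density_inner density_outer chamber_tetrahedron parts_disjoint by (auto simp: indicator_def)
qed

lemma proj_density_nonneg: "proj_density x \<ge> 0"
  using det_M_pos lnorm_pos[OF timelike_M[of x]] by (simp add: proj_density_def)

lemma finite_volume_target: "emeasure hyp_vol T.chamber < \<infinity>"
proof -
  have "T.chamber \<subseteq> tetrahedron m" by (force simp: T.chamber_def T.in_tetrahedron)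
  then have "emeasure hyp_vol T.chamber \<le> emeasure hyp_vol (tetrahedron m)"
    using T.closed_tetrahedron by (intro emeasure_mono borel_in_hyp_vol) auto
  also have "\<dots> < \<infinity>" by (rule emeasure_hyp_vol_compact[OF T.compact_tetrahedron])
  finally show ?thesis .
qed

text \<open>Both integrals reduce to the tetrahedron; there the density is the Jacobian of the
  projective map on the inner part and 0 on the outer part.\<close>

lemma nn_integral_density:
  "(\<integral>\<^sup>+x. ennreal (density x) * indicator S.dom x \<partial>hyp_vol) = 2 * emeasure hyp_vol T.chamber"
  "(\<integral>\<^sup>+x. ennreal (- density x) * indicator S.dom x \<partial>hyp_vol) = 0"
proof -
  note dm = density_measurable
  have inv: "density (hmap S.mirror x) = density x" for x by (rule density_W[OF S.mirror(1)])
  have "(\<integral>\<^sup>+x. ennreal (density x) * indicator S.dom x \<partial>hyp_vol)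
      = 2 * (\<integral>\<^sup>+x. ennreal (density x) * indicator S.chamber x \<partial>hyp_vol)"
    using dm inv by (intro S.nn_integral_dom) auto
  also have "(\<integral>\<^sup>+x. ennreal (density x) * indicator S.chamber x \<partial>hyp_vol)
      = (\<integral>\<^sup>+x. ennreal (proj_density x) * indicator inner_part x \<partial>hyp_vol)"
    using density_nonneg_chamber
    by (intro nn_integral_cong_AE) (auto elim!: eventually_mono simp: indicator_def split: if_splits dest: inner_part_chamber)
  also have "\<dots> = emeasure hyp_vol (hmap M ` inner_part)"
    using open_parts(1) T.open_chamber det_M_pos
    by (subst hyp_vol_hmap_image[OF linear_M]) (auto simp: image_inner proj_density_def timelike_M)
  finally show "(\<integral>\<^sup>+x. ennreal (density x) * indicator S.dom x \<partial>hyp_vol) = 2 * emeasure hyp_vol T.chamber"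
    unfolding image_inner .
  have "(\<integral>\<^sup>+x. ennreal (- density x) * indicator S.dom x \<partial>hyp_vol)
      = 2 * (\<integral>\<^sup>+x. ennreal (- density x) * indicator S.chamber x \<partial>hyp_vol)"
    using dm inv by (intro S.nn_integral_dom) auto
  also have "(\<integral>\<^sup>+x. ennreal (- density x) * indicator S.chamber x \<partial>hyp_vol) = (\<integral>\<^sup>+(x::hyp3). 0 \<partial>hyp_vol)"
    using density_nonneg_chamber
    by (intro nn_integral_cong_AE) (auto elim!: eventually_mono simp: indicator_def ennreal_neg proj_density_nonneg)
  finally show "(\<integral>\<^sup>+x. ennreal (- density x) * indicator S.dom x \<partial>hyp_vol) = 0" by simp
qed

theorem degree_one:
  "orbifold_form_integrable (rotation_group n) (pullback F vol_form)"
  "ereal (orbifold_form_integral (rotation_group n) (pullback F vol_form))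
     = enn2ereal (orbifold_volume (rotation_group m))"
proof -
  let ?f = "\<lambda>x. indicator S.dom x *\<^sub>R density x"
  have p: "(\<integral>\<^sup>+x. ennreal (?f x) \<partial>hyp_vol) = 2 * emeasure hyp_vol T.chamber"
    unfolding nn_integral_density(1)[symmetric] by (intro nn_integral_cong) (simp add: indicator_def)
  have q: "(\<integral>\<^sup>+x. ennreal (- ?f x) \<partial>hyp_vol) = 0"
    unfolding nn_integral_density(2)[symmetric] by (intro nn_integral_cong) (simp add: indicator_def)
  have fin: "2 * emeasure hyp_vol T.chamber < \<infinity>"
    using finite_volume_target by (simp add: ennreal_mult_less_top)
  have m: "?f \<in> borel_measurable hyp_vol" using density_measurable S.dom_sets by measurable
  have int: "integrable hyp_vol ?f"
    unfolding real_integrable_def using m p q fin by auto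
  have inv: "density (hmap w x) = density x" if "w \<in> S.Wp" for w x
    using density_W S.Wp_W[OF that] by blast
  show "orbifold_form_integrable (rotation_group n) (pullback F vol_form)"
    using S.orbifold_form(1)[OF density_measurable inv] int by simp
  have "orbifold_form_integral (rotation_group n) (pullback F vol_form) = integral\<^sup>L hyp_vol ?f"
    using S.orbifold_form(2)[OF density_measurable inv] by simp
  also have "\<dots> = enn2real (2 * emeasure hyp_vol T.chamber)"
    unfolding real_lebesgue_integral_def[OF int] p q by simp
  finally have "ereal (orbifold_form_integral (rotation_group n) (pullback F vol_form))
      = enn2ereal (ennreal (enn2real (2 * emeasure hyp_vol T.chamber)))"
    by (simp add: enn2ereal_ennreal)
  also have "ennreal (enn2real (2 * emeasure hyp_vol T.chamber)) = orbifold_volume (rotation_group m)"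
    using fin by (simp add: T.orbifold_volume ennreal_enn2real)
  finally show "ereal (orbifold_form_integral (rotation_group n) (pullback F vol_form))
     = enn2ereal (orbifold_volume (rotation_group m))" .
qed

end

section \<open>Gram matrices of tetrahedra\<close>

text \<open>Two faces of a tetrahedron meet along an edge, whose midpoint is a point of hyperbolic space orthogonal
  to both normals.  Hence the plane spanned by the normals is spacelike.\<close>

lemma lor_normals_le_one:
  assumes tet: "is_tetrahedron n" and ik: "i \<in> {1..4}" "k \<in> {1..4}" "i \<noteq> k"
  shows "\<bar>lor (n i) (n k)\<bar> \<le> 1"
proof -
  obtain p where p: "\<forall>i\<in>{1..4}. causal (p i) \<and> lor (p i) (n i) < 0 \<and> (\<forall>k\<in>{1..4} - {i}. lor (p i) (n k) = 0)"
    and unit: "lor (n i) (n i) = 1" "lor (n k) (n k) = 1"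
    using tet ik unfolding is_tetrahedron_def causal_def by blast
  have "card ({1..4} - {i, k}) = 2" using ik by (simp add: card_Diff_subset)
  then obtain j l where "{1..4} - {i, k} = {j, l}" "j \<noteq> l" unfolding card_2_iff by blast
  then have jl: "j \<in> {1..4}" "l \<in> {1..4}" "j \<noteq> l" "j \<notin> {i, k}" "l \<notin> {i, k}" by blast+
  have c: "causal (p j)" "causal (p l)" using p jl by blast+
  have "lor (p j) (p l) \<noteq> 0"
  proof
    assume "lor (p j) (p l) = 0"
    then have eq: "p l $ 4 *\<^sub>R p j = p j $ 4 *\<^sub>R p l" by (rule causal_orthogonal_imp_parallel[OF c])
    have "p l $ 4 * lor (p j) (n j) = p j $ 4 * lor (p l) (n j)"
      using arg_cong[OF eq, of "\<lambda>x. lor x (n j)"] by (simp add: lor_scale_left)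
    moreover have "lor (p l) (n j) = 0" "lor (p j) (n j) < 0" "p l $ 4 > 0" using p jl by (auto simp: causal_def)
    ultimately show False by simp
  qed
  then have "lor (p j) (p l) < 0" using causal_lor_le[OF c] by simp
  then have "lor (p j + p l) (p j + p l) < 0"
    using c by (simp add: lor_simps causal_def lor_commute[of "p l" "p j"])
  then have tl: "timelike (p j + p l)" using causal_add[OF c] by (simp add: timelike_def causal_def)
  have o: "lor (p j) (n i) = 0" "lor (p j) (n k) = 0" "lor (p l) (n i) = 0" "lor (p l) (n k) = 0"
    using p jl ik by blast+
  have "(lor (n i) (n k))\<^sup>2 \<le> lor (n i) (n i) * lor (n k) (n k)"
    by (rule lor_cauchy_schwarz[OF timelike_normalise[OF tl]]) (simp_all add: lor_simps o lor_commute[of "n _"])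
  then show ?thesis using unit by (simp add: abs_square_le_1)
qed

lemma lor_of_dihedral_angle:
  assumes "is_tetrahedron n" "i \<in> {1..4}" "k \<in> {1..4}" "i \<noteq> k" "dihedral_angle n i k = \<theta>"
  shows "lor (n i) (n k) = - cos \<theta>"
proof -
  have "lor (n i) (n k) = cos (arccos (lor (n i) (n k)))"
    using lor_normals_le_one[OF assms(1-4)] by (simp add: cos_arccos abs_le_iff)
  also have "arccos (lor (n i) (n k)) = pi - \<theta>" using assms(5) by (simp add: dihedral_angle_def)
  finally show ?thesis by simp
qed

text \<open>Comparing unordered pairs of indices makes the exponents symmetric.\<close>

definition angle_order :: "nat \<Rightarrow> nat \<Rightarrow> nat \<Rightarrow> nat" where
  "angle_order j i k =
     (if {i, k} = {1, 2} then 5 else if {i, k} \<in> {{1, 4}, {2, 3}} then 2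
      else if {i, k} = {3, 4} then j else 3)"

lemma family_coxeter:
  assumes "tetrahedron_family N" and j: "j \<in> {2..6}"
  shows "coxeter_tetrahedron (N j) (angle_order j)"
proof
  have tet: "is_tetrahedron (N j)" and ang: "dihedral_angle (N j) 1 4 = pi / 2" "dihedral_angle (N j) 2 4 = pi / 3"
    "dihedral_angle (N j) 3 4 = pi / real j" "dihedral_angle (N j) 2 3 = pi / 2"
    "dihedral_angle (N j) 1 3 = pi / 3" "dihedral_angle (N j) 1 2 = pi / 5"
    using assms unfolding tetrahedron_family_def by blast+
  show "is_tetrahedron (N j)" by (rule tet)
  show "lor (N j i) (N j i) = 1" if "i \<in> {1..4}" for i using tet that by (simp add: is_tetrahedron_def)
  have sym: "dihedral_angle (N j) i k = dihedral_angle (N j) k i" for i k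
    by (simp add: dihedral_angle_def lor_commute)
  define Q where "Q i k \<longleftrightarrow> dihedral_angle (N j) i k = pi / real (angle_order j i k) \<and> angle_order j i k \<ge> 2" for i k
  have "Q k i = Q i k" for i k by (simp add: Q_def sym[of k] angle_order_def insert_commute)
  moreover have "Q 1 2" "Q 1 3" "Q 1 4" "Q 2 3" "Q 2 4" "Q 3 4"
    using j by (simp_all add: Q_def ang angle_order_def doubleton_eq_iff)
  ultimately have Q: "Q 1 2" "Q 1 3" "Q 1 4" "Q 2 3" "Q 2 4" "Q 3 4" "Q 2 1" "Q 3 1" "Q 4 1" "Q 3 2" "Q 4 2" "Q 4 3"
    by blast+
  fix i k :: nat assume ik: "i \<in> {1..4}" "k \<in> {1..4}" "i \<noteq> k"
  have "Q i k" using ik(1,2)[unfolded one_to_four] ik(3) by (elim insertE emptyE) (simp_all add: Q)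
  then have "dihedral_angle (N j) i k = pi / real (angle_order j i k) \<and> angle_order j i k \<ge> 2" by (simp add: Q_def)
  then show "lor (N j i) (N j k) = - cos (pi / real (angle_order j i k))" "angle_order j i k \<ge> 2"
    using lor_of_dihedral_angle[OF tet ik] by auto
qed

text \<open>The vertex opposite to a face is, up to a factor, the component of the normal of that face orthogonal to
  the other three normals.  Cramer's rule gives the component, and hence the Lorentz square of the vertex in
  terms of the angles.\<close>

lemma (in coxeter_tetrahedron) vertex_gram:
  assumes ijkl: "i \<in> {1..4}" "j \<in> {1..4}" "k \<in> {1..4}" "l \<in> {1..4}" "distinct [i, j, k, l]"
  defines "r \<equiv> lor (n i) (n j)" and "s \<equiv> lor (n i) (n k)" and "t \<equiv> lor (n i) (n l)"
    and "x \<equiv> lor (n j) (n k)" and "y \<equiv> lor (n j) (n l)" and "z \<equiv> lor (n k) (n l)"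
  shows "lor (P i) (P i) *
      (r * ((1 - z\<^sup>2) * r + (y * z - x) * s + (x * z - y) * t)
       + s * ((y * z - x) * r + (1 - y\<^sup>2) * s + (x * y - z) * t)
       + t * ((x * z - y) * r + (x * y - z) * s + (1 - x\<^sup>2) * t)
       - (1 + 2 * x * y * z - x\<^sup>2 - y\<^sup>2 - z\<^sup>2)) = - (1 + 2 * x * y * z - x\<^sup>2 - y\<^sup>2 - z\<^sup>2)"
proof -
  define \<delta> where "\<delta> = 1 + 2 * x * y * z - x\<^sup>2 - y\<^sup>2 - z\<^sup>2"
  define a b c where "a = (1 - z\<^sup>2) * r + (y * z - x) * s + (x * z - y) * t"
    and "b = (y * z - x) * r + (1 - y\<^sup>2) * s + (x * y - z) * t"
    and "c = (x * z - y) * r + (x * y - z) * s + (1 - x\<^sup>2) * t"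
  define v where "v = \<delta> *\<^sub>R n i - a *\<^sub>R n j - b *\<^sub>R n k - c *\<^sub>R n l"
  define q where "q = \<delta> - (r * a + s * b + t * c)"
  have g: "lor (n i) (n j) = r" "lor (n j) (n i) = r" "lor (n i) (n k) = s" "lor (n k) (n i) = s"
    "lor (n i) (n l) = t" "lor (n l) (n i) = t" "lor (n j) (n k) = x" "lor (n k) (n j) = x"
    "lor (n j) (n l) = y" "lor (n l) (n j) = y" "lor (n k) (n l) = z" "lor (n l) (n k) = z"
    by (simp_all add: r_def s_def t_def x_def y_def z_def lor_commute)
  note u = unit[OF ijkl(1)] unit[OF ijkl(2)] unit[OF ijkl(3)] unit[OF ijkl(4)]
  have cover: "h \<in> {i, j, k, l}" if "h \<in> {1..4}" for h
  proof -
    have "card {i, j, k, l} = card {1..4::nat}" using ijkl(5) by simp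
    then have "{i, j, k, l} = {1..4}" using ijkl(1-4) by (intro card_subset_eq) auto
    then show ?thesis using that by blast
  qed
  have v: "lor v (n i) = q" "lor v (n j) = 0" "lor v (n k) = 0" "lor v (n l) = 0"
    unfolding v_def q_def lor_simps g u a_def b_def c_def \<delta>_def by algebra+
  have "v = (- q) *\<^sub>R P i"
  proof (rule eqI_n)
    fix h :: nat assume h: "h \<in> {1..4}"
    show "lor v (n h) = lor ((- q) *\<^sub>R P i) (n h)"
      using cover[OF h] v P_n[OF ijkl(1) h] ijkl(5) unfolding lor_scale_left by auto
  qed
  then have "lor (P i) v = - q * lor (P i) (P i)" by (simp only: lor_scale_right)
  moreover have "lor (P i) v = - \<delta>"
    using ijkl by (simp add: v_def lor_simps P_n)
  ultimately show ?thesis unfolding a_def[symmetric] b_def[symmetric] c_def[symmetric] \<delta>_def[symmetric] q_def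
    by (simp add: algebra_simps)
qed

lemma (in coxeter_tetrahedron) vertex_timelike_if:
  assumes ijkl: "i \<in> {1..4}" "j \<in> {1..4}" "k \<in> {1..4}" "l \<in> {1..4}" "distinct [i, j, k, l]"
    and det: "1 + 2 * lor (n j) (n k) * lor (n j) (n l) * lor (n k) (n l)
      - (lor (n j) (n k))\<^sup>2 - (lor (n j) (n l))\<^sup>2 - (lor (n k) (n l))\<^sup>2 \<noteq> 0"
  shows "lor (P i) (P i) < 0"
proof -
  have "lor (P i) (P i) \<noteq> 0" using vertex_gram[OF ijkl] det by force
  then show ?thesis using P_causal[OF ijkl(1)] by (simp add: causal_def)
qed

text \<open>A vector in the kernel becomes orthogonal to all normals when its time coordinate changes
  sign.\<close>

lemma (in coxeter_tetrahedron) det_normals: "det (vector [n 1, n 2, n 3, n 4] :: real^4^4) \<noteq> 0"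
proof
  let ?A = "vector [n 1, n 2, n 3, n 4] :: real^4^4"
  assume "det ?A = 0"
  then obtain y where y: "?A *v y = 0" "y \<noteq> 0"
    using invertible_det_nz[of ?A] matrix_left_invertible_ker[of ?A] invertible_left_inverse[of ?A] by blast
  define w where "w = (vector [y $ 1, y $ 2, y $ 3, - (y $ 4)] :: real^4)"
  have "lor w (n i) = (?A *v y) $ (if i = 1 then 1 else if i = 2 then 2 else if i = 3 then 3 else 4)" if "i \<in> {1..4}" for i
    using that unfolding one_to_four by (auto simp: w_def lor_def matrix_vector_mult_def sum_4 mult.commute)
  then have "w = 0" using y(1) by (intro eqI_n) (simp add: lor.zero_left)
  then have "w $ 1 = 0" "w $ 2 = 0" "w $ 3 = 0" "w $ 4 = 0" by simp_all
  then show False using y(2) by (simp add: w_def vec_eq_iff[where 'b = 4] forall_4)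
qed

section \<open>A contraction criterion\<close>

text \<open>The map \<open>w \<mapsto> w + lor w d *\<^sub>R h\<close> differs from the identity only in the direction of the point \<open>h\<close>.
  Splitting \<open>w\<close> along \<open>h\<close> and its orthogonal complement, the claim becomes the positivity of a binary
  quadratic form, shown by completing the square.\<close>

lemma shear_contracting:
  assumes h: "h \<in> hyperboloid" and \<mu>: "\<mu> > 1"
    and T: "T = 1 + lor h d" and D: "D = lor d d + (lor h d)\<^sup>2"
    and less: "\<mu> * (D + \<mu> - 1) < (\<mu> - 1) * T\<^sup>2"
    and w: "w \<noteq> 0"
  shows "lor (w + lor w d *\<^sub>R h) (w + lor w d *\<^sub>R h) < \<mu> * lor w w"
proof -
  define a where "a = - lor w h"
  define y where "y = w - a *\<^sub>R h"
  define q where "q = lor y d"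
  define Y where "Y = lor y y"
  note hh = lor_self[OF h]
  have yh: "lor y h = 0" by (simp add: y_def a_def lor_simps hh)
  then have hy: "lor h y = 0" by (simp add: lor_commute)
  have wy: "w = a *\<^sub>R h + y" by (simp add: y_def)
  have wd: "lor w d = a * (T - 1) + q" by (simp add: wy lor_simps q_def T)
  have "w + lor w d *\<^sub>R h = (a * T + q) *\<^sub>R h + y" by (simp add: wd) (simp add: wy algebra_simps)
  then have lhs: "lor (w + lor w d *\<^sub>R h) (w + lor w d *\<^sub>R h) = - (a * T + q)\<^sup>2 + Y"
    by (simp add: lor_simps hh yh hy Y_def power2_eq_square) (simp add: algebra_simps)
  have rhs: "lor w w = - a\<^sup>2 + Y" by (simp add: wy lor_simps hh yh hy Y_def power2_eq_square)
  let ?d = "d + lor h d *\<^sub>R h"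
  have dh: "lor ?d h = 0" by (simp add: lor_simps hh lor_commute[of d h])
  have dd: "lor ?d ?d = D" by (simp add: lor_simps hh lor_commute[of d h] D power2_eq_square)
  have "lor ?d y = q" by (simp add: lor_simps hy q_def lor_commute[of d y])
  then have cs: "q\<^sup>2 \<le> D * Y" using lor_cauchy_schwarz[OF h dh yh] by (simp add: dd Y_def)
  have D0: "D \<ge> 0" using lor_orthogonal_pos(1)[OF h dh] by (simp add: dd)
  have Y0: "Y \<ge> 0" using lor_orthogonal_pos(1)[OF h yh] by (simp add: Y_def)
  have "(a * T + q)\<^sup>2 + (\<mu> - 1) * Y - \<mu> * a\<^sup>2 > 0"
  proof (cases "a = 0")
    case True
    then have "y \<noteq> 0" using w wy by auto
    then have "Y > 0" using lor_orthogonal_pos(2)[OF h yh] Y0 unfolding Y_def by linarith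
    then show ?thesis using True \<mu> by (simp add: add_nonneg_pos)
  next
    case False
    then have a2: "a\<^sup>2 > 0" by simp
    show ?thesis
    proof (cases "D = 0")
      case True
      then have "q = 0" using cs by simp
      have "(\<mu> - 1) * \<mu> < (\<mu> - 1) * T\<^sup>2" using less True by (simp add: algebra_simps)
      then have "\<mu> < T\<^sup>2" using \<mu> by simp
      then have "a\<^sup>2 * \<mu> < a\<^sup>2 * T\<^sup>2" using a2 by simp
      moreover have "(\<mu> - 1) * Y \<ge> 0" using \<mu> Y0 by simp
      ultimately show ?thesis unfolding \<open>q = 0\<close> by (simp add: power_mult_distrib algebra_simps)
    next
      case False
      then have D1: "D > 0" using D0 by simp
      let ?E = "(a * T + q)\<^sup>2 + (\<mu> - 1) * Y - \<mu> * a\<^sup>2"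
      have "(\<mu> - 1) * q\<^sup>2 \<le> (\<mu> - 1) * (D * Y)" using cs \<mu> by (intro mult_left_mono) auto
      then have e1: "D * (a * T + q)\<^sup>2 + (\<mu> - 1) * q\<^sup>2 - D * \<mu> * a\<^sup>2 \<le> D * ?E" by (simp add: algebra_simps)
      have "0 < D * a\<^sup>2 * ((\<mu> - 1) * T\<^sup>2 - \<mu> * (D + \<mu> - 1))"
        using D1 a2 less by (intro mult_pos_pos) auto
      also have "\<dots> \<le> ((D + \<mu> - 1) * q + D * a * T)\<^sup>2 + D * a\<^sup>2 * ((\<mu> - 1) * T\<^sup>2 - \<mu> * (D + \<mu> - 1))" by simp
      also have "\<dots> = (D + \<mu> - 1) * (D * (a * T + q)\<^sup>2 + (\<mu> - 1) * q\<^sup>2 - D * \<mu> * a\<^sup>2)" by algebra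
      finally have "0 < D * (a * T + q)\<^sup>2 + (\<mu> - 1) * q\<^sup>2 - D * \<mu> * a\<^sup>2"
        using D1 \<mu> by (simp add: zero_less_mult_iff)
      then have "0 < D * ?E" using e1 by linarith
      then show ?thesis using D1 by (simp add: zero_less_mult_iff)
    qed
  qed
  then show ?thesis unfolding lhs rhs by (simp add: algebra_simps)
qed

text \<open>With \<open>c = cos (pi / 5)\<close>, the equation \<open>cos (3 pi / 5) = - cos (2 pi / 5)\<close> is a cubic in \<open>c\<close>
  with the root \<open>-1\<close> and a quadratic factor.\<close>

lemma cos_pi_5:
  "4 * (cos (pi / 5))\<^sup>2 = 2 * cos (pi / 5) + 1" "0 < cos (pi / 5)" "cos (pi / 5) < 81 / 100"
proof -
  define c where "c = cos (pi / 5)"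
  have "cos (3 * (pi / 5)) = - cos (2 * (pi / 5))"
    using cos_minus_pi[of "2 * (pi / 5)"] by (simp add: cos_diff algebra_simps)
  then have "4 * c ^ 3 - 3 * c = - (2 * c\<^sup>2 - 1)" by (simp only: cos_treble_cos cos_double_cos c_def)
  then have "(c + 1) * (4 * c\<^sup>2 - 2 * c - 1) = 0" by algebra
  moreover show c0: "0 < cos (pi / 5)" using pi_gt_zero by (intro cos_gt_zero_pi) linarith+
  ultimately have eq: "4 * c\<^sup>2 = 2 * c + 1" by (auto simp: c_def)
  show "4 * (cos (pi / 5))\<^sup>2 = 2 * cos (pi / 5) + 1" using eq by (simp add: c_def)
  show "cos (pi / 5) < 81 / 100"
  proof (rule ccontr)
    assume "\<not> ?thesis"
    then have c: "c \<ge> 81 / 100" by (simp add: c_def)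
    then have "c * (81 / 100) \<le> c * c" by (intro mult_left_mono) auto
    then show False using eq c unfolding power2_eq_square by linarith
  qed
qed

lemma sqrt_3_bounds: "173 / 100 < sqrt 3"
  by (rule real_less_rsqrt) (simp add: power2_eq_square)

section \<open>The two tetrahedra\<close>

text \<open>The Gram determinant of the three faces at a vertex is \<open>3 / 4\<close> or
  \<open>3 / 4 - (cos (pi / 5))\<^sup>2\<close>, so no vertex is ideal.\<close>

lemma compact_coxeter_tetrahedron_2:
  assumes "coxeter_tetrahedron m (angle_order 2)"
  shows "compact_coxeter_tetrahedron m (angle_order 2)"
proof -
  interpret coxeter_tetrahedron m "angle_order 2" by (rule assms)
  have g: "lor (m 1) (m 2) = - cos (pi / 5)" "lor (m 1) (m 3) = - (1 / 2)" "lor (m 2) (m 3) = 0"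
    "lor (m 1) (m 4) = 0" "lor (m 2) (m 4) = - (1 / 2)" "lor (m 3) (m 4) = 0"
    using gram[of 1 2] gram[of 1 3] gram[of 2 3] gram[of 1 4] gram[of 2 4] gram[of 3 4]
    by (simp_all add: angle_order_def doubleton_eq_iff cos_60)
  have c: "3 / 4 - (cos (pi / 5))\<^sup>2 \<noteq> 0" using cos_pi_5 by simp
  show ?thesis
  proof
    fix i :: nat assume "i \<in> {1..4}"
    then consider "i = 1" | "i = 2" | "i = 3" | "i = 4" by fastforce
    then show "lor (P i) (P i) < 0"
    proof cases
      case 1
      show ?thesis unfolding 1 by (rule vertex_timelike_if[of 1 2 3 4]) (simp_all add: g power2_eq_square)
    next
      case 2
      show ?thesis unfolding 2 by (rule vertex_timelike_if[of 2 1 3 4]) (simp_all add: g power2_eq_square)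
    next
      case 3
      show ?thesis unfolding 3 by (rule vertex_timelike_if[of 3 1 2 4]) (use c in \<open>simp_all add: g power_divide\<close>)
    next
      case 4
      show ?thesis unfolding 4 by (rule vertex_timelike_if[of 4 1 2 3]) (use c in \<open>simp_all add: g power_divide\<close>)
    qed
  qed
qed

text \<open>The tetrahedra \<open>m\<close> for \<open>j = 2\<close> and \<open>n\<close> for \<open>j = 6\<close>, whose faces through the common vertex
  span the same planes.\<close>

locale tetrahedra_2_6 =
  T: coxeter_tetrahedron m "angle_order 2" + S: coxeter_tetrahedron n "angle_order 6" for m n +
  assumes common: "i \<in> {1..3} \<Longrightarrow> n i = m i"
begin

lemma indices: "(1::nat) \<in> {1..4}" "(2::nat) \<in> {1..4}" "(3::nat) \<in> {1..4}" "(4::nat) \<in> {1..4}"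
  "(1::nat) \<in> {1..3}" "(2::nat) \<in> {1..3}" "(3::nat) \<in> {1..3}"
  by auto

lemma gram_m: "lor (m 1) (m 2) = - cos (pi / 5)" "lor (m 1) (m 3) = - (1 / 2)" "lor (m 2) (m 3) = 0"
  "lor (m 1) (m 4) = 0" "lor (m 2) (m 4) = - (1 / 2)" "lor (m 3) (m 4) = 0"
  using T.gram[of 1 2] T.gram[of 1 3] T.gram[of 2 3] T.gram[of 1 4] T.gram[of 2 4] T.gram[of 3 4]
  by (simp_all add: angle_order_def doubleton_eq_iff cos_60)

lemma gram_n: "lor (n 1) (n 2) = - cos (pi / 5)" "lor (n 1) (n 3) = - (1 / 2)" "lor (n 2) (n 3) = 0"
  "lor (n 1) (n 4) = 0" "lor (n 2) (n 4) = - (1 / 2)" "lor (n 3) (n 4) = - (sqrt 3 / 2)"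
  using S.gram[of 1 2] S.gram[of 1 3] S.gram[of 2 3] S.gram[of 1 4] S.gram[of 2 4] S.gram[of 3 4]
  by (simp_all add: angle_order_def doubleton_eq_iff cos_60 cos_30)

lemma gram_m': "lor (m 2) (m 1) = - cos (pi / 5)" "lor (m 3) (m 1) = - (1 / 2)" "lor (m 3) (m 2) = 0"
  "lor (m 4) (m 1) = 0" "lor (m 4) (m 2) = - (1 / 2)" "lor (m 4) (m 3) = 0"
  and gram_n': "lor (n 4) (n 1) = 0" "lor (n 4) (n 2) = - (1 / 2)" "lor (n 4) (n 3) = - (sqrt 3 / 2)"
  using gram_m gram_n by (simp_all only: lor_commute)

lemma det_common: "3 / 4 - (cos (pi / 5))\<^sup>2 > 0"
  using cos_pi_5 by simp

sublocale T: compact_coxeter_tetrahedron m "angle_order 2"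
  by (rule compact_coxeter_tetrahedron_2[OF T.coxeter_tetrahedron_axioms])

lemma P4_parallel: "S.P 4 = (- lor (S.P 4) (m 4)) *\<^sub>R T.P 4" and P4_side: "lor (S.P 4) (m 4) < 0"
proof -
  show eq: "S.P 4 = (- lor (S.P 4) (m 4)) *\<^sub>R T.P 4"
  proof (rule T.eqI_n)
    fix i :: nat assume i: "i \<in> {1..4}"
    show "lor (S.P 4) (m i) = lor ((- lor (S.P 4) (m 4)) *\<^sub>R T.P 4) (m i)"
    proof (cases "i = 4")
      case False
      then have "i \<in> {1..3}" using i by auto
      then have "lor (S.P 4) (m i) = 0" using S.P_n[OF indices(4) i] False by (simp flip: common)
      then show ?thesis using T.P_n[OF indices(4) i] False unfolding lor_scale_left by simp
    qed (simp only: lor_scale_left T.P_n[OF indices(4) indices(4)], simp)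
  qed
  have "S.P 4 $ 4 > 0" "T.P 4 $ 4 > 0" using S.P_causal[of 4] T.P_causal[of 4] by (simp_all add: causal_def)
  moreover have "S.P 4 $ 4 = - lor (S.P 4) (m 4) * T.P 4 $ 4" by (subst eq) simp
  ultimately show "lor (S.P 4) (m 4) < 0" by (simp add: mult_less_0_iff)
qed

text \<open>The two fourth normals have the same products with the first two common normals. So their
  difference is the sum of a multiple of the common vertex vector and a vector in the span of the
  common normals that is explicit in terms of their Gram matrix.\<close>

lemma normal_difference:
  "lor (T.P 4) (T.P 4) * (lor (n 4 - m 4) (n 4 - m 4) - 3 / 4 * (1 - (cos (pi / 5))\<^sup>2) / (3 / 4 - (cos (pi / 5))\<^sup>2))
     = (lor (T.P 4) (n 4 - m 4))\<^sup>2"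
proof -
  define c where "c = cos (pi / 5)"
  define \<delta> where "\<delta> = 3 / 4 - c\<^sup>2"
  define p where "p = T.P 4"
  define s where "s = n 4 - m 4"
  define g where "g = - (sqrt 3 / 2)"
  have \<delta>: "\<delta> > 0" using det_common by (simp add: \<delta>_def c_def)
  have sm: "lor s (m 1) = 0" "lor s (m 2) = 0" "lor s (m 3) = g"
    using gram_n' gram_m' common[OF indices(5)] common[OF indices(6)] common[OF indices(7)]
    by (simp_all add: s_def lor_simps g_def)
  have pm: "lor p (m 1) = 0" "lor p (m 2) = 0" "lor p (m 3) = 0" "lor p (m 4) = -1"
    using T.P_n[of 4] by (simp_all add: p_def)
  have pp: "lor p p < 0" using T.vertex_timelike[of 4] by (simp add: p_def)
  \<comment> \<open>The coefficients are the third column of the inverse Gram matrix of the common normals.\<close>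
  define k where "k = g / \<delta>"
  define z where "z = k *\<^sub>R ((1 / 2) *\<^sub>R m 1 + (c / 2) *\<^sub>R m 2 + (1 - c\<^sup>2) *\<^sub>R m 3)"
  have k: "k * (3 / 4 - c\<^sup>2) = g" using \<delta> by (simp add: k_def flip: \<delta>_def)
  have zm: "lor z (m 1) = 0" "lor z (m 2) = 0" "lor z (m 3) = g"
    using T.unit[OF indices(1)] T.unit[OF indices(2)] T.unit[OF indices(3)] unfolding k[symmetric]
    by (simp_all add: z_def lor_simps gram_m gram_m' c_def[symmetric] power2_eq_square algebra_simps)
  have zp: "lor z p = 0" by (simp add: z_def lor_simps pm lor_commute[of "m _" p])
  define w where "w = s - z"
  have "w = (- lor w (m 4)) *\<^sub>R p"
  proof (rule T.eqI_n)
    fix i :: nat assume "i \<in> {1..4}"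
    then consider "i = 1" | "i = 2" | "i = 3" | "i = 4" by fastforce
    then show "lor w (m i) = lor ((- lor w (m 4)) *\<^sub>R p) (m i)"
      unfolding lor_scale_left by cases (simp_all add: pm, simp_all add: w_def lor_simps sm zm)
  qed
  then obtain t where t: "w = t *\<^sub>R p" by blast
  then have s: "s = z + t *\<^sub>R p" by (simp add: w_def algebra_simps)
  have "lor s s = lor z s + t * lor p s" by (subst (1) s) (simp add: lor_simps)
  moreover have ps: "lor p s = t * lor p p" by (simp add: s lor_simps zp lor_commute[of p z])
  moreover have "lor z s = 3 / 4 * (1 - c\<^sup>2) / \<delta>"
  proof -
    have "lor z s = g / \<delta> * ((1 - c\<^sup>2) * g)" by (simp add: z_def k_def lor_simps sm lor_commute[of "m _" s])
    also have "\<dots> = g * g * (1 - c\<^sup>2) / \<delta>" by simp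
    also have "g * g = 3 / 4" by (simp add: g_def)
    finally show ?thesis .
  qed
  ultimately have "lor s s - 3 / 4 * (1 - c\<^sup>2) / \<delta> = t * (t * lor p p)" by simp
  then have "lor p p * (lor s s - 3 / 4 * (1 - c\<^sup>2) / \<delta>) = (lor p s)\<^sup>2"
    unfolding ps by (simp add: power2_eq_square)
  then show ?thesis unfolding p_def s_def c_def \<delta>_def .
qed

text \<open>As three normals agree, the vertex map changes \<open>w\<close> by a multiple of the vector \<open>h\<close> of the
  common vertex, and \<open>shear_contracting\<close> applies. In its notation the hypothesis can be met by some
  \<open>\<mu>\<close> if and only if \<open>T\<^sup>2 > (1 + sqrt D)\<^sup>2\<close>, with the optimum at \<open>\<mu> = 1 + sqrt D\<close>, which is about
  \<open>2.7\<close> here; the constant 3 is a nearby integer.\<close>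

theorem contracting:
  assumes w: "w \<noteq> 0"
  shows "lor (vertex_map n T.P 0 w) (vertex_map n T.P 0 w) < 3 * lor w w"
proof -
  define c where "c = cos (pi / 5)"
  define \<delta> where "\<delta> = 3 / 4 - c\<^sup>2"
  define p where "p = T.P 4"
  define L where "L = lnorm p"
  define h where "h = (1 / L) *\<^sub>R p"
  define s where "s = n 4 - m 4"
  define d where "d = (- L) *\<^sub>R s"
  have \<delta>: "\<delta> > 0" using det_common by (simp add: \<delta>_def c_def)
  have tl: "timelike p" using T.vertex_timelike[of 4] T.P_causal[of 4] by (simp add: p_def timelike_def causal_def)
  have L: "L > 0" "L\<^sup>2 = - lor p p" using lnorm_pos[OF tl] lnorm_sq[OF tl] by (simp_all add: L_def)
  have h: "h \<in> hyperboloid" using timelike_normalise[OF tl] by (simp add: h_def L_def)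
  have pm4: "lor p (m 4) = -1" using T.P_n[of 4 4] by (simp add: p_def)
  have map: "vertex_map n T.P 0 w = w + lor w d *\<^sub>R h"
  proof -
    have "vertex_map n T.P 0 w - (\<Sum>i\<in>{1..4}. (- lor w (m i)) *\<^sub>R T.P i) = (- lor w s) *\<^sub>R p"
      using common[OF indices(5)] common[OF indices(6)] common[OF indices(7)]
      unfolding vertex_map_def sum_one_to_four by (simp add: p_def s_def lor_simps algebra_simps)
    then have "vertex_map n T.P 0 w - w = (- lor w s) *\<^sub>R p" by (simp only: T.P_expand[symmetric])
    also have "\<dots> = lor w d *\<^sub>R h" using L(1) unfolding d_def h_def lor_scale_right by simp
    finally show ?thesis by (simp add: algebra_simps)
  qed
  define R where "R = - lor p (n 4)"
  have T: "1 + lor h d = R"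
    using L(1) unfolding h_def d_def lor_scale_left lor_scale_right by (simp add: s_def R_def lor_simps pm4)
  have hd: "lor h d = R - 1" using T by simp
  have ps: "lor p s = 1 - R" by (simp add: s_def R_def lor_simps pm4)
  define E where "E = 3 / 4 * (1 - c\<^sup>2) / \<delta>"
  have "- (L\<^sup>2) * (lor s s - E) = (lor p s)\<^sup>2"
    using normal_difference unfolding p_def[symmetric] s_def[symmetric] c_def[symmetric] \<delta>_def[symmetric] E_def L(2) by simp
  then have D: "lor d d + (lor h d)\<^sup>2 = L\<^sup>2 * E"
    unfolding hd ps unfolding d_def lor_scale_left lor_scale_right by (simp add: power2_eq_square algebra_simps)
  \<comment> \<open>The Lorentz squares of the vertex, normalised by the normals of either tetrahedron.\<close>
  have "lor p p * (3 / 16 - \<delta>) = - \<delta>"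
    using T.vertex_gram[of 4 1 2 3] unfolding p_def[symmetric]
    by (simp add: gram_m gram_m' c_def[symmetric] \<delta>_def power_divide algebra_simps power2_eq_square)
  then have p2: "L\<^sup>2 * (3 / 16 - \<delta>) = \<delta>" unfolding L(2) by simp
  have q2: "lor (S.P 4) (S.P 4) * (3 / 16 + c * sqrt 3 / 4 + 3 / 4 * (1 - c\<^sup>2) - \<delta>) = - \<delta>"
    using S.vertex_gram[of 4 1 2 3]
    by (simp add: gram_n gram_n' c_def[symmetric] \<delta>_def power_divide algebra_simps power2_eq_square)
      (simp add: field_simps)
  have R: "lor (S.P 4) (S.P 4) * R\<^sup>2 = - (L\<^sup>2)"
  proof -
    define k where "k = - lor (S.P 4) (m 4)"
    have eq: "S.P 4 = k *\<^sub>R p" using P4_parallel by (simp add: k_def p_def)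
    have "lor (S.P 4) (n 4) = -1" using S.P_n[of 4 4] by simp
    then have "k * R = 1" by (simp add: eq lor_scale_left R_def)
    moreover have "lor (S.P 4) (S.P 4) * R\<^sup>2 = (k * R)\<^sup>2 * lor p p"
      by (simp add: eq lor_simps power2_eq_square)
    ultimately show ?thesis using L(2) by simp
  qed
  have ineq: "3 * (3 / 4 * (1 - c\<^sup>2)) + 6 * (3 / 16 - \<delta>) < 2 * (3 / 16 + c * sqrt 3 / 4 + 3 / 4 * (1 - c\<^sup>2) - \<delta>)"
  proof -
    have "c * (173 / 100) < c * sqrt 3" using cos_pi_5(2) sqrt_3_bounds by (intro mult_strict_left_mono) (simp_all add: c_def)
    then show ?thesis using cos_pi_5(1,3) unfolding \<delta>_def c_def[symmetric] by (simp add: field_simps)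
  qed
  have "3 * (L\<^sup>2 * E + 3 - 1) < (3 - 1) * R\<^sup>2"
  proof -
    let ?B = "3 / 16 + c * sqrt 3 / 4 + 3 / 4 * (1 - c\<^sup>2) - \<delta>"
    have "\<delta> * R\<^sup>2 = - (lor (S.P 4) (S.P 4) * ?B) * R\<^sup>2" unfolding q2 by simp
    also have "\<dots> = - (lor (S.P 4) (S.P 4) * R\<^sup>2) * ?B" by (simp add: algebra_simps)
    also have "\<dots> = L\<^sup>2 * ?B" unfolding R by simp
    finally have B: "\<delta> * R\<^sup>2 = L\<^sup>2 * ?B" .
    have "\<delta> * (3 * (L\<^sup>2 * E + 3 - 1)) = L\<^sup>2 * (3 * (\<delta> * E)) + 6 * \<delta>" by (simp add: algebra_simps)
    also have "\<delta> * E = 3 / 4 * (1 - c\<^sup>2)" using \<delta> by (simp add: E_def)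
    also have "L\<^sup>2 * (3 * (3 / 4 * (1 - c\<^sup>2))) + 6 * \<delta> = L\<^sup>2 * (3 * (3 / 4 * (1 - c\<^sup>2)) + 6 * (3 / 16 - \<delta>))"
      using p2 by (simp add: algebra_simps)
    also have "\<dots> < L\<^sup>2 * (2 * ?B)" using ineq L(1) by (intro mult_strict_left_mono) auto
    also have "\<dots> = 2 * (L\<^sup>2 * ?B)" by (rule mult.left_commute)
    also have "\<dots> = \<delta> * ((3 - 1) * R\<^sup>2)" unfolding B[symmetric] by simp
    finally show ?thesis using \<delta> by (simp add: mult_less_cancel_left)
  qed
  then show ?thesis
    unfolding map by (intro shear_contracting[OF h _ T[symmetric] D[symmetric] _ w]) simp_all
qed

text \<open>As a function of the fourth row the determinant is the product with a vector orthogonal to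
  the common normals, that is, with a multiple of the common vertex vector; both fourth normals have
  negative product with the latter.\<close>

lemma orientation: "det (vector [n 1, n 2, n 3, n 4] :: real^4^4) * det (vector [m 1, m 2, m 3, m 4] :: real^4^4) > 0"
proof -
  define f where "f x = det (vector [m 1, m 2, m 3, x] :: real^4^4)" for x
  define k where "k = (vector [f (axis 1 1), f (axis 2 1), f (axis 3 1), - f (axis 4 1)] :: real^4)"
  have f: "f x = lor k x" for x
    unfolding k_def lor_def f_def det_4 by (simp add: axis_def algebra_simps)
  have f0: "f (m 1) = 0" "f (m 2) = 0" "f (m 3) = 0"
    unfolding f_def det_4 by (simp_all add: algebra_simps)
  have "k = (- lor k (m 4)) *\<^sub>R T.P 4"
  proof (rule T.eqI_n)
    fix i :: nat assume i: "i \<in> {1..4}"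
    then consider "i = 1" | "i = 2" | "i = 3" | "i = 4" by fastforce
    then show "lor k (m i) = lor ((- lor k (m 4)) *\<^sub>R T.P 4) (m i)"
      unfolding lor_scale_left using T.P_n[OF indices(4) i] by cases (simp_all add: f0 flip: f)
  qed
  then obtain t where k: "k = t *\<^sub>R T.P 4" by blast
  have "f (m 4) \<noteq> 0" using T.det_normals by (simp add: f_def)
  moreover have m4: "f (m 4) = - t" using T.P_n[of 4 4] by (simp add: f k lor_scale_left)
  ultimately have "t\<^sup>2 > 0" by simp
  have "- lor (S.P 4) (m 4) * lor (T.P 4) (n 4) = -1"
    using S.P_n[of 4 4] arg_cong[OF P4_parallel, of "\<lambda>x. lor x (n 4)"] by (simp only: lor_scale_left) simp
  then have "lor (T.P 4) (n 4) < 0" using P4_side by (smt (verit) mult_nonneg_nonneg)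
  then have "t\<^sup>2 * - lor (T.P 4) (n 4) > 0" using \<open>t\<^sup>2 > 0\<close> by (simp add: mult_pos_neg)
  moreover have "f (n 4) * f (m 4) = t\<^sup>2 * - lor (T.P 4) (n 4)"
    unfolding m4 by (simp add: f k lor_scale_left power2_eq_square)
  ultimately show ?thesis using common[OF indices(5)] common[OF indices(6)] common[OF indices(7)] by (simp add: f_def)
qed

end

section \<open>Unfolding the family\<close>

text \<open>A plane determines its unit normal up to sign, and the inclusion of the tetrahedra fixes the
  sign.\<close>

lemma common_normals:
  assumes m: "compact_coxeter_tetrahedron m f" and n: "is_tetrahedron n"
    and sub: "tetrahedron m \<subseteq> tetrahedron n" and i: "i \<in> {1..4}" and plane: "hyp_plane (n i) = hyp_plane (m i)"
  shows "n i = m i"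
proof -
  interpret T: compact_coxeter_tetrahedron m f by (rule m)
  have tl: "timelike (T.P l)" if "l \<in> {1..4}" for l
    using T.vertex_timelike[OF that] T.P_causal[OF that] by (simp add: timelike_def causal_def)
  have R: "Rep_hyp3 (hproj (T.P l)) = (1 / lnorm (T.P l)) *\<^sub>R T.P l" if "l \<in> {1..4}" for l
    by (rule Rep_hproj[OF tl[OF that]])
  have zero: "lor (T.P l) (n i) = 0" if l: "l \<in> {1..4}" "l \<noteq> i" for l
  proof -
    have "hproj (T.P l) \<in> hyp_plane (m i)" using T.P_n[OF l(1) i] l by (simp add: hyp_plane_def R lor_scale_left)
    then have "hproj (T.P l) \<in> hyp_plane (n i)" by (simp add: plane)
    then show ?thesis using lnorm_pos[OF tl[OF l(1)]] by (simp add: hyp_plane_def R[OF l(1)] lor_scale_left)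
  qed
  have "hproj (T.P i) \<in> tetrahedron m"
    using T.P_n[OF i] lnorm_pos[OF tl[OF i]] by (auto simp: T.in_tetrahedron R[OF i] lor_scale_left)
  then have "hproj (T.P i) \<in> tetrahedron n" using sub by blast
  then have "lor (Rep_hyp3 (hproj (T.P i))) (n i) \<le> 0" using i by (simp add: tetrahedron_def)
  then have side: "lor (T.P i) (n i) \<le> 0"
    using lnorm_pos[OF tl[OF i]] by (simp add: R[OF i] lor_scale_left divide_le_0_iff)
  define a where "a = - lor (T.P i) (n i)"
  have "lor (n i - a *\<^sub>R m i) x = 0" for x
  proof -
    have z: "lor (T.P l) (n i - a *\<^sub>R m i) = 0" if "l \<in> {1..4}" for l
      using T.P_n[OF that i] zero[OF that] by (cases "l = i") (simp_all add: lor_simps a_def)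
    have "lor x (n i - a *\<^sub>R m i) = (\<Sum>l\<in>{1..4}. (- lor x (m l)) * lor (T.P l) (n i - a *\<^sub>R m i))"
      by (rule T.lor_expand)
    also have "\<dots> = 0" by (intro sum.neutral) (simp add: z)
    finally show ?thesis by (simp add: lor_commute)
  qed
  then have eq: "n i = a *\<^sub>R m i" using lor_nondegenerate[of "n i - a *\<^sub>R m i"] by simp
  have "lor (n i) (n i) = 1" using n i by (simp add: is_tetrahedron_def)
  then have "a\<^sup>2 = 1" using T.unit[OF i] by (simp add: eq lor_simps power2_eq_square)
  then have "a = 1" using side by (simp add: a_def power2_eq_1_iff)
  then show ?thesis using eq by simp
qed

lemma family_pair:
  assumes fam: "tetrahedron_family N"
  shows "tetrahedra_2_6 (N 2) (N 6)"
proof -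
  interpret T: coxeter_tetrahedron "N 2" "angle_order 2" by (rule family_coxeter[OF fam]) simp
  interpret S: coxeter_tetrahedron "N 6" "angle_order 6" by (rule family_coxeter[OF fam]) simp
  have sub: "tetrahedron (N 2) \<subseteq> tetrahedron (N 6)"
  proof -
    have "tetrahedron (N j) \<subseteq> tetrahedron (N (Suc j))" if "j \<in> {2..5}" for j
      using fam that by (simp add: tetrahedron_family_def)
    from this[of 2] this[of 3] this[of 4] this[of 5] show ?thesis by simp
  qed
  obtain Q where Q: "\<forall>j\<in>{2..6}. \<forall>i\<in>{1..3}. hyp_plane (N j i) = Q i"
    using fam unfolding tetrahedron_family_def by blast
  show ?thesis
  proof
    fix i :: nat assume i: "i \<in> {1..3}"
    have "hyp_plane (N 6 i) = hyp_plane (N 2 i)" using Q i by simp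
    then show "N 6 i = N 2 i"
      using i by (intro common_normals[OF compact_coxeter_tetrahedron_2[OF T.coxeter_tetrahedron_axioms] S.tet sub]) auto
  qed
qed

text \<open>Induction on the word. The identity is preserved because its image is an idempotent
  bijection.\<close>

lemma hom_word:
  assumes S: "coxeter_tetrahedron n e" and T: "coxeter_tetrahedron m f"
    and hom: "\<rho> \<in> hom (isom_group\<lparr>carrier := reflection_group n\<rparr>) (isom_group\<lparr>carrier := reflection_group m\<rparr>)"
    and gen: "\<forall>i\<in>{1..4}. \<rho> (hyp_reflection (n i)) = hyp_reflection (m i)"
    and xs: "xs \<in> lists {1..4}"
  shows "\<rho> (hmap (word n xs)) = hmap (word m xs)"
proof -
  interpret S: coxeter_tetrahedron n e by (rule S)
  interpret T: coxeter_tetrahedron m f by (rule T)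
  have mult: "\<rho> (a \<circ> b) = \<rho> a \<circ> \<rho> b" if "a \<in> reflection_group n" "b \<in> reflection_group n" for a b
    using hom that by (simp add: hom_def isom_group_def)
  have word_in: "hmap (word n ys) \<in> reflection_group n" if "ys \<in> lists {1..4}" for ys
    using S.W_word[OF that] by (simp add: S.reflection_group_hmap)
  have id: "id \<in> reflection_group n" using word_in[of "[]"] by (simp add: hmap_id)
  show ?thesis using xs
  proof (induction xs)
    case Nil
    have "\<rho> id \<in> reflection_group m" using hom id by (auto simp: hom_def)
    then have "\<rho> id \<in> carrier isom_group" using subgroup.subset[OF T.subgroup_reflection_group] by blast
    then have "inj (\<rho> id)" by (simp add: isom_group_def bij_is_inj)
    moreover have "\<rho> id (\<rho> id x) = \<rho> id x" for x using fun_cong[OF mult[OF id id], of x] by simp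
    ultimately have "\<rho> id = id" by (auto simp: fun_eq_iff inj_def)
    then show ?case by (simp only: word.simps hmap_id)
  next
    case (Cons i xs)
    then have i: "i \<in> {1..4}" and xs: "xs \<in> lists {1..4}" by auto
    have l: "lorentz (word n xs)" "lorentz (word m xs)" "lorentz (lrefl (n i))" "lorentz (lrefl (m i))"
      using S.lorentz_W[OF S.W_word[OF xs]] T.lorentz_W[OF T.W_word[OF xs]] lorentz_refl S.unit[OF i] T.unit[OF i] by auto
    have r: "hyp_reflection (n i) = hmap (word n [i])"
      using hyp_reflection_hmap[OF S.unit[OF i]] by simp
    have "\<rho> (hmap (word n (i # xs))) = \<rho> (hyp_reflection (n i) \<circ> hmap (word n xs))"
      using hyp_reflection_hmap[OF S.unit[OF i]] l by (simp add: hmap_compose)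
    also have "\<dots> = \<rho> (hyp_reflection (n i)) \<circ> \<rho> (hmap (word n xs))"
      using word_in[of "[i]"] i word_in[OF xs] by (intro mult) (simp_all add: r)
    also have "\<dots> = hmap (word m (i # xs))"
      using gen i Cons.IH hyp_reflection_hmap[OF T.unit[OF i]] l by (simp add: hmap_compose)
    finally show ?case .
  qed
qed

context oriented_tetrahedron_pair
begin

text \<open>The value does not depend on the chosen representative, by \<open>quotient_map_orb\<close> below.\<close>

definition quotient_map :: "hyp3 set \<Rightarrow> hyp3 set" where
  "quotient_map a = orb (rotation_group m) (F (SOME x. x \<in> a))"

text \<open>A word preserves the orientation if and only if its length is even, in either group.\<close>

lemma rotation_word:
  assumes "\<gamma> \<in> rotation_group n"
  obtains xs where "xs \<in> lists {1..4}" "\<gamma> = hmap (word n xs)" "hmap (word m xs) \<in> rotation_group m"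
proof -
  obtain w where w: "w \<in> S.Wp" "\<gamma> = hmap w" using assms by (auto simp: S.rotation_group_hmap)
  then obtain xs where xs: "xs \<in> lists {1..4}" "w = word n xs" by (auto simp: S.Wp_def S.W_def)
  have "det (matrix (word n xs)) = (-1) ^ length xs" "det (matrix (word m xs)) = (-1) ^ length xs"
    using xs(1) S.unit T.unit by (auto intro!: det_word)
  then have "det (matrix (word m xs)) = det (matrix (word n xs))" by simp
  then have "word m xs \<in> T.Wp" using w(1) xs T.W_word[OF xs(1)] by (simp add: S.Wp_def T.Wp_def)
  then show ?thesis using that[OF xs(1)] w(2) xs(2) by (simp add: T.rotation_group_hmap)
qed

lemma orb_F:
  assumes "y \<in> orb (rotation_group n) x"
  shows "orb (rotation_group m) (F y) = orb (rotation_group m) (F x)"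
proof -
  obtain \<gamma> where \<gamma>: "\<gamma> \<in> rotation_group n" "y = \<gamma> x" using assms by (auto simp: orb_def)
  obtain xs where xs: "xs \<in> lists {1..4}" "\<gamma> = hmap (word n xs)" "hmap (word m xs) \<in> rotation_group m"
    by (rule rotation_word[OF \<gamma>(1)])
  show ?thesis using orb_eqI[OF T.subgroup_rotation_group xs(3), of "F x"] by (simp add: \<gamma>(2) xs(2) F_equivariant[OF xs(1)])
qed

lemma quotient_map_orb: "quotient_map (orb (rotation_group n) x) = orb (rotation_group m) (F x)"
proof -
  have "(SOME y. y \<in> orb (rotation_group n) x) \<in> orb (rotation_group n) x"
    by (rule someI) (rule orb_self[OF S.subgroup_rotation_group])
  then show ?thesis unfolding quotient_map_def by (rule orb_F)
qed

lemma quotient_map_lipschitz: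
  assumes K: "0 < K" "lipschitz_on K UNIV F"
    and a: "a \<in> orbifold (rotation_group n)" and b: "b \<in> orbifold (rotation_group n)"
  shows "setdist (quotient_map a) (quotient_map b) \<le> K * setdist a b"
proof -
  obtain x y where xy: "a = orb (rotation_group n) x" "b = orb (rotation_group n) y"
    using a b by (auto simp: orbifold_def)
  have ne: "x \<in> a" "y \<in> b" using orb_self[OF S.subgroup_rotation_group] by (simp_all add: xy)
  have "setdist (quotient_map a) (quotient_map b) / K \<le> setdist a b"
  proof (rule le_setdistI)
    fix u v assume uv: "u \<in> a" "v \<in> b"
    have "F u \<in> quotient_map a" "F v \<in> quotient_map b"
      using orb_F[of u x] orb_F[of v y] uv orb_self[OF T.subgroup_rotation_group]
      unfolding xy quotient_map_orb by metis+
    then have "setdist (quotient_map a) (quotient_map b) \<le> dist (F u) (F v)" by (rule setdist_le_dist)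
    also have "\<dots> \<le> K * dist u v" using lipschitz_onD[OF K(2)] by simp
    finally show "setdist (quotient_map a) (quotient_map b) / K \<le> dist u v"
      using K(1) by (simp add: field_simps)
  qed (use ne in auto)
  then show ?thesis using K(1) by (simp add: field_simps)
qed

lemma cusp_collapse:
  assumes \<xi>: "\<xi> \<in> cusp_points (rotation_group n)"
  shows "\<exists>U c. cusp_neighborhood (rotation_group n) \<xi> U \<and> quotient_map ` U = {c}"
proof -
  obtain \<gamma> where \<gamma>: "\<gamma> \<in> rotation_group n" "parabolic \<gamma>" "fixes_ideal \<gamma> \<xi>" and i: "\<xi> \<in> ideal_points"
    using \<xi> by (auto simp: cusp_points_def)
  obtain g where g: "g \<in> S.W" "\<gamma> = hmap g" using \<gamma>(1) by (auto simp: rotation_group_def S.reflection_group_hmap)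
  obtain r c where r: "r > 0" "F ` horoball \<xi> r = {c}"
    by (rule F_constant_on_horoball[OF g(1) _ i]) (use \<gamma> g in auto)
  define U where "U = orb (rotation_group n) ` horoball \<xi> r"
  have "cusp_neighborhood (rotation_group n) \<xi> U"
    using r(1) by (auto simp: cusp_neighborhood_def U_def orbifold_def)
  moreover have "quotient_map ` U = orb (rotation_group m) ` F ` horoball \<xi> r"
    by (simp add: U_def image_image quotient_map_orb)
  ultimately show ?thesis using r(2) by auto
qed

end

theorem theorem4p3:
  fixes N :: "nat \<Rightarrow> nat \<Rightarrow> real^4"
    and \<rho> :: "(hyp3 \<Rightarrow> hyp3) \<Rightarrow> (hyp3 \<Rightarrow> hyp3)"
  assumes "tetrahedron_family N"
    and "\<rho> \<in> hom (isom_group\<lparr>carrier := reflection_group (N 6)\<rparr>)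
                  (isom_group\<lparr>carrier := reflection_group (N 2)\<rparr>)"
    and "\<forall>i\<in>{1..4}. \<rho> (hyp_reflection (N 6 i)) = hyp_reflection (N 2 i)"
  shows "\<exists>K<1. \<exists>F f.
     lipschitz_on K UNIV F \<and>
     (\<forall>\<gamma>\<in>reflection_group (N 6). \<forall>x. F (\<gamma> x) = \<rho> \<gamma> (F x)) \<and>
     f \<in> orbifold (rotation_group (N 6)) \<rightarrow> orbifold (rotation_group (N 2)) \<and>
     (\<forall>x. f (orb (rotation_group (N 6)) x) = orb (rotation_group (N 2)) (F x)) \<and>
     (\<forall>a\<in>orbifold (rotation_group (N 6)). \<forall>b\<in>orbifold (rotation_group (N 6)).
        setdist (f a) (f b) \<le> K * setdist a b) \<and>
     (\<forall>\<xi>\<in>cusp_points (rotation_group (N 6)).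
        \<exists>U m. cusp_neighborhood (rotation_group (N 6)) \<xi> U \<and> f ` U = {m}) \<and>
     orbifold_form_integrable (rotation_group (N 6)) (pullback F vol_form) \<and>
     ereal (orbifold_form_integral (rotation_group (N 6)) (pullback F vol_form))
       = enn2ereal (orbifold_volume (rotation_group (N 2)))"
proof -
  interpret Q: tetrahedra_2_6 "N 2" "N 6" by (rule family_pair[OF assms(1)])
  note hw = hom_word[OF Q.S.coxeter_tetrahedron_axioms Q.T.coxeter_tetrahedron_axioms assms(2,3)]
  interpret oriented_tetrahedron_pair "N 6" "angle_order 6" "N 2" "angle_order 2" 3
  proof
    show "lor (vertex_map (N 6) Q.T.P 0 w) (vertex_map (N 6) Q.T.P 0 w) < 3 * lor w w" if "w \<noteq> 0" for w
      by (rule Q.contracting[OF that])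
    show "hmap (word (N 2) xs) = hmap (word (N 2) ys)"
      if "xs \<in> lists {1..4}" "ys \<in> lists {1..4}" "word (N 6) xs = word (N 6) ys" for xs ys
      using hw[OF that(1)] hw[OF that(2)] that(3) by simp
  qed (simp_all add: Q.orientation)
  obtain K where K: "0 < K" "K < 1" "lipschitz_on K UNIV F" using F_lipschitz by blast
  have "F (\<gamma> x) = \<rho> \<gamma> (F x)" if g: "\<gamma> \<in> reflection_group (N 6)" for \<gamma> x
  proof -
    obtain w where w: "\<gamma> = hmap w" "w \<in> Q.S.W" using g unfolding Q.S.reflection_group_hmap by (rule imageE)
    obtain xs where xs: "w = word (N 6) xs" "xs \<in> lists {1..4}" using w(2) unfolding Q.S.W_def by (rule imageE)
    show ?thesis using F_equivariant[OF xs(2)] hw[OF xs(2)] by (simp add: w(1) xs(1))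
  qed
  moreover have "quotient_map \<in> orbifold (rotation_group (N 6)) \<rightarrow> orbifold (rotation_group (N 2))"
    by (auto simp: orbifold_def quotient_map_orb)
  ultimately show ?thesis
    using K(2,3) quotient_map_orb quotient_map_lipschitz[OF K(1,3)] cusp_collapse degree_one
    by (intro exI[of _ K] exI[of _ F] exI[of _ quotient_map] conjI ballI allI) simp_all
qed

end
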